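(* Let $\delta t>0$, and let data $(\boldsymbol u,\phi,\rho,U,V,W)^{n-1}$, $(\boldsymbol u,\phi,\rho,U,V,W)^{n}$, $p^n$ be given as in the context, with the derived quantities $\boldsymbol u^\star,\phi^\star,\rho^\star,\boldsymbol Z^\star,H^\star$, the trilinear term $B$ and the right-hand sides $\boldsymbol f_1,f_2,f_3,f_4,f_5$ defined there. Then the linear problem: find $\boldsymbol X=(\boldsymbol u,\mu_\phi,\phi,\mu_\rho,\rho)\in H^1_{\boldsymbol u}(\Omega)\times \bar H^1(\Omega)\times \bar H^1(\Omega)\times \bar H^1(\Omega)\times \bar H^1(\Omega)$ such that $$(\boldsymbol u,\boldsymbol v)+\tfrac{2\delta t}{3}(B(\boldsymbol u^\star,\boldsymbol u),\boldsymbol v)+\tfrac{2\delta t}{3}\nu(\nabla\boldsymbol u,\nabla\boldsymbol v)+\tfrac{2\delta t}{3}(\phi^\star\nabla\mu_\phi+\rho^\star\nabla\mu_\rho,\boldsymbol v)=(\boldsymbol f_1,\boldsymbol v),$$ $$(\phi,w)-\tfrac{2\delta t}{3}(\boldsymbol u\phi^\star,\nabla w)+\tfrac{2\delta t}{3}M_1(\nabla\mu_\phi,\nabla w)=(f_2,w),$$ $$-(\mu_\phi,\psi)+\epsilon(\nabla\phi,\nabla\psi)+\tfrac{2}{\epsilon}(\phi^\star\phi,\phi^\star\psi)-\alpha(\rho\boldsymbol Z^\star,\nabla\psi)+\alpha(\boldsymbol Z^\star\cdot\nabla\phi,\boldsymbol Z^\star\cdot\nabla\psi)=f_3(\psi),$$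 $$(\rho,\varpi)-\tfrac{2\delta t}{3}(\boldsymbol u\rho^\star,\nabla\varpi)+\tfrac{2\delta t}{3}M_2(\nabla\mu_\rho,\nabla\varpi)=(f_4,\varpi),$$ $$-(\mu_\rho,\varrho)+\eta(\nabla\rho,\nabla\varrho)+\alpha(\rho,\varrho)-\alpha(\boldsymbol Z^\star\cdot\nabla\phi,\varrho)+\tfrac{\beta}{2}(H^\star\rho,H^\star\varrho)=f_5(\varrho)$$ for all $\boldsymbol v\in H^1_{\boldsymbol u}(\Omega)$ and all $w,\psi,\varpi,\varrho\in\bar H^1(\Omega)$, admits a unique solution.
   Context: Domain and spaces. $\Omega\subset\mathbb R^d$, $d=2$ or $3$, is a rectangular box and all functions are $\Omega$-periodic. $(f,g)=\int_\Omega f g\,d\boldsymbol x$ (with the obvious version for vector and matrix fields) and $\|f\|^2=(f,f)$. $H^1_{per}(\Omega)=\{\phi\in H^1(\Omega):\phi\text{ periodic}\}$, $\bar H^1(\Omega)=\{\phi\in H^1_{per}(\Omega):\int_\Omega\phi\,d\boldsymbol x=0\}$, $H^1_{\boldsymbol u}(\Omega)=[H^1_{per}(\Omega)]^d$. Parameters. $\nu,M_1,M_2,\epsilon,\eta,\alpha,\beta>0$ are constants. For fixed small $\widehat\epsilon\in(0,1/2)$, $G:\mathbb R\to\mathbb R$ is the regularized Flory–Huggins potential $$G(\rho)=\begin{cases}\rho\ln\rho+\frac{(1-\rho)^2}{2\widehat\epsilon}+(1-\rho)\ln\widehat\epsilon-\frac{\widehat\epsilon}{2},&\rho\ge 1-\widehat\epsilon,\\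 \rho\ln\rho+(1-\rho)\ln(1-\rho),&\widehat\epsilon\le\rho\le1-\widehat\epsilon,\\ (1-\rho)\ln(1-\rho)+\frac{\rho^2}{2\widehat\epsilon}+\rho\ln\widehat\epsilon-\frac{\widehat\epsilon}{2},&\rho\le\widehat\epsilon,\end{cases}$$ $A>0$ is a constant such that $G+A>0$ on $\mathbb R$, and $H(\rho)=G'(\rho)/\sqrt{G(\rho)+A}$. For $\phi\in H^1_{per}(\Omega)$, $\boldsymbol Z(\phi)=\nabla\phi/|\nabla\phi|$ (with $\boldsymbol Z(\phi)=0$ where $\nabla\phi=0$). Given data (two previous time levels $k=n-1,n$ of a time-stepping scheme): $\boldsymbol u^{k}\in H^1_{\boldsymbol u}(\Omega)$, $\phi^k,\rho^k\in H^1_{per}(\Omega)$, periodic $U^k,V^k,W^k\in L^2(\Omega)$, and $p^n\in H^1_{per}(\Omega)$. The means are conserved: $\frac1{|\Omega|}\int_\Omega\phi^k=\bar\phi^0$ and $\frac1{|\Omega|}\int_\Omega\rho^k=\bar\rho^0$ for $k=n-1,n$, where $\bar\phi^0,\bar\rho^0$ are constants. Derived quantities. $\boldsymbol u^\star=2\boldsymbol u^n-\boldsymbol u^{n-1}$, $\phi^\star=2\phi^n-\phi^{n-1}$, $\rho^\star=2\rho^n-\rho^{n-1}$, $\boldsymbol Z^\star=\boldsymbol Z(\phi^\star)$, $H^\star=H(\rho^\star)$, $B(\boldsymbol u,\boldsymbol v)=(\boldsymbol u\cdot\nabla)\boldsymbol v+\frac12(\nabla\cdot\boldsymbol u)\boldsymbol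 v$. For any variable $S$, $S^{n\dagger}=\frac{4S^n-S^{n-1}}{3}$. Put $$A_1=U^{n\dagger}-2\phi^\star\phi^{n\dagger},\quad B_1=V^{n\dagger}-\rho^{n\dagger}+\boldsymbol Z^\star\cdot\nabla\phi^{n\dagger},\quad C_1=W^{n\dagger}-\tfrac12H^\star\rho^{n\dagger}.$$ Right-hand sides. $$\boldsymbol f_1=\boldsymbol u^{n\dagger}-\tfrac{2\delta t}{3}\nabla p^n,\qquad f_2=\phi^{n\dagger},\qquad f_4=\rho^{n\dagger},$$ $$f_3(\psi)=-\tfrac1\epsilon(\phi^\star A_1,\psi)+\alpha(B_1\boldsymbol Z^\star,\nabla\psi)-\tfrac2\epsilon\bar\phi^0(\phi^\star\phi^\star,\psi)+\alpha\bar\rho^0(\boldsymbol Z^\star,\nabla\psi),$$ $$f_5(\varrho)=-\alpha(B_1,\varrho)-\beta(H^\star C_1,\varrho)-\tfrac\beta2\bar\rho^0(H^\star H^\star,\varrho).$$ (The unknowns $\phi,\rho$ are the new-time-level phase variables minus their means $\bar\phi^0,\bar\rho^0$, and $\mu_\phi,\mu_\rho$ are the new-time-level chemical potentials minus their means.) *)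

theory Defs
  imports "HOL-Analysis.Analysis"
begin

definition partial :: "'d \<Rightarrow> (real^'d \<Rightarrow> real) \<Rightarrow> real^'d \<Rightarrow> real"
  where "partial i f x = frechet_derivative f (at x) (axis i 1)"

primrec Ck :: "nat \<Rightarrow> (real^'d \<Rightarrow> real) \<Rightarrow> bool" where
  "Ck 0 f \<longleftrightarrow> continuous_on UNIV f"
| "Ck (Suc k) f \<longleftrightarrow> (\<forall>x. f differentiable (at x)) \<and> (\<forall>i. Ck k (partial i f))"

definition test_function :: "(real^'d \<Rightarrow> real) \<Rightarrow> bool"
  where "test_function \<psi> \<longleftrightarrow> (\<forall>k. Ck k \<psi>) \<and> compact (closure {x. \<psi> x \<noteq> 0})"

definition locally_integrable :: "('n::euclidean_space \<Rightarrow> 'b::euclidean_space) \<Rightarrow> bool"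
  where "locally_integrable f \<longleftrightarrow> (\<forall>K. compact K \<longrightarrow> set_integrable lborel K f)"

definition has_weak_gradient :: "(real^'d \<Rightarrow> real) \<Rightarrow> (real^'d \<Rightarrow> real^'d) \<Rightarrow> bool"
  where "has_weak_gradient f g \<longleftrightarrow>
    locally_integrable f \<and> locally_integrable g \<and>
    (\<forall>\<psi>. test_function \<psi> \<longrightarrow>
      (\<forall>i. (LINT x|lborel. f x * partial i \<psi> x) = - (LINT x|lborel. g x $ i * \<psi> x)))"

(* A weak gradient is unique only almost everywhere, so this picks a representative; every
   use below is insensitive to changing it on a null set. *)
definition wgrad :: "(real^'d \<Rightarrow> real) \<Rightarrow> real^'d \<Rightarrow> real^'d"
  where "wgrad f = (SOME g. has_weak_gradient f g)"

(* Row i is the gradient of the i-th component. *)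
definition vgrad :: "(real^'d \<Rightarrow> real^'d) \<Rightarrow> real^'d \<Rightarrow> real^'d^'d"
  where "vgrad v x = (\<chi> i. wgrad (\<lambda>y. v y $ i) x)"

definition wdiv :: "(real^'d \<Rightarrow> real^'d) \<Rightarrow> real^'d \<Rightarrow> real"
  where "wdiv v x = (\<Sum>i\<in>UNIV. wgrad (\<lambda>y. v y $ i) x $ i)"

(* Omega = box a b throughout; Omega-periodic functions are functions on the whole space with
   period b_i - a_i in direction i. The inner product is the product of reals, the dot product
   of vectors or the Frobenius product of matrices. *)
definition ip :: "real^'d \<Rightarrow> real^'d \<Rightarrow> (real^'d \<Rightarrow> 'b::euclidean_space) \<Rightarrow> (real^'d \<Rightarrow> 'b) \<Rightarrow> real"
  where "ip a b f g = (LINT x:box a b|lborel. f x \<bullet> g x)"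

definition mean :: "real^'d \<Rightarrow> real^'d \<Rightarrow> (real^'d \<Rightarrow> real) \<Rightarrow> real"
  where "mean a b f = 1 / measure lborel (box a b) * (LINT x:box a b|lborel. f x)"

definition box_periodic :: "real^'d \<Rightarrow> real^'d \<Rightarrow> (real^'d \<Rightarrow> 'b) \<Rightarrow> bool"
  where "box_periodic a b f \<longleftrightarrow> (\<forall>i x. f (x + axis i (b $ i - a $ i)) = f x)"

definition square_integrable :: "(real^'d) set \<Rightarrow> (real^'d \<Rightarrow> 'b::euclidean_space) \<Rightarrow> bool"
  where "square_integrable S f \<longleftrightarrow>
    f \<in> borel_measurable lborel \<and> set_integrable lborel S (\<lambda>x. (norm (f x))\<^sup>2)"

definition L2per :: "real^'d \<Rightarrow> real^'d \<Rightarrow> (real^'d \<Rightarrow> real) set"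
  where "L2per a b = {f. box_periodic a b f \<and> square_integrable (box a b) f}"

(* The weak gradient is taken on the whole space, not only inside the box: this is what forces
   the traces on opposite faces to agree. *)
definition H1per :: "real^'d \<Rightarrow> real^'d \<Rightarrow> (real^'d \<Rightarrow> real) set"
  where "H1per a b =
    {f \<in> L2per a b. \<exists>g. has_weak_gradient f g \<and> square_integrable (box a b) g}"

definition H1bar :: "real^'d \<Rightarrow> real^'d \<Rightarrow> (real^'d \<Rightarrow> real) set"
  where "H1bar a b = {f \<in> H1per a b. (LINT x:box a b|lborel. f x) = 0}"

definition H1vec :: "real^'d \<Rightarrow> real^'d \<Rightarrow> (real^'d \<Rightarrow> real^'d) set"
  where "H1vec a b = {v. \<forall>i. (\<lambda>x. v x $ i) \<in> H1per a b}"

(* Regularized Flory-Huggins potential; the branches agree at the two junction points. *)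
definition FH :: "real \<Rightarrow> real \<Rightarrow> real" where
  "FH e \<rho> =
    (if \<rho> \<ge> 1 - e then \<rho> * ln \<rho> + (1 - \<rho>)\<^sup>2 / (2 * e) + (1 - \<rho>) * ln e - e / 2
     else if \<rho> \<ge> e then \<rho> * ln \<rho> + (1 - \<rho>) * ln (1 - \<rho>)
     else (1 - \<rho>) * ln (1 - \<rho>) + \<rho>\<^sup>2 / (2 * e) + \<rho> * ln e - e / 2)"

definition FH_H :: "real \<Rightarrow> real \<Rightarrow> real \<Rightarrow> real"
  where "FH_H e A \<rho> = deriv (FH e) \<rho> / sqrt (FH e \<rho> + A)"

definition Zfield :: "(real^'d \<Rightarrow> real) \<Rightarrow> real^'d \<Rightarrow> real^'d"
  where "Zfield \<phi> x = (if wgrad \<phi> x = 0 then 0 else (1 / norm (wgrad \<phi> x)) *\<^sub>R wgrad \<phi> x)"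

(* Component i of (u . nabla) v is u . nabla v_i, that is, (vgrad v x *v u x) $ i. *)
definition Bform :: "(real^'d \<Rightarrow> real^'d) \<Rightarrow> (real^'d \<Rightarrow> real^'d) \<Rightarrow> real^'d \<Rightarrow> real^'d"
  where "Bform u v x = vgrad v x *v u x + (1/2 * wdiv u x) *\<^sub>R v x"

(* First argument: level n; second argument: level n-1. *)
definition star :: "('n \<Rightarrow> 'b::real_vector) \<Rightarrow> ('n \<Rightarrow> 'b) \<Rightarrow> 'n \<Rightarrow> 'b"
  where "star f g x = 2 *\<^sub>R f x - g x"

definition dagger :: "('n \<Rightarrow> 'b::real_vector) \<Rightarrow> ('n \<Rightarrow> 'b) \<Rightarrow> 'n \<Rightarrow> 'b"
  where "dagger f g x = (1/3) *\<^sub>R (4 *\<^sub>R f x - g x)"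

definition unique_up_to :: "('x \<Rightarrow> 'x \<Rightarrow> bool) \<Rightarrow> ('x \<Rightarrow> bool) \<Rightarrow> bool"
  where "unique_up_to R P \<longleftrightarrow> (\<exists>x. P x) \<and> (\<forall>x y. P x \<longrightarrow> P y \<longrightarrow> R x y)"

type_synonym 'd unknowns =
  "(real^'d \<Rightarrow> real^'d) \<times> (real^'d \<Rightarrow> real) \<times> (real^'d \<Rightarrow> real) \<times> (real^'d \<Rightarrow> real) \<times> (real^'d \<Rightarrow> real)"

(* Equality in the product of Sobolev spaces, whose elements are classes modulo null sets. *)
definition eq_ae :: "'d::finite unknowns \<Rightarrow> 'd unknowns \<Rightarrow> bool"
  where "eq_ae X Y \<longleftrightarrow> (AE x in lborel. case (X, Y) of
    ((u, m, p, k, r), (u', m', p', k', r')) \<Rightarrow>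
      u x = u' x \<and> m x = m' x \<and> p x = p' x \<and> k x = k' x \<and> r x = r' x)"

end

theory Submission
  imports Defs "HOL-Library.Function_Algebras"
begin

text \<open>The problem is solved by the Lax-Milgram theorem on the product of the five Sobolev spaces. Everything that is needed
  about weak gradients is drawn from one formula: if \<open>g\<close> is the weak gradient of \<open>f\<close>, then for every \<open>z\<close> and almost every
  \<open>x\<close> the difference \<open>f (x + z) - f x\<close> is the integral of \<open>g (x + s z) \<bullet> z\<close> over \<open>0 \<le> s \<le> 1\<close>. Averaging it over all \<open>z\<close> in a
  period cell gives the Poincare inequality for mean-free functions. Averaging over cubes of dyadic side \<open>h\<close> and comparing
  consecutive averages gives the embedding into \<open>L\<^sup>4\<close> for \<open>d < 4\<close>, which makes the trilinear terms continuous. Read along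
  almost every line through a period, it says that \<open>f\<close> is absolutely continuous there, so that the product rule gives
  \<open>(B(u\<^sup>*, u), u) = 0\<close>. Coercivity then follows by testing the equations with the solution itself.\<close>

section \<open>Test functions\<close>

text \<open>The coefficients are no better than H1, so a product such as \<open>\<phi>star\<close>
  times a gradient need not be square integrable. Every term of this kind is regrouped until an L2
  function meets a product of two H1 functions, which the embedding makes L2; continuity of the
  convective and the coupling terms comes from there. Coercivity hinges on the pairing of equations
  with test functions: each phase equation is tested with its potential, each potential equation
  with its phase. Of the four scalar unknowns this leaves usable positive control only of the
  gradients, and the restriction to mean-free functions lets the Poincare inequality recover the
  full norms. Sobolev functions are honest functions here, not classes modulo null sets, and
  \<open>wgrad\<close> is a chosen representative. Gradients are therefore linear and periodic only
  almost everywhere, the spaces carry only a semi-inner product, and limits are built pointwise so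
  that the functions themselves stay exactly periodic.\<close>

lemma partial_eq:
  assumes "(f has_derivative f') (at x)"
  shows "partial i f x = f' (axis i 1)"
  using assms frechet_derivative_at unfolding partial_def by metis

lemma Ck_differentiable: "Ck (Suc k) f \<Longrightarrow> (f has_derivative frechet_derivative f (at x)) (at x)"
  using frechet_derivative_works by auto

lemma Ck_Suc_imp: "Ck (Suc k) f \<Longrightarrow> Ck k f"
proof (induction k arbitrary: f)
  case 0
  then show ?case
    by (auto intro!: continuous_at_imp_continuous_on differentiable_imp_continuous_within)
next
  case (Suc k)
  then show ?case by auto
qed

lemma Ck_const: "Ck k (\<lambda>x::real^'d. c)"
proof (induction k arbitrary: c)
  case (Suc k)
  have "partial i (\<lambda>x::real^'d. c) = (\<lambda>x. 0)" for i
    by (rule ext) (auto simp: partial_eq[OF has_derivative_const])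
  then show ?case by (simp only: Ck.simps Suc) simp
qed auto

lemma Ck_add:
  assumes "Ck k f" "Ck k g"
  shows "Ck k (\<lambda>x. f x + g x)"
  using assms
proof (induction k arbitrary: f g)
  case 0
  then show ?case by (auto intro: continuous_intros)
next
  case (Suc k)
  have "partial i (\<lambda>x. f x + g x) = (\<lambda>x. partial i f x + partial i g x)" for i
  proof
    fix x
    from has_derivative_add[OF Ck_differentiable[OF Suc.prems(1)] Ck_differentiable[OF Suc.prems(2)]]
    show "partial i (\<lambda>x. f x + g x) x = partial i f x + partial i g x"
      by (subst partial_eq) (auto simp: partial_def)
  qed
  with Suc show ?case by auto
qed

lemma Ck_mult:
  assumes "Ck k f" "Ck k g"
  shows "Ck k (\<lambda>x. f x * g x)"
  using assms
proof (induction k arbitrary: f g)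
  case 0
  then show ?case by (auto intro: continuous_intros)
next
  case (Suc k)
  have "partial i (\<lambda>x. f x * g x) = (\<lambda>x. f x * partial i g x + partial i f x * g x)" for i
  proof
    fix x
    from has_derivative_mult[OF Ck_differentiable[OF Suc.prems(1)] Ck_differentiable[OF Suc.prems(2)]]
    show "partial i (\<lambda>x. f x * g x) x = f x * partial i g x + partial i f x * g x"
      by (subst partial_eq) (auto simp: partial_def)
  qed
  moreover have "Ck k f" "Ck k g" using Suc.prems by (auto intro: Ck_Suc_imp)
  ultimately show ?case using Suc by (auto intro!: Ck_add)
qed

lemma Ck_prod:
  assumes "\<And>i. i \<in> I \<Longrightarrow> Ck k (f i)"
  shows "Ck k (\<lambda>x. \<Prod>i\<in>I. f i x)"
  using assms by (induction I rule: infinite_finite_induct) (auto intro: Ck_const Ck_mult)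

lemma test_function_continuous: "test_function \<psi> \<Longrightarrow> continuous_on UNIV \<psi>"
  unfolding test_function_def by (metis Ck.simps(1))

lemma test_function_measurable: "test_function \<psi> \<Longrightarrow> \<psi> \<in> borel_measurable borel"
  by (intro borel_measurable_continuous_onI test_function_continuous)

section \<open>Smooth bumps on boxes\<close>

definition flat :: "nat \<Rightarrow> real \<Rightarrow> real"
  where "flat k t = (if t \<le> 0 then 0 else (1 / t) ^ k * exp (- (1 / t)))"

lemma flat_tendsto_0: "(flat k \<longlongrightarrow> 0) (at_right 0)"
proof -
  have "((\<lambda>y::real. y ^ k / exp y) \<longlongrightarrow> 0) at_top"
    by (rule tendsto_power_div_exp_0)
  then have "((\<lambda>t::real. inverse t ^ k / exp (inverse t)) \<longlongrightarrow> 0) (at_right 0)"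
    by (rule filterlim_compose) (rule filterlim_inverse_at_top_right)
  then show ?thesis
    by (rule Lim_transform_eventually)
       (auto simp: flat_def eventually_at_filter exp_minus divide_simps)
qed

text \<open>The factor \<open>(1 / t) ^ k\<close> in \<open>flat\<close> closes the family under
  differentiation, so that smoothness of all orders of the standard function
  \<open>exp (- (1 / t))\<close> follows from this one formula. At 0 both one-sided difference
  quotients tend to 0.\<close>

lemma DERIV_flat: "(flat k has_real_derivative (flat (k + 2) t - k * flat (k + 1) t)) (at t)"
proof -
  consider "t > 0" | "t < 0" | "t = 0" by linarith
  then show ?thesis
  proof cases
    case 1
    have "((\<lambda>t. (1 / t) ^ k * exp (- (1 / t))) has_real_derivative
        (flat (k + 2) t - k * flat (k + 1) t)) (at t)"
    proof (cases k)
      case 0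
      with 1 show ?thesis
        by (auto intro!: derivative_eq_intros simp: flat_def power2_eq_square)
    next
      case (Suc m)
      with 1 show ?thesis
        by (auto intro!: derivative_eq_intros simp: flat_def divide_simps)
           (cases m; auto simp: algebra_simps)+
    qed
    then show ?thesis
      by (rule DERIV_cong_ev[OF refl _ refl, THEN iffD1, rotated])
         (use eventually_nhds_in_open[of "{0<..}" t] 1 in \<open>auto elim!: eventually_mono simp: flat_def\<close>)
  next
    case 2
    have "((\<lambda>t. 0) has_real_derivative (flat (k + 2) t - k * flat (k + 1) t)) (at t)"
      using 2 by (auto simp: flat_def)
    then show ?thesis
      by (rule DERIV_cong_ev[OF refl _ refl, THEN iffD1, rotated])
         (use eventually_nhds_in_open[of "{..<0}" t] 2 in \<open>auto elim!: eventually_mono simp: flat_def\<close>)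
  next
    case 3
    \<comment> \<open>For positive \<open>h\<close> the difference quotient
      \<open>flat k h / h\<close> is \<open>flat (Suc k) h\<close>.\<close>
    have "((\<lambda>h. flat k h / h) \<longlongrightarrow> 0) (at_right 0)"
      by (rule Lim_transform_eventually[OF flat_tendsto_0[of "Suc k"]])
         (auto simp: flat_def eventually_at_filter)
    moreover have "((\<lambda>h. flat k h / h) \<longlongrightarrow> 0) (at_left 0)"
      by (rule tendsto_eventually) (auto simp: flat_def eventually_at_filter)
    ultimately have "((\<lambda>h. flat k h / h) \<longlongrightarrow> 0) (at 0)"
      by (rule filterlim_split_at_real[rotated])
    with 3 show ?thesis
      by (auto simp: DERIV_def flat_def)
  qed
qed

lemma Ck_flat: "Ck n (\<lambda>x. flat k (c * x $ i + d))"
proof (induction n arbitrary: k)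
  case 0
  have "continuous_on UNIV (flat k)"
    using DERIV_flat DERIV_isCont by (blast intro: continuous_at_imp_continuous_on)
  then have "continuous_on UNIV (flat k \<circ> (\<lambda>x. c * x $ i + d))"
    by (intro continuous_on_compose continuous_intros) (auto intro: continuous_on_subset)
  then show ?case by (simp add: o_def)
next
  case (Suc n)
  let ?f = "\<lambda>x. flat k (c * x $ i + d)"
  let ?D = "\<lambda>x. flat (k + 2) (c * x $ i + d) - k * flat (k + 1) (c * x $ i + d)"
  have der: "(?f has_derivative (\<lambda>h. (c * h $ i) * ?D x)) (at x)" for x
  proof -
    have "((\<lambda>x. c * x $ i + d) has_derivative (\<lambda>h. c * h $ i)) (at x)"
      by (auto intro!: derivative_eq_intros bounded_linear_imp_has_derivative bounded_linear_vec_nth)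
    moreover have "(flat k has_derivative (\<lambda>h. h * ?D x)) (at (c * x $ i + d))"
      using DERIV_flat[of k "c * x $ i + d"] by (simp add: has_field_derivative_def mult_commute_abs)
    ultimately show ?thesis by (rule has_derivative_compose)
  qed
  have pd: "partial j ?f = (\<lambda>x. (if i = j then c else 0) * flat (k + 2) (c * x $ i + d)
      + (if i = j then - c * k else 0) * flat (k + 1) (c * x $ i + d))" for j
    by (rule ext) (subst partial_eq[OF der], auto simp: axis_def algebra_simps)
  have "?f differentiable (at x)" for x using der by (auto simp: differentiable_def)
  moreover have "Ck n (partial j ?f)" for j
    unfolding pd by (intro Ck_add Ck_mult Ck_const Suc)
  ultimately show ?case by simp
qed

text \<open>The two factors per coordinate are \<open>flat 0 (n * (x $ i - p $ i))\<close> and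
  \<open>flat 0 (n * (q $ i - x $ i))\<close>, multiplied out to the shape
  \<open>c * x $ i + d\<close> that \<open>Ck_flat\<close> expects. Each is cut off at one face of
  the box, and large \<open>n\<close> pushes it towards 1 inside.\<close>

definition box_bump :: "real^'d \<Rightarrow> real^'d \<Rightarrow> nat \<Rightarrow> real^'d \<Rightarrow> real" where
  "box_bump p q n x =
    (\<Prod>i\<in>UNIV. flat 0 (real n * x $ i + - (real n * p $ i)) * flat 0 (- real n * x $ i + real n * q $ i))"

lemma flat_0_bounds: "0 \<le> flat 0 t" "flat 0 t \<le> 1"
  by (auto simp: flat_def)

lemma box_bump_bounds: "0 \<le> box_bump p q n x" "box_bump p q n x \<le> 1"
  unfolding box_bump_def
  by (auto intro!: prod_nonneg prod_le_1 mult_nonneg_nonneg mult_le_one simp: flat_0_bounds)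

lemma box_bump_outside:
  assumes "x \<notin> box p q"
  shows "box_bump p q n x = 0"
proof -
  from assms obtain i where "x $ i \<le> p $ i \<or> q $ i \<le> x $ i"
    by (auto simp: mem_box_cart not_less)
  then have "real n * x $ i + - (real n * p $ i) \<le> 0 \<or> - real n * x $ i + real n * q $ i \<le> 0"
    by (auto intro: mult_left_mono)
  then have "flat 0 (real n * x $ i + - (real n * p $ i)) * flat 0 (- real n * x $ i + real n * q $ i) = 0"
    by (auto simp: flat_def)
  then show ?thesis unfolding box_bump_def by (intro prod_zero) auto
qed

lemma test_function_box_bump: "test_function (box_bump p q n)"
proof -
  have "Ck k (box_bump p q n)" for k
    unfolding box_bump_def[abs_def] by (intro Ck_prod Ck_mult Ck_flat)
  moreover have "closure {x. box_bump p q n x \<noteq> 0} \<subseteq> cbox p q"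
    using box_bump_outside[of _ p q n] box_subset_cbox by (intro closure_minimal) blast+
  then have "compact (closure {x. box_bump p q n x \<noteq> 0})"
    by (meson bounded_cbox bounded_subset closed_closure compact_eq_bounded_closed)
  ultimately show ?thesis by (simp add: test_function_def)
qed

lemma flat_scaled_tendsto:
  assumes "c > 0"
  shows "(\<lambda>n. flat 0 (real n * c)) \<longlonglongrightarrow> 1"
proof -
  have "filterlim (\<lambda>n. real n * c) at_top sequentially"
    using assms by (simp add: filterlim_at_top_mult_tendsto_pos filterlim_real_sequentially
        filterlim_tendsto_pos_mult_at_top mult.commute filterlim_tendsto_pos_mult_at_top[OF tendsto_const])
  then have "(\<lambda>n. inverse (real n * c)) \<longlonglongrightarrow> 0"
    by (rule tendsto_inverse_0_at_top)
  then have "(\<lambda>n. exp (- inverse (real n * c))) \<longlonglongrightarrow> exp (- 0)"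
    by (intro tendsto_intros)
  then have "(\<lambda>n. exp (- inverse (real n * c))) \<longlonglongrightarrow> 1" by simp
  moreover have "\<forall>\<^sub>F n in sequentially. exp (- inverse (real n * c)) = flat 0 (real n * c)"
    using eventually_gt_at_top[of 0]
    by eventually_elim (use assms in \<open>auto simp: flat_def not_le divide_simps zero_less_mult_iff mult_le_0_iff\<close>)
  ultimately show ?thesis by (rule Lim_transform_eventually)
qed

lemma box_bump_tendsto: "(\<lambda>n. box_bump p q n x) \<longlonglongrightarrow> indicator (box p q) x"
proof (cases "x \<in> box p q")
  case True
  have "(\<lambda>n. box_bump p q n x) \<longlonglongrightarrow> (\<Prod>i\<in>(UNIV::'a set). 1 * 1)"
    unfolding box_bump_def
  proof (intro tendsto_prod tendsto_mult)
    fix i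
    have "real n * x $ i + - (real n * p $ i) = real n * (x $ i - p $ i)"
      and "- real n * x $ i + real n * q $ i = real n * (q $ i - x $ i)" for n
      by (auto simp: algebra_simps)
    with True flat_scaled_tendsto[of "x $ i - p $ i"] flat_scaled_tendsto[of "q $ i - x $ i"]
    show "(\<lambda>n. flat 0 (real n * x $ i + - (real n * p $ i))) \<longlonglongrightarrow> 1"
      "(\<lambda>n. flat 0 (- real n * x $ i + real n * q $ i)) \<longlonglongrightarrow> 1"
      by (auto simp: mem_box_cart)
  qed
  with True show ?thesis by simp
qed (auto simp: box_bump_outside)

text \<open>The positive and the negative part of \<open>h\<close> are densities of two measures.
  These agree and are finite on bounded open boxes, which form an intersection-stable generator of
  the Borel sets, so they coincide, and then so do their densities almost everywhere.\<close>

lemma integrable_zero_on_boxes: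
  fixes h :: "'a::euclidean_space \<Rightarrow> real"
  assumes h: "integrable lborel h"
    and 0: "\<And>p q. (LINT x|lborel. indicator (box p q) x * h x) = 0"
  shows "AE x in lborel. h x = 0"
proof -
  have [measurable]: "h \<in> borel_measurable borel" using h by auto
  \<comment> \<open>\<open>ennreal\<close> sends negative reals to 0, so \<open>M 1\<close> and
    \<open>M (- 1)\<close> have the positive and the negative part of \<open>h\<close> as
    densities.\<close>
  define M where "M s = density lborel (\<lambda>x. ennreal (s * h x))" for s :: real
  have int: "integrable lborel (\<lambda>x. indicator (box p q) x * h x)" for p q
    using integrable_mult_indicator[OF _ h, of "box p q"] by simp
  have M: "emeasure (M s) (box p q) = (\<integral>\<^sup>+x. ennreal (s * (indicator (box p q) x * h x)) \<partial>lborel)" for s p q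
    unfolding M_def
    by (subst emeasure_density) (auto intro!: nn_integral_cong split: split_indicator)
  have fin: "(\<integral>\<^sup>+x. ennreal (s * (indicator (box p q) x * h x)) \<partial>lborel) < \<infinity>" for s p q
  proof -
    have "integrable lborel (\<lambda>x. s * (indicator (box p q) x * h x))" using int by simp
    then have "(\<integral>\<^sup>+x. norm (s * (indicator (box p q) x * h x)) \<partial>lborel) < \<infinity>"
      unfolding integrable_iff_bounded by blast
    moreover have "(\<integral>\<^sup>+x. ennreal (s * (indicator (box p q) x * h x)) \<partial>lborel)
        \<le> (\<integral>\<^sup>+x. norm (s * (indicator (box p q) x * h x)) \<partial>lborel)"
      by (intro nn_integral_mono ennreal_leI) auto
    ultimately show ?thesis by (rule le_less_trans[rotated])
  qed
  have box_eq: "emeasure (M 1) (box p q) = emeasure (M (- 1)) (box p q)" for p q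
  proof -
    have "enn2real (emeasure (M 1) (box p q)) - enn2real (emeasure (M (- 1)) (box p q)) = 0"
      using real_lebesgue_integral_def[OF int, of p q] 0[of p q] by (simp add: M)
    then show ?thesis
      using fin[of 1 p q] fin[of "- 1" p q] ennreal_enn2real unfolding M infinity_ennreal_def
      by (metis eq_iff_diff_eq_0)
  qed
  have "M 1 = M (- 1)"
  proof (rule measure_eqI_generator_eq)
    let ?E = "range (\<lambda>(a, b). box a b::'a set)"
    show "Int_stable ?E"
      by (auto simp: Int_stable_def box_Int_box)
    show "?E \<subseteq> Pow UNIV" "sets (M 1) = sigma_sets UNIV ?E" "sets (M (- 1)) = sigma_sets UNIV ?E"
      by (simp_all add: borel_eq_box M_def)
    let ?A = "\<lambda>n::nat. box (- (real n *\<^sub>R One)) (real n *\<^sub>R One) :: 'a set"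
    show "range ?A \<subseteq> ?E" "(\<Union>i. ?A i) = UNIV"
      unfolding UN_box_eq_UNIV by auto
    show "emeasure (M 1) (?A i) \<noteq> \<infinity>" for i
      using fin[of 1] by (simp add: M less_top)
    show "emeasure (M 1) X = emeasure (M (- 1)) X" if "X \<in> ?E" for X
      using that box_eq by auto
  qed
  moreover have "(\<integral>\<^sup>+x. ennreal (1 * h x) \<partial>lborel) \<noteq> \<infinity>"
  proof -
    have "(\<integral>\<^sup>+x. ennreal (1 * h x) \<partial>lborel) \<le> (\<integral>\<^sup>+x. norm (h x) \<partial>lborel)"
      by (intro nn_integral_mono ennreal_leI) auto
    also have "\<dots> < \<infinity>" using h by (simp add: integrable_iff_bounded)
    finally show ?thesis by simp
  qed
  ultimately have "AE x in lborel. ennreal (1 * h x) = ennreal (- 1 * h x)"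
    unfolding M_def by (subst (asm) finite_density_unique) auto
  then show ?thesis
  proof eventually_elim
    case (elim x)
    then show ?case by (cases "h x \<ge> 0") (auto simp: ennreal_neg not_le less_imp_le)
  qed
qed

section \<open>Local integrability and the fundamental lemma of the calculus of variations\<close>

lemma locally_integrable_measurable:
  assumes "locally_integrable f"
  shows "f \<in> borel_measurable borel"
proof (rule borel_measurable_LIMSEQ_metric)
  show "(\<lambda>x. indicator (cball 0 (real n)) x *\<^sub>R f x) \<in> borel_measurable borel" for n
  proof -
    have "integrable lborel (\<lambda>x. indicator (cball 0 (real n)) x *\<^sub>R f x)"
      using assms by (auto simp: locally_integrable_def set_integrable_def)
    then show ?thesis by auto
  qed
  show "(\<lambda>n. indicator (cball 0 (real n)) x *\<^sub>R f x) \<longlonglongrightarrow> f x" for x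
  proof (rule tendsto_eventually)
    obtain N where "norm x \<le> real N" using real_arch_simple by blast
    then show "\<forall>\<^sub>F n in sequentially. indicator (cball 0 (real n)) x *\<^sub>R f x = f x"
      by (intro eventually_sequentiallyI[of N]) (auto simp: indicator_def intro: order_trans)
  qed
qed

lemma locally_integrable_subset:
  assumes "locally_integrable f" "S \<subseteq> K" "compact K" "S \<in> sets borel"
  shows "set_integrable lborel S f"
  using assms set_integrable_subset[of lborel K f S] by (auto simp: locally_integrable_def)

lemma locally_integrable_add:
  "locally_integrable f \<Longrightarrow> locally_integrable g \<Longrightarrow> locally_integrable (\<lambda>x. f x + g x)"
  by (auto simp: locally_integrable_def intro: set_integral_add)

lemma locally_integrable_diff:
  "locally_integrable f \<Longrightarrow> locally_integrable g \<Longrightarrow> locally_integrable (\<lambda>x. f x - g x)"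
  by (auto simp: locally_integrable_def intro: set_integral_diff)

lemma locally_integrable_bounded_linear:
  fixes f :: "'n::euclidean_space \<Rightarrow> 'b::euclidean_space" and T :: "'b \<Rightarrow> 'c::euclidean_space"
  assumes "bounded_linear T" "locally_integrable f"
  shows "locally_integrable (\<lambda>x. T (f x))"
  unfolding locally_integrable_def set_integrable_def
proof (intro allI impI)
  fix K :: "'n set" assume "compact K"
  then have "integrable lborel (\<lambda>x. indicator K x *\<^sub>R f x)"
    using assms(2) by (simp add: locally_integrable_def set_integrable_def)
  from integrable_bounded_linear[OF assms(1) this]
  have "integrable lborel (\<lambda>x. T (indicator K x *\<^sub>R f x))" .
  then show "integrable lborel (\<lambda>x. indicator K x *\<^sub>R T (f x))"
    by (simp add: linear_simps(5)[OF assms(1)])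
qed

lemma integrable_locally_times_bounded:
  fixes f c :: "'n::euclidean_space \<Rightarrow> real"
  assumes f: "locally_integrable f" and K: "compact K" and c[measurable]: "c \<in> borel_measurable borel"
    and B: "\<And>x. \<bar>c x\<bar> \<le> B" and 0: "\<And>x. x \<notin> K \<Longrightarrow> c x = 0"
  shows "integrable lborel (\<lambda>x. f x * c x)"
proof (rule Bochner_Integration.integrable_bound)
  have [measurable]: "f \<in> borel_measurable borel" using f by (rule locally_integrable_measurable)
  show "integrable lborel (\<lambda>x. B * (indicator K x *\<^sub>R f x))"
    using f K by (auto simp: locally_integrable_def set_integrable_def)
  show "(\<lambda>x. f x * c x) \<in> borel_measurable lborel" by measurable
  have "\<bar>f x * c x\<bar> \<le> \<bar>B * (indicator K x *\<^sub>R f x)\<bar>" for x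
  proof (cases "x \<in> K")
    case True
    have "\<bar>f x\<bar> * \<bar>c x\<bar> \<le> \<bar>f x\<bar> * \<bar>B\<bar>" using B[of x] by (intro mult_left_mono) auto
    with True show ?thesis by (simp add: abs_mult mult.commute)
  qed (auto simp: 0)
  then show "AE x in lborel. norm (f x * c x) \<le> norm (B * (indicator K x *\<^sub>R f x))" by simp
qed

text \<open>Box bumps converge boundedly to box indicators, so dominated convergence turns the
  hypothesis into vanishing integrals over all boxes.\<close>

theorem du_Bois_Reymond:
  fixes f :: "real^'d \<Rightarrow> real"
  assumes f: "locally_integrable f"
    and 0: "\<And>\<psi>. test_function \<psi> \<Longrightarrow> (LINT x|lborel. f x * \<psi> x) = 0"
  shows "AE x in lborel. f x = 0"
proof -
  have [measurable]: "f \<in> borel_measurable borel" using f by (rule locally_integrable_measurable)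
  have [measurable]: "box_bump p q n \<in> borel_measurable borel" for p q :: "real^'d" and n
    by (rule test_function_measurable[OF test_function_box_bump])
  have int: "integrable lborel (\<lambda>x. indicator (box p q) x *\<^sub>R f x)" for p q
    using locally_integrable_subset[OF f box_subset_cbox compact_cbox, of p q]
    by (simp add: set_integrable_def)
  have box0: "(LINT x|lborel. indicator (box p q) x * f x) = 0" for p q
  proof -
    have "(\<lambda>n. LINT x|lborel. f x * box_bump p q n x) \<longlonglongrightarrow> (LINT x|lborel. f x * indicator (box p q) x)"
    proof (rule integral_dominated_convergence[where w="\<lambda>x. norm (indicator (box p q) x *\<^sub>R f x)"])
      show "AE x in lborel. (\<lambda>n. f x * box_bump p q n x) \<longlonglongrightarrow> f x * indicator (box p q) x"
        by (intro AE_I2 tendsto_intros box_bump_tendsto)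
      show "AE x in lborel. norm (f x * box_bump p q n x) \<le> norm (indicator (box p q) x *\<^sub>R f x)" for n
      proof (intro AE_I2)
        fix x
        have "\<bar>f x\<bar> * \<bar>box_bump p q n x\<bar> \<le> \<bar>f x\<bar> * 1"
          using box_bump_bounds[of p q n x] by (intro mult_left_mono) auto
        then show "norm (f x * box_bump p q n x) \<le> norm (indicator (box p q) x *\<^sub>R f x)"
          by (cases "x \<in> box p q") (auto simp: abs_mult box_bump_outside)
      qed
    qed (use int in \<open>auto\<close>)
    moreover have "(LINT x|lborel. f x * box_bump p q n x) = 0" for n
      by (rule 0[OF test_function_box_bump])
    ultimately show ?thesis by (simp add: mult.commute LIMSEQ_const_iff)
  qed
  \<comment> \<open>\<open>f\<close> is integrable only locally, so it is cut to growing cubes. The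
    cut-off functions still have vanishing integrals over boxes, because a box meets a cube in a
    box.\<close>
  have "AE x in lborel. \<forall>n. indicator (box (- (real n *\<^sub>R One)) (real n *\<^sub>R One)) x *\<^sub>R f x = 0"
    unfolding AE_all_countable
  proof
    fix n
    let ?B = "box (- (real n *\<^sub>R One)) (real n *\<^sub>R One) :: (real^'d) set"
    show "AE x in lborel. indicator ?B x *\<^sub>R f x = 0"
    proof (rule integrable_zero_on_boxes[OF int])
      fix p q :: "real^'d"
      obtain p' q' where "box p q \<inter> ?B = box p' q'" using box_Int_box by blast
      then have eq: "indicator (box p q) x * (indicator ?B x *\<^sub>R f x) = indicator (box p' q') x * f x" for x
        using indicator_inter_arith[of "box p q" ?B x, where ?'a=real] by simp
      then show "(LINT x|lborel. indicator (box p q) x * (indicator ?B x *\<^sub>R f x)) = 0"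
        by (simp only: eq box0)
    qed
  qed
  then show ?thesis
  proof eventually_elim
    case (elim x)
    have "x \<in> (\<Union>n::nat. box (- (real n *\<^sub>R One)) (real n *\<^sub>R One))"
      unfolding UN_box_eq_UNIV by simp
    then obtain n where "x \<in> box (- (real n *\<^sub>R One)) (real n *\<^sub>R One)" by auto
    with elim show ?case by (auto dest: spec[of _ n])
  qed
qed

section \<open>Weak gradients\<close>

lemma distr_lborel_translate: "distr lborel borel (\<lambda>x. x + z) = (lborel :: 'a::euclidean_space measure)"
proof -
  have "(\<lambda>x. x + z) = (+) z" by (auto simp: add.commute)
  then show ?thesis by (simp add: lborel_distr_plus)
qed

lemma nn_integral_translate:
  fixes f :: "'a::euclidean_space \<Rightarrow> ennreal"
  assumes [measurable]: "f \<in> borel_measurable borel"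
  shows "(\<integral>\<^sup>+x. f (x + z) \<partial>lborel) = (\<integral>\<^sup>+x. f x \<partial>lborel)"
  by (subst (2) distr_lborel_translate[of z, symmetric]) (simp add: nn_integral_distr)

lemma AE_translate:
  fixes P :: "'a::euclidean_space \<Rightarrow> bool"
  assumes "AE x in lborel. P x"
  shows "AE x in lborel. P (x + z)"
proof -
  have "AE x in distr lborel borel (\<lambda>x. x + z). P x"
    unfolding distr_lborel_translate by (rule assms)
  from AE_distrD[OF _ this] show ?thesis by simp
qed

lemma integral_translate:
  fixes f :: "'a::euclidean_space \<Rightarrow> 'b::euclidean_space"
  assumes [measurable]: "f \<in> borel_measurable borel"
  shows "(LINT x|lborel. f (x + z)) = (LINT x|lborel. f x)"
  by (subst (2) distr_lborel_translate[of z, symmetric]) (simp add: integral_distr)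

lemma integrable_translate:
  fixes f :: "'a::euclidean_space \<Rightarrow> 'b::euclidean_space"
  assumes "integrable lborel f"
  shows "integrable lborel (\<lambda>x. f (x + z))"
  using assms integrable_distr[of "\<lambda>x. x + z" lborel borel f] by (simp add: distr_lborel_translate)

lemma locally_integrable_translate:
  assumes "locally_integrable f"
  shows "locally_integrable (\<lambda>x. f (x + z))"
  unfolding locally_integrable_def set_integrable_def
proof (intro allI impI)
  fix K :: "'a set" assume "compact K"
  then have "compact ((\<lambda>x. x + z) ` K)"
    by (intro compact_continuous_image continuous_intros)
  then have "integrable lborel (\<lambda>x. indicator ((\<lambda>x. x + z) ` K) x *\<^sub>R f x)"
    using assms by (simp add: locally_integrable_def set_integrable_def)
  from integrable_translate[OF this, of z]
  show "integrable lborel (\<lambda>x. indicator K x *\<^sub>R f (x + z))"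
    by (rule Bochner_Integration.integrable_cong[THEN iffD1, rotated 2])
       (auto simp: indicator_def)
qed

lemma compact_swept:
  fixes K :: "'a::euclidean_space set"
  assumes "compact K"
  shows "compact ((\<lambda>(x, s::real). x + s *\<^sub>R z) ` (K \<times> {0..1}))"
  using assms by (intro compact_continuous_image compact_Times)
    (auto intro!: continuous_intros simp: case_prod_unfold)

text \<open>For each fixed \<open>s\<close> translation moves the integral over \<open>K\<close>
  into the compact set swept out by \<open>K\<close> along the segment, so all slices share one
  finite bound. This licenses Fubini for integrals along segments.\<close>

lemma integrable_swept:
  fixes h :: "'a::euclidean_space \<Rightarrow> real"
  assumes h: "locally_integrable h" and K: "compact K"
  shows "integrable (lborel \<Otimes>\<^sub>M lborel)
    (\<lambda>(x, s). indicator K x * (indicator {0..1} s * h (x + s *\<^sub>R z)))"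
proof (rule integrableI_bounded)
  have [measurable]: "h \<in> borel_measurable borel" using h by (rule locally_integrable_measurable)
  have [measurable]: "K \<in> sets borel" using K by (simp add: compact_imp_closed)
  let ?f = "\<lambda>(x, s). indicator K x * (indicator {0..1} s * h (x + s *\<^sub>R z))"
  let ?K = "(\<lambda>(x, s::real). x + s *\<^sub>R z) ` (K \<times> {0..1})"
  have [measurable]: "?K \<in> sets borel" using compact_swept[OF K] compact_imp_closed borel_closed by blast
  show [measurable]: "?f \<in> borel_measurable (lborel \<Otimes>\<^sub>M lborel)" by measurable
  define B where "B = (\<integral>\<^sup>+x. ennreal (norm (indicator ?K x *\<^sub>R h x)) \<partial>lborel)"
  have "integrable lborel (\<lambda>x. indicator ?K x *\<^sub>R h x)"
    using h compact_swept[OF K] by (simp add: locally_integrable_def set_integrable_def)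
  then have B: "B < \<infinity>" unfolding B_def integrable_iff_bounded by blast
  have "(\<integral>\<^sup>+p. ennreal (norm (?f p)) \<partial>(lborel \<Otimes>\<^sub>M lborel))
      = (\<integral>\<^sup>+s. \<integral>\<^sup>+x. ennreal (norm (?f (x, s))) \<partial>lborel \<partial>lborel)"
    by (rule lborel_pair.nn_integral_snd[symmetric]) measurable
  also have "\<dots> \<le> (\<integral>\<^sup>+s. indicator {0..1::real} s * B \<partial>lborel)"
  proof (rule nn_integral_mono)
    fix s :: real
    show "(\<integral>\<^sup>+x. ennreal (norm (?f (x, s))) \<partial>lborel) \<le> indicator {0..1} s * B"
    proof (cases "s \<in> {0..1}")
      case True
      have "(\<integral>\<^sup>+x. ennreal (norm (?f (x, s))) \<partial>lborel)
          \<le> (\<integral>\<^sup>+x. ennreal (norm (indicator ?K (x + s *\<^sub>R z) *\<^sub>R h (x + s *\<^sub>R z))) \<partial>lborel)"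
      proof (intro nn_integral_mono ennreal_leI)
        fix x
        have "x \<in> K \<Longrightarrow> x + s *\<^sub>R z \<in> ?K" using True by force
        then show "norm (?f (x, s)) \<le> norm (indicator ?K (x + s *\<^sub>R z) *\<^sub>R h (x + s *\<^sub>R z))"
          using True by (auto simp: indicator_def)
      qed
      also have "\<dots> = B"
        unfolding B_def by (rule nn_integral_translate[of "\<lambda>x. ennreal (norm (indicator ?K x *\<^sub>R h x))"]) measurable
      finally show ?thesis using True by simp
    qed auto
  qed
  also have "\<dots> = B" by (subst nn_integral_multc) auto
  finally show "(\<integral>\<^sup>+p. ennreal (norm (?f p)) \<partial>(lborel \<Otimes>\<^sub>M lborel)) < \<infinity>" using B by (rule le_less_trans)
qed

section \<open>Translates and directional derivatives of test functions\<close>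

lemma Ck_cmult: "Ck k f \<Longrightarrow> Ck k (\<lambda>x. c * f x)"
  by (intro Ck_mult Ck_const)

lemma Ck_sum: "(\<And>i. i \<in> I \<Longrightarrow> Ck k (f i)) \<Longrightarrow> Ck k (\<lambda>x. \<Sum>i\<in>I. f i x)"
  by (induction I rule: infinite_finite_induct) (auto intro: Ck_const Ck_add)

lemma Ck_translate:
  fixes f :: "real^'d \<Rightarrow> real"
  assumes "Ck k f"
  shows "Ck k (\<lambda>x. f (x + w))"
  using assms
proof (induction k arbitrary: f)
  case 0
  then have "continuous_on UNIV (f \<circ> (\<lambda>x. x + w))"
    by (intro continuous_on_compose continuous_intros) (auto intro: continuous_on_subset)
  then show ?case by (simp add: o_def)
next
  case (Suc k)
  have "((\<lambda>x. f (x + w)) has_derivative frechet_derivative f (at (x + w))) (at x)" for x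
    by (rule has_derivative_compose[OF _ Ck_differentiable[OF Suc.prems], of "\<lambda>x. x + w" "\<lambda>h. h", simplified])
       (auto intro!: derivative_eq_intros)
  then have pd: "partial i (\<lambda>x. f (x + w)) = (\<lambda>x. partial i f (x + w))"
    and "(\<lambda>x. f (x + w)) differentiable (at x)" for i x
    by (auto simp: partial_eq partial_def[of i f] differentiable_def)
  moreover have "Ck k (partial i (\<lambda>x. f (x + w)))" for i
    unfolding pd using Suc by auto
  ultimately show ?case by simp
qed

lemma partial_translate:
  assumes "test_function \<psi>"
  shows "partial i (\<lambda>x. \<psi> (x + w)) x = partial i \<psi> (x + w)"
proof -
  have C: "Ck (Suc 0) \<psi>" using assms unfolding test_function_def by blast
  have "((\<lambda>x. \<psi> (x + w)) has_derivative frechet_derivative \<psi> (at (x + w))) (at x)"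
    by (rule has_derivative_compose[OF _ Ck_differentiable[OF C], of "\<lambda>x. x + w" "\<lambda>h. h", simplified])
       (auto intro!: derivative_eq_intros)
  then show ?thesis by (auto simp: partial_eq partial_def[of i \<psi>])
qed

lemma test_function_supportI:
  assumes "\<And>k. Ck k \<psi>" "{x. \<psi> x \<noteq> 0} \<subseteq> K" "compact K"
  shows "test_function \<psi>"
proof -
  have "closure {x. \<psi> x \<noteq> 0} \<subseteq> K"
    using assms(2) compact_imp_closed[OF assms(3)] by (rule closure_minimal)
  then have "compact (closure {x. \<psi> x \<noteq> 0})"
    using assms(3) bounded_subset by (auto simp: compact_eq_bounded_closed)
  with assms(1) show ?thesis by (simp add: test_function_def)
qed

lemma test_function_translate:
  assumes "test_function \<psi>"
  shows "test_function (\<lambda>x. \<psi> (x + w))"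
proof (rule test_function_supportI)
  let ?K = "closure {x. \<psi> x \<noteq> 0}"
  show "Ck k (\<lambda>x. \<psi> (x + w))" for k
    using assms by (auto simp: test_function_def intro: Ck_translate)
  show "compact ((\<lambda>x. x - w) ` ?K)"
    using assms by (intro compact_continuous_image continuous_intros) (simp add: test_function_def)
  show "{x. \<psi> (x + w) \<noteq> 0} \<subseteq> (\<lambda>x. x - w) ` ?K"
  proof
    fix x assume "x \<in> {x. \<psi> (x + w) \<noteq> 0}"
    then have "x + w \<in> ?K" using closure_subset[of "{x. \<psi> x \<noteq> 0}"] by auto
    then show "x \<in> (\<lambda>x. x - w) ` ?K" by (rule rev_image_eqI) simp
  qed
qed

lemma partial_outside_support:
  assumes "x \<notin> closure {x. \<psi> x \<noteq> 0}"
  shows "partial i \<psi> x = 0"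
proof -
  let ?U = "- closure {x. \<psi> x \<noteq> 0}"
  have 0: "\<psi> y = 0" if "y \<in> ?U" for y using that closure_subset[of "{x. \<psi> x \<noteq> 0}"] by auto
  have "(\<psi> has_derivative (\<lambda>h. 0)) (at x)"
  proof (rule has_derivative_transform_within_open[where f = "\<lambda>x. 0" and s = ?U])
    show "((\<lambda>x. 0) has_derivative (\<lambda>h. 0)) (at x)" by (rule has_derivative_const)
    show "x \<in> ?U" using assms by simp
    show "0 = \<psi> y" if "y \<in> ?U" for y using 0[OF that] by simp
  qed (rule open_Compl[OF closed_closure])
  then show ?thesis by (simp add: partial_eq)
qed

lemma test_function_partial:
  assumes "test_function \<psi>"
  shows "test_function (partial i \<psi>)"
proof (rule test_function_supportI)
  have "Ck (Suc k) \<psi>" for k using assms unfolding test_function_def by blast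
  then show "Ck k (partial i \<psi>)" for k by auto
  show "{x. partial i \<psi> x \<noteq> 0} \<subseteq> closure {x. \<psi> x \<noteq> 0}"
    using partial_outside_support by blast
qed (use assms in \<open>simp add: test_function_def\<close>)

lemma test_function_bounded:
  assumes "test_function \<psi>"
  obtains B where "\<And>x. \<bar>\<psi> x\<bar> \<le> B"
proof -
  let ?K = "closure {x. \<psi> x \<noteq> 0}"
  have "compact (\<psi> ` ?K)"
    using assms test_function_continuous[OF assms]
    by (intro compact_continuous_image) (auto simp: test_function_def intro: continuous_on_subset)
  then obtain B where B: "\<And>y. y \<in> \<psi> ` ?K \<Longrightarrow> norm y \<le> B"
    by (meson bounded_iff compact_imp_bounded)
  have "\<bar>\<psi> x\<bar> \<le> max B 0" for x
  proof (cases "\<psi> x = 0")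
    case False
    then have "x \<in> ?K" using closure_subset[of "{x. \<psi> x \<noteq> 0}"] by auto
    then show ?thesis using B[of "\<psi> x"] by auto
  qed auto
  then show thesis by (rule that)
qed

lemma integrable_times_test:
  assumes "locally_integrable f" "test_function \<psi>"
  shows "integrable lborel (\<lambda>x. f x * \<psi> x)"
proof -
  obtain B where "\<And>x. \<bar>\<psi> x\<bar> \<le> B" using test_function_bounded[OF assms(2)] by blast
  then show ?thesis
    using assms closure_subset[of "{x. \<psi> x \<noteq> 0}"]
    by (intro integrable_locally_times_bounded[of f "closure {x. \<psi> x \<noteq> 0}" \<psi> B])
       (auto simp: test_function_measurable test_function_def)
qed

lemma locally_integrable_component:
  "locally_integrable g \<Longrightarrow> locally_integrable (\<lambda>x. g x $ i :: real)"
  by (rule locally_integrable_bounded_linear[OF bounded_linear_vec_nth])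

lemma weak_gradient_directional:
  assumes w: "has_weak_gradient f g" and \<psi>: "test_function \<psi>"
  shows "(LINT x|lborel. f x * (\<Sum>i\<in>UNIV. z $ i * partial i \<psi> x)) = - (LINT x|lborel. (g x \<bullet> z) * \<psi> x)"
proof -
  have f: "locally_integrable f" and g: "locally_integrable g" using w by (auto simp: has_weak_gradient_def)
  have "(LINT x|lborel. f x * (\<Sum>i\<in>UNIV. z $ i * partial i \<psi> x))
      = (LINT x|lborel. (\<Sum>i\<in>UNIV. z $ i * (f x * partial i \<psi> x)))"
    by (simp add: sum_distrib_left mult.left_commute)
  also have "\<dots> = (\<Sum>i\<in>UNIV. z $ i * (LINT x|lborel. f x * partial i \<psi> x))"
    using integrable_times_test[OF f test_function_partial[OF \<psi>]]
    by (simp add: Bochner_Integration.integral_sum)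
  also have "\<dots> = (\<Sum>i\<in>UNIV. z $ i * - (LINT x|lborel. g x $ i * \<psi> x))"
    using w \<psi> by (simp add: has_weak_gradient_def)
  also have "\<dots> = - (LINT x|lborel. (\<Sum>i\<in>UNIV. z $ i * (g x $ i * \<psi> x)))"
    using integrable_times_test[OF locally_integrable_component[OF g] \<psi>]
    by (simp add: Bochner_Integration.integral_sum sum_negf)
  also have "(\<lambda>x. \<Sum>i\<in>UNIV. z $ i * (g x $ i * \<psi> x)) = (\<lambda>x. (g x \<bullet> z) * \<psi> x)"
    by (auto simp: inner_vec_def sum_distrib_right sum_distrib_left mult_ac)
  finally show ?thesis .
qed

lemma test_function_DERIV_line:
  assumes "test_function \<psi>"
  shows "((\<lambda>s. \<psi> (x + s *\<^sub>R z)) has_real_derivative (\<Sum>i\<in>UNIV. z $ i * partial i \<psi> (x + s *\<^sub>R z))) (at s)"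
proof -
  have "Ck (Suc 0) \<psi>" using assms unfolding test_function_def by blast
  note D = Ck_differentiable[OF this, of "x + s *\<^sub>R z"]
  have "((\<lambda>s. \<psi> (x + s *\<^sub>R z)) has_derivative (\<lambda>h. frechet_derivative \<psi> (at (x + s *\<^sub>R z)) (h *\<^sub>R z))) (at s)"
    by (rule has_derivative_compose[where f = "\<lambda>s. x + s *\<^sub>R z"])
       (auto intro!: derivative_eq_intros D)
  moreover have "frechet_derivative \<psi> (at (x + s *\<^sub>R z)) (h *\<^sub>R z)
      = (\<Sum>i\<in>UNIV. z $ i * partial i \<psi> (x + s *\<^sub>R z)) * h" for h
  proof -
    interpret linear "frechet_derivative \<psi> (at (x + s *\<^sub>R z))"
      using D has_derivative_linear by blast
    have "z = (\<Sum>i\<in>UNIV. z $ i *\<^sub>R axis i 1)"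
      using basis_expansion[of z] by (simp add: scalar_mult_eq_scaleR)
    then have "frechet_derivative \<psi> (at (x + s *\<^sub>R z)) z
        = frechet_derivative \<psi> (at (x + s *\<^sub>R z)) (\<Sum>i\<in>UNIV. z $ i *\<^sub>R axis i 1)"
      by (rule arg_cong)
    also have "\<dots> = (\<Sum>i\<in>UNIV. z $ i * partial i \<psi> (x + s *\<^sub>R z))"
      by (simp add: sum scale partial_def)
    finally have "frechet_derivative \<psi> (at (x + s *\<^sub>R z)) z = (\<Sum>i\<in>UNIV. z $ i * partial i \<psi> (x + s *\<^sub>R z))" .
    then show ?thesis by (simp add: scale mult.commute)
  qed
  ultimately show ?thesis by (simp add: has_field_derivative_def)
qed

lemma test_function_directional:
  assumes "test_function \<psi>"
  shows "test_function (\<lambda>x. \<Sum>i\<in>UNIV. z $ i * partial i \<psi> x)"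
proof (rule test_function_supportI)
  show "Ck k (\<lambda>x. \<Sum>i\<in>UNIV. z $ i * partial i \<psi> x)" for k
    using test_function_partial[OF assms] by (intro Ck_sum Ck_cmult) (simp add: test_function_def)
  show "{x. (\<Sum>i\<in>UNIV. z $ i * partial i \<psi> x) \<noteq> 0} \<subseteq> closure {x. \<psi> x \<noteq> 0}"
  proof (rule subsetI, rule ccontr)
    fix x assume "x \<in> {x. (\<Sum>i\<in>UNIV. z $ i * partial i \<psi> x) \<noteq> 0}" "x \<notin> closure {x. \<psi> x \<noteq> 0}"
    with partial_outside_support[of x \<psi>] show False by simp
  qed
  show "compact (closure {x. \<psi> x \<noteq> 0})" using assms by (simp add: test_function_def)
qed

text \<open>Moving the translation onto the test function and integrating its derivative along the segment
  reduces the difference formula to the weak gradient tested with translates of \<open>\<psi>\<close>.\<close>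

theorem weak_gradient_difference:
  fixes f :: "real^'d \<Rightarrow> real"
  assumes w: "has_weak_gradient f g"
  shows "AE x in lborel. f (x + z) - f x = (LINT s|lborel. indicator {0..1} s * (g (x + s *\<^sub>R z) \<bullet> z))"
proof -
  have f: "locally_integrable f" and g: "locally_integrable g" using w by (auto simp: has_weak_gradient_def)
  define h where "h x = g x \<bullet> z" for x
  have h: "locally_integrable h"
    unfolding h_def by (rule locally_integrable_bounded_linear[OF bounded_linear_inner_left g])
  have [measurable]: "f \<in> borel_measurable borel" "h \<in> borel_measurable borel"
    using f h by (auto intro: locally_integrable_measurable)
  define G where "G x = (LINT s|lborel. indicator {0..1} s * h (x + s *\<^sub>R z))" for x
  have G: "locally_integrable G"
    unfolding locally_integrable_def set_integrable_def
  proof (intro allI impI)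
    fix K :: "(real^'d) set" assume "compact K"
    from lborel_pair.integrable_fst[OF integrable_swept[OF h this, of z]]
    show "integrable lborel (\<lambda>x. indicator K x *\<^sub>R G x)"
      by (simp add: G_def)
  qed
  have "AE x in lborel. f (x + z) - f x - G x = 0"
  proof (rule du_Bois_Reymond)
    show "locally_integrable (\<lambda>x. f (x + z) - f x - G x)"
      by (intro locally_integrable_diff locally_integrable_translate f G)
    fix \<psi> :: "real^'d \<Rightarrow> real" assume \<psi>: "test_function \<psi>"
    note [measurable] = test_function_measurable[OF \<psi>]
    define D where "D x = (\<Sum>i\<in>UNIV. z $ i * partial i \<psi> x)" for x
    have D: "test_function D" unfolding D_def by (rule test_function_directional[OF \<psi>])
    note [measurable] = test_function_measurable[OF D]
    define K where "K = closure {x. \<psi> x \<noteq> 0}"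
    have K: "compact K" using \<psi> by (simp add: K_def test_function_def)
    have \<psi>0: "x \<notin> K \<Longrightarrow> \<psi> x = 0" for x using closure_subset[of "{x. \<psi> x \<noteq> 0}"] by (auto simp: K_def)
    have D0: "x \<notin> K \<Longrightarrow> D x = 0" for x
      using partial_outside_support[of x \<psi>] by (simp add: K_def D_def)
    let ?K = "(\<lambda>(x, s::real). x + s *\<^sub>R z) ` (K \<times> {0..1})"
    have [measurable]: "K \<in> sets borel" "?K \<in> sets borel"
      using K compact_swept[OF K, of z] compact_imp_closed borel_closed by blast+
    obtain B where B: "\<And>x. \<bar>\<psi> x\<bar> \<le> B" using test_function_bounded[OF \<psi>] by blast
    obtain C where C: "\<And>x. \<bar>D x\<bar> \<le> C" using test_function_bounded[OF D] by blast
    \<comment> \<open>The segment is traversed backwards, because translating \<open>f\<close> by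
      \<open>z\<close> amounts to translating the test function by \<open>- z\<close>.\<close>
    have FTC: "\<psi> (x - z) - \<psi> x = - (LINT s|lborel. indicator {0..1} s * D (x - s *\<^sub>R z))" for x
    proof -
      have "(LINT s|lborel. (- D (x - s *\<^sub>R z)) * indicator {0..1} s) = \<psi> (x + 1 *\<^sub>R - z) - \<psi> (x + 0 *\<^sub>R - z)"
      proof (rule integral_FTC_Icc_real)
        fix s :: real
        show "((\<lambda>s. \<psi> (x + s *\<^sub>R - z)) has_real_derivative - D (x - s *\<^sub>R z)) (at s)"
          using test_function_DERIV_line[OF \<psi>, of x "- z" s] by (simp add: D_def sum_negf)
        show "isCont (\<lambda>s. - D (x - s *\<^sub>R z)) s"
        proof -
          have "isCont D (x - s *\<^sub>R z)"
            using test_function_continuous[OF D] by (simp add: continuous_on_eq_continuous_at)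
          moreover have "isCont (\<lambda>s. x - s *\<^sub>R z) s" by (intro continuous_intros)
          ultimately show ?thesis by (intro continuous_minus) (rule isCont_o2)
        qed
      qed simp
      moreover have "(LINT s|lborel. (- D (x - s *\<^sub>R z)) * indicator {0..1} s)
          = (LINT s|lborel. - (indicator {0..1} s * D (x - s *\<^sub>R z)))"
        by (simp add: mult.commute)
      ultimately show ?thesis by simp
    qed
    have int1: "integrable (lborel \<Otimes>\<^sub>M lborel) (\<lambda>(x, s). f x * (indicator {0..1} s * D (x - s *\<^sub>R z)))"
    proof (rule Bochner_Integration.integrable_bound)
      \<comment> \<open>\<open>integrable_swept\<close> is used with displacement 0 and with the
        swept set in place of \<open>K\<close>: here \<open>f\<close> stays at \<open>x\<close>, and
        it is the factor \<open>D (x - s *\<^sub>R z)\<close> that confines \<open>x\<close> to the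
        swept set.\<close>
      show "integrable (lborel \<Otimes>\<^sub>M lborel) (\<lambda>p. C * (case p of (x, s) \<Rightarrow> indicator ?K x * (indicator {0..1} s * f (x + s *\<^sub>R 0))))"
        by (rule integrable_mult_right[OF integrable_swept[OF f compact_swept[OF K]]])
      have "norm (f x * (indicator {0..1} s * D (x - s *\<^sub>R z)))
          \<le> norm (C * (indicator ?K x * (indicator {0..1} s * f (x + s *\<^sub>R 0))))" for x s
      proof (cases "s \<in> {0..1} \<and> D (x - s *\<^sub>R z) \<noteq> 0")
        case True
        then have "x - s *\<^sub>R z \<in> K" using D0 by blast
        then have "x \<in> ?K" using True by (intro image_eqI[of _ _ "(x - s *\<^sub>R z, s)"]) auto
        moreover have "\<bar>f x\<bar> * \<bar>D (x - s *\<^sub>R z)\<bar> \<le> \<bar>f x\<bar> * \<bar>C\<bar>"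
          using C[of "x - s *\<^sub>R z"] by (intro mult_left_mono) auto
        ultimately show ?thesis using True by (simp add: abs_mult mult.commute)
      qed auto
      then show "AE p in lborel \<Otimes>\<^sub>M lborel. norm (case p of (x, s) \<Rightarrow> f x * (indicator {0..1} s * D (x - s *\<^sub>R z)))
          \<le> norm (C * (case p of (x, s) \<Rightarrow> indicator ?K x * (indicator {0..1} s * f (x + s *\<^sub>R 0))))"
        by (intro AE_I2) (simp add: case_prod_unfold)
    qed measurable
    have int2: "integrable (lborel \<Otimes>\<^sub>M lborel) (\<lambda>(x, s). \<psi> x * (indicator {0..1} s * h (x + s *\<^sub>R z)))"
    proof (rule Bochner_Integration.integrable_bound)
      show "integrable (lborel \<Otimes>\<^sub>M lborel) (\<lambda>p. B * (case p of (x, s) \<Rightarrow> indicator K x * (indicator {0..1} s * h (x + s *\<^sub>R z))))"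
        by (rule integrable_mult_right[OF integrable_swept[OF h K]])
      have "norm (\<psi> x * y) \<le> norm (B * (indicator K x * y))" for x y
        using B[of x] \<psi>0[of x] by (cases "x \<in> K") (auto simp: abs_mult intro!: mult_right_mono)
      then show "AE p in lborel \<Otimes>\<^sub>M lborel. norm (case p of (x, s) \<Rightarrow> \<psi> x * (indicator {0..1} s * h (x + s *\<^sub>R z)))
          \<le> norm (B * (case p of (x, s) \<Rightarrow> indicator K x * (indicator {0..1} s * h (x + s *\<^sub>R z))))"
        by (intro AE_I2) (simp add: case_prod_unfold)
    qed measurable
    have slice: "(LINT x|lborel. f x * D (x - s *\<^sub>R z)) = - (LINT x|lborel. \<psi> x * h (x + s *\<^sub>R z))" for s
    proof -
      have t: "test_function (\<lambda>x. \<psi> (x - s *\<^sub>R z))"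
        using test_function_translate[OF \<psi>, of "- (s *\<^sub>R z)"] by simp
      have "(LINT x|lborel. f x * D (x - s *\<^sub>R z)) = - (LINT x|lborel. h x * \<psi> (x - s *\<^sub>R z))"
        using weak_gradient_directional[OF w t, of z] partial_translate[OF \<psi>, of _ "- (s *\<^sub>R z)"]
        by (simp add: D_def h_def)
      also have "(LINT x|lborel. h x * \<psi> (x - s *\<^sub>R z)) = (LINT x|lborel. h (x + s *\<^sub>R z) * \<psi> (x + s *\<^sub>R z - s *\<^sub>R z))"
        by (rule integral_translate[of "\<lambda>x. h x * \<psi> (x - s *\<^sub>R z)", symmetric]) measurable
      finally show ?thesis by (simp add: mult.commute)
    qed
    have "(LINT x|lborel. f x * (\<psi> (x - z) - \<psi> x))
        = - (LINT x|lborel. LINT s|lborel. f x * (indicator {0..1} s * D (x - s *\<^sub>R z)))"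
      by (simp add: FTC)
    also have "(LINT x|lborel. LINT s|lborel. f x * (indicator {0..1} s * D (x - s *\<^sub>R z)))
        = (LINT s|lborel. LINT x|lborel. f x * (indicator {0..1} s * D (x - s *\<^sub>R z)))"
      by (rule lborel_pair.Fubini_integral[OF int1, symmetric])
    also have "\<dots> = (LINT s|lborel. indicator {0..1} s * (LINT x|lborel. f x * D (x - s *\<^sub>R z)))"
      by (simp add: mult.left_commute[of "f x" "indicator {0..1} s" for x s])
    also have "\<dots> = - (LINT s|lborel. LINT x|lborel. \<psi> x * (indicator {0..1} s * h (x + s *\<^sub>R z)))"
      by (simp add: slice mult.left_commute[of "\<psi> x" "indicator {0..1} s" for x s])
    also have "(LINT s|lborel. LINT x|lborel. \<psi> x * (indicator {0..1} s * h (x + s *\<^sub>R z)))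
        = (LINT x|lborel. G x * \<psi> x)"
      by (simp add: lborel_pair.Fubini_integral[OF int2] G_def mult.commute)
    finally have 1: "(LINT x|lborel. f x * (\<psi> (x - z) - \<psi> x)) = (LINT x|lborel. G x * \<psi> x)"
      by simp
    have t: "test_function (\<lambda>x. \<psi> (x - z))" using test_function_translate[OF \<psi>, of "- z"] by simp
    have "(LINT x|lborel. f (x + z) * \<psi> x) = (LINT x|lborel. f x * \<psi> (x - z))"
      using integral_translate[of "\<lambda>x. f x * \<psi> (x - z)" z] by simp
    with 1 show "(LINT x|lborel. (f (x + z) - f x - G x) * \<psi> x) = 0"
      using integrable_times_test[OF f \<psi>] integrable_times_test[OF f t] integrable_times_test[OF G \<psi>]
        integrable_times_test[OF locally_integrable_translate[OF f] \<psi>, of z]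
      by (simp add: left_diff_distrib right_diff_distrib)
  qed
  then show ?thesis by (simp add: G_def h_def)
qed

lemma weak_gradient_unique:
  assumes "has_weak_gradient f g" "has_weak_gradient f h"
  shows "AE x in lborel. g x = h x"
proof -
  have "AE x in lborel. g x $ i - h x $ i = 0" for i
  proof (rule du_Bois_Reymond)
    have g: "locally_integrable (\<lambda>x. g x $ i)" and h: "locally_integrable (\<lambda>x. h x $ i)"
      using assms locally_integrable_component unfolding has_weak_gradient_def by blast+
    then show "locally_integrable (\<lambda>x. g x $ i - h x $ i)" by (rule locally_integrable_diff)
    fix \<psi> :: "real^'a \<Rightarrow> real" assume \<psi>: "test_function \<psi>"
    have "(LINT x|lborel. f x * partial i \<psi> x) = - (LINT x|lborel. g x $ i * \<psi> x)"
      "(LINT x|lborel. f x * partial i \<psi> x) = - (LINT x|lborel. h x $ i * \<psi> x)"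
      using assms \<psi> unfolding has_weak_gradient_def by blast+
    then show "(LINT x|lborel. (g x $ i - h x $ i) * \<psi> x) = 0"
      using integrable_times_test[OF g \<psi>] integrable_times_test[OF h \<psi>] by (simp add: left_diff_distrib)
  qed
  then have "AE x in lborel. \<forall>i\<in>UNIV. g x $ i - h x $ i = 0"
    by (intro AE_finite_allI) auto
  then show ?thesis by eventually_elim (simp add: vec_eq_iff)
qed

lemma has_weak_gradient_wgrad: "has_weak_gradient f g \<Longrightarrow> has_weak_gradient f (wgrad f)"
  unfolding wgrad_def by (metis someI)

lemma wgrad_AE: "has_weak_gradient f g \<Longrightarrow> AE x in lborel. wgrad f x = g x"
  using has_weak_gradient_wgrad weak_gradient_unique by blast

lemma has_weak_gradient_lincomb:
  assumes "has_weak_gradient f g" "has_weak_gradient f' g'"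
  shows "has_weak_gradient (\<lambda>x. c * f x + d * f' x) (\<lambda>x. c *\<^sub>R g x + d *\<^sub>R g' x)"
proof -
  have L: "locally_integrable f" "locally_integrable f'" "locally_integrable g" "locally_integrable g'"
    using assms by (auto simp: has_weak_gradient_def)
  have "locally_integrable (\<lambda>x. c * f x + d * f' x)" "locally_integrable (\<lambda>x. c *\<^sub>R g x + d *\<^sub>R g' x)"
    by (rule locally_integrable_add; rule locally_integrable_bounded_linear[OF bounded_linear_mult_right]
      locally_integrable_bounded_linear[OF bounded_linear_scaleR_right]; rule L)+
  moreover have "(LINT x|lborel. (c * f x + d * f' x) * partial i \<psi> x) =
      - (LINT x|lborel. (c *\<^sub>R g x + d *\<^sub>R g' x) $ i * \<psi> x)" if \<psi>: "test_function \<psi>" for \<psi> i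
    using assms \<psi> integrable_times_test[OF L(1) test_function_partial[OF \<psi>], of i]
      integrable_times_test[OF L(2) test_function_partial[OF \<psi>], of i]
      integrable_times_test[OF locally_integrable_component[OF L(3)] \<psi>, of i]
      integrable_times_test[OF locally_integrable_component[OF L(4)] \<psi>, of i]
    by (simp add: distrib_right mult.assoc has_weak_gradient_def)
  ultimately show ?thesis by (simp add: has_weak_gradient_def)
qed

section \<open>Periodic functions\<close>

text \<open>Closure under differences makes the almost-everywhere periods of \<open>f\<close> a
  subgroup; sums, negatives and integer multiples are derived from it in
  \<open>ae_periodic_lat\<close>.\<close>

lemma AE_translate_group:
  fixes f :: "'a::euclidean_space \<Rightarrow> 'b"
  assumes "AE x in lborel. f (x + y) = f x" "AE x in lborel. f (x + z) = f x"
  shows "AE x in lborel. f (x + (y - z)) = f x"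
  using AE_translate[OF assms(1), of "- z"] AE_translate[OF assms(2), of "- z"]
  by eventually_elim (simp add: algebra_simps)

text \<open>Weak gradients are determined only up to null sets, so the pointwise condition
  \<open>box_periodic\<close> cannot be asked of them.\<close>

definition ae_periodic :: "real^'d \<Rightarrow> real^'d \<Rightarrow> (real^'d \<Rightarrow> 'b) \<Rightarrow> bool"
  where "ae_periodic a b f \<longleftrightarrow> (\<forall>i. AE x in lborel. f (x + axis i (b $ i - a $ i)) = f x)"

lemma ae_periodic_compose: "ae_periodic a b f \<Longrightarrow> ae_periodic a b (\<lambda>x. h (f x))"
  unfolding ae_periodic_def
proof
  fix i assume "\<forall>i. AE x in lborel. f (x + axis i (b $ i - a $ i)) = f x"
  then have "AE x in lborel. f (x + axis i (b $ i - a $ i)) = f x" ..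
  then show "AE x in lborel. h (f (x + axis i (b $ i - a $ i))) = h (f x)"
    by eventually_elim simp
qed

lemma ae_periodic_compose2:
  "ae_periodic a b f \<Longrightarrow> ae_periodic a b g \<Longrightarrow> ae_periodic a b (\<lambda>x. h (f x) (g x))"
  using ae_periodic_compose[of a b "\<lambda>x. (f x, g x)" "\<lambda>p. h (fst p) (snd p)"]
  by (auto simp: ae_periodic_def intro: eventually_conj)

lemma box_periodic_imp_ae: "box_periodic a b f \<Longrightarrow> ae_periodic a b f"
  by (simp add: ae_periodic_def box_periodic_def)

locale periodic_cell =
  fixes a b :: "real^'d"
  assumes nondegenerate: "\<And>i. a $ i < b $ i"
begin

definition lat :: "int^'d \<Rightarrow> real^'d"
  where "lat k = (\<chi> i. of_int (k $ i) * (b $ i - a $ i))"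

text \<open>Half-open, unlike \<open>box a b\<close>, so that every point of the space lies in
  exactly one lattice translate; the two sets differ by a null set.\<close>

definition cell :: "(real^'d) set"
  where "cell = {x. \<forall>i. a $ i \<le> x $ i \<and> x $ i < b $ i}"

lemma cell_measurable [measurable]: "cell \<in> sets borel"
  unfolding cell_def by measurable

lemma lat_uminus: "lat (- k) = - lat k"
  by (simp add: lat_def vec_eq_iff)

lemma ae_periodic_lat:
  assumes f: "ae_periodic a b f"
  shows "AE x in lborel. f (x + lat k) = f x"
proof -
  let ?G = "{z. AE x in lborel. f (x + z) = f x}"
  have 0: "0 \<in> ?G" by simp
  have diff: "y - z \<in> ?G" if "y \<in> ?G" "z \<in> ?G" for y z
    using that AE_translate_group by blast
  have neg: "- z \<in> ?G" if "z \<in> ?G" for z using diff[OF 0 that] by simp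
  have add: "y + z \<in> ?G" if "y \<in> ?G" "z \<in> ?G" for y z using diff[OF that(1) neg[OF that(2)]] by simp
  have nat: "real n *\<^sub>R z \<in> ?G" if "z \<in> ?G" for n z
  proof (induction n)
    case (Suc n)
    have "real (Suc n) *\<^sub>R z = z + real n *\<^sub>R z" by (simp add: scaleR_add_left)
    then show ?case using add[OF that Suc] by (simp only:)
  qed (use 0 in simp)
  have int: "of_int m *\<^sub>R z \<in> ?G" if "z \<in> ?G" for m z
  proof (cases "m \<ge> 0")
    case True
    then show ?thesis using nat[OF that, of "nat m"] by simp
  next
    case False
    then show ?thesis using neg[OF nat[OF that, of "nat (- m)"]] by simp
  qed
  have sum: "(\<Sum>i\<in>I. of_int (k $ i) *\<^sub>R axis i (b $ i - a $ i)) \<in> ?G" for I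
  proof (induction I rule: infinite_finite_induct)
    case (insert i I)
    have "axis i (b $ i - a $ i) \<in> ?G" using f by (simp add: ae_periodic_def)
    from add[OF int[OF this] insert.IH] insert show ?case by simp
  qed (use 0 in auto)
  have "lat k = (\<Sum>i\<in>UNIV. of_int (k $ i) *\<^sub>R axis i (b $ i - a $ i))"
    by (simp add: lat_def vec_eq_iff axis_def if_distrib cong: if_cong)
  with sum[of UNIV] show ?thesis by simp
qed

text \<open>The conditions on the coordinates are independent, and each forces its shift to be the
  ceiling of \<open>(a $ i - y $ i) / (b $ i - a $ i)\<close>.\<close>

lemma cell_tiling: "\<exists>!k. y + lat k \<in> cell"
proof -
  have 1: "a $ i \<le> y $ i + of_int m * (b $ i - a $ i) \<and> y $ i + of_int m * (b $ i - a $ i) < b $ i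
      \<longleftrightarrow> m = \<lceil>(a $ i - y $ i) / (b $ i - a $ i)\<rceil>" for m i
    using nondegenerate[of i] by (subst eq_commute) (auto simp: ceiling_eq_iff field_simps)
  have "y + lat k \<in> cell \<longleftrightarrow> k = (\<chi> i. \<lceil>(a $ i - y $ i) / (b $ i - a $ i)\<rceil>)" for k
    by (simp add: cell_def lat_def 1 vec_eq_iff)
  then show ?thesis by simp
qed

lemma cell_tiling_sum:
  "(\<integral>\<^sup>+k. indicator cell (y + lat k) \<partial>count_space UNIV) = 1"
  "(\<integral>\<^sup>+k. indicator cell (y - lat k) \<partial>count_space UNIV) = 1"
proof -
  obtain k0 where k0: "\<And>k. y + lat k \<in> cell \<longleftrightarrow> k = k0" using cell_tiling[of y] by metis
  have "(\<lambda>k. indicator cell (y + lat k) :: ennreal) = indicator {k0}"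
    by (auto simp: indicator_def k0)
  then show "(\<integral>\<^sup>+k. indicator cell (y + lat k) \<partial>count_space UNIV) = 1"
    by (simp add: nn_integral_indicator)
  have "y - lat k \<in> cell \<longleftrightarrow> k = - k0" for k
    using k0[of "- k"] by (auto simp: lat_uminus)
  then have "(\<lambda>k. indicator cell (y - lat k) :: ennreal) = indicator {- k0}"
    by (auto simp: indicator_def)
  then show "(\<integral>\<^sup>+k. indicator cell (y - lat k) \<partial>count_space UNIV) = 1"
    by (simp add: nn_integral_indicator)
qed

text \<open>The space is split into lattice translates of the cell and each piece is translated
  back; \<open>F\<close> does not notice, while the weight \<open>h\<close> is replaced by the sum
  of its translates. Translation invariance and the comparison with compact sets are two choices of
  \<open>h\<close>.\<close>

lemma nn_integral_unfold:
  assumes [measurable]: "F \<in> borel_measurable borel" "h \<in> borel_measurable borel"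
    and F: "ae_periodic a b F"
  shows "(\<integral>\<^sup>+y. h y * F y \<partial>lborel) =
    (\<integral>\<^sup>+y. indicator cell y * F y * (\<integral>\<^sup>+k. h (y - lat k) \<partial>count_space UNIV) \<partial>lborel)"
proof -
  have "(\<integral>\<^sup>+y. h y * F y \<partial>lborel)
      = (\<integral>\<^sup>+y. (\<integral>\<^sup>+k. indicator cell (y + lat k) \<partial>count_space UNIV) * (h y * F y) \<partial>lborel)"
    by (simp add: cell_tiling_sum)
  also have "\<dots> = (\<integral>\<^sup>+y. \<integral>\<^sup>+k. indicator cell (y + lat k) * (h y * F y) \<partial>count_space UNIV \<partial>lborel)"
    by (simp add: nn_integral_multc)
  also have "\<dots> = (\<integral>\<^sup>+k. \<integral>\<^sup>+y. indicator cell (y + lat k) * (h y * F y) \<partial>lborel \<partial>count_space UNIV)"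
    by (rule nn_integral_count_space_nn_integral) auto
  also have "\<dots> = (\<integral>\<^sup>+k. \<integral>\<^sup>+y. indicator cell y * F y * h (y - lat k) \<partial>lborel \<partial>count_space UNIV)"
  proof (rule nn_integral_cong)
    fix k
    have "(\<integral>\<^sup>+y. indicator cell (y + lat k) * (h y * F y) \<partial>lborel)
        = (\<integral>\<^sup>+y. indicator cell y * (h (y - lat k) * F (y - lat k)) \<partial>lborel)"
      using nn_integral_translate[of "\<lambda>y. indicator cell y * (h (y - lat k) * F (y - lat k))" "lat k"] by simp
    also have "\<dots> = (\<integral>\<^sup>+y. indicator cell y * F y * h (y - lat k) \<partial>lborel)"
      using ae_periodic_lat[OF F, of "- k"]
      by (intro nn_integral_cong_AE) (auto elim!: eventually_mono simp: lat_uminus mult_ac)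
    finally show "(\<integral>\<^sup>+y. indicator cell (y + lat k) * (h y * F y) \<partial>lborel)
        = (\<integral>\<^sup>+y. indicator cell y * F y * h (y - lat k) \<partial>lborel)" .
  qed
  also have "\<dots> = (\<integral>\<^sup>+y. \<integral>\<^sup>+k. indicator cell y * F y * h (y - lat k) \<partial>count_space UNIV \<partial>lborel)"
    by (rule nn_integral_count_space_nn_integral[symmetric]) auto
  also have "\<dots> = (\<integral>\<^sup>+y. indicator cell y * F y * (\<integral>\<^sup>+k. h (y - lat k) \<partial>count_space UNIV) \<partial>lborel)"
    by (simp add: nn_integral_cmult)
  finally show ?thesis .
qed

lemma AE_box_cell: "AE x in lborel. x \<in> cell \<longleftrightarrow> x \<in> box a b"
proof -
  have "AE x in lborel. \<forall>i\<in>UNIV. x $ i \<noteq> a $ i"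
  proof (intro AE_finite_allI)
    fix i show "AE x in lborel. x $ i \<noteq> a $ i"
      using AE_lborel_inner_neq[of "axis i 1 :: real^'d" "a $ i"] by (simp add: inner_axis axis_in_Basis_iff)
  qed simp
  then show ?thesis
    by eventually_elim (unfold cell_def mem_box_cart mem_Collect_eq, metis UNIV_I less_le)
qed

lemma nn_integral_cell_box:
  "(\<integral>\<^sup>+x. indicator cell x * F x \<partial>lborel) = (\<integral>\<^sup>+x\<in>box a b. F x \<partial>lborel)"
  using AE_box_cell by (intro nn_integral_cong_AE) (auto elim!: eventually_mono simp: indicator_def)

text \<open>Unfolding with a translated cell as the weight: its lattice translates tile the space as
  well, so the periodised weight is the constant 1.\<close>

lemma nn_integral_periodic_translate:
  assumes [measurable]: "F \<in> borel_measurable borel" and F: "ae_periodic a b F"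
  shows "(\<integral>\<^sup>+x\<in>box a b. F (x + z) \<partial>lborel) = (\<integral>\<^sup>+x\<in>box a b. F x \<partial>lborel)"
proof -
  have "(\<integral>\<^sup>+x\<in>box a b. F (x + z) \<partial>lborel) = (\<integral>\<^sup>+x. indicator cell x * F (x + z) \<partial>lborel)"
    by (rule nn_integral_cell_box[symmetric])
  also have "\<dots> = (\<integral>\<^sup>+x. indicator cell (x - z) * F x \<partial>lborel)"
    using nn_integral_translate[of "\<lambda>x. indicator cell (x - z) * F x" z] by simp
  also have "\<dots> = (\<integral>\<^sup>+y. indicator cell y * F y * (\<integral>\<^sup>+k. indicator cell (y - z - lat k) \<partial>count_space UNIV) \<partial>lborel)"
    by (subst nn_integral_unfold[OF _ _ F]) (auto simp: algebra_simps)
  also have "\<dots> = (\<integral>\<^sup>+x\<in>box a b. F x \<partial>lborel)"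
    by (simp add: cell_tiling_sum nn_integral_cell_box)
  finally show ?thesis .
qed

text \<open>A compact set meets only finitely many lattice translates of the cell, and
  \<open>N\<close> bounds their number. It depends on \<open>K\<close> alone, so one constant serves
  every periodic integrand.\<close>

lemma nn_integral_compact_le:
  assumes K: "compact K"
  obtains N :: nat where "\<And>F. F \<in> borel_measurable borel \<Longrightarrow> ae_periodic a b F \<Longrightarrow>
    (\<integral>\<^sup>+x\<in>K. F x \<partial>lborel) \<le> of_nat N * (\<integral>\<^sup>+x\<in>box a b. F x \<partial>lborel)"
proof -
  have [measurable]: "K \<in> sets borel" using K by (simp add: compact_imp_closed)
  obtain R where R: "\<And>x. x \<in> K \<Longrightarrow> norm x \<le> R"
    using compact_imp_bounded[OF K] by (auto simp: bounded_iff)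
  \<comment> \<open>If \<open>y\<close> is in the cell and \<open>y - lat k\<close> is in
    \<open>K\<close>, then \<open>|k $ i| * (b $ i - a $ i)\<close> is at most
    \<open>|y $ i| + R\<close>, and \<open>|y $ i|\<close> is at most
    \<open>|a $ i| + |b $ i|\<close>.\<close>
  define M where "M i = \<lceil>(R + \<bar>a $ i\<bar> + \<bar>b $ i\<bar>) / (b $ i - a $ i)\<rceil>" for i
  define S where "S = (\<lambda>f. \<chi> i. f i) ` (PiE UNIV (\<lambda>i. {- M i..M i}))"
  have S: "finite S" unfolding S_def by (intro finite_imageI finite_PiE) auto
  have kS: "k \<in> S" if y: "y \<in> cell" and K: "y - lat k \<in> K" for y k
  proof -
    have "k $ i \<in> {- M i..M i}" for i
    proof -
      let ?l = "b $ i - a $ i"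
      have l: "?l > 0" using nondegenerate[of i] by simp
      have "\<bar>(y - lat k) $ i\<bar> \<le> R" using component_le_norm_cart R[OF K] order_trans by blast
      moreover have "\<bar>y $ i\<bar> \<le> \<bar>a $ i\<bar> + \<bar>b $ i\<bar>"
        using y unfolding cell_def by (auto dest!: spec[of _ i])
      ultimately have "\<bar>of_int (k $ i) * ?l\<bar> \<le> R + \<bar>a $ i\<bar> + \<bar>b $ i\<bar>"
        by (simp add: lat_def)
      then have "\<bar>of_int (k $ i)\<bar> \<le> (R + \<bar>a $ i\<bar> + \<bar>b $ i\<bar>) / ?l"
        using l by (simp add: abs_mult field_simps)
      also have "\<dots> \<le> of_int (M i)" unfolding M_def by (rule le_of_int_ceiling)
      finally have "\<bar>k $ i\<bar> \<le> M i" by linarith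
      then show ?thesis by auto
    qed
    then show ?thesis unfolding S_def by (intro image_eqI[of _ _ "\<lambda>i. k $ i"]) auto
  qed
  show thesis
  proof
    fix F :: "real^'d \<Rightarrow> ennreal" assume [measurable]: "F \<in> borel_measurable borel" and F: "ae_periodic a b F"
    have "(\<integral>\<^sup>+x\<in>K. F x \<partial>lborel) = (\<integral>\<^sup>+x. indicator K x * F x \<partial>lborel)"
      by (simp add: mult.commute)
    also have "\<dots> = (\<integral>\<^sup>+y. indicator cell y * F y * (\<integral>\<^sup>+k. indicator K (y - lat k) \<partial>count_space UNIV) \<partial>lborel)"
      by (rule nn_integral_unfold[OF _ _ F]) auto
    also have "\<dots> \<le> (\<integral>\<^sup>+y. of_nat (card S) * (indicator cell y * F y) \<partial>lborel)"
    proof (rule nn_integral_mono)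
      fix y
      show "indicator cell y * F y * (\<integral>\<^sup>+k. indicator K (y - lat k) \<partial>count_space UNIV)
        \<le> of_nat (card S) * (indicator cell y * F y)"
      proof (cases "y \<in> cell")
        case True
        have "(\<integral>\<^sup>+k. indicator K (y - lat k) \<partial>count_space UNIV) \<le> (\<integral>\<^sup>+k. indicator S k \<partial>count_space UNIV)"
          using kS[OF True] by (intro nn_integral_mono) (auto simp: indicator_def)
        also have "\<dots> = of_nat (card S)" using S by (simp add: nn_integral_indicator emeasure_count_space)
        finally show ?thesis using True by (simp add: mult.commute mult_left_mono)
      qed simp
    qed
    also have "\<dots> = of_nat (card S) * (\<integral>\<^sup>+x\<in>box a b. F x \<partial>lborel)"
      by (subst nn_integral_cmult) (auto simp: nn_integral_cell_box)
    finally show "(\<integral>\<^sup>+x\<in>K. F x \<partial>lborel) \<le> of_nat (card S) * (\<integral>\<^sup>+x\<in>box a b. F x \<partial>lborel)" .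
  qed
qed

section \<open>Integrability of periodic functions\<close>

lemma set_integrable_box_iff:
  fixes f :: "real^'d \<Rightarrow> 'b::euclidean_space"
  assumes [measurable]: "f \<in> borel_measurable borel"
  shows "set_integrable lborel (box a b) f \<longleftrightarrow> (\<integral>\<^sup>+x\<in>box a b. ennreal (norm (f x)) \<partial>lborel) < \<infinity>"
proof -
  have "(\<integral>\<^sup>+x. ennreal (norm (indicator (box a b) x *\<^sub>R f x)) \<partial>lborel) = (\<integral>\<^sup>+x\<in>box a b. ennreal (norm (f x)) \<partial>lborel)"
    by (intro nn_integral_cong) (auto simp: indicator_def)
  then show ?thesis
    unfolding set_integrable_def by (simp add: integrable_iff_bounded)
qed

lemma set_integrable_periodic_translate:
  fixes f :: "real^'d \<Rightarrow> 'b::euclidean_space"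
  assumes [measurable]: "f \<in> borel_measurable borel" and f: "ae_periodic a b f"
  shows "set_integrable lborel (box a b) (\<lambda>x. f (x + z)) \<longleftrightarrow> set_integrable lborel (box a b) f"
  using nn_integral_periodic_translate[OF _ ae_periodic_compose[OF f], of "\<lambda>y. ennreal (norm y)" z]
  by (simp add: set_integrable_box_iff)

text \<open>Positive and negative parts reduce this to the nonnegative case.\<close>

lemma integral_periodic_translate:
  fixes f :: "real^'d \<Rightarrow> real"
  assumes [measurable]: "f \<in> borel_measurable borel" and f: "ae_periodic a b f"
    and int: "set_integrable lborel (box a b) f"
  shows "(LINT x:box a b|lborel. f (x + z)) = (LINT x:box a b|lborel. f x)"
proof -
  have eq: "ennreal (indicator (box a b) x *\<^sub>R y) = ennreal y * indicator (box a b) x"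
    "ennreal (- (indicator (box a b) x *\<^sub>R y)) = ennreal (- y) * indicator (box a b) x" for x and y :: real
    by (auto simp: indicator_def)
  have int': "set_integrable lborel (box a b) (\<lambda>x. f (x + z))"
    using int by (simp add: set_integrable_periodic_translate f)
  show ?thesis
    using int int' unfolding set_lebesgue_integral_def set_integrable_def
    by (simp only: real_lebesgue_integral_def eq
      nn_integral_periodic_translate[OF _ ae_periodic_compose[OF f, of ennreal], simplified]
      nn_integral_periodic_translate[OF _ ae_periodic_compose[OF f, of "\<lambda>y. ennreal (- y)"], simplified])
qed

lemma locally_integrable_periodic:
  fixes f :: "real^'d \<Rightarrow> 'b::euclidean_space"
  assumes [measurable]: "f \<in> borel_measurable borel" and f: "ae_periodic a b f"
    and int: "set_integrable lborel (box a b) f"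
  shows "locally_integrable f"
  unfolding locally_integrable_def
proof (intro allI impI)
  fix K :: "(real^'d) set" assume K: "compact K"
  then have [measurable]: "K \<in> sets borel" by (simp add: compact_imp_closed)
  obtain N :: nat where "\<And>F. F \<in> borel_measurable borel \<Longrightarrow> ae_periodic a b F \<Longrightarrow>
    (\<integral>\<^sup>+x\<in>K. F x \<partial>lborel) \<le> of_nat N * (\<integral>\<^sup>+x\<in>box a b. F x \<partial>lborel)"
    using nn_integral_compact_le[OF K] by blast
  from this[OF _ ae_periodic_compose[OF f, of "\<lambda>y. ennreal (norm y)"]]
  have "(\<integral>\<^sup>+x\<in>K. ennreal (norm (f x)) \<partial>lborel) \<le> of_nat N * (\<integral>\<^sup>+x\<in>box a b. ennreal (norm (f x)) \<partial>lborel)"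
    by simp
  also have "\<dots> < \<infinity>"
    using int by (simp add: set_integrable_box_iff ennreal_mult_less_top of_nat_less_top)
  finally have "(\<integral>\<^sup>+x\<in>K. ennreal (norm (f x)) \<partial>lborel) < \<infinity>" .
  moreover have "(\<integral>\<^sup>+x. ennreal (norm (indicator K x *\<^sub>R f x)) \<partial>lborel) = (\<integral>\<^sup>+x\<in>K. ennreal (norm (f x)) \<partial>lborel)"
    by (intro nn_integral_cong) (auto simp: indicator_def)
  ultimately show "set_integrable lborel K f"
    unfolding set_integrable_def by (simp add: integrable_iff_bounded)
qed

end

section \<open>The Poincare and Sobolev inequalities\<close>

lemma square_set_integral_le:
  fixes k :: "'a \<Rightarrow> real"
  assumes [measurable]: "k \<in> borel_measurable M" "S \<in> sets M"
  shows "ennreal ((LINT x:S|M. k x)\<^sup>2) \<le> emeasure M S * (\<integral>\<^sup>+x\<in>S. ennreal ((k x)\<^sup>2) \<partial>M)"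
proof (cases "set_integrable M S k")
  case True
  have "ennreal \<bar>LINT x:S|M. k x\<bar> \<le> (\<integral>\<^sup>+x. ennreal (norm (indicator S x *\<^sub>R k x)) \<partial>M)"
    using integral_norm_bound_ennreal[OF True[unfolded set_integrable_def]]
    by (simp add: set_lebesgue_integral_def)
  also have "\<dots> = (\<integral>\<^sup>+x. indicator S x * (ennreal \<bar>k x\<bar> * indicator S x) \<partial>M)"
    by (intro nn_integral_cong) (auto simp: indicator_def)
  finally have "(ennreal \<bar>LINT x:S|M. k x\<bar>)\<^sup>2 \<le> (\<integral>\<^sup>+x. indicator S x * (ennreal \<bar>k x\<bar> * indicator S x) \<partial>M)\<^sup>2"
    by (rule power_mono) simp
  also have "\<dots> \<le> (\<integral>\<^sup>+x. indicator S x ^ 2 \<partial>M) * (\<integral>\<^sup>+x. (ennreal \<bar>k x\<bar> * indicator S x) ^ 2 \<partial>M)"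
    by (rule Cauchy_Schwarz_nn_integral) auto
  also have "(\<integral>\<^sup>+x. indicator S x ^ 2 \<partial>M) = (\<integral>\<^sup>+x. indicator S x \<partial>M)"
    by (intro nn_integral_cong) (auto simp: indicator_def)
  also have "(\<integral>\<^sup>+x. (ennreal \<bar>k x\<bar> * indicator S x) ^ 2 \<partial>M) = (\<integral>\<^sup>+x\<in>S. ennreal ((k x)\<^sup>2) \<partial>M)"
    by (intro nn_integral_cong) (auto simp: indicator_def ennreal_power)
  finally show ?thesis by (simp add: ennreal_power)
\<comment> \<open>If \<open>k\<close> is not integrable on \<open>S\<close>, its integral is 0 by
  convention and the bound is trivial.\<close>
qed (simp add: set_integrable_def set_lebesgue_integral_def not_integrable_integral_eq)

lemma nn_integral_set_Fubini:
  fixes F :: "'a::euclidean_space \<Rightarrow> 'b::euclidean_space \<Rightarrow> ennreal"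
  assumes [measurable]: "(\<lambda>(x, y). F x y) \<in> borel_measurable (borel \<Otimes>\<^sub>M borel)" "S \<in> sets borel" "T \<in> sets borel"
  shows "(\<integral>\<^sup>+x\<in>S. (\<integral>\<^sup>+y\<in>T. F x y \<partial>lborel) \<partial>lborel) = (\<integral>\<^sup>+y\<in>T. (\<integral>\<^sup>+x\<in>S. F x y \<partial>lborel) \<partial>lborel)"
proof -
  have "(\<integral>\<^sup>+x\<in>S. (\<integral>\<^sup>+y\<in>T. F x y \<partial>lborel) \<partial>lborel)
      = (\<integral>\<^sup>+x. \<integral>\<^sup>+y. F x y * indicator T y * indicator S x \<partial>lborel \<partial>lborel)"
    by (intro nn_integral_cong nn_integral_multc[symmetric]) measurable
  also have "\<dots> = (\<integral>\<^sup>+y. \<integral>\<^sup>+x. F x y * indicator T y * indicator S x \<partial>lborel \<partial>lborel)"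
    by (rule lborel_pair.Fubini'[symmetric]) measurable
  also have "\<dots> = (\<integral>\<^sup>+y\<in>T. (\<integral>\<^sup>+x\<in>S. F x y \<partial>lborel) \<partial>lborel)"
  proof (rule nn_integral_cong)
    fix y
    have "(\<integral>\<^sup>+x. F x y * indicator T y * indicator S x \<partial>lborel) = (\<integral>\<^sup>+x. F x y * indicator S x * indicator T y \<partial>lborel)"
      by (simp add: mult_ac)
    also have "\<dots> = (\<integral>\<^sup>+x\<in>S. F x y \<partial>lborel) * indicator T y"
      by (intro nn_integral_multc) measurable
    finally show "(\<integral>\<^sup>+x. F x y * indicator T y * indicator S x \<partial>lborel) = (\<integral>\<^sup>+x\<in>S. F x y \<partial>lborel) * indicator T y" .
  qed
  finally show ?thesis .
qed

lemma nn_integral_affine: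
  fixes G :: "'a::euclidean_space \<Rightarrow> ennreal"
  assumes [measurable]: "G \<in> borel_measurable borel" and c: "c > 0"
  shows "(\<integral>\<^sup>+x. G x \<partial>lborel) = ennreal (c ^ DIM('a)) * (\<integral>\<^sup>+y. G (t + c *\<^sub>R y) \<partial>lborel)"
proof -
  have "(\<integral>\<^sup>+x. G x \<partial>lborel)
      = (\<integral>\<^sup>+x. G x \<partial>density (distr lborel borel (\<lambda>y. t + c *\<^sub>R y)) (\<lambda>_. ennreal (\<bar>c\<bar> ^ DIM('a))))"
    using c by (subst lborel_affine[of c t]) (auto simp: ennreal_power)
  also have "\<dots> = ennreal (c ^ DIM('a)) * (\<integral>\<^sup>+y. G (t + c *\<^sub>R y) \<partial>lborel)"
    using c by (simp add: nn_integral_density nn_integral_distr nn_integral_cmult)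
  finally show ?thesis .
qed

text \<open>Weighting the squares by \<open>t ^ n\<close> trades geometric \<open>L\<^sup>2\<close> decay for pointwise summability.\<close>

lemma AE_summable_of_geometric_L2:
  fixes u :: "nat \<Rightarrow> 'a \<Rightarrow> 'b::euclidean_space"
  assumes [measurable]: "\<And>n. u n \<in> borel_measurable M" and t: "0 < t" "t < 1" and c: "c \<ge> 0"
    and bound: "\<And>n. (\<integral>\<^sup>+x. ennreal ((norm (u n x))\<^sup>2) \<partial>M) \<le> ennreal (c * t ^ (2 * n))"
  shows "AE x in M. summable (\<lambda>n. norm (u n x))"
proof -
  have "(\<integral>\<^sup>+x. (\<Sum>n. ennreal ((norm (u n x))\<^sup>2 / t ^ n)) \<partial>M) = (\<Sum>n. \<integral>\<^sup>+x. ennreal ((norm (u n x))\<^sup>2 / t ^ n) \<partial>M)"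
    by (rule nn_integral_suminf) measurable
  also have "\<dots> \<le> (\<Sum>n. ennreal (c * t ^ n))"
  proof (intro suminf_le summableI)
    fix n
    have "(\<integral>\<^sup>+x. ennreal ((norm (u n x))\<^sup>2 / t ^ n) \<partial>M) = (\<integral>\<^sup>+x. ennreal (1 / t ^ n) * ennreal ((norm (u n x))\<^sup>2) \<partial>M)"
      using t by (intro nn_integral_cong) (simp add: ennreal_mult[symmetric])
    also have "\<dots> = ennreal (1 / t ^ n) * (\<integral>\<^sup>+x. ennreal ((norm (u n x))\<^sup>2) \<partial>M)"
      by (rule nn_integral_cmult) measurable
    also have "\<dots> \<le> ennreal (1 / t ^ n) * ennreal (c * t ^ (2 * n))"
      by (intro mult_left_mono bound) simp
    also have "\<dots> = ennreal (c * t ^ n)"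
    proof -
      have "1 / t ^ n * (c * t ^ (2 * n)) = c * t ^ n" using t by (simp add: mult_2 power_add)
      then show ?thesis using t c by (simp add: ennreal_mult[symmetric])
    qed
    finally show "(\<integral>\<^sup>+x. ennreal ((norm (u n x))\<^sup>2 / t ^ n) \<partial>M) \<le> ennreal (c * t ^ n)" .
  qed
  also have "\<dots> < \<infinity>"
  proof -
    have "summable (\<lambda>n. c * t ^ n)" using t by (intro summable_mult summable_geometric) simp
    then have "(\<Sum>n. ennreal (c * t ^ n)) \<noteq> top" using t c by (intro ennreal_suminf_neq_top) auto
    then show ?thesis by (simp add: less_top)
  qed
  finally have "AE x in M. (\<Sum>n. ennreal ((norm (u n x))\<^sup>2 / t ^ n)) \<noteq> \<infinity>"
    by (intro nn_integral_noteq_infinite) auto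
  then show ?thesis
  proof eventually_elim
    case (elim x)
    then have "summable (\<lambda>n. (norm (u n x))\<^sup>2 / t ^ n)"
      using t by (intro summable_suminf_not_top) auto
    moreover have "summable (\<lambda>n. t ^ n)" using t by (simp add: summable_geometric)
    ultimately have s: "summable (\<lambda>n. t ^ n + (norm (u n x))\<^sup>2 / t ^ n)" by (rule summable_add[rotated])
    have "norm (u n x) \<le> t ^ n + (norm (u n x))\<^sup>2 / t ^ n" for n
    proof (cases "norm (u n x) \<le> t ^ n")
      case True
      then show ?thesis using t by (simp add: add_increasing2)
    next
      case False
      then have "norm (u n x) * t ^ n \<le> (norm (u n x))\<^sup>2"
        unfolding power2_eq_square by (intro mult_left_mono) auto
      then have "norm (u n x) \<le> (norm (u n x))\<^sup>2 / t ^ n" using t by (simp add: field_simps)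
      then show ?thesis using t by (simp add: add_increasing)
    qed
    with s show ?case by (intro summable_comparison_test'[OF s, of 0]) auto
  qed
qed

text \<open>Cauchy-Schwarz is applied twice with the weights \<open>(9/10) ^ j\<close>, whose sum is
  at most 10; three powers of that sum give the 1000. The ratio is close enough to 1 that
  \<open>(10/9) ^ 3 / 2 < 1\<close>, so in \<open>sobolev_fourth\<close> the growing weights are
  absorbed by the decay \<open>(1/2) ^ j\<close>.\<close>

lemma geometric_fourth_power_le:
  fixes d :: "nat \<Rightarrow> real"
  shows "(\<Sum>j\<le>K. d j) ^ 4 \<le> 1000 * (\<Sum>j\<le>K. (10/9) ^ (3 * j) * d j ^ 4)"
proof -
  define \<theta> :: real where "\<theta> = 9 / 10"
  define T where "T = (\<Sum>j\<le>K. \<theta> ^ j)"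
  have T: "0 \<le> T" "T \<le> 10"
  proof -
    have "T \<le> (\<Sum>j. \<theta> ^ j)"
      unfolding T_def by (intro sum_le_suminf) (auto simp: \<theta>_def summable_geometric)
    also have "\<dots> = 10" by (subst suminf_geometric) (auto simp: \<theta>_def)
    finally show "T \<le> 10" .
  qed (auto simp: T_def \<theta>_def intro: sum_nonneg)
  have CS: "(\<Sum>j\<le>K. x j)\<^sup>2 \<le> T * (\<Sum>j\<le>K. (x j)\<^sup>2 / \<theta> ^ j)" for x :: "nat \<Rightarrow> real"
  proof -
    have "(\<Sum>j\<le>K. sqrt (\<theta> ^ j) * (x j / sqrt (\<theta> ^ j)))\<^sup>2
        \<le> (\<Sum>j\<le>K. (sqrt (\<theta> ^ j))\<^sup>2) * (\<Sum>j\<le>K. (x j / sqrt (\<theta> ^ j))\<^sup>2)"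
      by (rule Cauchy_Schwarz_ineq_sum)
    then show ?thesis by (simp add: T_def \<theta>_def power_divide)
  qed
  have "(\<Sum>j\<le>K. d j) ^ 4 = ((\<Sum>j\<le>K. d j)\<^sup>2)\<^sup>2" by simp
  also have "\<dots> \<le> (T * (\<Sum>j\<le>K. (d j)\<^sup>2 / \<theta> ^ j))\<^sup>2"
    by (intro power_mono CS) simp
  also have "\<dots> = T\<^sup>2 * (\<Sum>j\<le>K. (d j)\<^sup>2 / \<theta> ^ j)\<^sup>2" by (simp add: power_mult_distrib)
  also have "\<dots> \<le> T\<^sup>2 * (T * (\<Sum>j\<le>K. ((d j)\<^sup>2 / \<theta> ^ j)\<^sup>2 / \<theta> ^ j))"
    by (intro mult_left_mono CS) simp
  also have "\<dots> = T ^ 3 * (\<Sum>j\<le>K. (10/9) ^ (3 * j) * d j ^ 4)"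
  proof -
    have "((d j)\<^sup>2 / \<theta> ^ j)\<^sup>2 / \<theta> ^ j = (10/9) ^ (3 * j) * d j ^ 4" for j
    proof -
      have "(10/9::real) ^ (3 * j) = 1 / (\<theta> ^ j) ^ 3"
        by (simp add: \<theta>_def power_mult[symmetric] mult.commute power_divide)
      then show ?thesis by (simp add: power_divide power_mult_distrib power2_eq_square power3_eq_cube power4_eq_xxxx)
    qed
    then show ?thesis by (simp add: power2_eq_square power3_eq_cube)
  qed
  also have "\<dots> \<le> 10 ^ 3 * (\<Sum>j\<le>K. (10/9) ^ (3 * j) * d j ^ 4)"
    using T by (intro mult_right_mono power_mono sum_nonneg) auto
  finally show ?thesis by simp
qed

lemma has_weak_gradient_translate:
  assumes "has_weak_gradient f g"
  shows "has_weak_gradient (\<lambda>x. f (x + z)) (\<lambda>x. g (x + z))"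
proof -
  have L: "locally_integrable f" "locally_integrable g" using assms by (auto simp: has_weak_gradient_def)
  have [measurable]: "f \<in> borel_measurable borel" "g \<in> borel_measurable borel"
    using L by (auto intro: locally_integrable_measurable)
  have "(LINT x|lborel. f (x + z) * partial i \<psi> x) = - (LINT x|lborel. g (x + z) $ i * \<psi> x)"
    if \<psi>: "test_function \<psi>" for \<psi> i
  proof -
    have t: "test_function (\<lambda>x. \<psi> (x - z))" using test_function_translate[OF \<psi>, of "- z"] by simp
    note [measurable] = locally_integrable_measurable[OF locally_integrable_component[OF L(2)], of i]
      test_function_measurable[OF \<psi>] test_function_measurable[OF test_function_partial[OF \<psi>, of i]]
    have "(LINT x|lborel. f (x + z) * partial i \<psi> x) = (LINT x|lborel. f x * partial i \<psi> (x - z))"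
      using integral_translate[of "\<lambda>x. f x * partial i \<psi> (x - z)" z] by simp
    also have "\<dots> = (LINT x|lborel. f x * partial i (\<lambda>x. \<psi> (x - z)) x)"
      using partial_translate[OF \<psi>, of i "- z"] by simp
    also have "\<dots> = - (LINT x|lborel. g x $ i * \<psi> (x - z))"
      using assms t by (simp add: has_weak_gradient_def)
    also have "(LINT x|lborel. g x $ i * \<psi> (x - z)) = (LINT x|lborel. g (x + z) $ i * \<psi> x)"
      using integral_translate[of "\<lambda>x. g x $ i * \<psi> (x - z)" z] by simp
    finally show ?thesis .
  qed
  then show ?thesis
    unfolding has_weak_gradient_def
    using locally_integrable_translate[OF L(1)] locally_integrable_translate[OF L(2)] by blast
qed

section \<open>Mean squares of differences\<close>

context periodic_cell begin

definition sq :: "(real^'d \<Rightarrow> 'b::euclidean_space) \<Rightarrow> ennreal"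
  where "sq f = (\<integral>\<^sup>+x\<in>box a b. ennreal ((norm (f x))\<^sup>2) \<partial>lborel)"

lemma sq_translate:
  assumes "f \<in> borel_measurable borel" "ae_periodic a b f"
  shows "sq (\<lambda>x. f (x + z)) = sq f"
  unfolding sq_def using assms(1)
  by (intro nn_integral_periodic_translate[OF _ ae_periodic_compose[OF assms(2), of "\<lambda>y. ennreal ((norm y)\<^sup>2)"]])
     measurable

text \<open>Translating \<open>f\<close> by a period changes nothing, so the translated gradient is
  again a weak gradient of \<open>f\<close>, and uniqueness applies.\<close>

lemma weak_gradient_periodic:
  assumes f: "box_periodic a b f" and w: "has_weak_gradient f g"
  shows "ae_periodic a b g"
  unfolding ae_periodic_def
proof
  fix i
  have "(\<lambda>x. f (x + axis i (b $ i - a $ i))) = f" using f by (auto simp: box_periodic_def)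
  with has_weak_gradient_translate[OF w, of "axis i (b $ i - a $ i)"]
  have "has_weak_gradient f (\<lambda>x. g (x + axis i (b $ i - a $ i)))" by simp
  from weak_gradient_unique[OF this w] show "AE x in lborel. g (x + axis i (b $ i - a $ i)) = g x" .
qed

lemma square_difference_le:
  fixes g :: "real^'d \<Rightarrow> real^'d"
  assumes [measurable]: "g \<in> borel_measurable borel"
  shows "ennreal ((LINT s|lborel. indicator {0..1} s * (g (x + s *\<^sub>R z) \<bullet> z))\<^sup>2)
    \<le> ennreal ((norm z)\<^sup>2) * (\<integral>\<^sup>+s\<in>{0..1}. ennreal ((norm (g (x + s *\<^sub>R z)))\<^sup>2) \<partial>lborel)"
proof -
  have "ennreal ((LINT s:{0..1}|lborel. g (x + s *\<^sub>R z) \<bullet> z)\<^sup>2)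
      \<le> emeasure lborel {0..1::real} * (\<integral>\<^sup>+s\<in>{0..1}. ennreal ((g (x + s *\<^sub>R z) \<bullet> z)\<^sup>2) \<partial>lborel)"
    by (rule square_set_integral_le) measurable
  also have "\<dots> = (\<integral>\<^sup>+s\<in>{0..1}. ennreal ((g (x + s *\<^sub>R z) \<bullet> z)\<^sup>2) \<partial>lborel)" by simp
  also have "\<dots> \<le> (\<integral>\<^sup>+s. ennreal ((norm z)\<^sup>2) * (ennreal ((norm (g (x + s *\<^sub>R z)))\<^sup>2) * indicator {0..1} s) \<partial>lborel)"
  proof (rule nn_integral_mono)
    fix s :: real
    have "(g (x + s *\<^sub>R z) \<bullet> z)\<^sup>2 \<le> (norm z)\<^sup>2 * (norm (g (x + s *\<^sub>R z)))\<^sup>2"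
      by (metis Cauchy_Schwarz_ineq mult.commute power2_norm_eq_inner)
    then show "ennreal ((g (x + s *\<^sub>R z) \<bullet> z)\<^sup>2) * indicator {0..1} s
        \<le> ennreal ((norm z)\<^sup>2) * (ennreal ((norm (g (x + s *\<^sub>R z)))\<^sup>2) * indicator {0..1} s)"
      by (auto simp: indicator_def ennreal_mult[symmetric] intro: ennreal_leI)
  qed
  also have "\<dots> = ennreal ((norm z)\<^sup>2) * (\<integral>\<^sup>+s\<in>{0..1}. ennreal ((norm (g (x + s *\<^sub>R z)))\<^sup>2) \<partial>lborel)"
    by (rule nn_integral_cmult) measurable
  finally show ?thesis by (simp add: set_lebesgue_integral_def)
qed

end

locale periodic_weak_gradient = periodic_cell a b for a b :: "real^'d" +
  fixes f :: "real^'d \<Rightarrow> real" and g :: "real^'d \<Rightarrow> real^'d"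
  assumes weak: "has_weak_gradient f g" and f_per: "ae_periodic a b f" and g_per: "ae_periodic a b g"
    and f_sq: "sq f < \<infinity>" and g_sq: "sq g < \<infinity>"
begin

lemma f_meas [measurable]: "f \<in> borel_measurable borel" and g_meas [measurable]: "g \<in> borel_measurable borel"
  using weak by (auto simp: has_weak_gradient_def intro: locally_integrable_measurable)

text \<open>Cauchy-Schwarz in \<open>s\<close> bounds the squared difference by
  \<open>(norm z)\<^sup>2\<close> times the mean of the squared gradient along the segment. After
  exchanging the integrals every slice is a translate of the gradient, and all translates have the
  same norm.\<close>

lemma difference_sq_le: "sq (\<lambda>x. f (x + z) - f x) \<le> ennreal ((norm z)\<^sup>2) * sq g"
proof -
  have "sq (\<lambda>x. f (x + z) - f x)
      \<le> (\<integral>\<^sup>+x\<in>box a b. (ennreal ((norm z)\<^sup>2) * (\<integral>\<^sup>+s\<in>{0..1}. ennreal ((norm (g (x + s *\<^sub>R z)))\<^sup>2) \<partial>lborel)) \<partial>lborel)"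
    unfolding sq_def
  proof (rule nn_integral_mono_AE)
    show "AE x in lborel. ennreal ((norm (f (x + z) - f x))\<^sup>2) * indicator (box a b) x
      \<le> ennreal ((norm z)\<^sup>2) * (\<integral>\<^sup>+s\<in>{0..1}. ennreal ((norm (g (x + s *\<^sub>R z)))\<^sup>2) \<partial>lborel) * indicator (box a b) x"
      using weak_gradient_difference[OF weak, of z]
      by eventually_elim (simp add: mult_right_mono square_difference_le)
  qed
  also have "\<dots> = ennreal ((norm z)\<^sup>2) * (\<integral>\<^sup>+x\<in>box a b. (\<integral>\<^sup>+s\<in>{0..1}. ennreal ((norm (g (x + s *\<^sub>R z)))\<^sup>2) \<partial>lborel) \<partial>lborel)"
    by (subst mult.assoc) (rule nn_integral_cmult, measurable)
  also have "(\<integral>\<^sup>+x\<in>box a b. (\<integral>\<^sup>+s\<in>{0..1}. ennreal ((norm (g (x + s *\<^sub>R z)))\<^sup>2) \<partial>lborel) \<partial>lborel)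
      = (\<integral>\<^sup>+s\<in>{0..1}. (\<integral>\<^sup>+x\<in>box a b. ennreal ((norm (g (x + s *\<^sub>R z)))\<^sup>2) \<partial>lborel) \<partial>lborel)"
    by (rule nn_integral_set_Fubini) measurable
  also have "\<dots> = (\<integral>\<^sup>+s\<in>{0..1::real}. sq g \<partial>lborel)"
    using sq_translate[OF g_meas g_per] unfolding sq_def by simp
  also have "\<dots> = sq g" by (simp add: nn_integral_cmult)
  finally show ?thesis .
qed

end

section \<open>Mean values over small cubes\<close>

definition unit_box :: "(real^'d) set"
  where "unit_box = box 0 (\<chi> i. 1)"

lemma unit_box_measurable [measurable]: "unit_box \<in> sets borel"
  by (simp add: unit_box_def)

lemma emeasure_unit_box: "emeasure lborel (unit_box :: (real^'d) set) = 1"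
proof -
  have "(\<chi> i. 1) \<bullet> j = 1" if "j \<in> (Basis :: (real^'d) set)" for j
    using that by (auto simp: Basis_vec_def inner_axis)
  then show ?thesis unfolding unit_box_def by (simp add: emeasure_lborel_box)
qed

context periodic_cell begin

lemma emeasure_box: "emeasure lborel (box a b) = ennreal (measure lborel (box a b))"
  and measure_box_pos: "measure lborel (box a b) > 0"
proof -
  show "emeasure lborel (box a b) = ennreal (measure lborel (box a b))"
    using emeasure_lborel_box_finite[of a b] by (intro emeasure_eq_ennreal_measure) (simp add: less_top)
  have "a \<bullet> i < b \<bullet> i" if "i \<in> Basis" for i
    using that nondegenerate by (auto simp: Basis_vec_def inner_axis)
  then have "measure lborel (box a b) = (\<Prod>i\<in>Basis. (b - a) \<bullet> i)"
    by (intro measure_lborel_box) (auto intro: less_imp_le)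
  also have "\<dots> > 0"
    using \<open>\<And>i. i \<in> Basis \<Longrightarrow> a \<bullet> i < b \<bullet> i\<close> by (intro prod_pos) (auto simp: inner_diff_left)
  finally show "measure lborel (box a b) > 0" .
qed

text \<open>Pointwise \<open>t \<le> 1 + t\<^sup>2\<close>, and the cell has finite measure.\<close>

lemma set_integrable_if_sq_finite:
  fixes f :: "real^'d \<Rightarrow> 'b::euclidean_space"
  assumes [measurable]: "f \<in> borel_measurable borel" and "sq f < \<infinity>"
  shows "set_integrable lborel (box a b) f"
proof -
  have "(\<integral>\<^sup>+x\<in>box a b. ennreal (norm (f x)) \<partial>lborel)
      \<le> (\<integral>\<^sup>+x. indicator (box a b) x + ennreal ((norm (f x))\<^sup>2) * indicator (box a b) x \<partial>lborel)"
  proof (rule nn_integral_mono)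
    fix x
    have "norm (f x) \<le> 1 + (norm (f x))\<^sup>2"
      using sum_power2_ge_zero[of "norm (f x) - 1" 0] zero_le_power2[of "norm (f x)"]
      by (cases "norm (f x) \<le> 1") (auto simp: power2_eq_square intro: add_increasing add_increasing2 mult_left_le_one_le
        order_trans[OF mult_left_mono[of 1 "norm (f x)" "norm (f x)", simplified]])
    then have "ennreal (norm (f x)) \<le> 1 + ennreal ((norm (f x))\<^sup>2)"
      by (metis ennreal_1 ennreal_leI ennreal_plus zero_le_one zero_le_power2)
    then show "ennreal (norm (f x)) * indicator (box a b) x
        \<le> indicator (box a b) x + ennreal ((norm (f x))\<^sup>2) * indicator (box a b) x"
      by (simp add: indicator_def)
  qed
  also have "\<dots> = emeasure lborel (box a b) + sq f"
    unfolding sq_def by (subst nn_integral_add) auto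
  also have "\<dots> < \<infinity>" using assms(2) by (simp add: emeasure_box)
  finally show ?thesis by (simp add: set_integrable_box_iff)
qed

text \<open>A cube of side \<open>\<sigma>\<close> no longer than any period fits into one
  translated period cell, and rescaling it to the unit cube costs \<open>\<sigma>\<close> to the
  power minus the dimension.\<close>

lemma nn_integral_unit_box_le:
  assumes [measurable]: "F \<in> borel_measurable borel" and F: "ae_periodic a b F"
    and \<sigma>: "0 < \<sigma>" "\<And>i. \<sigma> \<le> b $ i - a $ i"
  shows "(\<integral>\<^sup>+y\<in>unit_box. F (x + \<sigma> *\<^sub>R y) \<partial>lborel)
    \<le> ennreal ((1 / \<sigma>) ^ CARD('d)) * (\<integral>\<^sup>+x\<in>box a b. F x \<partial>lborel)"
proof -
  define I where "I = (\<integral>\<^sup>+y\<in>unit_box. F (x + \<sigma> *\<^sub>R y) \<partial>lborel)"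
  have "ennreal (\<sigma> ^ CARD('d)) * I
      \<le> ennreal (\<sigma> ^ CARD('d)) * (\<integral>\<^sup>+y. F (x + \<sigma> *\<^sub>R y) * indicator (box a b) (x + \<sigma> *\<^sub>R y + (a - x)) \<partial>lborel)"
    unfolding I_def
  proof (rule mult_left_mono[OF nn_integral_mono])
    fix y :: "real^'d"
    have "x + \<sigma> *\<^sub>R y + (a - x) \<in> box a b" if y: "y \<in> unit_box"
    proof -
      have "0 < \<sigma> * y $ i \<and> \<sigma> * y $ i < b $ i - a $ i" for i
      proof
        have "0 < y $ i" "y $ i < 1" using y by (auto simp: unit_box_def mem_box_cart)
        then show "0 < \<sigma> * y $ i" using \<sigma>(1) by simp
        have "\<sigma> * y $ i < \<sigma> * 1" using \<open>y $ i < 1\<close> \<sigma>(1) by (rule mult_strict_left_mono)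
        then show "\<sigma> * y $ i < b $ i - a $ i" using \<sigma>(2)[of i] by simp
      qed
      then show ?thesis by (simp add: mem_box_cart less_diff_eq add.commute)
    qed
    then show "F (x + \<sigma> *\<^sub>R y) * indicator unit_box y
        \<le> F (x + \<sigma> *\<^sub>R y) * indicator (box a b) (x + \<sigma> *\<^sub>R y + (a - x))"
      by (auto simp: indicator_def)
  qed simp
  also have "\<dots> = (\<integral>\<^sup>+w. F w * indicator (box a b) (w + (a - x)) \<partial>lborel)"
    using nn_integral_affine[of "\<lambda>w. F w * indicator (box a b) (w + (a - x))" \<sigma> x] \<sigma> by simp
  also have "\<dots> = (\<integral>\<^sup>+w\<in>box a b. F (w + (x - a)) \<partial>lborel)"
    using nn_integral_translate[of "\<lambda>w. F w * indicator (box a b) (w + (a - x))" "x - a"]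
    by (simp add: algebra_simps)
  also have "\<dots> = (\<integral>\<^sup>+x\<in>box a b. F x \<partial>lborel)"
    by (rule nn_integral_periodic_translate[OF _ F]) measurable
  finally have "ennreal ((1 / \<sigma>) ^ CARD('d)) * (ennreal (\<sigma> ^ CARD('d)) * I)
      \<le> ennreal ((1 / \<sigma>) ^ CARD('d)) * (\<integral>\<^sup>+x\<in>box a b. F x \<partial>lborel)"
    by (rule mult_left_mono) simp
  moreover have "ennreal ((1 / \<sigma>) ^ CARD('d)) * ennreal (\<sigma> ^ CARD('d)) = 1"
    using \<sigma> by (simp add: ennreal_mult[symmetric] power_mult_distrib[symmetric])
  ultimately show ?thesis by (simp add: I_def mult.assoc[symmetric])
qed

text \<open>In the square of \<open>c * E\<close> one factor is replaced by its supremum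
  \<open>S\<close> and the other is integrated. In both uses \<open>E\<close> is a local mean of a
  square, so \<open>S\<close> costs only a power of the scale.\<close>

lemma fourth_power_le:
  assumes [measurable]: "E \<in> borel_measurable borel"
    and P: "AE x in lborel. ennreal ((P x)\<^sup>2) \<le> ennreal c * E x" and c: "c \<ge> 0"
    and S: "\<And>x. E x \<le> S" and I: "(\<integral>\<^sup>+x\<in>box a b. E x \<partial>lborel) \<le> I"
  shows "(\<integral>\<^sup>+x\<in>box a b. ennreal (P x ^ 4) \<partial>lborel) \<le> ennreal (c\<^sup>2) * S * I"
proof -
  have "(\<integral>\<^sup>+x\<in>box a b. ennreal (P x ^ 4) \<partial>lborel)
      \<le> (\<integral>\<^sup>+x. (ennreal (c\<^sup>2) * S) * (E x * indicator (box a b) x) \<partial>lborel)"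
  proof (rule nn_integral_mono_AE)
    show "AE x in lborel. ennreal (P x ^ 4) * indicator (box a b) x
        \<le> (ennreal (c\<^sup>2) * S) * (E x * indicator (box a b) x)"
      using P
    proof eventually_elim
      case (elim x)
      have "ennreal (P x ^ 4) = ennreal ((P x)\<^sup>2) * ennreal ((P x)\<^sup>2)"
        by (simp add: ennreal_mult[symmetric] power2_eq_square power4_eq_xxxx mult.assoc)
      also have "\<dots> \<le> (ennreal c * E x) * (ennreal c * E x)"
        using elim by (intro mult_mono) auto
      also have "\<dots> \<le> (ennreal c * S) * (ennreal c * E x)"
        using S by (intro mult_right_mono mult_left_mono) auto
      also have "\<dots> = (ennreal (c\<^sup>2) * S) * E x"
        using c by (simp add: power2_eq_square ennreal_mult mult_ac)
      finally show ?case by (simp add: indicator_def)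
    qed
  qed
  also have "\<dots> = (ennreal (c\<^sup>2) * S) * (\<integral>\<^sup>+x\<in>box a b. E x \<partial>lborel)"
    by (rule nn_integral_cmult) measurable
  also have "\<dots> \<le> (ennreal (c\<^sup>2) * S) * I" by (rule mult_left_mono[OF I]) simp
  finally show ?thesis .
qed

end

context periodic_weak_gradient begin

lemma f_set_integrable: "set_integrable lborel (box a b) f"
  using f_sq by (intro set_integrable_if_sq_finite) auto

text \<open>As \<open>z\<close> runs over \<open>box a b\<close>, one full period, the integral of
  \<open>f (x + z)\<close> vanishes for every \<open>x\<close>. So \<open>f x\<close> is minus the
  mean over \<open>z\<close> of \<open>f (x + z) - f x\<close>, and the displacements that occur are
  the points of the box; hence the constant is a bound for their norms.\<close>

theorem poincare:
  assumes mean: "(LINT x:box a b|lborel. f x) = 0" and R: "\<And>x. x \<in> box a b \<Longrightarrow> norm x \<le> R"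
  shows "sq f \<le> ennreal (R\<^sup>2) * sq g"
proof -
  define m where "m = measure lborel (box a b)"
  have m: "m > 0" "emeasure lborel (box a b) = ennreal m"
    using measure_box_pos emeasure_box by (auto simp: m_def)
  have pointwise: "ennreal (m\<^sup>2) * ennreal ((norm (f x))\<^sup>2)
      \<le> ennreal m * (\<integral>\<^sup>+z\<in>box a b. ennreal ((norm (f (x + z) - f x))\<^sup>2) \<partial>lborel)" for x
  proof -
    have i: "set_integrable lborel (box a b) (\<lambda>z. f (x + z))"
      using set_integrable_periodic_translate[OF f_meas f_per, of x] f_set_integrable by (simp add: add.commute)
    have c: "set_integrable lborel (box a b) (\<lambda>z. f x)"
      unfolding set_integrable_def using m by (intro integrable_scaleR_left) (auto simp: integrable_indicator_iff)
    have "(LINT z:box a b|lborel. f (x + z) - f x) = (LINT z:box a b|lborel. f (x + z)) - (LINT z:box a b|lborel. f x)"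
      by (rule set_integral_diff(2)[OF i c])
    also have "(LINT z:box a b|lborel. f (x + z)) = 0"
      using integral_periodic_translate[OF f_meas f_per f_set_integrable, of x] mean by (simp add: add.commute)
    also have "(LINT z:box a b|lborel. f x) = m * f x"
      unfolding set_lebesgue_integral_def by (simp add: m_def)
    finally have "(LINT z:box a b|lborel. f (x + z) - f x)\<^sup>2 = m\<^sup>2 * (f x)\<^sup>2"
      by (simp add: power_mult_distrib)
    moreover have "ennreal ((LINT z:box a b|lborel. f (x + z) - f x)\<^sup>2)
        \<le> ennreal m * (\<integral>\<^sup>+z\<in>box a b. ennreal ((f (x + z) - f x)\<^sup>2) \<partial>lborel)"
      unfolding m(2)[symmetric] by (rule square_set_integral_le) measurable
    ultimately show ?thesis by (simp add: ennreal_mult)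
  qed
  have "(\<integral>\<^sup>+x\<in>box a b. (\<integral>\<^sup>+z\<in>box a b. ennreal ((norm (f (x + z) - f x))\<^sup>2) \<partial>lborel) \<partial>lborel)
      = (\<integral>\<^sup>+z\<in>box a b. sq (\<lambda>x. f (x + z) - f x) \<partial>lborel)"
    unfolding sq_def by (rule nn_integral_set_Fubini) measurable
  also have "\<dots> \<le> (\<integral>\<^sup>+z\<in>box a b. (ennreal (R\<^sup>2) * sq g) \<partial>lborel)"
  proof (rule nn_integral_mono)
    fix z :: "real^'d"
    have "sq (\<lambda>x. f (x + z) - f x) \<le> ennreal (R\<^sup>2) * sq g" if "z \<in> box a b"
    proof -
      have "(norm z)\<^sup>2 \<le> R\<^sup>2" using R[OF that] by (intro power_mono) auto
      with difference_sq_le[of z] show ?thesis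
        by (meson ennreal_leI mult_right_mono order_trans zero_le)
    qed
    then show "sq (\<lambda>x. f (x + z) - f x) * indicator (box a b) z \<le> ennreal (R\<^sup>2) * sq g * indicator (box a b) z"
      by (simp add: indicator_def)
  qed
  also have "\<dots> = ennreal (R\<^sup>2) * sq g * ennreal m" by (simp add: nn_integral_cmult m)
  finally have difference: "(\<integral>\<^sup>+x\<in>box a b. (\<integral>\<^sup>+z\<in>box a b. ennreal ((norm (f (x + z) - f x))\<^sup>2) \<partial>lborel) \<partial>lborel)
      \<le> ennreal (R\<^sup>2) * sq g * ennreal m" .
  have "ennreal (m\<^sup>2) * sq f = (\<integral>\<^sup>+x. ennreal (m\<^sup>2) * (ennreal ((norm (f x))\<^sup>2) * indicator (box a b) x) \<partial>lborel)"
    unfolding sq_def by (rule nn_integral_cmult[symmetric]) measurable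
  also have "\<dots> \<le> (\<integral>\<^sup>+x. ennreal m * ((\<integral>\<^sup>+z\<in>box a b. ennreal ((norm (f (x + z) - f x))\<^sup>2) \<partial>lborel) * indicator (box a b) x) \<partial>lborel)"
    using pointwise by (intro nn_integral_mono) (simp add: mult.assoc[symmetric] mult_right_mono)
  also have "\<dots> = ennreal m * (\<integral>\<^sup>+x\<in>box a b. (\<integral>\<^sup>+z\<in>box a b. ennreal ((norm (f (x + z) - f x))\<^sup>2) \<partial>lborel) \<partial>lborel)"
    by (rule nn_integral_cmult) measurable
  also have "\<dots> \<le> ennreal m * (ennreal (R\<^sup>2) * sq g * ennreal m)" by (rule mult_left_mono[OF difference]) simp
  also have "\<dots> = ennreal (m\<^sup>2) * (ennreal (R\<^sup>2) * sq g)"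
    using m(1) by (simp add: power2_eq_square ennreal_mult mult_ac)
  finally show ?thesis using m by (subst (asm) ennreal_mult_le_mult_iff) auto
qed

text \<open>The mean of \<open>f\<close> over the cube of side \<open>r\<close> with lower corner
  \<open>x\<close>, pulled back to the unit cube so that means at different scales can be subtracted
  under one integral.\<close>

definition avg :: "real \<Rightarrow> real^'d \<Rightarrow> real"
  where "avg r x = (LINT y:unit_box|lborel. f (x + r *\<^sub>R y))"

lemma avg_measurable [measurable]: "avg r \<in> borel_measurable borel"
  unfolding avg_def[abs_def] set_lebesgue_integral_def by measurable

lemma unit_box_integrable:
  assumes r: "0 < r" "\<And>i. r \<le> b $ i - a $ i"
  shows "set_integrable lborel unit_box (\<lambda>y. f (x + r *\<^sub>R y))"
proof -
  have "(\<integral>\<^sup>+y\<in>unit_box. ennreal (norm (f (x + r *\<^sub>R y))) \<partial>lborel)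
      \<le> ennreal ((1 / r) ^ CARD('d)) * (\<integral>\<^sup>+x\<in>box a b. ennreal (norm (f x)) \<partial>lborel)"
    by (rule nn_integral_unit_box_le[OF _ ae_periodic_compose[OF f_per, of "\<lambda>y. ennreal (norm y)"] r]) measurable
  also have "\<dots> < \<infinity>"
    using f_set_integrable by (simp add: set_integrable_box_iff ennreal_mult_less_top)
  finally have "(\<integral>\<^sup>+y\<in>unit_box. ennreal (norm (f (x + r *\<^sub>R y))) \<partial>lborel) < \<infinity>" .
  moreover have "(\<integral>\<^sup>+y. ennreal (norm (indicator unit_box y *\<^sub>R f (x + r *\<^sub>R y))) \<partial>lborel)
      = (\<integral>\<^sup>+y\<in>unit_box. ennreal (norm (f (x + r *\<^sub>R y))) \<partial>lborel)"
    by (intro nn_integral_cong) (auto simp: indicator_def)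
  ultimately show ?thesis unfolding set_integrable_def by (simp add: integrable_iff_bounded)
qed

lemma square_unit_box_integral_le:
  fixes k :: "real^'d \<Rightarrow> real"
  assumes "k \<in> borel_measurable borel"
  shows "ennreal ((LINT y:unit_box|lborel. k y)\<^sup>2) \<le> (\<integral>\<^sup>+y\<in>unit_box. ennreal ((k y)\<^sup>2) \<partial>lborel)"
  using square_set_integral_le[of k lborel unit_box] assms by (simp add: emeasure_unit_box)

text \<open>The square of a mean over the unit cube is at most the mean of the squares, which
  reduces this to \<open>difference_sq_le\<close> with displacement \<open>r *\<^sub>R y\<close>.
  The bound is quadratic in \<open>r\<close>, hence geometric along dyadic scales.\<close>

lemma avg_close:
  assumes r: "0 < r" "\<And>i. r \<le> b $ i - a $ i" and R: "\<And>y :: real^'d. y \<in> unit_box \<Longrightarrow> norm y \<le> R"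
  shows "sq (\<lambda>x. avg r x - f x) \<le> ennreal ((r * R)\<^sup>2) * sq g"
proof -
  have "ennreal ((avg r x - f x)\<^sup>2) \<le> (\<integral>\<^sup>+y\<in>unit_box. ennreal ((f (x + r *\<^sub>R y) - f x)\<^sup>2) \<partial>lborel)" for x
  proof -
    have c: "set_integrable lborel unit_box (\<lambda>y::real^'d. f x)"
      unfolding set_integrable_def
      by (intro integrable_scaleR_left) (auto simp: integrable_indicator_iff emeasure_unit_box)
    have "(LINT y:unit_box|lborel. f (x + r *\<^sub>R y) - f x) = avg r x - (LINT y:(unit_box::(real^'d) set)|lborel. f x)"
      unfolding avg_def by (rule set_integral_diff(2)[OF unit_box_integrable[OF r] c])
    also have "(LINT y:(unit_box::(real^'d) set)|lborel. f x) = f x"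
      unfolding set_lebesgue_integral_def by (simp add: measure_def emeasure_unit_box)
    finally show ?thesis
      using square_unit_box_integral_le[of "\<lambda>y. f (x + r *\<^sub>R y) - f x"] by simp
  qed
  then have "sq (\<lambda>x. avg r x - f x) \<le> (\<integral>\<^sup>+x\<in>box a b. (\<integral>\<^sup>+y\<in>unit_box. ennreal ((norm (f (x + r *\<^sub>R y) - f x))\<^sup>2) \<partial>lborel) \<partial>lborel)"
    unfolding sq_def by (intro nn_integral_mono) (simp add: indicator_def)
  also have "\<dots> = (\<integral>\<^sup>+y\<in>unit_box. sq (\<lambda>x. f (x + r *\<^sub>R y) - f x) \<partial>lborel)"
    unfolding sq_def by (rule nn_integral_set_Fubini) measurable
  also have "\<dots> \<le> (\<integral>\<^sup>+y\<in>(unit_box :: (real^'d) set). (ennreal ((r * R)\<^sup>2) * sq g) \<partial>lborel)"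
  proof (rule nn_integral_mono)
    fix y :: "real^'d"
    have "sq (\<lambda>x. f (x + r *\<^sub>R y) - f x) \<le> ennreal ((r * R)\<^sup>2) * sq g" if "y \<in> unit_box"
    proof -
      have "(norm (r *\<^sub>R y))\<^sup>2 \<le> (r * R)\<^sup>2"
        using R[OF that] r by (intro power_mono) (auto intro: mult_left_mono)
      with difference_sq_le[of "r *\<^sub>R y"] show ?thesis
        by (meson ennreal_leI mult_right_mono order_trans zero_le)
    qed
    then show "sq (\<lambda>x. f (x + r *\<^sub>R y) - f x) * indicator unit_box y \<le> ennreal ((r * R)\<^sup>2) * sq g * indicator unit_box y"
      by (simp add: indicator_def)
  qed
  also have "\<dots> = ennreal ((r * R)\<^sup>2) * sq g" by (simp add: nn_integral_cmult emeasure_unit_box)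
  finally show ?thesis .
qed

text \<open>The coarsest scale of the dyadic decomposition: only the L2 norm of \<open>f\<close>
  enters, at the price of a negative power of \<open>r\<close>.\<close>

lemma avg_fourth:
  assumes r: "0 < r" "\<And>i. r \<le> b $ i - a $ i"
  shows "(\<integral>\<^sup>+x\<in>box a b. ennreal (avg r x ^ 4) \<partial>lborel) \<le> ennreal ((1 / r) ^ CARD('d)) * (sq f * sq f)"
proof -
  let ?E = "\<lambda>x. \<integral>\<^sup>+y\<in>unit_box. ennreal ((norm (f (x + r *\<^sub>R y)))\<^sup>2) \<partial>lborel"
  have "(\<integral>\<^sup>+x\<in>box a b. ennreal (avg r x ^ 4) \<partial>lborel)
      \<le> ennreal (1\<^sup>2) * (ennreal ((1 / r) ^ CARD('d)) * sq f) * sq f"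
  proof (rule fourth_power_le)
    show "?E \<in> borel_measurable borel" by measurable
    show "AE x in lborel. ennreal ((avg r x)\<^sup>2) \<le> ennreal 1 * ?E x"
      using square_unit_box_integral_le[of "\<lambda>y. f (x + r *\<^sub>R y)" for x] by (simp add: avg_def)
    show "?E x \<le> ennreal ((1 / r) ^ CARD('d)) * sq f" for x
      unfolding sq_def
      by (rule nn_integral_unit_box_le[OF _ ae_periodic_compose[OF f_per, of "\<lambda>y. ennreal ((norm y)\<^sup>2)"] r]) measurable
    have "(\<integral>\<^sup>+x\<in>box a b. ?E x \<partial>lborel) = (\<integral>\<^sup>+y\<in>unit_box. sq (\<lambda>x. f (x + r *\<^sub>R y)) \<partial>lborel)"
      unfolding sq_def by (rule nn_integral_set_Fubini) measurable
    also have "\<dots> = sq f" by (simp add: sq_translate[OF f_meas f_per] nn_integral_cmult emeasure_unit_box)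
    finally show "(\<integral>\<^sup>+x\<in>box a b. ?E x \<partial>lborel) \<le> sq f" by simp
  qed simp
  then show ?thesis by (simp add: mult.assoc)
qed

text \<open>The points \<open>x + h y\<close> and \<open>x + 2 h y\<close> differ by
  \<open>h y\<close>, so their values of \<open>f\<close> differ by an integral of the gradient at
  \<open>x + (1 + s) h y\<close>. Cauchy-Schwarz then bounds the squared difference of the means by
  \<open>E\<close>, a mean of the squared gradient over \<open>s\<close> and \<open>y\<close>, to
  which \<open>fourth_power_le\<close> applies.\<close>

lemma avg_difference_fourth:
  assumes h: "0 < h" "\<And>i. 2 * h \<le> b $ i - a $ i" and R: "\<And>y :: real^'d. y \<in> unit_box \<Longrightarrow> norm y \<le> R"
  shows "(\<integral>\<^sup>+x\<in>box a b. ennreal ((avg h x - avg (2 * h) x) ^ 4) \<partial>lborel)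
    \<le> ennreal ((h * R) ^ 4 * (1 / h) ^ CARD('d)) * (sq g * sq g)"
proof -
  define N where "N w = ennreal ((norm (g w))\<^sup>2)" for w
  have [measurable]: "N \<in> borel_measurable borel" unfolding N_def by measurable
  have N: "ae_periodic a b N" unfolding N_def by (rule ae_periodic_compose[OF g_per])
  have hle: "h \<le> b $ i - a $ i" for i using h(1) h(2)[of i] by simp
  define E where "E x = (\<integral>\<^sup>+s\<in>{0..1::real}. (\<integral>\<^sup>+y\<in>unit_box. N (x + ((1 + s) * h) *\<^sub>R y) \<partial>lborel) \<partial>lborel)" for x
  have "(\<integral>\<^sup>+x\<in>box a b. ennreal ((avg h x - avg (2 * h) x) ^ 4) \<partial>lborel)
    \<le> ennreal (((h * R)\<^sup>2)\<^sup>2) * (ennreal ((1 / h) ^ CARD('d)) * sq g) * sq g"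
  proof (rule fourth_power_le)
    show "E \<in> borel_measurable borel" unfolding E_def[abs_def] by measurable
    have "AE x in lborel. ennreal ((f (x + (2 * h) *\<^sub>R y) - f (x + h *\<^sub>R y))\<^sup>2)
        \<le> ennreal ((norm (h *\<^sub>R y))\<^sup>2) * (\<integral>\<^sup>+s\<in>{0..1}. N (x + ((1 + s) * h) *\<^sub>R y) \<partial>lborel)" for y
      using AE_translate[OF weak_gradient_difference[OF weak, of "h *\<^sub>R y"], of "h *\<^sub>R y"]
    proof eventually_elim
      case (elim x)
      have e1: "x + h *\<^sub>R y + h *\<^sub>R y = x + (2 * h) *\<^sub>R y" 
        by (simp only: mult_2 scaleR_add_left add.assoc)
      have e2: "x + h *\<^sub>R y + s *\<^sub>R h *\<^sub>R y = x + ((1 + s) * h) *\<^sub>R y" for s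
        by (simp add: distrib_right scaleR_add_left add.assoc)
      show ?case
        using square_difference_le[OF g_meas, of "x + h *\<^sub>R y" "h *\<^sub>R y"]
        unfolding elim[unfolded e1 e2] e2 N_def .
    qed
    then have "AE y in lborel. AE x in lborel. ennreal ((f (x + (2 * h) *\<^sub>R y) - f (x + h *\<^sub>R y))\<^sup>2)
        \<le> ennreal ((norm (h *\<^sub>R y))\<^sup>2) * (\<integral>\<^sup>+s\<in>{0..1}. N (x + ((1 + s) * h) *\<^sub>R y) \<partial>lborel)"
      by simp
    \<comment> \<open>The difference formula has an exceptional null set of \<open>x\<close> for
      each \<open>y\<close>; Fubini exchanges the two, so that for almost every \<open>x\<close> it
      can be integrated in \<open>y\<close>.\<close>
    then have "AE x in lborel. AE y in lborel. ennreal ((f (x + (2 * h) *\<^sub>R y) - f (x + h *\<^sub>R y))\<^sup>2)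
        \<le> ennreal ((norm (h *\<^sub>R y))\<^sup>2) * (\<integral>\<^sup>+s\<in>{0..1}. N (x + ((1 + s) * h) *\<^sub>R y) \<partial>lborel)"
      by (rule lborel_pair.AE_commute[THEN iffD1, rotated]) measurable
    then show "AE x in lborel. ennreal ((avg h x - avg (2 * h) x)\<^sup>2) \<le> ennreal ((h * R)\<^sup>2) * E x"
    proof eventually_elim
      case (elim x)
      have "avg h x - avg (2 * h) x = (LINT y:unit_box|lborel. f (x + h *\<^sub>R y) - f (x + (2 * h) *\<^sub>R y))"
        unfolding avg_def
        by (rule set_integral_diff(2)[symmetric]) (use h hle in \<open>auto intro!: unit_box_integrable\<close>)
      then have "ennreal ((avg h x - avg (2 * h) x)\<^sup>2)
          \<le> (\<integral>\<^sup>+y\<in>unit_box. ennreal ((f (x + h *\<^sub>R y) - f (x + (2 * h) *\<^sub>R y))\<^sup>2) \<partial>lborel)"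
        using square_unit_box_integral_le[of "\<lambda>y. f (x + h *\<^sub>R y) - f (x + (2 * h) *\<^sub>R y)"] by simp
      also have "\<dots> \<le> (\<integral>\<^sup>+y. ennreal ((h * R)\<^sup>2) * ((\<integral>\<^sup>+s\<in>{0..1}. N (x + ((1 + s) * h) *\<^sub>R y) \<partial>lborel) * indicator unit_box y) \<partial>lborel)"
      proof (rule nn_integral_mono_AE)
        show "AE y in lborel. ennreal ((f (x + h *\<^sub>R y) - f (x + (2 * h) *\<^sub>R y))\<^sup>2) * indicator unit_box y
          \<le> ennreal ((h * R)\<^sup>2) * ((\<integral>\<^sup>+s\<in>{0..1}. N (x + ((1 + s) * h) *\<^sub>R y) \<partial>lborel) * indicator unit_box y)"
          using elim
        proof eventually_elim
          case (elim y)
          show ?case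
          proof (cases "y \<in> unit_box")
            case True
            have "(norm (h *\<^sub>R y))\<^sup>2 \<le> (h * R)\<^sup>2"
              using R[OF True] h by (intro power_mono) (auto intro: mult_left_mono)
            with elim have "ennreal ((f (x + (2 * h) *\<^sub>R y) - f (x + h *\<^sub>R y))\<^sup>2)
              \<le> ennreal ((h * R)\<^sup>2) * (\<integral>\<^sup>+s\<in>{0..1}. N (x + ((1 + s) * h) *\<^sub>R y) \<partial>lborel)"
              by (meson ennreal_leI mult_right_mono order_trans zero_le)
            with True show ?thesis by (simp add: power2_commute)
          qed simp
        qed
      qed
      also have "\<dots> = ennreal ((h * R)\<^sup>2) * (\<integral>\<^sup>+y\<in>unit_box. (\<integral>\<^sup>+s\<in>{0..1}. N (x + ((1 + s) * h) *\<^sub>R y) \<partial>lborel) \<partial>lborel)"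
        by (rule nn_integral_cmult) measurable
      also have "(\<integral>\<^sup>+y\<in>unit_box. (\<integral>\<^sup>+s\<in>{0..1}. N (x + ((1 + s) * h) *\<^sub>R y) \<partial>lborel) \<partial>lborel) = E x"
        unfolding E_def by (rule nn_integral_set_Fubini) measurable
      finally show ?case .
    qed
    show "E x \<le> ennreal ((1 / h) ^ CARD('d)) * sq g" for x
    proof -
      have "E x \<le> (\<integral>\<^sup>+s\<in>{0..1::real}. (ennreal ((1 / h) ^ CARD('d)) * sq g) \<partial>lborel)"
        unfolding E_def
      proof (rule nn_integral_mono)
        fix s :: real
        have "(\<integral>\<^sup>+y\<in>unit_box. N (x + ((1 + s) * h) *\<^sub>R y) \<partial>lborel) \<le> ennreal ((1 / h) ^ CARD('d)) * sq g"
          if s: "s \<in> {0..1}"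
        proof -
          \<comment> \<open>The scale \<open>(1 + s) * h\<close> lies between \<open>h\<close> and
            \<open>2 * h\<close>: the upper bound keeps the cube within one period, the lower bound
            yields the factor \<open>(1 / h) ^ CARD('d)\<close>.\<close>
          have "(1 + s) * h \<le> 2 * h" using s h by (intro mult_right_mono) auto
          then have "(1 + s) * h \<le> b $ i - a $ i" for i using h(2)[of i] by simp
          moreover have "h \<le> (1 + s) * h" using s h mult_right_mono[of 1 "1 + s" h] by simp
          moreover from this have "0 < (1 + s) * h" using h by simp
          ultimately have "(\<integral>\<^sup>+y\<in>unit_box. N (x + ((1 + s) * h) *\<^sub>R y) \<partial>lborel)
              \<le> ennreal ((1 / ((1 + s) * h)) ^ CARD('d)) * sq g"
            unfolding sq_def N_def[symmetric] by (intro nn_integral_unit_box_le N) auto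
          also have "\<dots> \<le> ennreal ((1 / h) ^ CARD('d)) * sq g"
            using \<open>h \<le> (1 + s) * h\<close> \<open>0 < (1 + s) * h\<close> h
            by (intro mult_right_mono ennreal_leI power_mono divide_left_mono) auto
          finally show ?thesis .
        qed
        then show "(\<integral>\<^sup>+y\<in>unit_box. N (x + ((1 + s) * h) *\<^sub>R y) \<partial>lborel) * indicator {0..1} s
            \<le> ennreal ((1 / h) ^ CARD('d)) * sq g * indicator {0..1} s"
          by (simp add: indicator_def)
      qed
      then show ?thesis by (simp add: nn_integral_cmult)
    qed
    have "(\<integral>\<^sup>+x\<in>box a b. E x \<partial>lborel)
        = (\<integral>\<^sup>+s\<in>{0..1::real}. (\<integral>\<^sup>+x\<in>box a b. (\<integral>\<^sup>+y\<in>unit_box. N (x + ((1 + s) * h) *\<^sub>R y) \<partial>lborel) \<partial>lborel) \<partial>lborel)"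
      unfolding E_def by (rule nn_integral_set_Fubini) measurable
    also have "\<dots> = (\<integral>\<^sup>+s\<in>{0..1::real}. (\<integral>\<^sup>+y\<in>unit_box. (\<integral>\<^sup>+x\<in>box a b. N (x + ((1 + s) * h) *\<^sub>R y) \<partial>lborel) \<partial>lborel) \<partial>lborel)"
      by (subst nn_integral_set_Fubini) auto
    also have "\<dots> = sq g"
      using nn_integral_periodic_translate[OF _ N] unfolding sq_def N_def[symmetric]
      by (simp add: nn_integral_cmult emeasure_unit_box)
    finally show "(\<integral>\<^sup>+x\<in>box a b. E x \<partial>lborel) \<le> sq g" by simp
  qed simp
  also have "\<dots> = ennreal ((h * R) ^ 4 * (1 / h) ^ CARD('d)) * (sq g * sq g)"
    using h by (simp add: ennreal_mult mult.assoc)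
  finally show ?thesis .
qed

text \<open>By \<open>avg_close\<close> the squared errors at scale \<open>r / 2 ^ n\<close> decay
  like \<open>(1/4) ^ n\<close>. Such a sequence is summable almost everywhere, so the pointwise
  limit exists without passing to a subsequence.\<close>

lemma avg_tendsto:
  assumes r: "0 < r" "\<And>i. r \<le> b $ i - a $ i" and R: "\<And>y :: real^'d. y \<in> unit_box \<Longrightarrow> norm y \<le> R"
  shows "AE x in lborel. x \<in> box a b \<longrightarrow> (\<lambda>n. avg (r / 2 ^ n) x) \<longlonglongrightarrow> f x"
proof -
  define u where "u n x = indicator (box a b) x *\<^sub>R (avg (r / 2 ^ n) x - f x)" for n x
  obtain \<gamma> where \<gamma>: "\<gamma> \<ge> 0" "sq g = ennreal \<gamma>" using g_sq by (cases "sq g") auto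
  have "AE x in lborel. summable (\<lambda>n. norm (u n x))"
  proof (rule AE_summable_of_geometric_L2[where t = "1 / 2" and c = "(r * R)\<^sup>2 * \<gamma>"])
    fix n
    have "r / 2 ^ n \<le> r" using r by (simp add: field_simps)
    then have "r / 2 ^ n \<le> b $ i - a $ i" for i using r(2)[of i] by simp
    with r have "sq (\<lambda>x. avg (r / 2 ^ n) x - f x) \<le> ennreal ((r / 2 ^ n * R)\<^sup>2) * sq g"
      by (intro avg_close R) auto
    also have "\<dots> = ennreal ((r * R)\<^sup>2 * \<gamma> * (1 / 2) ^ (2 * n))"
    proof -
      have "(r / 2 ^ n * R)\<^sup>2 * \<gamma> = (r * R)\<^sup>2 * \<gamma> * (1 / 2) ^ (2 * n)"
        by (simp add: power_mult_distrib power_divide power_mult[symmetric] mult.commute)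
      then show ?thesis using \<gamma> by (simp add: ennreal_mult[symmetric])
    qed
    also have "sq (\<lambda>x. avg (r / 2 ^ n) x - f x) = (\<integral>\<^sup>+x. ennreal ((norm (u n x))\<^sup>2) \<partial>lborel)"
      unfolding sq_def u_def by (intro nn_integral_cong) (auto simp: indicator_def)
    finally show "(\<integral>\<^sup>+x. ennreal ((norm (u n x))\<^sup>2) \<partial>lborel) \<le> ennreal ((r * R)\<^sup>2 * \<gamma> * (1 / 2) ^ (2 * n))" .
    show "u n \<in> borel_measurable lborel" unfolding u_def[abs_def] by measurable
  qed (use \<gamma> in auto)
  then show ?thesis
  proof eventually_elim
    case (elim x)
    then have "(\<lambda>n. norm (u n x)) \<longlonglongrightarrow> 0" by (rule summable_LIMSEQ_zero)
    then have "(\<lambda>n. u n x) \<longlonglongrightarrow> 0" by (rule tendsto_norm_zero_cancel)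
    then show ?case by (auto simp: u_def LIM_zero_iff)
  qed
qed

text \<open>Below the scale \<open>r\<close> the averages telescope over dyadic scales \<open>h\<close>, and a difference of consecutive averages has
  fourth moment \<open>O(h ^ (4 - d))\<close>: this is where \<open>d < 4\<close> enters.\<close>

theorem sobolev_fourth:
  assumes d: "CARD('d) \<le> 3" and r: "0 < r" "r \<le> 1" "\<And>i. r \<le> b $ i - a $ i"
    and R: "\<And>y :: real^'d. y \<in> unit_box \<Longrightarrow> norm y \<le> R"
  shows "(\<integral>\<^sup>+x\<in>box a b. ennreal (f x ^ 4) \<partial>lborel)
    \<le> ennreal (4000 * ((1 / r) ^ CARD('d) + R ^ 4)) * (sq f + sq g)\<^sup>2"
proof -
  define C where "C = (1 / r) ^ CARD('d) + R ^ 4"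
  have C: "C \<ge> 0" using r by (simp add: C_def)
  define Q where "Q = (sq f + sq g)\<^sup>2"
  define D where "D j x = (if j = 0 then avg r x else avg (r / 2 ^ j) x - avg (r / 2 ^ (j - 1)) x)" for j x
  have [measurable]: "D j \<in> borel_measurable borel" for j unfolding D_def[abs_def] by measurable
  have tel: "(\<Sum>j\<le>K. D j x) = avg (r / 2 ^ K) x" for K x
    by (induction K) (auto simp: D_def)
  have D4: "(\<integral>\<^sup>+x\<in>box a b. ennreal (D j x ^ 4) \<partial>lborel) \<le> ennreal (C * (1 / 2) ^ j) * Q" for j
  proof (cases j)
    case 0
    have "(\<integral>\<^sup>+x\<in>box a b. ennreal (D j x ^ 4) \<partial>lborel) \<le> ennreal ((1 / r) ^ CARD('d)) * (sq f * sq f)"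
      using avg_fourth[OF r(1,3)] by (simp add: D_def 0)
    also have "\<dots> \<le> ennreal (C * (1 / 2) ^ j) * Q"
      unfolding Q_def power2_eq_square using r
      by (intro mult_mono ennreal_leI) (auto simp: C_def 0 intro: add_increasing2)
    finally show ?thesis .
  next
    case (Suc k)
    define h where "h = r / 2 ^ j"
    have h: "0 < h" "h \<le> (1 / 2) ^ j" "2 * h = r / 2 ^ k"
      using r by (auto simp: h_def Suc power_divide divide_right_mono)
    have "(1 / 2 :: real) ^ j \<le> 1" by (rule power_le_one) auto
    with h have h1: "h \<le> 1" by linarith
    have "2 * h \<le> r" using r unfolding h(3) by (simp add: field_simps)
    then have hb: "2 * h \<le> b $ i - a $ i" for i using r(3)[of i] by simp
    have "(\<integral>\<^sup>+x\<in>box a b. ennreal (D j x ^ 4) \<partial>lborel) \<le> ennreal ((h * R) ^ 4 * (1 / h) ^ CARD('d)) * (sq g * sq g)"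
    proof -
      have "D j x = avg h x - avg (2 * h) x" for x
        by (simp add: D_def Suc h(3)) (simp add: h_def Suc)
      then show ?thesis using avg_difference_fourth[OF h(1) hb R] by simp
    qed
    also have "\<dots> \<le> ennreal (C * (1 / 2) ^ j) * Q"
    proof (rule mult_mono[OF ennreal_leI])
      have "h ^ 3 * (1 / h) ^ CARD('d) \<le> h ^ CARD('d) * (1 / h) ^ CARD('d)"
        using h h1 d by (intro mult_right_mono power_decreasing) auto
      also have "\<dots> = 1" using h by (simp add: power_mult_distrib[symmetric])
      finally have "h * (h ^ 3 * (1 / h) ^ CARD('d)) \<le> h * 1" using h by (intro mult_left_mono) auto
      then have "h ^ 4 * (1 / h) ^ CARD('d) \<le> (1 / 2) ^ j"
        using h(2) by (simp add: power4_eq_xxxx power3_eq_cube mult.assoc)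
      then have "R ^ 4 * (h ^ 4 * (1 / h) ^ CARD('d)) \<le> C * (1 / 2) ^ j"
        using r h by (intro mult_mono) (auto simp: C_def)
      then show "(h * R) ^ 4 * (1 / h) ^ CARD('d) \<le> C * (1 / 2) ^ j"
        by (simp add: power_mult_distrib mult_ac)
      show "sq g * sq g \<le> Q" unfolding Q_def power2_eq_square by (intro mult_mono) auto
    qed auto
    finally show ?thesis .
  qed
  have bound: "(\<integral>\<^sup>+x\<in>box a b. ennreal (avg (r / 2 ^ K) x ^ 4) \<partial>lborel) \<le> ennreal (4000 * C) * Q" for K
  proof -
    have "(\<integral>\<^sup>+x\<in>box a b. ennreal (avg (r / 2 ^ K) x ^ 4) \<partial>lborel)
        \<le> (\<integral>\<^sup>+x. (\<Sum>j\<le>K. ennreal (1000 * (10/9) ^ (3 * j)) * (ennreal (D j x ^ 4) * indicator (box a b) x)) \<partial>lborel)"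
    proof (rule nn_integral_mono)
      fix x
      have "ennreal (avg (r / 2 ^ K) x ^ 4) \<le> ennreal (\<Sum>j\<le>K. 1000 * (10/9) ^ (3 * j) * D j x ^ 4)"
        using geometric_fourth_power_le[of "\<lambda>j. D j x" K]
        by (intro ennreal_leI) (simp add: tel sum_distrib_left mult.assoc)
      also have "\<dots> = (\<Sum>j\<le>K. ennreal (1000 * (10/9) ^ (3 * j)) * ennreal (D j x ^ 4))"
        by (subst sum_ennreal[symmetric]) (auto simp: ennreal_mult)
      finally show "ennreal (avg (r / 2 ^ K) x ^ 4) * indicator (box a b) x
          \<le> (\<Sum>j\<le>K. ennreal (1000 * (10/9) ^ (3 * j)) * (ennreal (D j x ^ 4) * indicator (box a b) x))"
        by (simp add: indicator_def)
    qed
    also have "\<dots> = (\<Sum>j\<le>K. ennreal (1000 * (10/9) ^ (3 * j)) * (\<integral>\<^sup>+x\<in>box a b. ennreal (D j x ^ 4) \<partial>lborel))"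
      by (simp add: nn_integral_sum nn_integral_cmult)
    also have "\<dots> \<le> (\<Sum>j\<le>K. ennreal (1000 * (10/9) ^ (3 * j)) * (ennreal (C * (1 / 2) ^ j) * Q))"
      by (intro sum_mono mult_left_mono D4) simp
    also have "\<dots> = (\<Sum>j\<le>K. ennreal (1000 * C * (500 / 729) ^ j)) * Q"
    proof -
      have eq: "1000 * (10/9) ^ (3 * j) * (C * (1 / 2) ^ j) = 1000 * C * (500 / 729) ^ j" for j :: nat
      proof -
        have "(10/9::real) ^ (3 * j) * (1 / 2) ^ j = (500 / 729) ^ j"
          by (simp add: power_mult power_mult_distrib[symmetric] power3_eq_cube)
        then show ?thesis by simp
      qed
      have "ennreal (1000 * (10/9) ^ (3 * j)) * (ennreal (C * (1 / 2) ^ j) * Q)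
          = ennreal (1000 * (10/9) ^ (3 * j) * (C * (1 / 2) ^ j)) * Q" for j
        using C by (simp add: ennreal_mult mult.assoc)
      then show ?thesis unfolding sum_distrib_right eq by (rule sum.cong[OF refl])
    qed
    also have "\<dots> \<le> ennreal (4000 * C) * Q"
    proof (rule mult_right_mono)
      \<comment> \<open>The full series is \<open>729 / 229\<close>, below 4; with the 1000 of
        \<open>geometric_fourth_power_le\<close> this produces the 4000 of the statement.\<close>
      have "(\<Sum>j\<le>K. (500 / 729 :: real) ^ j) \<le> (\<Sum>j. (500 / 729) ^ j)"
        by (intro sum_le_suminf) (auto simp: summable_geometric)
      also have "\<dots> \<le> 4" by (subst suminf_geometric) auto
      finally have "1000 * C * (\<Sum>j\<le>K. (500 / 729) ^ j) \<le> 1000 * C * 4"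
        using C by (intro mult_left_mono) auto
      then have "(\<Sum>j\<le>K. 1000 * C * (500 / 729) ^ j) \<le> 4000 * C" by (simp add: sum_distrib_left)
      then show "(\<Sum>j\<le>K. ennreal (1000 * C * (500 / 729) ^ j)) \<le> ennreal (4000 * C)"
        using C by (subst sum_ennreal) (auto intro: ennreal_leI)
    qed simp
    finally show ?thesis .
  qed
  have lim: "AE x in lborel. x \<in> box a b \<longrightarrow> (\<lambda>n. avg (r / 2 ^ n) x) \<longlonglongrightarrow> f x"
    by (rule avg_tendsto[OF r(1,3)]) (rule R)
  \<comment> \<open>The bound is uniform in \<open>K\<close>, so Fatou's lemma carries it from the
    averages to \<open>f\<close>.\<close>
  have "(\<integral>\<^sup>+x\<in>box a b. ennreal (f x ^ 4) \<partial>lborel)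
      = (\<integral>\<^sup>+x. liminf (\<lambda>K. ennreal (avg (r / 2 ^ K) x ^ 4) * indicator (box a b) x) \<partial>lborel)"
  proof (rule nn_integral_cong_AE)
    show "AE x in lborel. ennreal (f x ^ 4) * indicator (box a b) x
        = liminf (\<lambda>K. ennreal (avg (r / 2 ^ K) x ^ 4) * indicator (box a b) x)"
      using lim
    proof eventually_elim
      case (elim x)
      show ?case
      proof (cases "x \<in> box a b")
        case True
        with elim have "(\<lambda>K. ennreal (avg (r / 2 ^ K) x ^ 4)) \<longlonglongrightarrow> ennreal (f x ^ 4)"
          by (intro tendsto_intros) auto
        from lim_imp_Liminf[OF _ this] True show ?thesis by simp
      qed (simp add: Liminf_const)
    qed
  qed
  also have "\<dots> \<le> liminf (\<lambda>K. \<integral>\<^sup>+x\<in>box a b. ennreal (avg (r / 2 ^ K) x ^ 4) \<partial>lborel)"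
    by (rule nn_integral_liminf) measurable
  also have "\<dots> \<le> liminf (\<lambda>K::nat. ennreal (4000 * C) * Q)"
    using bound by (intro Liminf_mono always_eventually allI)
  also have "\<dots> = ennreal (4000 * C) * Q" by (rule Liminf_const) simp
  finally show ?thesis by (simp add: C_def Q_def)
qed

end

section \<open>The product rule along lines\<close>

text \<open>The absolutely continuous primitive of \<open>k\<close> that starts from 0 at minus
  infinity. The cut-off sits in the integrand, so that all integrals run over the whole line and
  Fubini applies directly.\<close>

definition cumul :: "(real \<Rightarrow> real) \<Rightarrow> real \<Rightarrow> real"
  where "cumul k t = (LINT r|lborel. (if r \<le> t then k r else 0))"

lemma integrable_truncate:
  fixes k :: "real \<Rightarrow> real"
  assumes "integrable lborel k"
  shows "integrable lborel (\<lambda>r. if r \<le> t then k r else 0)"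
proof -
  have "integrable lborel (\<lambda>r. indicator {..t} r *\<^sub>R k r)"
    using assms by (intro integrable_mult_indicator) auto
  then show ?thesis
    by (rule Bochner_Integration.integrable_cong[THEN iffD1, rotated 2]) (auto simp: indicator_def)
qed

lemma cumul_measurable [measurable (raw)]:
  assumes [measurable]: "k \<in> borel_measurable borel"
  shows "cumul k \<in> borel_measurable borel"
  unfolding cumul_def[abs_def] by measurable

lemma cumul_bound:
  assumes "integrable lborel k"
  shows "\<bar>cumul k t\<bar> \<le> (LINT r|lborel. \<bar>k r\<bar>)"
proof -
  have "\<bar>cumul k t\<bar> \<le> (LINT r|lborel. \<bar>(if r \<le> t then k r else 0)\<bar>)"
    unfolding cumul_def by (rule integral_abs_bound)
  also have "\<dots> \<le> (LINT r|lborel. \<bar>k r\<bar>)"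
    using assms integrable_truncate[OF assms] by (intro integral_mono) auto
  finally show ?thesis .
qed

lemma integrable_times_cumul:
  assumes k1: "integrable lborel k1" and k2: "integrable lborel k2"
  shows "integrable lborel (\<lambda>s. k1 s * (c + cumul k2 s))"
proof (rule Bochner_Integration.integrable_bound)
  let ?B = "\<bar>c\<bar> + (LINT r|lborel. \<bar>k2 r\<bar>)"
  have [measurable]: "k1 \<in> borel_measurable borel" "k2 \<in> borel_measurable borel" using k1 k2 by auto
  show "integrable lborel (\<lambda>s. k1 s * ?B)" using k1 by simp
  show "(\<lambda>s. k1 s * (c + cumul k2 s)) \<in> borel_measurable lborel" by measurable
  show "AE s in lborel. norm (k1 s * (c + cumul k2 s)) \<le> norm (k1 s * ?B)"
  proof (rule AE_I2)
    fix s
    have "\<bar>c + cumul k2 s\<bar> \<le> ?B" using cumul_bound[OF k2, of s] by linarith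
    then have "\<bar>k1 s\<bar> * \<bar>c + cumul k2 s\<bar> \<le> \<bar>k1 s\<bar> * \<bar>?B\<bar>" by (intro mult_left_mono) auto
    then show "norm (k1 s * (c + cumul k2 s)) \<le> norm (k1 s * ?B)" by (simp only: real_norm_def abs_mult)
  qed
qed

lemma integrable_tensor:
  fixes k1 k2 :: "real \<Rightarrow> real"
  assumes k1: "integrable lborel k1" and k2: "integrable lborel k2"
  shows "integrable (lborel \<Otimes>\<^sub>M lborel) (\<lambda>(s, r). k1 s * k2 r)"
proof (rule lborel_pair.Fubini_integrable)
  have [measurable]: "k1 \<in> borel_measurable borel" "k2 \<in> borel_measurable borel" using k1 k2 by auto
  show "(\<lambda>(s, r). k1 s * k2 r) \<in> borel_measurable (lborel \<Otimes>\<^sub>M lborel)" by measurable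
  show "integrable lborel (\<lambda>s. LINT r|lborel. norm (case (s, r) of (s, r) \<Rightarrow> k1 s * k2 r))"
    using k1 by (simp add: abs_mult)
  show "AE s in lborel. integrable lborel (\<lambda>r. case (s, r) of (s, r) \<Rightarrow> k1 s * k2 r)"
    using k2 by simp
qed

text \<open>Integration by parts for absolutely continuous functions: split the square into the two triangles
  \<open>r \<le> s\<close> and \<open>s < r\<close>.\<close>

lemma integral_product_cumul:
  assumes k1: "integrable lborel k1" and k2: "integrable lborel k2"
  shows "(LINT s|lborel. k1 s) * (LINT s|lborel. k2 s) = (LINT s|lborel. k1 s * cumul k2 s + k2 s * cumul k1 s)"
proof -
  have [measurable]: "k1 \<in> borel_measurable borel" "k2 \<in> borel_measurable borel" using k1 k2 by auto
  have T: "integrable (lborel \<Otimes>\<^sub>M lborel) (\<lambda>(s, r). k1 s * k2 r)" by (rule integrable_tensor[OF k1 k2])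
  have U: "integrable (lborel \<Otimes>\<^sub>M lborel) (\<lambda>(s, r). if r \<le> s then k1 s * k2 r else 0)"
    by (rule Bochner_Integration.integrable_bound[OF T]) (auto split: prod.split)
  have V: "integrable (lborel \<Otimes>\<^sub>M lborel) (\<lambda>(s, r). if s < r then k1 s * k2 r else 0)"
    by (rule Bochner_Integration.integrable_bound[OF T]) (auto split: prod.split)
  have "(LINT s|lborel. k1 s) * (LINT r|lborel. k2 r) = (LINT s|lborel. LINT r|lborel. k1 s * k2 r)"
    by simp
  also have "\<dots> = (LINT p|(lborel \<Otimes>\<^sub>M lborel). (case p of (s, r) \<Rightarrow> k1 s * k2 r))"
    by (rule lborel_pair.integral_fst[OF T])
  also have "\<dots> = (LINT p|(lborel \<Otimes>\<^sub>M lborel). (case p of (s, r) \<Rightarrow> if r \<le> s then k1 s * k2 r else 0)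
      + (case p of (s, r) \<Rightarrow> if s < r then k1 s * k2 r else 0))"
    by (intro Bochner_Integration.integral_cong) (auto split: prod.split)
  also have "\<dots> = (LINT p|(lborel \<Otimes>\<^sub>M lborel). (case p of (s, r) \<Rightarrow> if r \<le> s then k1 s * k2 r else 0))
      + (LINT p|(lborel \<Otimes>\<^sub>M lborel). (case p of (s, r) \<Rightarrow> if s < r then k1 s * k2 r else 0))"
    by (rule Bochner_Integration.integral_add[OF U V])
  also have "(LINT p|(lborel \<Otimes>\<^sub>M lborel). (case p of (s, r) \<Rightarrow> if r \<le> s then k1 s * k2 r else 0))
      = (LINT s|lborel. k1 s * cumul k2 s)"
  proof -
    have "(LINT s|lborel. LINT r|lborel. (if r \<le> s then k1 s * k2 r else 0)) = (LINT s|lborel. k1 s * cumul k2 s)"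
    proof (rule Bochner_Integration.integral_cong[OF refl])
      fix s
      have "(LINT r|lborel. (if r \<le> s then k1 s * k2 r else 0)) = (LINT r|lborel. k1 s * (if r \<le> s then k2 r else 0))"
        by (intro Bochner_Integration.integral_cong) auto
      then show "(LINT r|lborel. (if r \<le> s then k1 s * k2 r else 0)) = k1 s * cumul k2 s"
        by (simp add: cumul_def)
    qed
    then show ?thesis using lborel_pair.integral_fst[OF U] by simp
  qed
  also have "(LINT p|(lborel \<Otimes>\<^sub>M lborel). (case p of (s, r) \<Rightarrow> if s < r then k1 s * k2 r else 0))
      = (LINT r|lborel. k2 r * cumul k1 r)"
  proof -
    have "(LINT r|lborel. LINT s|lborel. (if s < r then k1 s * k2 r else 0)) = (LINT r|lborel. k2 r * cumul k1 r)"
    proof (rule Bochner_Integration.integral_cong[OF refl])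
      fix r
      have "(LINT s|lborel. (if s < r then k1 s * k2 r else 0)) = (LINT s|lborel. k2 r * (if s \<le> r then k1 s else 0))"
      proof (rule integral_cong_AE)
        show "AE s in lborel. (if s < r then k1 s * k2 r else 0) = k2 r * (if s \<le> r then k1 s else 0)"
          using AE_lborel_singleton[of r] by eventually_elim auto
      qed measurable
      then show "(LINT s|lborel. (if s < r then k1 s * k2 r else 0)) = k2 r * cumul k1 r"
        by (simp add: cumul_def)
    qed
    then show ?thesis using lborel_pair.integral_snd[OF V] by simp
  qed
  also have "(LINT s|lborel. k1 s * cumul k2 s) + (LINT r|lborel. k2 r * cumul k1 r)
      = (LINT s|lborel. k1 s * cumul k2 s + k2 s * cumul k1 s)"
    using integrable_times_cumul[OF k1 k2, of 0] integrable_times_cumul[OF k2 k1, of 0]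
    by (intro Bochner_Integration.integral_add[symmetric]) auto
  finally show ?thesis .
qed

text \<open>\<open>integral_product_cumul\<close> is applied to the two functions truncated at
  \<open>t\<close>; below \<open>t\<close> their primitives agree with the original ones, and beyond
  \<open>t\<close> the integrand is 0.\<close>

lemma product_rule_cumul:
  assumes k1: "integrable lborel k1" and k2: "integrable lborel k2"
  shows "(c1 + cumul k1 t) * (c2 + cumul k2 t)
    = c1 * c2 + cumul (\<lambda>s. k1 s * (c2 + cumul k2 s) + k2 s * (c1 + cumul k1 s)) t"
proof -
  define l1 where "l1 r = (if r \<le> t then k1 r else 0)" for r
  define l2 where "l2 r = (if r \<le> t then k2 r else 0)" for r
  have l: "integrable lborel l1" "integrable lborel l2"
    unfolding l1_def l2_def by (intro integrable_truncate k1 k2)+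
  have c: "s \<le> t \<Longrightarrow> cumul l1 s = cumul k1 s" "s \<le> t \<Longrightarrow> cumul l2 s = cumul k2 s" for s
    unfolding cumul_def l1_def l2_def by (intro Bochner_Integration.integral_cong; auto)+
  have "(c1 + cumul k1 t) * (c2 + cumul k2 t)
      = c1 * c2 + ((LINT s|lborel. l1 s * c2) + (LINT s|lborel. l2 s * c1) + (LINT s|lborel. l1 s) * (LINT s|lborel. l2 s))"
    by (simp add: cumul_def l1_def[symmetric] l2_def[symmetric] algebra_simps)
  also have "(LINT s|lborel. l1 s * c2) + (LINT s|lborel. l2 s * c1) + (LINT s|lborel. l1 s) * (LINT s|lborel. l2 s)
      = (LINT s|lborel. l1 s * c2 + l2 s * c1 + (l1 s * cumul l2 s + l2 s * cumul l1 s))"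
    unfolding integral_product_cumul[OF l]
    using l integrable_times_cumul[OF l, of 0] integrable_times_cumul[OF l(2,1), of 0] by simp
  also have "\<dots> = cumul (\<lambda>s. k1 s * (c2 + cumul k2 s) + k2 s * (c1 + cumul k1 s)) t"
    unfolding cumul_def[of _ t]
    by (intro Bochner_Integration.integral_cong refl) (auto simp: c l1_def l2_def algebra_simps)
  finally show ?thesis .
qed

lemma cumul_at_end:
  assumes "\<And>s. s > T \<Longrightarrow> k s = 0"
  shows "cumul k T = (LINT s|lborel. k s)"
  unfolding cumul_def using assms by (intro Bochner_Integration.integral_cong) auto

text \<open>The primitives \<open>c + cumul k\<close> and \<open>d + cumul l\<close> return to
  \<open>c\<close> and \<open>d\<close> at time 1. By the product rule, used once for the square and
  once for the product with it, the integrand is the derivative of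
  \<open>(c + cumul k) * (d + cumul l)\<^sup>2\<close>, which therefore has total increment
  0.\<close>

lemma triple_product_loop:
  assumes k: "integrable lborel k" "integrable lborel l"
    and 0: "(LINT s|lborel. k s) = 0" "(LINT s|lborel. l s) = 0"
    and supp: "\<And>s. s > 1 \<Longrightarrow> k s = 0" "\<And>s. s > 1 \<Longrightarrow> l s = 0"
  shows "(LINT s|lborel. k s * (d + cumul l s)\<^sup>2 + 2 * l s * (d + cumul l s) * (c + cumul k s)) = 0"
proof -
  define q where "q s = l s * (d + cumul l s) + l s * (d + cumul l s)" for s
  have q: "integrable lborel q"
    unfolding q_def using integrable_times_cumul[OF k(2,2)] by simp
  have q2: "d * d + cumul q t = (d + cumul l t)\<^sup>2" for t
    using product_rule_cumul[OF k(2,2), of d t d] by (simp only: q_def[abs_def] power2_eq_square)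
  define m where "m s = k s * (d * d + cumul q s) + q s * (c + cumul k s)" for s
  have "(c + cumul k 1) * (d * d + cumul q 1) = c * (d * d) + cumul m 1"
    unfolding m_def using product_rule_cumul[OF k(1) q] .
  moreover have "cumul k 1 = 0" "cumul l 1 = 0" "cumul m 1 = (LINT s|lborel. m s)"
    using 0 supp by (auto simp: cumul_at_end m_def q_def)
  ultimately have "(LINT s|lborel. m s) = 0"
    using q2[of 1] by (simp add: power2_eq_square)
  moreover have "m s = k s * (d + cumul l s)\<^sup>2 + 2 * l s * (d + cumul l s) * (c + cumul k s)" for s
    unfolding m_def q2 by (simp add: q_def)
  ultimately show ?thesis by simp
qed

text \<open>For every \<open>t\<close> the difference formula with displacement
  \<open>t *\<^sub>R z\<close>, rescaled in \<open>s\<close>, holds off a null set of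
  \<open>x\<close> that depends on \<open>t\<close>. Fubini exchanges the two, so that almost every
  line carries the formula at almost all its points. \<open>t = 0\<close> is excluded because the
  rescaling must be invertible.\<close>

lemma weak_gradient_on_lines:
  fixes f :: "real^'d \<Rightarrow> real"
  assumes w: "has_weak_gradient f g"
  shows "AE x in lborel. AE t in lborel. t \<in> {0<..1} \<longrightarrow>
    f (x + t *\<^sub>R z) = f x + cumul (\<lambda>s. indicator {0..1} s * (g (x + s *\<^sub>R z) \<bullet> z)) t"
proof -
  have [measurable]: "f \<in> borel_measurable borel" "g \<in> borel_measurable borel"
    using w by (auto simp: has_weak_gradient_def intro: locally_integrable_measurable)
  have "AE x in lborel. t \<in> {0<..1} \<longrightarrow>
    f (x + t *\<^sub>R z) = f x + (LINT s|lborel. (if s \<le> t then indicator {0..1} s * (g (x + s *\<^sub>R z) \<bullet> z) else 0))" for t :: real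
    using weak_gradient_difference[OF w, of "t *\<^sub>R z"]
  proof eventually_elim
    case (elim x)
    show ?case
    proof
      assume t: "t \<in> {0<..1}"
      let ?k = "\<lambda>s. if s \<le> t then indicator {0..1} s * (g (x + s *\<^sub>R z) \<bullet> z) else 0"
      have "(LINT s|lborel. ?k s) = \<bar>t\<bar> *\<^sub>R (LINT s|lborel. ?k (0 + t * s))"
        using t by (intro lborel_integral_real_affine) auto
      also have "\<dots> = (LINT s|lborel. t * ?k (0 + t * s))" using t by simp
      also have "\<dots> = (LINT s|lborel. indicator {0..1} s * (g (x + s *\<^sub>R t *\<^sub>R z) \<bullet> t *\<^sub>R z))"
      proof (rule Bochner_Integration.integral_cong[OF refl])
        fix s :: real
        have "t * s \<le> t \<longleftrightarrow> s \<le> 1" "0 \<le> t * s \<longleftrightarrow> 0 \<le> s"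
          using t by (auto simp: zero_le_mult_iff)
        moreover have "s \<le> 1 \<Longrightarrow> t * s \<le> 1"
          using t mult_mono[of t 1 s 1] by (cases "s \<ge> 0") (auto simp: mult_nonneg_nonpos intro: order_trans[of _ 0])
        ultimately show "t * ?k (0 + t * s) = indicator {0..1} s * (g (x + s *\<^sub>R t *\<^sub>R z) \<bullet> t *\<^sub>R z)"
          by (auto simp: indicator_def mult.commute)
      qed
      finally show "f (x + t *\<^sub>R z) = f x + (LINT s|lborel. ?k s)" using elim by simp
    qed
  qed
  then have "AE t in lborel. AE x in lborel. t \<in> {0<..1} \<longrightarrow>
    f (x + t *\<^sub>R z) = f x + (LINT s|lborel. (if s \<le> t then indicator {0..1} s * (g (x + s *\<^sub>R z) \<bullet> z) else 0))"
    by simp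
  then show ?thesis
    unfolding cumul_def
    by (rule lborel_pair.AE_commute[THEN iffD1, rotated]) measurable
qed

section \<open>Integrals along loops through a period\<close>

context periodic_cell begin

lemma integrable_swept_box:
  assumes h: "locally_integrable (h :: real^'d \<Rightarrow> real)"
  shows "integrable (lborel \<Otimes>\<^sub>M lborel) (\<lambda>(x, s). indicator (box a b) x * (indicator {0..1} s * h (x + s *\<^sub>R z)))"
proof (rule Bochner_Integration.integrable_bound[OF integrable_swept[OF h compact_cbox[of a b], of z]])
  have [measurable]: "h \<in> borel_measurable borel" using h by (rule locally_integrable_measurable)
  show "(\<lambda>(x, s). indicator (box a b) x * (indicator {0..1} s * h (x + s *\<^sub>R z))) \<in> borel_measurable (lborel \<Otimes>\<^sub>M lborel)"
    by measurable
  show "AE p in lborel \<Otimes>\<^sub>M lborel. norm (case p of (x, s) \<Rightarrow> indicator (box a b) x * (indicator {0..1} s * h (x + s *\<^sub>R z)))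
      \<le> norm (case p of (x, s) \<Rightarrow> indicator (cbox a b) x * (indicator {0..1} s * h (x + s *\<^sub>R z)))"
    using box_subset_cbox[of a b] by (intro AE_I2) (auto simp: indicator_def split: prod.split)
qed

text \<open>The integrand is formally the derivative of \<open>h * w\<^sup>2\<close> in direction
  \<open>j\<close>. It integrates to 0 over one period along almost every line in that direction,
  and averaging over the starting points turns these line integrals into the integral over the
  cell.\<close>

theorem integral_derivative_product_zero:
  assumes h: "has_weak_gradient h dh" "ae_periodic a b h" "ae_periodic a b dh"
    and w: "has_weak_gradient w dw" "ae_periodic a b w" "ae_periodic a b dw"
    and int: "set_integrable lborel (box a b) (\<lambda>x. dh x $ j * (w x)\<^sup>2 + 2 * h x * w x * dw x $ j)"
  shows "(LINT x:box a b|lborel. dh x $ j * (w x)\<^sup>2 + 2 * h x * w x * dw x $ j) = 0"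
proof -
  define z :: "real^'d" where "z = axis j (b $ j - a $ j)"
  have z: "y \<bullet> z = (b $ j - a $ j) * y $ j" for y by (simp add: z_def inner_axis)
  have [measurable]: "h \<in> borel_measurable borel" "dh \<in> borel_measurable borel"
    "w \<in> borel_measurable borel" "dw \<in> borel_measurable borel"
    using h(1) w(1) by (auto simp: has_weak_gradient_def intro: locally_integrable_measurable)
  have [measurable]: "(\<lambda>x. dh x $ j) \<in> borel_measurable borel" "(\<lambda>x. dw x $ j) \<in> borel_measurable borel"
    using h(1) w(1) by (auto simp: has_weak_gradient_def intro!: locally_integrable_measurable locally_integrable_component)
  define \<kappa> where "\<kappa> x = dh x $ j * (w x)\<^sup>2 + 2 * h x * w x * dw x $ j" for x
  have [measurable]: "\<kappa> \<in> borel_measurable borel" unfolding \<kappa>_def[abs_def] by measurable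
  have \<kappa>_int: "set_integrable lborel (box a b) \<kappa>" using int by (simp add: \<kappa>_def[abs_def])
  have \<kappa>_per: "ae_periodic a b \<kappa>"
  proof -
    have "ae_periodic a b (\<lambda>x. ((h x, dh x), (w x, dw x)))"
      by (intro ae_periodic_compose2[where h = Pair] h w)
    from ae_periodic_compose[OF this, of "\<lambda>((h, dh), (w, dw)). dh $ j * w\<^sup>2 + 2 * h * w * dw $ j"]
    show ?thesis by (simp add: \<kappa>_def[abs_def])
  qed
  have \<kappa>_loc: "locally_integrable \<kappa>" by (rule locally_integrable_periodic[OF _ \<kappa>_per \<kappa>_int]) measurable
  \<comment> \<open>A segment over a full period has equal values of \<open>f\<close> at its ends,
    so the derivative integrates to 0 along it.\<close>
  have loop: "AE x in lborel. x \<in> box a b \<longrightarrow> integrable lborel (\<lambda>s. indicator {0..1} s * (g (x + s *\<^sub>R z) \<bullet> z)) \<and>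
      (LINT s|lborel. indicator {0..1} s * (g (x + s *\<^sub>R z) \<bullet> z)) = 0"
    if f: "has_weak_gradient f g" "ae_periodic a b f" for f and g :: "real^'d \<Rightarrow> real^'d"
  proof -
    have "locally_integrable g" using f by (simp add: has_weak_gradient_def)
    from integrable_swept_box[OF locally_integrable_bounded_linear[OF bounded_linear_inner_left this], of z z]
    have "AE x in lborel. integrable lborel (\<lambda>s. indicator (box a b) x * (indicator {0..1} s * (g (x + s *\<^sub>R z) \<bullet> z)))"
      by (rule lborel_pair.AE_integrable_fst)
    moreover have "AE x in lborel. f (x + z) = f x" using f(2) by (simp add: ae_periodic_def z_def)
    ultimately show ?thesis
      using weak_gradient_difference[OF f(1), of z]
      by eventually_elim auto
  qed
  have "AE x in lborel. x \<in> box a b \<longrightarrow> (LINT s|lborel. indicator {0..1} s * \<kappa> (x + s *\<^sub>R z)) = 0"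
    using loop[OF h(1,2)] loop[OF w(1,2)] weak_gradient_on_lines[OF h(1), of z] weak_gradient_on_lines[OF w(1), of z]
  proof eventually_elim
    case (elim x)
    show ?case
    proof
      assume x: "x \<in> box a b"
      define k where "k s = indicator {0..1} s * (dh (x + s *\<^sub>R z) \<bullet> z)" for s
      define l where "l s = indicator {0..1} s * (dw (x + s *\<^sub>R z) \<bullet> z)" for s
      have kl: "integrable lborel k" "integrable lborel l" "(LINT s|lborel. k s) = 0" "(LINT s|lborel. l s) = 0"
        using elim(1,2) x by (auto simp: k_def[abs_def] l_def[abs_def])
      have [measurable]: "k \<in> borel_measurable borel" "l \<in> borel_measurable borel" using kl by auto
      have "(LINT s|lborel. k s * (w x + cumul l s)\<^sup>2 + 2 * l s * (w x + cumul l s) * (h x + cumul k s)) = 0"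
        by (rule triple_product_loop[OF kl]) (auto simp: k_def l_def)
      also have "(LINT s|lborel. k s * (w x + cumul l s)\<^sup>2 + 2 * l s * (w x + cumul l s) * (h x + cumul k s))
          = (LINT s|lborel. (b $ j - a $ j) * (indicator {0..1} s * \<kappa> (x + s *\<^sub>R z)))"
      proof (rule integral_cong_AE)
        show "AE s in lborel. k s * (w x + cumul l s)\<^sup>2 + 2 * l s * (w x + cumul l s) * (h x + cumul k s)
            = (b $ j - a $ j) * (indicator {0..1} s * \<kappa> (x + s *\<^sub>R z))"
          using elim(3,4) AE_lborel_singleton[of "0::real"] unfolding k_def[symmetric] l_def[symmetric]
        proof eventually_elim
          case (elim s)
          show ?case
          proof (cases "s \<in> {0..1}")
            case True
            with elim have "h x + cumul k s = h (x + s *\<^sub>R z)" "w x + cumul l s = w (x + s *\<^sub>R z)" by auto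
            with True show ?thesis by (simp add: k_def l_def \<kappa>_def z algebra_simps)
          qed (auto simp: k_def l_def indicator_def)
        qed
      qed measurable
      finally show "(LINT s|lborel. indicator {0..1} s * \<kappa> (x + s *\<^sub>R z)) = 0"
        using nondegenerate[of j] by simp
    qed
  qed
  then have "(LINT x|lborel. LINT s|lborel. indicator (box a b) x * (indicator {0..1} s * \<kappa> (x + s *\<^sub>R z))) = 0"
    by (intro integral_eq_zero_AE) (auto elim!: eventually_mono simp: indicator_def)
  also have "(LINT x|lborel. LINT s|lborel. indicator (box a b) x * (indicator {0..1} s * \<kappa> (x + s *\<^sub>R z)))
      = (LINT s|lborel. LINT x|lborel. indicator (box a b) x * (indicator {0..1} s * \<kappa> (x + s *\<^sub>R z)))"
    by (rule lborel_pair.Fubini_integral[OF integrable_swept_box[OF \<kappa>_loc], symmetric])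
  \<comment> \<open>After Fubini the inner integral runs over a translate of the cell, hence does
    not depend on \<open>s\<close>, and the interval of length 1 leaves the integral over the
    cell.\<close>
  also have "\<dots> = (LINT s|lborel. indicator {0..1::real} s * (LINT x:box a b|lborel. \<kappa> x))"
  proof (rule Bochner_Integration.integral_cong[OF refl])
    fix s :: real
    have "(LINT x|lborel. indicator (box a b) x * (indicator {0..1} s * \<kappa> (x + s *\<^sub>R z)))
        = indicator {0..1} s * (LINT x:box a b|lborel. \<kappa> (x + s *\<^sub>R z))"
      unfolding set_lebesgue_integral_def
      by (simp add: mult.left_commute[of "indicator (box a b) x" "indicator {0..1} s" for x])
    then show "(LINT x|lborel. indicator (box a b) x * (indicator {0..1} s * \<kappa> (x + s *\<^sub>R z)))
        = indicator {0..1} s * (LINT x:box a b|lborel. \<kappa> x)"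
      by (simp add: integral_periodic_translate[OF _ \<kappa>_per \<kappa>_int])
  qed
  finally show ?thesis by (simp add: \<kappa>_def)
qed

end

section \<open>The Lax-Milgram theorem\<close>

text \<open>Definiteness is not required, so that functions need not be identified modulo null sets; completeness is only
  asked for geometrically fast Cauchy sequences.\<close>

locale semi_hilbert =
  fixes S :: "'v::real_vector set" and I :: "'v \<Rightarrow> 'v \<Rightarrow> real"
  assumes sub: "subspace S"
    and I_add: "x \<in> S \<Longrightarrow> y \<in> S \<Longrightarrow> z \<in> S \<Longrightarrow> I (x + y) z = I x z + I y z"
    and I_scale: "x \<in> S \<Longrightarrow> z \<in> S \<Longrightarrow> I (c *\<^sub>R x) z = c * I x z"
    and I_sym: "x \<in> S \<Longrightarrow> y \<in> S \<Longrightarrow> I x y = I y x"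
    and I_nonneg: "x \<in> S \<Longrightarrow> 0 \<le> I x x"
    and complete: "(\<And>n. X n \<in> S) \<Longrightarrow> 0 < t \<Longrightarrow> t < 1 \<Longrightarrow> 0 \<le> c \<Longrightarrow>
      (\<And>n. I (X (Suc n) - X n) (X (Suc n) - X n) \<le> c * t ^ (2 * n)) \<Longrightarrow>
      \<exists>x\<in>S. (\<lambda>n. I (X n - x) (X n - x)) \<longlonglongrightarrow> 0"
begin

lemmas closed = subspace_0[OF sub] subspace_add[OF sub] subspace_scale[OF sub] subspace_diff[OF sub]

lemma I_add2: "x \<in> S \<Longrightarrow> y \<in> S \<Longrightarrow> z \<in> S \<Longrightarrow> I x (y + z) = I x y + I x z"
  using I_add[of y z x] by (simp add: I_sym closed)

lemma I_scale2: "x \<in> S \<Longrightarrow> y \<in> S \<Longrightarrow> I x (c *\<^sub>R y) = c * I x y"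
  using I_scale[of y x c] by (simp add: I_sym closed)

lemma I_diff: "x \<in> S \<Longrightarrow> y \<in> S \<Longrightarrow> z \<in> S \<Longrightarrow> I (x - y) z = I x z - I y z"
  using I_add[of x "(-1) *\<^sub>R y" z] I_scale[of y z "-1"] closed(3)[of y "-1"] by simp

lemma I_diff2: "x \<in> S \<Longrightarrow> y \<in> S \<Longrightarrow> z \<in> S \<Longrightarrow> I x (y - z) = I x y - I x z"
  using I_diff[of y z x] by (simp add: I_sym closed)

lemmas I_simps = I_add I_add2 I_scale I_scale2 I_diff I_diff2

definition N :: "'v \<Rightarrow> real" where "N x = sqrt (I x x)"

lemma N_sq: "x \<in> S \<Longrightarrow> (N x)\<^sup>2 = I x x"
  by (simp add: N_def I_nonneg)

lemma N_nonneg: "x \<in> S \<Longrightarrow> 0 \<le> N x"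
  by (simp add: N_def I_nonneg)

text \<open>A vector with \<open>I y y = 0\<close> need not be 0 and is treated apart: there the
  quadratic in \<open>s\<close> degenerates to an affine function, which is nonnegative only if its
  slope vanishes.\<close>

lemma Cauchy_Schwarz:
  assumes x: "x \<in> S" and y: "y \<in> S"
  shows "\<bar>I x y\<bar> \<le> N x * N y"
proof -
  have q: "0 \<le> I x x - 2 * s * I x y + s\<^sup>2 * I y y" for s
    using I_nonneg[of "x - s *\<^sub>R y"] x y I_sym[OF x y]
    by (simp add: I_simps closed power2_eq_square algebra_simps)
  have "(I x y)\<^sup>2 \<le> I x x * I y y"
  proof (cases "I y y = 0")
    case True
    have "I x y = 0"
    proof (rule ccontr)
      assume "I x y \<noteq> 0"
      then show False
        \<comment> \<open>At this \<open>s\<close> the affine function takes the value -1.\<close>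
        using q[of "(I x x + 1) / (2 * I x y)"] True by (simp add: field_simps)
    qed
    with True show ?thesis by simp
  next
    case False
    then have "I y y > 0" using I_nonneg[OF y] by simp
    then show ?thesis
      using q[of "I x y / I y y"] by (simp add: field_simps power2_eq_square)
  qed
  then have "sqrt ((I x y)\<^sup>2) \<le> sqrt (I x x * I y y)" by (rule real_sqrt_le_mono)
  then show ?thesis by (simp add: N_def real_sqrt_mult)
qed

text \<open>The representing vector minimises \<open>J\<close>. A sequence that is minimising up to
  \<open>(1/4) ^ n\<close> has, by the parallelogram identity, increments of geometrically small
  norm, which is the kind of Cauchy sequence that \<open>complete\<close> accepts. The first
  variation of \<open>J\<close> at the limit gives the representation.\<close>

theorem Riesz:
  assumes F_add: "\<And>x y. x \<in> S \<Longrightarrow> y \<in> S \<Longrightarrow> F (x + y) = F x + F y"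
    and F_scale: "\<And>c x. x \<in> S \<Longrightarrow> F (c *\<^sub>R x) = c * F x"
    and F_bound: "\<And>x. x \<in> S \<Longrightarrow> \<bar>F x\<bar> \<le> K * N x"
  shows "\<exists>r\<in>S. \<forall>y\<in>S. I r y = F y"
proof -
  define J where "J y = I y y - 2 * F y" for y
  have Jlow: "- K\<^sup>2 \<le> J y" if y: "y \<in> S" for y
  proof -
    have "2 * F y \<le> 2 * (K * N y)" using F_bound[OF y] by linarith
    moreover have "0 \<le> (N y - K)\<^sup>2" by simp
    ultimately show ?thesis
      using N_sq[OF y] by (simp add: J_def power2_diff mult.commute[of K] mult.assoc)
  qed
  define j where "j = Inf (J ` S)"
  have bdd: "bdd_below (J ` S)" using Jlow by (auto intro!: bdd_belowI)
  have j: "j \<le> J y" if "y \<in> S" for y unfolding j_def using that bdd by (intro cInf_lower) auto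
  have "\<exists>y\<in>S. J y < j + (1 / 4) ^ n" for n :: nat
  proof -
    have "\<exists>v\<in>J ` S. v < j + (1 / 4) ^ n"
      using closed(1) bdd unfolding j_def by (intro cInf_lessD) auto
    then show ?thesis by auto
  qed
  then obtain Y where Y: "\<And>n. Y n \<in> S" "\<And>n. J (Y n) < j + (1 / 4) ^ n" by metis
  have F_diff: "F (x - y) = F x - F y" if "x \<in> S" "y \<in> S" for x y
    using F_add[of x "(-1) *\<^sub>R y"] F_scale[of y "-1"] closed(3)[of y "-1"] that by simp
  have "I (Y (Suc n) - Y n) (Y (Suc n) - Y n) \<le> 4 * (1 / 2) ^ (2 * n)" for n
  proof -
    let ?y = "Y n" and ?z = "Y (Suc n)"
    have yz: "?y \<in> S" "?z \<in> S" by (rule Y)+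
    have "j \<le> J ((1 / 2) *\<^sub>R (?y + ?z))" using yz by (intro j closed)
    also have "4 * J ((1 / 2) *\<^sub>R (?y + ?z)) = 2 * J ?y + 2 * J ?z - I (?z - ?y) (?z - ?y)"
      using yz I_sym[OF yz] by (simp add: J_def I_simps closed F_add F_scale algebra_simps)
    finally have "I (?z - ?y) (?z - ?y) \<le> 2 * J ?y + 2 * J ?z - 4 * j"
      by (simp add: field_simps)
    also have "\<dots> \<le> 2 * (1 / 4) ^ n + 2 * (1 / 4) ^ Suc n" using Y(2)[of n] Y(2)[of "Suc n"] by linarith
    also have "\<dots> \<le> 4 * (1 / 4) ^ n" by simp
    finally show ?thesis by (simp add: power_mult power_divide)
  qed
  from complete[OF Y(1) _ _ _ this]
  obtain r where r: "r \<in> S" and lim: "(\<lambda>n. I (Y n - r) (Y n - r)) \<longlonglongrightarrow> 0" by auto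
  have N0: "(\<lambda>n. N (Y n - r)) \<longlonglongrightarrow> 0"
    unfolding N_def using tendsto_real_sqrt[OF lim] by simp
  have I0: "(\<lambda>n. I (Y n - r) y) \<longlonglongrightarrow> 0" if y: "y \<in> S" for y
  proof (rule Lim_null_comparison)
    show "(\<lambda>n. N (Y n - r) * N y) \<longlonglongrightarrow> 0" using tendsto_mult[OF N0 tendsto_const[of "N y"]] by simp
    show "\<forall>\<^sub>F n in sequentially. norm (I (Y n - r) y) \<le> N (Y n - r) * N y"
      using Cauchy_Schwarz Y r y closed by (intro always_eventually allI) auto
  qed
  have F0: "(\<lambda>n. F (Y n - r)) \<longlonglongrightarrow> 0"
  proof (rule Lim_null_comparison)
    show "(\<lambda>n. K * N (Y n - r)) \<longlonglongrightarrow> 0" using tendsto_mult[OF tendsto_const[of K] N0] by simp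
    show "\<forall>\<^sub>F n in sequentially. norm (F (Y n - r)) \<le> K * N (Y n - r)"
      using F_bound Y r closed by (intro always_eventually allI) auto
  qed
  have "J (Y n) = J r + 2 * I (Y n - r) r + I (Y n - r) (Y n - r) - 2 * F (Y n - r)" for n
    using Y(1)[of n] r I_sym[OF Y(1)[of n] r] by (simp add: J_def I_simps F_diff closed algebra_simps)
  moreover have "(\<lambda>n. J r + 2 * I (Y n - r) r + I (Y n - r) (Y n - r) - 2 * F (Y n - r)) \<longlonglongrightarrow> J r + 2 * 0 + 0 - 2 * 0"
    by (intro tendsto_intros lim I0 r F0)
  ultimately have Jlim: "(\<lambda>n. J (Y n)) \<longlonglongrightarrow> J r" by simp
  have "(\<lambda>n. j + (1 / 4) ^ n) \<longlonglongrightarrow> j + 0"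
    by (intro tendsto_intros LIMSEQ_realpow_zero) auto
  from LIMSEQ_le[OF Jlim this] Y(2) have Jr: "J r \<le> j" by (auto intro: less_imp_le)
  have "I r y = F y" if y: "y \<in> S" for y
  proof -
    define p where "p = I r y - F y"
    have pos: "0 \<le> s\<^sup>2 * I y y + 2 * s * p" for s
    proof -
      have "J r \<le> J (r + s *\<^sub>R y)" using Jr j[of "r + s *\<^sub>R y"] r y closed by auto
      then show ?thesis
        using r y I_sym[OF r y] by (simp add: J_def p_def I_simps closed F_add F_scale power2_eq_square algebra_simps)
    qed
    have "p = 0"
    proof (rule ccontr)
      assume "p \<noteq> 0"
      \<comment> \<open>The minimising step would be \<open>- p / I y y\<close>; adding 1 keeps the
        denominator positive for null vectors \<open>y\<close> and still makes the variation
        negative.\<close>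
      let ?c = "I y y + 1"
      have c: "?c > 0" using I_nonneg[OF y] by simp
      have "0 \<le> (p / ?c)\<^sup>2 * I y y - 2 * (p / ?c) * p" using pos[of "- (p / ?c)"] by simp
      also have "\<dots> \<le> (p / ?c)\<^sup>2 * ?c - 2 * (p / ?c) * p" by (simp add: algebra_simps)
      also have "(p / c)\<^sup>2 * c - 2 * (p / c) * p = - (p\<^sup>2 / c)" if "c > 0" for c
        using that by (simp add: power2_eq_square field_simps)
      from this[OF c] have "(p / ?c)\<^sup>2 * ?c - 2 * (p / ?c) * p = - (p\<^sup>2 / ?c)" .
      also have "\<dots> < 0" using c \<open>p \<noteq> 0\<close> by simp
      finally show False by simp
    qed
    then show ?thesis by (simp add: p_def)
  qed
  with r show ?thesis by blast
qed

definition bounded_form :: "('v \<Rightarrow> 'v \<Rightarrow> real) \<Rightarrow> bool"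
  where "bounded_form B \<longleftrightarrow>
    (\<forall>x\<in>S. \<forall>y\<in>S. \<forall>z\<in>S. B (x + y) z = B x z + B y z \<and> B x (y + z) = B x y + B x z) \<and>
    (\<forall>x\<in>S. \<forall>y\<in>S. \<forall>c. B (c *\<^sub>R x) y = c * B x y \<and> B x (c *\<^sub>R y) = c * B x y) \<and>
    (\<exists>M. \<forall>x\<in>S. \<forall>y\<in>S. \<bar>B x y\<bar> \<le> M * (N x * N y))"

definition bounded_functional :: "('v \<Rightarrow> real) \<Rightarrow> bool"
  where "bounded_functional F \<longleftrightarrow>
    (\<forall>x\<in>S. \<forall>y\<in>S. F (x + y) = F x + F y) \<and> (\<forall>x\<in>S. \<forall>c. F (c *\<^sub>R x) = c * F x) \<and>
    (\<exists>K. \<forall>x\<in>S. \<bar>F x\<bar> \<le> K * N x)"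

lemma bounded_form_add:
  assumes "bounded_form B" "bounded_form C"
  shows "bounded_form (\<lambda>x y. B x y + C x y)"
proof -
  obtain M where M: "\<And>x y. x \<in> S \<Longrightarrow> y \<in> S \<Longrightarrow> \<bar>B x y\<bar> \<le> M * (N x * N y)"
    using assms(1) unfolding bounded_form_def by blast
  obtain M' where "\<And>x y. x \<in> S \<Longrightarrow> y \<in> S \<Longrightarrow> \<bar>C x y\<bar> \<le> M' * (N x * N y)"
    using assms(2) unfolding bounded_form_def by blast
  with M have "\<bar>B x y + C x y\<bar> \<le> (M + M') * (N x * N y)" if "x \<in> S" "y \<in> S" for x y
    using that abs_triangle_ineq[of "B x y" "C x y"] by (fastforce simp: distrib_right)
  then show ?thesis
    using assms unfolding bounded_form_def by (auto simp: algebra_simps intro!: exI[of _ "M + M'"])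
qed

lemma bounded_form_cmult:
  assumes "bounded_form B"
  shows "bounded_form (\<lambda>x y. k * B x y)"
proof -
  obtain M where M: "\<And>x y. x \<in> S \<Longrightarrow> y \<in> S \<Longrightarrow> \<bar>B x y\<bar> \<le> M * (N x * N y)"
    using assms unfolding bounded_form_def by blast
  have "\<bar>k * B x y\<bar> \<le> (\<bar>k\<bar> * M) * (N x * N y)" if "x \<in> S" "y \<in> S" for x y
    using mult_left_mono[OF M[OF that], of "\<bar>k\<bar>"] by (simp add: abs_mult mult.assoc)
  then show ?thesis
    using assms unfolding bounded_form_def by (auto simp: algebra_simps intro!: exI[of _ "\<bar>k\<bar> * M"])
qed

lemma bounded_functional_add:
  assumes "bounded_functional B" "bounded_functional C"
  shows "bounded_functional (\<lambda>x. B x + C x)"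
proof -
  obtain M where M: "\<And>x. x \<in> S \<Longrightarrow> \<bar>B x\<bar> \<le> M * N x"
    using assms(1) unfolding bounded_functional_def by blast
  obtain M' where "\<And>x. x \<in> S \<Longrightarrow> \<bar>C x\<bar> \<le> M' * N x"
    using assms(2) unfolding bounded_functional_def by blast
  with M have "\<bar>B x + C x\<bar> \<le> (M + M') * N x" if "x \<in> S" for x
    using that abs_triangle_ineq[of "B x" "C x"] by (fastforce simp: distrib_right)
  then show ?thesis
    using assms unfolding bounded_functional_def by (auto simp: algebra_simps intro!: exI[of _ "M + M'"])
qed

lemma bounded_functional_cmult:
  assumes "bounded_functional B"
  shows "bounded_functional (\<lambda>x. k * B x)"
proof -
  obtain M where M: "\<And>x. x \<in> S \<Longrightarrow> \<bar>B x\<bar> \<le> M * N x"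
    using assms unfolding bounded_functional_def by blast
  have "\<bar>k * B x\<bar> \<le> (\<bar>k\<bar> * M) * N x" if "x \<in> S" for x
    using mult_left_mono[OF M[OF that], of "\<bar>k\<bar>"] by (simp add: abs_mult mult.assoc)
  then show ?thesis
    using assms unfolding bounded_functional_def by (auto simp: algebra_simps intro!: exI[of _ "\<bar>k\<bar> * M"])
qed

lemma bounded_form_diff:
  assumes "bounded_form B" "x \<in> S" "y \<in> S" "z \<in> S"
  shows "B (x - y) z = B x z - B y z"
proof -
  have "B (x + (-1) *\<^sub>R y) z = B x z + B ((-1) *\<^sub>R y) z" "B ((-1) *\<^sub>R y) z = - 1 * B y z"
    using assms closed(3)[of y "-1"] unfolding bounded_form_def by blast+
  then show ?thesis by simp
qed

text \<open>The solution is the fixed point of \<open>x \<mapsto> x - \<tau> R x\<close>, where \<open>R x\<close> represents the residual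
  \<open>B x - F\<close>; the step \<open>\<tau> = \<delta> / M\<^sup>2\<close> makes it a contraction.\<close>

theorem Lax_Milgram:
  assumes B: "bounded_form B" and F: "bounded_functional F"
    and coercive: "\<And>x. x \<in> S \<Longrightarrow> \<delta> * I x x \<le> B x x" and \<delta>: "\<delta> > 0"
  shows "\<exists>x\<in>S. \<forall>y\<in>S. B x y = F y"
proof -
  obtain M0 where M0: "\<And>x y. x \<in> S \<Longrightarrow> y \<in> S \<Longrightarrow> \<bar>B x y\<bar> \<le> M0 * (N x * N y)"
    using B unfolding bounded_form_def by blast
  obtain K where K: "\<And>x. x \<in> S \<Longrightarrow> \<bar>F x\<bar> \<le> K * N x"
    using F unfolding bounded_functional_def by blast
  \<comment> \<open>The summand \<open>2 * \<delta>\<close> forces \<open>M > \<delta>\<close>, so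
    that the contraction factor \<open>1 - \<delta>\<^sup>2 / M\<^sup>2\<close> lies strictly
    between 0 and 1 whatever \<open>M0\<close> is.\<close>
  define M where "M = \<bar>M0\<bar> + 2 * \<delta>"
  have M: "M > \<delta>" "M > 0" using \<delta> by (auto simp: M_def)
  have Mb: "\<bar>B x y\<bar> \<le> M * (N x * N y)" if "x \<in> S" "y \<in> S" for x y
  proof -
    have "M0 * (N x * N y) \<le> M * (N x * N y)"
      using that \<delta> by (intro mult_right_mono) (auto simp: M_def N_nonneg)
    with M0[OF that] show ?thesis by simp
  qed
  have "\<exists>r\<in>S. \<forall>y\<in>S. I r y = B x y - F y" if x: "x \<in> S" for x
  proof (rule Riesz)
    show "B x (y + z) - F (y + z) = (B x y - F y) + (B x z - F z)" if "y \<in> S" "z \<in> S" for y z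
      using B F x that unfolding bounded_form_def bounded_functional_def by simp
    show "B x (c *\<^sub>R y) - F (c *\<^sub>R y) = c * (B x y - F y)" if "y \<in> S" for c y
      using B F x that unfolding bounded_form_def bounded_functional_def by (simp add: right_diff_distrib)
    show "\<bar>B x y - F y\<bar> \<le> (M * N x + K) * N y" if "y \<in> S" for y
      using Mb[OF x that] K[OF that] by (simp add: algebra_simps)
  qed
  then obtain R where R: "\<And>x. x \<in> S \<Longrightarrow> R x \<in> S" "\<And>x y. x \<in> S \<Longrightarrow> y \<in> S \<Longrightarrow> I (R x) y = B x y - F y"
    by metis
  define \<tau> where "\<tau> = \<delta> / M\<^sup>2"
  have \<tau>: "\<tau> > 0" using \<delta> M by (simp add: \<tau>_def)
  define q where "q = 1 - \<delta>\<^sup>2 / M\<^sup>2"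
  have "\<delta>\<^sup>2 < M\<^sup>2" using M \<delta> by (intro power_strict_mono) auto
  then have q: "0 < q" "q < 1" using M \<delta> by (auto simp: q_def field_simps)
  define T where "T x = x - \<tau> *\<^sub>R R x" for x
  have T: "T x \<in> S" if "x \<in> S" for x unfolding T_def by (intro closed R(1) that)
  have contr: "I (T x - T y) (T x - T y) \<le> q * I (x - y) (x - y)" if x: "x \<in> S" and y: "y \<in> S" for x y
  proof -
    define d where "d = x - y"
    define e where "e = R x - R y"
    have de: "d \<in> S" "e \<in> S" using x y R closed by (auto simp: d_def e_def)
    have Ie: "I e z = B d z" if "z \<in> S" for z
      unfolding e_def d_def I_diff[OF R(1)[OF x] R(1)[OF y] that] bounded_form_diff[OF B x y that]
        R(2)[OF x that] R(2)[OF y that] by simp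
    have "(N e)\<^sup>2 \<le> M * (N d * N e)"
      using Mb[OF de] Ie[OF de(2)] N_sq[OF de(2)] by simp
    then have "N e \<le> M * N d"
      using N_nonneg[OF de(1)] N_nonneg[OF de(2)] M
      by (cases "N e = 0") (auto simp: power2_eq_square mult.assoc[symmetric])
    then have "(N e)\<^sup>2 \<le> (M * N d)\<^sup>2" using N_nonneg[OF de(2)] by (intro power_mono)
    then have Iee: "I e e \<le> M\<^sup>2 * I d d" using N_sq de by (simp add: power_mult_distrib)
    have TT: "T x - T y = d - \<tau> *\<^sub>R e" by (simp add: T_def d_def e_def algebra_simps)
    have "I (T x - T y) (T x - T y) = I d d - 2 * \<tau> * I e d + \<tau>\<^sup>2 * I e e"
      unfolding TT using de I_sym[OF de] by (simp add: I_simps closed power2_eq_square algebra_simps)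
    \<comment> \<open>Coercivity enters through the linear term, which contributes
      \<open>- 2 * \<delta>\<^sup>2 / M\<^sup>2\<close>; the quadratic term gives back
      \<open>\<delta>\<^sup>2 / M\<^sup>2\<close>.\<close>
    also have "\<dots> \<le> I d d - 2 * \<tau> * (\<delta> * I d d) + \<tau>\<^sup>2 * (M\<^sup>2 * I d d)"
      using Iee Ie[OF de(1)] coercive[OF de(1)] \<tau> by (intro add_mono diff_mono mult_left_mono) auto
    also have "\<dots> = q * I d d" using M by (simp add: \<tau>_def q_def power2_eq_square field_simps)
    finally show ?thesis by (simp add: d_def)
  qed
  define X where "X n = (T ^^ n) 0" for n
  have X: "X n \<in> S" for n by (induction n) (auto simp: X_def closed T)
  have XS: "X (Suc n) = T (X n)" for n by (simp add: X_def)
  define c where "c = I (X 1 - X 0) (X 1 - X 0)"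
  \<comment> \<open>The ratio handed to \<open>complete\<close> is \<open>sqrt q\<close>, since the
    decay of squared norms is measured there by \<open>t ^ (2 * n)\<close>.\<close>
  have "I (X (Suc n) - X n) (X (Suc n) - X n) \<le> c * sqrt q ^ (2 * n)" for n
  proof (induction n)
    case (Suc n)
    have "I (X (Suc (Suc n)) - X (Suc n)) (X (Suc (Suc n)) - X (Suc n)) \<le> q * I (X (Suc n) - X n) (X (Suc n) - X n)"
      using contr[OF X X, of "Suc n" n] by (simp add: XS)
    also have "\<dots> \<le> q * (c * sqrt q ^ (2 * n))" using Suc q by (intro mult_left_mono) auto
    also have "\<dots> = c * sqrt q ^ (2 * Suc n)" using q by (simp add: power_mult)
    finally show ?case .
  qed (simp add: c_def)
  from complete[OF X _ _ _ this] q
  obtain x where x: "x \<in> S" and "(\<lambda>n. I (X n - x) (X n - x)) \<longlonglongrightarrow> 0"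
    using I_nonneg X closed by (auto simp: c_def)
  then have N0: "(\<lambda>n. N (X n - x)) \<longlonglongrightarrow> 0"
    unfolding N_def using tendsto_real_sqrt by force
  have "B x y = F y" if y: "y \<in> S" for y
  proof -
    \<comment> \<open>The residual at \<open>x\<close> is the residual at the iterate
      \<open>X n\<close> minus \<open>B (X n - x) y\<close>, and the residual at \<open>X n\<close>
      is represented by the increment of the iteration divided by \<open>\<tau>\<close>. Both parts
      tend to 0.\<close>
    have lin: "\<bar>B x y - F y\<bar> \<le> (M + 2 / \<tau>) * N y * (N (X n - x) + N (X (Suc n) - x))" for n
    proof -
      have Xx: "X n - x \<in> S" "X (Suc n) - x \<in> S" using X x closed by auto
      have "X n - X (Suc n) = \<tau> *\<^sub>R R (X n)" by (simp add: XS T_def)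
      then have "\<tau> * I (R (X n)) y = I ((X n - x) - (X (Suc n) - x)) y"
        using I_scale[of "R (X n)" y \<tau>] R(1)[OF X] y by simp
      also have "\<dots> = I (X n - x) y - I (X (Suc n) - x) y" by (rule I_diff[OF Xx y])
      also have "\<bar>\<dots>\<bar> \<le> (N (X n - x) + N (X (Suc n) - x)) * N y"
        using Cauchy_Schwarz[OF Xx(1) y] Cauchy_Schwarz[OF Xx(2) y] by (simp add: distrib_right)
      finally have 1: "\<bar>I (R (X n)) y\<bar> \<le> (N (X n - x) + N (X (Suc n) - x)) * N y / \<tau>"
        using \<tau> by (simp add: abs_mult field_simps)
      have "B x y - F y = I (R (X n)) y - B (X n - x) y"
        using R(2)[OF X y] bounded_form_diff[OF B X x y] by simp
      then have "\<bar>B x y - F y\<bar> \<le> (N (X n - x) + N (X (Suc n) - x)) * N y / \<tau> + M * (N (X n - x) * N y)"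
        using 1 Mb[OF Xx(1) y] by linarith
      also have "\<dots> \<le> (M + 2 / \<tau>) * N y * (N (X n - x) + N (X (Suc n) - x))"
      proof -
        have "0 \<le> N y * (N (X n - x) + N (X (Suc n) - x)) / \<tau>" "0 \<le> M * (N (X (Suc n) - x) * N y)"
          using N_nonneg Xx y \<tau> M by auto
        then show ?thesis by (simp add: algebra_simps add_divide_distrib)
      qed
      finally show ?thesis .
    qed
    have "(\<lambda>n. (M + 2 / \<tau>) * N y * (N (X n - x) + N (X (Suc n) - x))) \<longlonglongrightarrow> (M + 2 / \<tau>) * N y * (0 + 0)"
      by (intro tendsto_intros N0 LIMSEQ_Suc[OF N0])
    from LIMSEQ_le_const[OF this, of "\<bar>B x y - F y\<bar>"] lin have "\<bar>B x y - F y\<bar> \<le> 0" by simp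
    then show ?thesis by simp
  qed
  with x show ?thesis by blast
qed

end

text \<open>For completeness, the increments in each factor inherit the geometric bound because the
  other summand is nonnegative.\<close>

lemma semi_hilbert_prod:
  assumes "semi_hilbert S I" "semi_hilbert T J"
  shows "semi_hilbert (S \<times> T) (\<lambda>x y. I (fst x) (fst y) + J (snd x) (snd y))"
proof -
  interpret S: semi_hilbert S I by fact
  interpret T: semi_hilbert T J by fact
  show ?thesis
  proof
    show "subspace (S \<times> T)" by (rule subspace_Times[OF S.sub T.sub])
    fix X :: "nat \<Rightarrow> 'a \<times> 'b" and t c :: real
    assume X: "\<And>n. X n \<in> S \<times> T" and t: "0 < t" "t < 1" and c: "0 \<le> c"
      and le: "\<And>n. I (fst (X (Suc n) - X n)) (fst (X (Suc n) - X n))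
        + J (snd (X (Suc n) - X n)) (snd (X (Suc n) - X n)) \<le> c * t ^ (2 * n)"
    have X': "fst (X n) \<in> S" "snd (X n) \<in> T" for n using X[of n] by (auto simp: mem_Times_iff)
    have "I (fst (X (Suc n)) - fst (X n)) (fst (X (Suc n)) - fst (X n)) \<le> c * t ^ (2 * n)" for n
      using le[of n] T.I_nonneg[OF T.closed(4)[OF X'(2) X'(2)], of "Suc n" n] by simp
    from S.complete[OF X'(1) t c this] obtain x where
      x: "x \<in> S" "(\<lambda>n. I (fst (X n) - x) (fst (X n) - x)) \<longlonglongrightarrow> 0" by blast
    have "J (snd (X (Suc n)) - snd (X n)) (snd (X (Suc n)) - snd (X n)) \<le> c * t ^ (2 * n)" for n
      using le[of n] S.I_nonneg[OF S.closed(4)[OF X'(1) X'(1)], of "Suc n" n] by simp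
    from T.complete[OF X'(2) t c this] obtain y where
      y: "y \<in> T" "(\<lambda>n. J (snd (X n) - y) (snd (X n) - y)) \<longlonglongrightarrow> 0" by blast
    show "\<exists>x\<in>S \<times> T. (\<lambda>n. I (fst (X n - x)) (fst (X n - x)) + J (snd (X n - x)) (snd (X n - x))) \<longlonglongrightarrow> 0"
      using x y tendsto_add[OF x(2) y(2)] by (intro bexI[of _ "(x, y)"]) auto
  qed (auto simp: S.I_simps T.I_simps S.closed T.closed S.I_sym T.I_sym S.I_nonneg T.I_nonneg algebra_simps)
qed

section \<open>Periodic Sobolev spaces\<close>

text \<open>Together with the pointwise addition of \<open>Function_Algebras\<close> this turns
  functions and tuples of functions into vectors, as \<open>semi_hilbert\<close> demands.\<close>

instantiation "fun" :: (type, real_vector) real_vector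
begin

definition scaleR_fun :: "real \<Rightarrow> ('a \<Rightarrow> 'b) \<Rightarrow> 'a \<Rightarrow> 'b"
  where "scaleR_fun c f = (\<lambda>x. c *\<^sub>R f x)"

instance
  by standard (auto simp: scaleR_fun_def fun_eq_iff scaleR_add_left scaleR_add_right)

end

lemma scaleR_fun_apply [simp]: "(c *\<^sub>R f) x = c *\<^sub>R f x"
  by (simp add: scaleR_fun_def)

lemma ennreal_le_of_square:
  assumes "x\<^sup>2 \<le> ennreal (r\<^sup>2)" "0 \<le> r"
  shows "x \<le> ennreal r"
proof (cases x)
  case (real y)
  with assms have "y\<^sup>2 \<le> r\<^sup>2" by (simp add: ennreal_power)
  then have "y \<le> r" using assms(2) by (rule power2_le_imp_le)
  with real show ?thesis by (simp add: ennreal_leI)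
qed (use assms in \<open>simp add: power2_eq_square top_unique\<close>)

section \<open>Square-integrable functions on the cell\<close>

context periodic_cell begin

definition L2 :: "(real^'d \<Rightarrow> 'b::euclidean_space) \<Rightarrow> bool"
  where "L2 f \<longleftrightarrow> f \<in> borel_measurable borel \<and> sq f < \<infinity>"

text \<open>\<open>enn2real\<close> sends infinity to 0, so this is the norm only for functions that
  satisfy \<open>L2\<close>.\<close>

definition l2 :: "(real^'d \<Rightarrow> 'b::euclidean_space) \<Rightarrow> real"
  where "l2 f = sqrt (enn2real (sq f))"

lemma L2_measurable: "L2 f \<Longrightarrow> f \<in> borel_measurable borel"
  by (simp add: L2_def)

lemma l2_nonneg [simp]: "0 \<le> l2 f"
  by (simp add: l2_def)

lemma sq_l2: "L2 f \<Longrightarrow> sq f = ennreal ((l2 f)\<^sup>2)"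
  by (simp add: L2_def l2_def)

lemma l2_le: "sq f \<le> ennreal (c\<^sup>2) \<Longrightarrow> 0 \<le> c \<Longrightarrow> l2 f \<le> c"
  unfolding l2_def by (intro real_le_lsqrt) (auto intro: enn2real_leI)

lemma sq_cong_AE: "(AE x in lborel. f x = g x) \<Longrightarrow> sq f = sq g"
  unfolding sq_def by (intro nn_integral_cong_AE) (auto elim!: eventually_mono)

lemma sq_le:
  assumes [measurable]: "h \<in> borel_measurable borel" and "0 \<le> c"
    and le: "\<And>x. norm (f x) \<le> c * norm (h x)"
  shows "sq f \<le> ennreal (c\<^sup>2) * sq h"
proof -
  have "sq f \<le> (\<integral>\<^sup>+x. ennreal (c\<^sup>2) * (ennreal ((norm (h x))\<^sup>2) * indicator (box a b) x) \<partial>lborel)"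
    unfolding sq_def
  proof (rule nn_integral_mono)
    fix x
    have "(norm (f x))\<^sup>2 \<le> (c * norm (h x))\<^sup>2" using le by (intro power_mono) auto
    then show "ennreal ((norm (f x))\<^sup>2) * indicator (box a b) x
        \<le> ennreal (c\<^sup>2) * (ennreal ((norm (h x))\<^sup>2) * indicator (box a b) x)"
      by (auto simp: indicator_def ennreal_mult[symmetric] power_mult_distrib intro: ennreal_leI)
  qed
  also have "\<dots> = ennreal (c\<^sup>2) * sq h" unfolding sq_def by (rule nn_integral_cmult) measurable
  finally show ?thesis .
qed

lemma L2_bound:
  assumes h: "L2 h" and f: "f \<in> borel_measurable borel" and c: "0 \<le> c"
    and le: "\<And>x. norm (f x) \<le> c * norm (h x)"
  shows "L2 f" "l2 f \<le> c * l2 h"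
proof -
  have "sq f \<le> ennreal (c\<^sup>2) * sq h" using h c le by (intro sq_le) (auto simp: L2_def)
  also have "\<dots> = ennreal ((c * l2 h)\<^sup>2)"
    by (simp add: sq_l2[OF h] ennreal_mult[symmetric] power_mult_distrib)
  finally have 1: "sq f \<le> ennreal ((c * l2 h)\<^sup>2)" .
  then show "L2 f" using f by (auto simp: L2_def intro: le_less_trans)
  show "l2 f \<le> c * l2 h" using 1 c by (intro l2_le) auto
qed

lemma sq_add_le:
  assumes [measurable]: "f \<in> borel_measurable borel" "g \<in> borel_measurable borel"
  shows "sq (\<lambda>x. f x + g x) \<le> 2 * sq f + 2 * sq g"
proof -
  have "sq (\<lambda>x. f x + g x) \<le> (\<integral>\<^sup>+x. 2 * (ennreal ((norm (f x))\<^sup>2) * indicator (box a b) x)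
      + 2 * (ennreal ((norm (g x))\<^sup>2) * indicator (box a b) x) \<partial>lborel)"
    unfolding sq_def
  proof (rule nn_integral_mono)
    fix x
    have "(norm (f x + g x))\<^sup>2 \<le> (norm (f x) + norm (g x))\<^sup>2"
      by (intro power_mono norm_triangle_ineq) simp
    also have "\<dots> \<le> 2 * (norm (f x))\<^sup>2 + 2 * (norm (g x))\<^sup>2"
      using zero_le_power2[of "norm (f x) - norm (g x)"] by (simp add: power2_diff power2_sum)
    finally have "ennreal ((norm (f x + g x))\<^sup>2) \<le> ennreal (2 * (norm (f x))\<^sup>2 + 2 * (norm (g x))\<^sup>2)"
      by (rule ennreal_leI)
    also have "\<dots> = 2 * ennreal ((norm (f x))\<^sup>2) + 2 * ennreal ((norm (g x))\<^sup>2)"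
      by (simp add: ennreal_plus ennreal_mult)
    finally show "ennreal ((norm (f x + g x))\<^sup>2) * indicator (box a b) x
        \<le> 2 * (ennreal ((norm (f x))\<^sup>2) * indicator (box a b) x) + 2 * (ennreal ((norm (g x))\<^sup>2) * indicator (box a b) x)"
      by (simp add: indicator_def)
  qed
  also have "\<dots> = 2 * sq f + 2 * sq g"
    unfolding sq_def by (subst nn_integral_add) (auto simp: nn_integral_cmult)
  finally show ?thesis .
qed

lemma L2_add:
  assumes "L2 f" "L2 g"
  shows "L2 (\<lambda>x. f x + g x)"
proof -
  have m: "f \<in> borel_measurable borel" "g \<in> borel_measurable borel" using assms by (auto simp: L2_def)
  have "sq (\<lambda>x. f x + g x) \<le> 2 * sq f + 2 * sq g" by (rule sq_add_le[OF m])
  also have "\<dots> < \<infinity>" using assms by (simp add: L2_def ennreal_mult_less_top)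
  finally show ?thesis using m by (simp add: L2_def)
qed

lemma L2_scale: "L2 f \<Longrightarrow> L2 (\<lambda>x. c *\<^sub>R f x)"
  by (rule L2_bound(1)[where h = f and c = "\<bar>c\<bar>"]) (auto simp: L2_def)

lemma L2_diff: "L2 f \<Longrightarrow> L2 g \<Longrightarrow> L2 (\<lambda>x. f x - g x)"
  using L2_add[OF _ L2_scale[of g "-1"]] by simp

lemma integrable_inner:
  fixes f g :: "real^'d \<Rightarrow> 'b::euclidean_space"
  assumes f: "L2 f" and g: "L2 g"
  shows "set_integrable lborel (box a b) (\<lambda>x. f x \<bullet> g x)"
    and "\<bar>ip a b f g\<bar> \<le> l2 f * l2 g"
proof -
  have [measurable]: "f \<in> borel_measurable borel" "g \<in> borel_measurable borel" using f g by (auto simp: L2_def)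
  have "(\<integral>\<^sup>+x\<in>box a b. ennreal (norm (f x \<bullet> g x)) \<partial>lborel)
      \<le> (\<integral>\<^sup>+x. (ennreal (norm (f x)) * indicator (box a b) x) * (ennreal (norm (g x)) * indicator (box a b) x) \<partial>lborel)"
    by (intro nn_integral_mono) (auto simp: indicator_def ennreal_mult[symmetric] Cauchy_Schwarz_ineq2 intro!: ennreal_leI)
  then have "(\<integral>\<^sup>+x\<in>box a b. ennreal (norm (f x \<bullet> g x)) \<partial>lborel)\<^sup>2
      \<le> (\<integral>\<^sup>+x. (ennreal (norm (f x)) * indicator (box a b) x) * (ennreal (norm (g x)) * indicator (box a b) x) \<partial>lborel)\<^sup>2"
    by (rule power_mono) simp
  also have "\<dots> \<le> (\<integral>\<^sup>+x. (ennreal (norm (f x)) * indicator (box a b) x)\<^sup>2 \<partial>lborel)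
      * (\<integral>\<^sup>+x. (ennreal (norm (g x)) * indicator (box a b) x)\<^sup>2 \<partial>lborel)"
    by (rule Cauchy_Schwarz_nn_integral) measurable
  also have "\<dots> = sq f * sq g"
  proof -
    have "(\<integral>\<^sup>+x. (ennreal (norm (u x)) * indicator (box a b) x)\<^sup>2 \<partial>lborel) = sq u" for u :: "real^'d \<Rightarrow> 'b"
      unfolding sq_def by (intro nn_integral_cong) (auto simp: indicator_def ennreal_power)
    then show ?thesis by simp
  qed
  also have "\<dots> = ennreal ((l2 f * l2 g)\<^sup>2)"
    by (simp add: sq_l2 f g ennreal_mult[symmetric] power_mult_distrib)
  finally have *: "(\<integral>\<^sup>+x\<in>box a b. ennreal (norm (f x \<bullet> g x)) \<partial>lborel) \<le> ennreal (l2 f * l2 g)"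
    by (rule ennreal_le_of_square) simp
  also have "\<dots> < \<infinity>" by simp
  finally show int: "set_integrable lborel (box a b) (\<lambda>x. f x \<bullet> g x)"
    by (subst set_integrable_box_iff) auto
  have "ennreal \<bar>ip a b f g\<bar> \<le> (\<integral>\<^sup>+x. ennreal (norm (indicator (box a b) x *\<^sub>R (f x \<bullet> g x))) \<partial>lborel)"
    unfolding ip_def set_lebesgue_integral_def real_norm_def[symmetric]
    by (rule integral_norm_bound_ennreal) (use int in \<open>simp add: set_integrable_def\<close>)
  also have "\<dots> = (\<integral>\<^sup>+x\<in>box a b. ennreal (norm (f x \<bullet> g x)) \<partial>lborel)"
    by (intro nn_integral_cong) (auto simp: indicator_def)
  also note *
  finally show "\<bar>ip a b f g\<bar> \<le> l2 f * l2 g" by (subst (asm) ennreal_le_iff) auto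
qed

lemma ip_commute: "ip a b f g = ip a b g f"
  by (simp add: ip_def inner_commute)

lemma ip_cong_AE:
  assumes "AE x in lborel. f x = f' x" "AE x in lborel. g x = g' x"
    and [measurable]: "f \<in> borel_measurable borel" "f' \<in> borel_measurable borel"
      "g \<in> borel_measurable borel" "g' \<in> borel_measurable borel"
  shows "ip a b f g = ip a b f' g'"
  unfolding ip_def set_lebesgue_integral_def
proof (rule integral_cong_AE)
  show "AE x in lborel. indicat_real (box a b) x *\<^sub>R (f x \<bullet> g x) = indicat_real (box a b) x *\<^sub>R (f' x \<bullet> g' x)"
    using assms(1,2) by eventually_elim simp
qed measurable

lemma ip_add_left: "L2 f \<Longrightarrow> L2 g \<Longrightarrow> L2 h \<Longrightarrow> ip a b (\<lambda>x. f x + g x) h = ip a b f h + ip a b g h"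
  unfolding ip_def inner_add_left by (intro set_integral_add integrable_inner)

lemma ip_scale_left: "ip a b (\<lambda>x. c *\<^sub>R f x) h = c * ip a b f h"
  unfolding ip_def inner_scaleR_left by simp

lemma ip_add_right: "L2 f \<Longrightarrow> L2 g \<Longrightarrow> L2 h \<Longrightarrow> ip a b h (\<lambda>x. f x + g x) = ip a b h f + ip a b h g"
  by (simp add: ip_commute[of h] ip_add_left)

lemma ip_scale_right: "ip a b h (\<lambda>x. c *\<^sub>R f x) = c * ip a b h f"
  by (simp add: ip_commute[of h] ip_scale_left)

lemma ip_self: "L2 f \<Longrightarrow> ip a b f f = (l2 f)\<^sup>2"
proof -
  assume f: "L2 f"
  have [measurable]: "f \<in> borel_measurable borel" using f by (simp add: L2_def)
  have "ip a b f f = enn2real (\<integral>\<^sup>+x. ennreal (indicator (box a b) x *\<^sub>R (f x \<bullet> f x)) \<partial>lborel)"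
    unfolding ip_def set_lebesgue_integral_def by (rule integral_eq_nn_integral) auto
  also have "(\<integral>\<^sup>+x. ennreal (indicator (box a b) x *\<^sub>R (f x \<bullet> f x)) \<partial>lborel) = sq f"
    unfolding sq_def by (intro nn_integral_cong) (auto simp: indicator_def power2_norm_eq_inner)
  finally show ?thesis by (simp add: l2_def)
qed

text \<open>The limit is the pointwise \<open>lim\<close>, which exists almost everywhere on the box
  by \<open>AE_summable_of_geometric_L2\<close>. Taking \<open>lim\<close> at every point makes it
  measurable and, later, lets periodicity pass to it. The distances to \<open>u n\<close> are
  estimated by Cauchy-Schwarz with weights \<open>t ^ k\<close>, and Fatou's lemma carries the
  estimate to the limit.\<close>

lemma L2_fast_limit:
  fixes u :: "nat \<Rightarrow> real^'d \<Rightarrow> 'b::euclidean_space"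
  assumes u: "\<And>n. L2 (u n)" and t: "0 < t" "t < 1" and c: "0 \<le> c"
    and d: "\<And>n. sq (\<lambda>x. u (Suc n) x - u n x) \<le> ennreal (c * t ^ (2 * n))"
  defines "v \<equiv> \<lambda>x. lim (\<lambda>n. u n x)"
  shows "L2 v" and "(\<lambda>n. l2 (\<lambda>x. u n x - v x)) \<longlonglongrightarrow> 0"
proof -
  have [measurable]: "u n \<in> borel_measurable borel" for n using u by (simp add: L2_def)
  have [measurable]: "v \<in> borel_measurable borel" unfolding v_def by measurable
  define D where "D n x = u (Suc n) x - u n x" for n x
  have [measurable]: "D n \<in> borel_measurable borel" for n unfolding D_def[abs_def] by measurable
  have D_le: "sq (D n) \<le> ennreal (c * t ^ (2 * n))" for n
    unfolding D_def[abs_def] by (rule d)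
  have "AE x in lborel. summable (\<lambda>n. norm (indicator (box a b) x *\<^sub>R D n x))"
  proof (rule AE_summable_of_geometric_L2[OF _ t c])
    show "(\<lambda>x. indicator (box a b) x *\<^sub>R D n x) \<in> borel_measurable lborel" for n by measurable
    show "(\<integral>\<^sup>+x. ennreal ((norm (indicator (box a b) x *\<^sub>R D n x))\<^sup>2) \<partial>lborel) \<le> ennreal (c * t ^ (2 * n))" for n
    proof -
      have "(\<integral>\<^sup>+x. ennreal ((norm (indicator (box a b) x *\<^sub>R D n x))\<^sup>2) \<partial>lborel) = sq (D n)"
        unfolding sq_def by (intro nn_integral_cong) (auto simp: indicator_def)
      with D_le[of n] show ?thesis by simp
    qed
  qed
  then have lim: "AE x in lborel. x \<in> box a b \<longrightarrow> (\<lambda>n. u n x) \<longlonglongrightarrow> v x"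
  proof eventually_elim
    case (elim x)
    show ?case
    proof
      assume "x \<in> box a b"
      with elim have "summable (\<lambda>n. norm (D n x))" by simp
      then have "summable (\<lambda>n. D n x)" by (rule summable_norm_cancel)
      then have "(\<lambda>n. \<Sum>k<n. D k x) \<longlonglongrightarrow> (\<Sum>k. D k x)" by (rule summable_LIMSEQ)
      then have "(\<lambda>n. u 0 x + (\<Sum>k<n. D k x)) \<longlonglongrightarrow> u 0 x + (\<Sum>k. D k x)" by (intro tendsto_intros)
      moreover have "u 0 x + (\<Sum>k<n. D k x) = u n x" for n
        by (induction n) (auto simp: D_def add_diff_eq diff_add_eq)
      ultimately have "convergent (\<lambda>n. u n x)" by (auto simp: convergent_def)
      then show "(\<lambda>n. u n x) \<longlonglongrightarrow> v x" by (simp add: v_def convergent_LIMSEQ_iff)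
    qed
  qed
  \<comment> \<open>One factor \<open>1 / (1 - t)\<close> is the sum of the Cauchy-Schwarz weights,
    the other sums the weighted increments.\<close>
  define K where "K = c / (1 - t)\<^sup>2"
  have K: "K \<ge> 0" using c by (simp add: K_def)
  have part: "sq (\<lambda>x. u n x - u (n + m) x) \<le> ennreal (K * t ^ n)" for n m
  proof -
    have geo: "(\<Sum>k<m. t ^ k) \<le> 1 / (1 - t)"
    proof -
      have "(\<Sum>k<m. t ^ k) \<le> (\<Sum>k. t ^ k)" using t by (intro sum_le_suminf) (auto simp: summable_geometric)
      also have "\<dots> = 1 / (1 - t)" using t by (subst suminf_geometric) auto
      finally show ?thesis .
    qed
    have pw: "(norm (u n x - u (n + m) x))\<^sup>2 \<le> (\<Sum>k<m. (1 / (1 - t)) / t ^ k * (norm (D (n + k) x))\<^sup>2)" for x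
    proof -
      have "u n x + (\<Sum>k<m. D (n + k) x) = u (n + m) x"
        by (induction m) (auto simp: D_def add_diff_eq diff_add_eq)
      then have "u (n + m) x - u n x = (\<Sum>k<m. D (n + k) x)" by (simp add: algebra_simps)
      then have "norm (u n x - u (n + m) x) \<le> (\<Sum>k<m. norm (D (n + k) x))"
        by (metis norm_minus_commute norm_sum)
      then have "(norm (u n x - u (n + m) x))\<^sup>2 \<le> (\<Sum>k<m. norm (D (n + k) x))\<^sup>2"
        by (intro power_mono) auto
      also have "\<dots> = (\<Sum>k<m. sqrt (t ^ k) * (norm (D (n + k) x) / sqrt (t ^ k)))\<^sup>2"
        using t by simp
      also have "\<dots> \<le> (\<Sum>k<m. (sqrt (t ^ k))\<^sup>2) * (\<Sum>k<m. (norm (D (n + k) x) / sqrt (t ^ k))\<^sup>2)"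
        by (rule Cauchy_Schwarz_ineq_sum)
      also have "\<dots> = (\<Sum>k<m. t ^ k) * (\<Sum>k<m. (norm (D (n + k) x))\<^sup>2 / t ^ k)"
        using t by (simp add: power_divide)
      also have "\<dots> \<le> 1 / (1 - t) * (\<Sum>k<m. (norm (D (n + k) x))\<^sup>2 / t ^ k)"
        using geo t by (intro mult_right_mono sum_nonneg) auto
      finally show ?thesis by (simp add: sum_distrib_left)
    qed
    have "sq (\<lambda>x. u n x - u (n + m) x)
      \<le> (\<integral>\<^sup>+x. (\<Sum>k<m. ennreal ((1 / (1 - t)) / t ^ k) * (ennreal ((norm (D (n + k) x))\<^sup>2) * indicator (box a b) x)) \<partial>lborel)"
      unfolding sq_def
    proof (rule nn_integral_mono)
      fix x
      have "ennreal ((norm (u n x - u (n + m) x))\<^sup>2) \<le> ennreal (\<Sum>k<m. (1 / (1 - t)) / t ^ k * (norm (D (n + k) x))\<^sup>2)"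
        by (rule ennreal_leI[OF pw])
      also have "\<dots> = (\<Sum>k<m. ennreal ((1 / (1 - t)) / t ^ k * (norm (D (n + k) x))\<^sup>2))"
        using t by (intro sum_ennreal[symmetric]) auto
      also have "\<dots> = (\<Sum>k<m. ennreal ((1 / (1 - t)) / t ^ k) * ennreal ((norm (D (n + k) x))\<^sup>2))"
        using t by (intro sum.cong refl ennreal_mult) auto
      finally show "ennreal ((norm (u n x - u (n + m) x))\<^sup>2) * indicator (box a b) x
          \<le> (\<Sum>k<m. ennreal ((1 / (1 - t)) / t ^ k) * (ennreal ((norm (D (n + k) x))\<^sup>2) * indicator (box a b) x))"
        by (simp add: indicator_def)
    qed
    also have "\<dots> = (\<Sum>k<m. ennreal ((1 / (1 - t)) / t ^ k) * sq (D (n + k)))"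
      unfolding sq_def by (simp add: nn_integral_sum nn_integral_cmult)
    also have "\<dots> \<le> (\<Sum>k<m. ennreal ((1 / (1 - t)) / t ^ k) * ennreal (c * t ^ (2 * (n + k))))"
      by (intro sum_mono mult_left_mono D_le) simp
    also have "\<dots> = (\<Sum>k<m. ennreal (c / (1 - t) * t ^ (2 * n) * t ^ k))"
    proof (rule sum.cong[OF refl])
      fix k
      have "t ^ (2 * (n + k)) = t ^ (2 * n) * t ^ k * t ^ k" by (simp add: mult_2 power_add)
      then have "(1 / (1 - t)) / t ^ k * (c * t ^ (2 * (n + k))) = c / (1 - t) * t ^ (2 * n) * t ^ k"
        using t by simp
      then show "ennreal ((1 / (1 - t)) / t ^ k) * ennreal (c * t ^ (2 * (n + k))) = ennreal (c / (1 - t) * t ^ (2 * n) * t ^ k)"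
        using t c by (simp add: ennreal_mult[symmetric])
    qed
    also have "\<dots> = ennreal (c / (1 - t) * t ^ (2 * n) * (\<Sum>k<m. t ^ k))"
      using t c by (subst sum_ennreal) (auto simp: sum_distrib_left)
    also have "\<dots> \<le> ennreal (K * t ^ n)"
    proof (rule ennreal_leI)
      have "c / (1 - t) * t ^ (2 * n) * (\<Sum>k<m. t ^ k) \<le> c / (1 - t) * t ^ n * (1 / (1 - t))"
        using t c geo by (intro mult_mono power_decreasing) (auto intro: sum_nonneg)
      then show "c / (1 - t) * t ^ (2 * n) * (\<Sum>k<m. t ^ k) \<le> K * t ^ n"
        by (simp add: K_def power2_eq_square)
    qed
    finally show ?thesis .
  qed
  have lim_bound: "sq (\<lambda>x. u n x - v x) \<le> ennreal (K * t ^ n)" for n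
  proof -
    have "sq (\<lambda>x. u n x - v x) = (\<integral>\<^sup>+x. liminf (\<lambda>m. ennreal ((norm (u n x - u (n + m) x))\<^sup>2) * indicator (box a b) x) \<partial>lborel)"
      unfolding sq_def
    proof (rule nn_integral_cong_AE)
      show "AE x in lborel. ennreal ((norm (u n x - v x))\<^sup>2) * indicator (box a b) x
          = liminf (\<lambda>m. ennreal ((norm (u n x - u (n + m) x))\<^sup>2) * indicator (box a b) x)"
        using lim
      proof eventually_elim
        case (elim x)
        show ?case
        proof (cases "x \<in> box a b")
          case True
          with elim have "(\<lambda>m. u (m + n) x) \<longlonglongrightarrow> v x" by (intro LIMSEQ_ignore_initial_segment) auto
          then have "(\<lambda>m. ennreal ((norm (u n x - u (m + n) x))\<^sup>2)) \<longlonglongrightarrow> ennreal ((norm (u n x - v x))\<^sup>2)"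
            by (intro tendsto_intros)
          from lim_imp_Liminf[OF _ this] True show ?thesis by (simp add: add.commute)
        qed (simp add: Liminf_const)
      qed
    qed
    also have "\<dots> \<le> liminf (\<lambda>m. sq (\<lambda>x. u n x - u (n + m) x))"
      unfolding sq_def by (rule nn_integral_liminf) measurable
    also have "\<dots> \<le> liminf (\<lambda>m::nat. ennreal (K * t ^ n))"
      using part by (intro Liminf_mono always_eventually allI)
    also have "\<dots> = ennreal (K * t ^ n)" by (rule Liminf_const) simp
    finally show ?thesis .
  qed
  have Ld: "L2 (\<lambda>x. u n x - v x)" for n
    using lim_bound[of n] by (auto simp: L2_def intro: le_less_trans)
  show "L2 v" using L2_diff[OF u[of 0] Ld[of 0]] by simp
  show "(\<lambda>n. l2 (\<lambda>x. u n x - v x)) \<longlonglongrightarrow> 0"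
  proof (rule Lim_null_comparison)
    have "(\<lambda>n. sqrt (K * t ^ n)) \<longlonglongrightarrow> sqrt (K * 0)"
      using t by (intro tendsto_intros LIMSEQ_realpow_zero) auto
    then show "(\<lambda>n. sqrt (K * t ^ n)) \<longlonglongrightarrow> 0" by simp
    have "l2 (\<lambda>x. u n x - v x) \<le> sqrt (K * t ^ n)" for n
      using lim_bound[of n] K t by (intro l2_le) auto
    then show "\<forall>\<^sub>F n in sequentially. norm (l2 (\<lambda>x. u n x - v x)) \<le> sqrt (K * t ^ n)"
      by (intro always_eventually allI) simp
  qed
qed

lemma ae_periodic_lim:
  assumes "\<And>n. ae_periodic a b (u n)"
  shows "ae_periodic a b (\<lambda>x. lim (\<lambda>n. u n x))"
  unfolding ae_periodic_def
proof
  fix i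
  have "AE x in lborel. \<forall>n. u n (x + axis i (b $ i - a $ i)) = u n x"
    using assms by (simp add: ae_periodic_def AE_all_countable)
  then show "AE x in lborel. lim (\<lambda>n. u n (x + axis i (b $ i - a $ i))) = lim (\<lambda>n. u n x)"
    by eventually_elim simp
qed

text \<open>The support of \<open>\<theta>\<close> is covered by finitely many period cells, so
  integration against \<open>\<theta>\<close> over the whole space is continuous in the L2 norm of a
  single cell. This is what lets the defining identity of weak gradients pass to L2 limits.\<close>

lemma integral_test_bound:
  assumes \<theta>: "test_function \<theta>"
  obtains C where "\<And>v. L2 v \<Longrightarrow> ae_periodic a b v \<Longrightarrow> \<bar>LINT x|lborel. v x * \<theta> x\<bar> \<le> C * l2 v"
proof -
  define K where "K = closure {x. \<theta> x \<noteq> 0}"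
  have K: "compact K" using \<theta> by (simp add: K_def test_function_def)
  have [measurable]: "K \<in> sets borel" using K by (simp add: compact_imp_closed)
  obtain B where B: "\<And>x. \<bar>\<theta> x\<bar> \<le> B" using test_function_bounded[OF \<theta>] by blast
  have B0: "B \<ge> 0" using B[of 0] by linarith
  obtain N :: nat where N: "\<And>F. F \<in> borel_measurable borel \<Longrightarrow> ae_periodic a b F \<Longrightarrow>
    (\<integral>\<^sup>+x\<in>K. F x \<partial>lborel) \<le> of_nat N * (\<integral>\<^sup>+x\<in>box a b. F x \<partial>lborel)"
    using nn_integral_compact_le[OF K] by blast
  define m where "m = measure lborel (box a b)"
  have m: "m > 0" "emeasure lborel (box a b) = ennreal m"
    using measure_box_pos emeasure_box by (auto simp: m_def)
  show thesis
  proof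
    fix v :: "real^'d \<Rightarrow> real" assume v: "L2 v" "ae_periodic a b v"
    have [measurable]: "v \<in> borel_measurable borel" using v by (simp add: L2_def)
    have loc: "locally_integrable v"
      using v by (intro locally_integrable_periodic set_integrable_if_sq_finite) (auto simp: L2_def)
    have "(\<integral>\<^sup>+x\<in>box a b. ennreal \<bar>v x\<bar> \<partial>lborel)\<^sup>2
        = (\<integral>\<^sup>+x. indicator (box a b) x * (ennreal \<bar>v x\<bar> * indicator (box a b) x) \<partial>lborel)\<^sup>2"
      by (intro arg_cong[where f = "\<lambda>x. x\<^sup>2"] nn_integral_cong) (auto simp: indicator_def)
    also have "\<dots> \<le> (\<integral>\<^sup>+x. (indicator (box a b) x)\<^sup>2 \<partial>lborel) * (\<integral>\<^sup>+x. (ennreal \<bar>v x\<bar> * indicator (box a b) x)\<^sup>2 \<partial>lborel)"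
      by (rule Cauchy_Schwarz_nn_integral) measurable
    also have "(\<integral>\<^sup>+x. (indicator (box a b) x)\<^sup>2 \<partial>lborel) = (\<integral>\<^sup>+x. indicator (box a b) x \<partial>lborel)"
      by (intro nn_integral_cong) (auto simp: indicator_def)
    also have "(\<integral>\<^sup>+x. (ennreal \<bar>v x\<bar> * indicator (box a b) x)\<^sup>2 \<partial>lborel) = sq v"
      unfolding sq_def by (intro nn_integral_cong) (auto simp: indicator_def ennreal_power)
    also have "(\<integral>\<^sup>+x. indicator (box a b) x \<partial>lborel) * sq v = ennreal ((sqrt m * l2 v)\<^sup>2)"
      using m by (simp add: sq_l2[OF v(1)] ennreal_mult[symmetric] power_mult_distrib)
    finally have 1: "(\<integral>\<^sup>+x\<in>box a b. ennreal \<bar>v x\<bar> \<partial>lborel) \<le> ennreal (sqrt m * l2 v)"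
      by (rule ennreal_le_of_square) (use m in simp)
    have "ennreal \<bar>LINT x|lborel. v x * \<theta> x\<bar> \<le> (\<integral>\<^sup>+x. ennreal (norm (v x * \<theta> x)) \<partial>lborel)"
      unfolding real_norm_def[symmetric] by (rule integral_norm_bound_ennreal[OF integrable_times_test[OF loc \<theta>]])
    also have "\<dots> \<le> (\<integral>\<^sup>+x. ennreal B * (ennreal \<bar>v x\<bar> * indicator K x) \<partial>lborel)"
    proof (rule nn_integral_mono)
      fix x
      show "ennreal (norm (v x * \<theta> x)) \<le> ennreal B * (ennreal \<bar>v x\<bar> * indicator K x)"
      proof (cases "\<theta> x = 0")
        case False
        then have "x \<in> K" using closure_subset[of "{x. \<theta> x \<noteq> 0}"] by (auto simp: K_def)
        moreover have "\<bar>v x\<bar> * \<bar>\<theta> x\<bar> \<le> \<bar>v x\<bar> * B" using B by (intro mult_left_mono) auto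
        ultimately show ?thesis
          using B0 by (simp add: abs_mult ennreal_mult[symmetric] mult.commute ennreal_leI)
      qed simp
    qed
    also have "\<dots> = ennreal B * (\<integral>\<^sup>+x\<in>K. ennreal \<bar>v x\<bar> \<partial>lborel)"
      by (rule nn_integral_cmult) measurable
    also have "\<dots> \<le> ennreal B * (of_nat N * (\<integral>\<^sup>+x\<in>box a b. ennreal \<bar>v x\<bar> \<partial>lborel))"
      by (intro mult_left_mono N[OF _ ae_periodic_compose[OF v(2), of "\<lambda>y. ennreal \<bar>y\<bar>"]]) auto
    also have "\<dots> \<le> ennreal B * (of_nat N * ennreal (sqrt m * l2 v))"
      by (intro mult_left_mono 1) auto
    also have "\<dots> = ennreal (B * real N * sqrt m * l2 v)"
      using B0 m by (simp add: ennreal_mult ennreal_of_nat_eq_real_of_nat mult_ac)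
    finally show "\<bar>LINT x|lborel. v x * \<theta> x\<bar> \<le> (B * real N * sqrt m) * l2 v"
      using B0 m by (subst (asm) ennreal_le_iff) auto
  qed
qed

end

section \<open>Periodic H1 functions: completeness and products\<close>

context periodic_cell begin

lemma square_integrable_iff: "square_integrable (box a b) f \<longleftrightarrow> L2 f"
proof (cases "f \<in> borel_measurable borel")
  case True
  note [measurable] = True
  show ?thesis
    using set_integrable_box_iff[of "\<lambda>x. (norm (f x))\<^sup>2"]
    by (simp add: square_integrable_def L2_def sq_def)
qed (simp add: square_integrable_def L2_def)

lemma H1perD:
  assumes "f \<in> H1per a b"
  shows "box_periodic a b f" "ae_periodic a b f" "L2 f"
    "has_weak_gradient f (wgrad f)" "ae_periodic a b (wgrad f)" "L2 (wgrad f)"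
proof -
  from assms obtain g where f: "box_periodic a b f" "L2 f" and g: "has_weak_gradient f g" "L2 g"
    by (auto simp: H1per_def L2per_def square_integrable_iff)
  show "box_periodic a b f" "L2 f" by fact+
  then show "ae_periodic a b f" by (simp add: box_periodic_imp_ae)
  show w: "has_weak_gradient f (wgrad f)" by (rule has_weak_gradient_wgrad[OF g(1)])
  show "ae_periodic a b (wgrad f)" by (rule weak_gradient_periodic[OF f(1) w])
  have "wgrad f \<in> borel_measurable borel"
    using w by (auto simp: has_weak_gradient_def intro: locally_integrable_measurable)
  moreover have "sq (wgrad f) = sq g" by (rule sq_cong_AE[OF wgrad_AE[OF g(1)]])
  ultimately show "L2 (wgrad f)" using g by (simp add: L2_def)
qed

lemma H1perI:
  assumes "box_periodic a b f" "L2 f" "has_weak_gradient f g" "L2 g"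
  shows "f \<in> H1per a b"
  using assms by (auto simp: H1per_def L2per_def square_integrable_iff)

lemma H1per_weak_gradient_locale: "f \<in> H1per a b \<Longrightarrow> periodic_weak_gradient a b f (wgrad f)"
  using H1perD[of f] by unfold_locales (auto simp: L2_def)

lemma H1per_lincomb:
  assumes f: "f \<in> H1per a b" and g: "g \<in> H1per a b"
  shows "(\<lambda>x. c * f x + d * g x) \<in> H1per a b"
    and "AE x in lborel. wgrad (\<lambda>x. c * f x + d * g x) x = c *\<^sub>R wgrad f x + d *\<^sub>R wgrad g x"
proof -
  note F = H1perD[OF f] and G = H1perD[OF g]
  have w: "has_weak_gradient (\<lambda>x. c * f x + d * g x) (\<lambda>x. c *\<^sub>R wgrad f x + d *\<^sub>R wgrad g x)"
    by (rule has_weak_gradient_lincomb[OF F(4) G(4)])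
  show "(\<lambda>x. c * f x + d * g x) \<in> H1per a b"
  proof (rule H1perI[OF _ _ w])
    show "box_periodic a b (\<lambda>x. c * f x + d * g x)" using F(1) G(1) by (simp add: box_periodic_def)
    show "L2 (\<lambda>x. c * f x + d * g x)" using L2_add[OF L2_scale[OF F(3), of c] L2_scale[OF G(3), of d]] by simp
    show "L2 (\<lambda>x. c *\<^sub>R wgrad f x + d *\<^sub>R wgrad g x)" by (rule L2_add[OF L2_scale[OF F(6)] L2_scale[OF G(6)]])
  qed
  show "AE x in lborel. wgrad (\<lambda>x. c * f x + d * g x) x = c *\<^sub>R wgrad f x + d *\<^sub>R wgrad g x"
    by (rule wgrad_AE[OF w])
qed

lemma H1per_fun:
  assumes f: "f \<in> H1per a b" and g: "g \<in> H1per a b"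
  shows "f + g \<in> H1per a b" "c *\<^sub>R f \<in> H1per a b" "f - g \<in> H1per a b"
    "AE x in lborel. wgrad (f + g) x = wgrad f x + wgrad g x"
    "AE x in lborel. wgrad (c *\<^sub>R f) x = c *\<^sub>R wgrad f x"
    "AE x in lborel. wgrad (f - g) x = wgrad f x - wgrad g x"
proof -
  have e: "f + g = (\<lambda>x. 1 * f x + 1 * g x)" "c *\<^sub>R f = (\<lambda>x. c * f x + 0 * f x)" "f - g = (\<lambda>x. 1 * f x + (- 1) * g x)"
    by (auto simp: fun_eq_iff)
  show "f + g \<in> H1per a b" "c *\<^sub>R f \<in> H1per a b" "f - g \<in> H1per a b"
    unfolding e by (intro H1per_lincomb f g)+
  show "AE x in lborel. wgrad (f + g) x = wgrad f x + wgrad g x"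
    "AE x in lborel. wgrad (c *\<^sub>R f) x = c *\<^sub>R wgrad f x"
    "AE x in lborel. wgrad (f - g) x = wgrad f x - wgrad g x"
    unfolding e using H1per_lincomb(2)[OF f g, of 1 1] H1per_lincomb(2)[OF f f, of c 0]
      H1per_lincomb(2)[OF f g, of 1 "-1"] by simp_all
qed

lemma H1per_zero: "0 \<in> H1per a b"
proof (rule H1perI)
  show "box_periodic a b 0" by (simp add: box_periodic_def)
  show "L2 (0 :: real^'d \<Rightarrow> real)" "L2 (\<lambda>x. 0 :: real^'d)" by (auto simp: L2_def sq_def zero_fun_def)
  show "has_weak_gradient 0 (\<lambda>x. 0)"
    by (simp add: has_weak_gradient_def locally_integrable_def set_integrable_def)
qed

lemma subspace_H1per: "subspace (H1per a b)"
  unfolding subspace_def using H1per_zero H1per_fun(1,2) by blast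

lemma box_mean_bound:
  obtains C where "\<And>v :: real^'d \<Rightarrow> real. L2 v \<Longrightarrow> \<bar>LINT x:box a b|lborel. v x\<bar> \<le> C * l2 v"
proof
  fix v :: "real^'d \<Rightarrow> real" assume v: "L2 v"
  have one: "L2 (\<lambda>x. 1 :: real)" by (simp add: L2_def sq_def nn_integral_cmult emeasure_box)
  show "\<bar>LINT x:box a b|lborel. v x\<bar> \<le> l2 (\<lambda>x :: real^'d. 1 :: real) * l2 v"
    using integrable_inner(2)[OF v one] by (simp add: ip_def mult.commute)
qed

lemma L2_set_integrable: "L2 v \<Longrightarrow> set_integrable lborel (box a b) v"
  by (intro set_integrable_if_sq_finite) (auto simp: L2_def)

lemma subspace_H1bar: "subspace (H1bar a b)"
proof -
  have "f + g \<in> H1bar a b" if "f \<in> H1bar a b" "g \<in> H1bar a b" for f g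
  proof -
    have F: "f \<in> H1per a b" "g \<in> H1per a b" using that by (auto simp: H1bar_def)
    have "(LINT x:box a b|lborel. f x + g x) = (LINT x:box a b|lborel. f x) + (LINT x:box a b|lborel. g x)"
      using H1perD(3)[OF F(1)] H1perD(3)[OF F(2)] by (intro set_integral_add L2_set_integrable)
    then show ?thesis using that H1per_fun(1)[OF F] by (simp add: H1bar_def plus_fun_def)
  qed
  moreover have "c *\<^sub>R f \<in> H1bar a b" if "f \<in> H1bar a b" for c f
    using that H1per_fun(2)[of f f c] by (simp add: H1bar_def scaleR_fun_def)
  moreover have "0 \<in> H1bar a b" using H1per_zero by (simp add: H1bar_def zero_fun_def)
  ultimately show ?thesis unfolding subspace_def by blast
qed

definition h1 :: "(real^'d \<Rightarrow> real) \<Rightarrow> (real^'d \<Rightarrow> real) \<Rightarrow> real"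
  where "h1 f g = ip a b f g + ip a b (wgrad f) (wgrad g)"

lemma h1_self: "f \<in> H1per a b \<Longrightarrow> h1 f f = (l2 f)\<^sup>2 + (l2 (wgrad f))\<^sup>2"
  by (simp add: h1_def ip_self H1perD)

lemma l2_cong_AE: "(AE x in lborel. f x = g x) \<Longrightarrow> l2 f = l2 g"
  by (simp add: l2_def sq_cong_AE)

lemma h1_add:
  assumes f: "f \<in> H1per a b" and g: "g \<in> H1per a b" and h: "h \<in> H1per a b"
  shows "h1 (f + g) h = h1 f h + h1 g h"
proof -
  note F = H1perD[OF f] and G = H1perD[OF g] and H = H1perD[OF h] and FG = H1perD[OF H1per_fun(1)[OF f g]]
  have "ip a b (wgrad (f + g)) (wgrad h) = ip a b (\<lambda>x. wgrad f x + wgrad g x) (wgrad h)"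
    using H1per_fun(4)[OF f g] L2_measurable[OF L2_add[OF F(6) G(6)]] L2_measurable[OF FG(6)] L2_measurable[OF H(6)]
    by (intro ip_cong_AE) auto
  then show ?thesis
    by (simp add: h1_def ip_add_left[OF F(6) G(6) H(6)] ip_add_left[OF F(3) G(3) H(3)] plus_fun_def)
qed

lemma h1_scale:
  assumes f: "f \<in> H1per a b" and h: "h \<in> H1per a b"
  shows "h1 (c *\<^sub>R f) h = c * h1 f h"
proof -
  note F = H1perD[OF f] and H = H1perD[OF h] and FG = H1perD[OF H1per_fun(2)[OF f f, of c]]
  have "ip a b (wgrad (c *\<^sub>R f)) (wgrad h) = ip a b (\<lambda>x. c *\<^sub>R wgrad f x) (wgrad h)"
    using H1per_fun(5)[OF f f, of c] L2_measurable[OF L2_scale[OF F(6), of c]] L2_measurable[OF FG(6)] L2_measurable[OF H(6)]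
    by (intro ip_cong_AE) auto
  moreover have "ip a b (c *\<^sub>R f) h = c * ip a b f h"
    using ip_scale_left[of c f h] by (simp add: scaleR_fun_def)
  ultimately show ?thesis by (simp add: h1_def ip_scale_left distrib_left)
qed

text \<open>The functions and their gradients converge separately in L2. Both sides of the weak
  gradient identity converge for every fixed test function, so the limit of the gradients is the
  gradient of the limit.\<close>

lemma H1per_complete:
  assumes X: "\<And>n. X n \<in> H1per a b" and t: "0 < t" "t < 1" and c: "0 \<le> c"
    and d: "\<And>n. h1 (X (Suc n) - X n) (X (Suc n) - X n) \<le> c * t ^ (2 * n)"
  shows "\<exists>f\<in>H1per a b. (\<lambda>n. h1 (X n - f) (X n - f)) \<longlonglongrightarrow> 0"
proof -
  define f where "f = (\<lambda>x. lim (\<lambda>n. X n x))"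
  define g where "g = (\<lambda>x. lim (\<lambda>n. wgrad (X n) x))"
  note XD = H1perD[OF X]
  have Xd: "X (Suc n) - X n \<in> H1per a b" for n by (intro H1per_fun X)
  note XdD = H1perD[OF Xd]
  have d1: "sq (\<lambda>x. X (Suc n) x - X n x) \<le> ennreal (c * t ^ (2 * n))" for n
  proof -
    have "(l2 (X (Suc n) - X n))\<^sup>2 \<le> c * t ^ (2 * n)" 
      using d[of n] unfolding h1_self[OF Xd] by (rule order_trans[rotated]) simp
    then show ?thesis using sq_l2[OF XdD(3)[of n]] by (simp add: ennreal_leI fun_diff_def)
  qed
  have d2: "sq (\<lambda>x. wgrad (X (Suc n)) x - wgrad (X n) x) \<le> ennreal (c * t ^ (2 * n))" for n
  proof -
    have "(l2 (wgrad (X (Suc n) - X n)))\<^sup>2 \<le> c * t ^ (2 * n)" 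
      using d[of n] unfolding h1_self[OF Xd] by (rule order_trans[rotated]) simp
    then have "sq (wgrad (X (Suc n) - X n)) \<le> ennreal (c * t ^ (2 * n))"
      using sq_l2[OF XdD(6)[of n]] by (simp add: ennreal_leI)
    then show ?thesis using sq_cong_AE[OF H1per_fun(6)[OF X X, of "Suc n" n]] by simp
  qed
  have f_lim: "L2 f" "(\<lambda>n. l2 (\<lambda>x. X n x - f x)) \<longlonglongrightarrow> 0"
    unfolding f_def by (rule L2_fast_limit[OF XD(3) t c d1])+
  have g_lim: "L2 g" "(\<lambda>n. l2 (\<lambda>x. wgrad (X n) x - g x)) \<longlonglongrightarrow> 0"
    unfolding g_def by (rule L2_fast_limit[OF XD(6) t c d2])+
  \<comment> \<open>\<open>lim\<close> depends only on the sequence of values, so exact periodicity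
    of every \<open>X n\<close> passes to \<open>f\<close> even at points of divergence.\<close>
  have f_per: "box_periodic a b f" using XD(1) by (simp add: f_def box_periodic_def)
  have g_per: "ae_periodic a b g" unfolding g_def by (rule ae_periodic_lim[OF XD(5)])
  have loc: "locally_integrable f" "locally_integrable g"
    using f_lim(1) g_lim(1) L2_set_integrable[OF f_lim(1)] set_integrable_if_sq_finite[of g]
      locally_integrable_periodic[OF _ box_periodic_imp_ae[OF f_per]] locally_integrable_periodic[OF _ g_per]
    by (auto simp: L2_def)
  have weak: "has_weak_gradient f g"
    unfolding has_weak_gradient_def
  proof (intro conjI loc allI impI)
    fix \<psi> :: "real^'d \<Rightarrow> real" and i assume \<psi>: "test_function \<psi>"
    note \<psi>' = test_function_partial[OF \<psi>, of i]
    have lim1: "(\<lambda>n. LINT x|lborel. X n x * partial i \<psi> x) \<longlonglongrightarrow> (LINT x|lborel. f x * partial i \<psi> x)"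
    proof -
      obtain C where C: "\<And>v. L2 v \<Longrightarrow> ae_periodic a b v \<Longrightarrow> \<bar>LINT x|lborel. v x * partial i \<psi> x\<bar> \<le> C * l2 v"
        using integral_test_bound[OF \<psi>'] by blast
      have le: "norm ((LINT x|lborel. X n x * partial i \<psi> x) - (LINT x|lborel. f x * partial i \<psi> x)) \<le> C * l2 (\<lambda>x. X n x - f x)" for n
      proof -
        have L: "locally_integrable (X n)" using XD(4)[of n] by (simp add: has_weak_gradient_def)
        have "\<bar>LINT x|lborel. (X n x - f x) * partial i \<psi> x\<bar> \<le> C * l2 (\<lambda>x. X n x - f x)"
          by (rule C[OF L2_diff[OF XD(3) f_lim(1)] ae_periodic_compose2[OF XD(2) box_periodic_imp_ae[OF f_per]]])
        then show ?thesis
          using integrable_times_test[OF L \<psi>'] integrable_times_test[OF loc(1) \<psi>'] by (simp add: left_diff_distrib)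
      qed
      have to0: "(\<lambda>n. C * l2 (\<lambda>x. X n x - f x)) \<longlonglongrightarrow> 0"
        using tendsto_mult[OF tendsto_const[of C] f_lim(2)] by simp
      have "(\<lambda>n. (LINT x|lborel. X n x * partial i \<psi> x) - (LINT x|lborel. f x * partial i \<psi> x)) \<longlonglongrightarrow> 0"
        by (rule Lim_null_comparison[OF always_eventually[OF allI[OF le]] to0])
      then show ?thesis by (simp add: LIM_zero_iff)
    qed
    have lim2: "(\<lambda>n. LINT x|lborel. wgrad (X n) x $ i * \<psi> x) \<longlonglongrightarrow> (LINT x|lborel. g x $ i * \<psi> x)"
    proof -
      obtain C where C: "\<And>v. L2 v \<Longrightarrow> ae_periodic a b v \<Longrightarrow> \<bar>LINT x|lborel. v x * \<psi> x\<bar> \<le> C * l2 v"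
        using integral_test_bound[OF \<psi>] by blast
      have C0: "C * l2 v \<le> \<bar>C\<bar> * l2 v" for v :: "real^'d \<Rightarrow> real" by (intro mult_right_mono) auto
      have le: "norm ((LINT x|lborel. wgrad (X n) x $ i * \<psi> x) - (LINT x|lborel. g x $ i * \<psi> x)) \<le> \<bar>C\<bar> * l2 (\<lambda>x. wgrad (X n) x - g x)" for n
      proof -
        have L: "locally_integrable (wgrad (X n))" using XD(4)[of n] by (simp add: has_weak_gradient_def)
        have D: "L2 (\<lambda>x. wgrad (X n) x - g x)" by (rule L2_diff[OF XD(6) g_lim(1)])
        have m: "(\<lambda>x. wgrad (X n) x $ i - g x $ i) \<in> borel_measurable borel"
          using locally_integrable_measurable[OF locally_integrable_component[OF locally_integrable_diff[OF L loc(2)], of i]] by simp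
        have Di: "L2 (\<lambda>x. wgrad (X n) x $ i - g x $ i)" "l2 (\<lambda>x. wgrad (X n) x $ i - g x $ i) \<le> 1 * l2 (\<lambda>x. wgrad (X n) x - g x)"
        proof -
          have "norm (wgrad (X n) x $ i - g x $ i) \<le> 1 * norm (wgrad (X n) x - g x)" for x
            using component_le_norm_cart[of "wgrad (X n) x - g x" i] by simp
          from L2_bound[OF D m _ this]
          show "L2 (\<lambda>x. wgrad (X n) x $ i - g x $ i)"
            "l2 (\<lambda>x. wgrad (X n) x $ i - g x $ i) \<le> 1 * l2 (\<lambda>x. wgrad (X n) x - g x)" by simp_all
        qed
        have "ae_periodic a b (\<lambda>x. wgrad (X n) x $ i - g x $ i)"
          using ae_periodic_compose2[OF XD(5)[of n] g_per, of "\<lambda>u v. u $ i - v $ i"] .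
        from C[OF Di(1) this] have "\<bar>LINT x|lborel. (wgrad (X n) x $ i - g x $ i) * \<psi> x\<bar> \<le> C * l2 (\<lambda>x. wgrad (X n) x $ i - g x $ i)" .
        also have "\<dots> \<le> \<bar>C\<bar> * l2 (\<lambda>x. wgrad (X n) x $ i - g x $ i)" by (rule C0)
        also have "\<dots> \<le> \<bar>C\<bar> * l2 (\<lambda>x. wgrad (X n) x - g x)" using Di(2) by (intro mult_left_mono) auto
        finally show ?thesis
          using integrable_times_test[OF locally_integrable_component[OF L] \<psi>] integrable_times_test[OF locally_integrable_component[OF loc(2)] \<psi>]
          by (simp add: left_diff_distrib)
      qed
      have to0: "(\<lambda>n. \<bar>C\<bar> * l2 (\<lambda>x. wgrad (X n) x - g x)) \<longlonglongrightarrow> 0"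
        using tendsto_mult[OF tendsto_const[of "\<bar>C\<bar>"] g_lim(2)] by simp
      have "(\<lambda>n. (LINT x|lborel. wgrad (X n) x $ i * \<psi> x) - (LINT x|lborel. g x $ i * \<psi> x)) \<longlonglongrightarrow> 0"
        by (rule Lim_null_comparison[OF always_eventually[OF allI[OF le]] to0])
      then show ?thesis by (simp add: LIM_zero_iff)
    qed
    have "(LINT x|lborel. X n x * partial i \<psi> x) = - (LINT x|lborel. wgrad (X n) x $ i * \<psi> x)" for n
      using XD(4)[of n] \<psi> by (simp add: has_weak_gradient_def)
    with lim1 have "(\<lambda>n. - (LINT x|lborel. wgrad (X n) x $ i * \<psi> x)) \<longlonglongrightarrow> (LINT x|lborel. f x * partial i \<psi> x)" by simp
    from LIMSEQ_unique[OF this tendsto_minus[OF lim2]]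
    show "(LINT x|lborel. f x * partial i \<psi> x) = - (LINT x|lborel. g x $ i * \<psi> x)" .
  qed
  have f: "f \<in> H1per a b" by (rule H1perI[OF f_per f_lim(1) weak g_lim(1)])
  have "h1 (X n - f) (X n - f) = (l2 (\<lambda>x. X n x - f x))\<^sup>2 + (l2 (\<lambda>x. wgrad (X n) x - g x))\<^sup>2" for n
  proof -
    have "AE x in lborel. wgrad (X n - f) x = wgrad (X n) x - g x"
      using H1per_fun(6)[OF X f, of n] wgrad_AE[OF weak] by eventually_elim simp
    from l2_cong_AE[OF this] show ?thesis
      unfolding h1_self[OF H1per_fun(3)[OF X f]] by (simp add: fun_diff_def)
  qed
  moreover have "(\<lambda>n. (l2 (\<lambda>x. X n x - f x))\<^sup>2 + (l2 (\<lambda>x. wgrad (X n) x - g x))\<^sup>2) \<longlonglongrightarrow> 0\<^sup>2 + 0\<^sup>2"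
    by (intro tendsto_intros f_lim g_lim)
  ultimately show ?thesis using f by (intro bexI[of _ f]) auto
qed

lemma semi_hilbert_H1per: "semi_hilbert (H1per a b) h1"
proof
  show "h1 f g = h1 g f" for f g by (simp add: h1_def ip_commute)
qed (auto simp: subspace_H1per h1_add h1_scale h1_self intro: H1per_complete)

text \<open>The mean is continuous in the L2 norm, so a limit of mean-free functions is
  mean-free.\<close>

lemma semi_hilbert_H1bar: "semi_hilbert (H1bar a b) h1"
proof -
  interpret semi_hilbert "H1per a b" h1 by (rule semi_hilbert_H1per)
  have sub': "f \<in> H1bar a b \<Longrightarrow> f \<in> H1per a b" for f by (simp add: H1bar_def)
  show ?thesis
  proof
    fix X :: "nat \<Rightarrow> real^'d \<Rightarrow> real" and t c :: real
    assume X: "\<And>n. X n \<in> H1bar a b" and t: "0 < t" "t < 1" "0 \<le> c"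
      and d: "\<And>n. h1 (X (Suc n) - X n) (X (Suc n) - X n) \<le> c * t ^ (2 * n)"
    from H1per_complete[OF sub'[OF X] t d] obtain f where
      f: "f \<in> H1per a b" and lim: "(\<lambda>n. h1 (X n - f) (X n - f)) \<longlonglongrightarrow> 0" by blast
    obtain C where C: "\<And>v :: real^'d \<Rightarrow> real. L2 v \<Longrightarrow> \<bar>LINT x:box a b|lborel. v x\<bar> \<le> C * l2 v"
      using box_mean_bound by blast
    have le: "\<bar>LINT x:box a b|lborel. f x\<bar> \<le> \<bar>C\<bar> * sqrt (h1 (X n - f) (X n - f))" for n
    proof -
      have Xf: "X n - f \<in> H1per a b" by (intro H1per_fun sub' X f)
      have L: "L2 (X n - f)" by (rule H1perD[OF Xf])
      have "(LINT x:box a b|lborel. X n x - f x) = (LINT x:box a b|lborel. X n x) - (LINT x:box a b|lborel. f x)"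
        using H1perD(3)[OF sub'[OF X]] H1perD(3)[OF f] by (intro set_integral_diff L2_set_integrable)
      then have "\<bar>LINT x:box a b|lborel. f x\<bar> = \<bar>LINT x:box a b|lborel. (X n - f) x\<bar>"
        using X[of n] by (simp add: H1bar_def)
      also have "\<dots> \<le> C * l2 (X n - f)" by (rule C[OF L])
      also have "\<dots> \<le> \<bar>C\<bar> * l2 (X n - f)" by (intro mult_right_mono) auto
      also have "\<dots> \<le> \<bar>C\<bar> * sqrt (h1 (X n - f) (X n - f))"
        by (intro mult_left_mono real_le_rsqrt) (auto simp: h1_self[OF Xf])
      finally show ?thesis .
    qed
    have "(\<lambda>n. \<bar>C\<bar> * sqrt (h1 (X n - f) (X n - f))) \<longlonglongrightarrow> \<bar>C\<bar> * sqrt 0"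
      by (intro tendsto_intros lim)
    from LIMSEQ_le_const[OF this, of "\<bar>LINT x:box a b|lborel. f x\<bar>"] le
    have "(LINT x:box a b|lborel. f x) = 0" by simp
    with f lim show "\<exists>x\<in>H1bar a b. (\<lambda>n. h1 (X n - x) (X n - x)) \<longlonglongrightarrow> 0" by (auto simp: H1bar_def)
  qed (auto simp: subspace_H1bar I_simps I_nonneg dest!: sub' intro: I_sym)
qed

definition h1v :: "(real^'d \<Rightarrow> real^'d) \<Rightarrow> (real^'d \<Rightarrow> real^'d) \<Rightarrow> real"
  where "h1v u v = (\<Sum>i\<in>UNIV. h1 (\<lambda>x. u x $ i) (\<lambda>x. v x $ i))"

lemma vec_component_fun:
  fixes u v :: "real^'d \<Rightarrow> real^'d"
  shows "(\<lambda>x. (u + v) x $ i) = (\<lambda>x. u x $ i) + (\<lambda>x. v x $ i)"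
    "(\<lambda>x. (u - v) x $ i) = (\<lambda>x. u x $ i) - (\<lambda>x. v x $ i)"
    "(\<lambda>x. (c *\<^sub>R u) x $ i) = c *\<^sub>R (\<lambda>x. u x $ i)"
  by (auto simp: fun_eq_iff)

lemma semi_hilbert_H1vec: "semi_hilbert (H1vec a b) h1v"
proof -
  interpret semi_hilbert "H1per a b" h1 by (rule semi_hilbert_H1per)
  have C: "u \<in> H1vec a b \<Longrightarrow> (\<lambda>x. u x $ i) \<in> H1per a b" for u i by (simp add: H1vec_def)
  show ?thesis
  proof
    show "subspace (H1vec a b)"
      unfolding subspace_def H1vec_def using H1per_zero
      by (auto simp: vec_component_fun zero_fun_def intro!: H1per_fun simp del: plus_fun_apply scaleR_fun_apply)
    fix X :: "nat \<Rightarrow> real^'d \<Rightarrow> real^'d" and t c :: real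
    assume X: "\<And>n. X n \<in> H1vec a b" and t: "0 < t" "t < 1" "0 \<le> c"
      and d: "\<And>n. h1v (X (Suc n) - X n) (X (Suc n) - X n) \<le> c * t ^ (2 * n)"
    define P where "P i f \<longleftrightarrow> f \<in> H1per a b \<and> (\<lambda>n. h1 ((\<lambda>x. X n x $ i) - f) ((\<lambda>x. X n x $ i) - f)) \<longlonglongrightarrow> 0" for i f
    have ex: "\<exists>f\<in>H1per a b. (\<lambda>n. h1 ((\<lambda>x. X n x $ i) - f) ((\<lambda>x. X n x $ i) - f)) \<longlonglongrightarrow> 0" for i
    proof (rule H1per_complete[OF C[OF X] t])
      fix n
      let ?d = "\<lambda>i. (\<lambda>x. X (Suc n) x $ i) - (\<lambda>x. X n x $ i)"
      have "h1 (?d i) (?d i) \<le> (\<Sum>i\<in>UNIV. h1 (?d i) (?d i))"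
        by (intro member_le_sum) (auto intro!: I_nonneg closed C X)
      also have "\<dots> \<le> c * t ^ (2 * n)" using d[of n] by (simp only: h1v_def vec_component_fun)
      finally show "h1 (?d i) (?d i) \<le> c * t ^ (2 * n)" .
    qed
    define f where "f i = (SOME f. P i f)" for i
    have "P i (f i)" for i
    proof -
      have "\<exists>f. P i f" using ex[of i] unfolding P_def by blast
      then show ?thesis unfolding f_def by (rule someI_ex)
    qed
    then have f: "\<And>i. f i \<in> H1per a b"
      "\<And>i. (\<lambda>n. h1 ((\<lambda>x. X n x $ i) - f i) ((\<lambda>x. X n x $ i) - f i)) \<longlonglongrightarrow> 0"
      by (simp_all add: P_def)
    define u where "u x = (\<chi> i. f i x)" for x
    have u: "(\<lambda>x. u x $ i) = f i" for i by (simp add: u_def)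
    have "(\<lambda>n. \<Sum>i\<in>UNIV. h1 ((\<lambda>x. X n x $ i) - f i) ((\<lambda>x. X n x $ i) - f i)) \<longlonglongrightarrow> (\<Sum>i\<in>(UNIV::'d set). 0)"
      by (intro tendsto_sum f)
    then have "(\<lambda>n. h1v (X n - u) (X n - u)) \<longlonglongrightarrow> 0" by (simp only: h1v_def vec_component_fun u sum.neutral_const)
    moreover have "u \<in> H1vec a b" by (simp add: H1vec_def u f)
    ultimately show "\<exists>u\<in>H1vec a b. (\<lambda>n. h1v (X n - u) (X n - u)) \<longlonglongrightarrow> 0" by blast
  next
    fix u v w :: "real^'d \<Rightarrow> real^'d" and c :: real
    show "h1v (u + v) w = h1v u w + h1v v w" if "u \<in> H1vec a b" "v \<in> H1vec a b" "w \<in> H1vec a b"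
      by (simp only: h1v_def vec_component_fun I_add[OF C[OF that(1)] C[OF that(2)] C[OF that(3)]] sum.distrib)
    show "h1v (c *\<^sub>R u) w = c * h1v u w" if "u \<in> H1vec a b" "w \<in> H1vec a b"
      by (simp only: h1v_def vec_component_fun I_scale[OF C[OF that(1)] C[OF that(2)]] sum_distrib_left)
    show "h1v u v = h1v v u" if "u \<in> H1vec a b" "v \<in> H1vec a b"
      unfolding h1v_def by (intro sum.cong refl I_sym C that)
    show "0 \<le> h1v u u" if "u \<in> H1vec a b"
      unfolding h1v_def by (intro sum_nonneg I_nonneg C that)
  qed
qed

lemma H1bar_poincare:
  obtains C where "C \<ge> 0" "\<And>f. f \<in> H1bar a b \<Longrightarrow> h1 f f \<le> C * ip a b (wgrad f) (wgrad f)"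
proof -
  obtain R where R: "\<And>x. x \<in> box a b \<Longrightarrow> norm x \<le> R"
    using bounded_box[of a b] by (auto simp: bounded_iff)
  have "h1 f f \<le> (R\<^sup>2 + 1) * ip a b (wgrad f) (wgrad f)" if f: "f \<in> H1bar a b" for f
  proof -
    have f': "f \<in> H1per a b" "(LINT x:box a b|lborel. f x) = 0" using f by (auto simp: H1bar_def)
    interpret periodic_weak_gradient a b f "wgrad f" by (rule H1per_weak_gradient_locale[OF f'(1)])
    have "ennreal ((l2 f)\<^sup>2) \<le> ennreal (R\<^sup>2 * (l2 (wgrad f))\<^sup>2)"
      using poincare[OF f'(2) R] by (simp add: sq_l2 H1perD[OF f'(1)] ennreal_mult)
    then have "(l2 f)\<^sup>2 \<le> R\<^sup>2 * (l2 (wgrad f))\<^sup>2" by (subst (asm) ennreal_le_iff) auto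
    then show ?thesis by (simp add: h1_self[OF f'(1)] ip_self H1perD[OF f'(1)] distrib_right)
  qed
  then show thesis by (rule that[rotated]) auto
qed

text \<open>Cauchy-Schwarz for the squares leaves the integrals of the fourth powers, which
  \<open>sobolev_fourth\<close> bounds. Through this estimate coefficients that are merely H1 become
  admissible multipliers.\<close>

lemma H1per_product_L2:
  assumes d: "CARD('d) \<le> 3"
  obtains C where "C \<ge> 0"
    "\<And>f g. f \<in> H1per a b \<Longrightarrow> g \<in> H1per a b \<Longrightarrow> L2 (\<lambda>x. f x * g x) \<and>
      l2 (\<lambda>x. f x * g x) \<le> C * (sqrt (h1 f f) * sqrt (h1 g g))"
proof -
  \<comment> \<open>A single scale for \<open>sobolev_fourth\<close>: at most 1 and at most every
    period.\<close>
  define r where "r = Min (insert 1 (range (\<lambda>i. b $ i - a $ i)))"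
  have r: "0 < r" "r \<le> 1" "r \<le> b $ i - a $ i" for i
  proof -
    show "0 < r" using nondegenerate by (auto simp: r_def Min_gr_iff)
    show "r \<le> 1" "r \<le> b $ i - a $ i" unfolding r_def by (rule Min_le; simp)+
  qed
  obtain R where R: "\<And>y :: real^'d. y \<in> unit_box \<Longrightarrow> norm y \<le> R"
    using bounded_box[of "0 :: real^'d" "\<chi> i. 1"] by (auto simp: bounded_iff unit_box_def)
  define K where "K = 4000 * ((1 / r) ^ CARD('d) + R ^ 4)"
  have K: "K \<ge> 0" using r by (simp add: K_def)
  have four: "(\<integral>\<^sup>+x\<in>box a b. ennreal (f x ^ 4) \<partial>lborel) \<le> ennreal (K * (h1 f f)\<^sup>2)" if f: "f \<in> H1per a b" for f
  proof -
    interpret periodic_weak_gradient a b f "wgrad f" by (rule H1per_weak_gradient_locale[OF f])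
    have "sq f + sq (wgrad f) = ennreal (h1 f f)"
      by (simp add: sq_l2 H1perD[OF f] h1_self[OF f])
    moreover have "h1 f f \<ge> 0" by (simp add: h1_self[OF f])
    moreover have "(\<integral>\<^sup>+x\<in>box a b. ennreal (f x ^ 4) \<partial>lborel) \<le> ennreal K * (sq f + sq (wgrad f))\<^sup>2"
      unfolding K_def by (rule sobolev_fourth[OF d r]) (rule R)
    ultimately show ?thesis using K by (simp add: ennreal_mult ennreal_power)
  qed
  have "L2 (\<lambda>x. f x * g x) \<and> l2 (\<lambda>x. f x * g x) \<le> sqrt K * (sqrt (h1 f f) * sqrt (h1 g g))"
    if f: "f \<in> H1per a b" and g: "g \<in> H1per a b" for f g
  proof -
    have [measurable]: "f \<in> borel_measurable borel" "g \<in> borel_measurable borel"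
      using f g H1perD(3) L2_measurable by blast+
    have nonneg: "h1 f f \<ge> 0" "h1 g g \<ge> 0" using f g by (auto simp: h1_self)
    have "(sq (\<lambda>x. f x * g x))\<^sup>2
        = (\<integral>\<^sup>+x. (ennreal ((f x)\<^sup>2) * indicator (box a b) x) * (ennreal ((g x)\<^sup>2) * indicator (box a b) x) \<partial>lborel)\<^sup>2"
      unfolding sq_def
      by (intro arg_cong[where f = "\<lambda>x. x\<^sup>2"] nn_integral_cong)
         (auto simp: indicator_def ennreal_mult[symmetric] power_mult_distrib)
    also have "\<dots> \<le> (\<integral>\<^sup>+x. (ennreal ((f x)\<^sup>2) * indicator (box a b) x)\<^sup>2 \<partial>lborel)
        * (\<integral>\<^sup>+x. (ennreal ((g x)\<^sup>2) * indicator (box a b) x)\<^sup>2 \<partial>lborel)"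
      by (rule Cauchy_Schwarz_nn_integral) measurable
    also have "\<dots> = (\<integral>\<^sup>+x\<in>box a b. ennreal (f x ^ 4) \<partial>lborel) * (\<integral>\<^sup>+x\<in>box a b. ennreal (g x ^ 4) \<partial>lborel)"
      by (intro arg_cong2[where f = "(*)"] nn_integral_cong) (auto simp: indicator_def ennreal_power)
    also have "\<dots> \<le> ennreal (K * (h1 f f)\<^sup>2) * ennreal (K * (h1 g g)\<^sup>2)"
      by (intro mult_mono four f g) auto
    also have "\<dots> = ennreal ((K * (h1 f f * h1 g g))\<^sup>2)"
      using K by (simp add: ennreal_mult[symmetric] power2_eq_square mult_ac)
    finally have "sq (\<lambda>x. f x * g x) \<le> ennreal (K * (h1 f f * h1 g g))"
      by (rule ennreal_le_of_square) (use K nonneg in simp)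
    also have "K * (h1 f f * h1 g g) = (sqrt K * (sqrt (h1 f f) * sqrt (h1 g g)))\<^sup>2"
      using K nonneg by (simp add: power_mult_distrib)
    finally have le: "sq (\<lambda>x. f x * g x) \<le> ennreal ((sqrt K * (sqrt (h1 f f) * sqrt (h1 g g)))\<^sup>2)" .
    have "l2 (\<lambda>x. f x * g x) \<le> sqrt K * (sqrt (h1 f f) * sqrt (h1 g g))"
      by (rule l2_le[OF le]) (use K nonneg in simp)
    then show ?thesis using le by (auto simp: L2_def intro: le_less_trans)
  qed
  then show thesis by (rule that[rotated]) (use K in auto)
qed

end

section \<open>The regularized Flory-Huggins potential\<close>

text \<open>The junction points \<open>e\<close> and \<open>1 - e\<close> are left out: later they
  enter only as two single values, which matter neither for measurability nor for
  boundedness.\<close>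

lemma deriv_FH:
  assumes e: "0 < e" "e < 1 / 2"
  shows "\<rho> > 1 - e \<Longrightarrow> deriv (FH e) \<rho> = ln \<rho> + 1 - (1 - \<rho>) / e - ln e"
    and "e < \<rho> \<Longrightarrow> \<rho> < 1 - e \<Longrightarrow> deriv (FH e) \<rho> = ln \<rho> - ln (1 - \<rho>)"
    and "\<rho> < e \<Longrightarrow> deriv (FH e) \<rho> = ln e - ln (1 - \<rho>) - 1 + \<rho> / e"
proof -
  have local: "deriv (FH e) \<rho> = d"
    if D: "(h has_real_derivative d) (at \<rho>)" and S: "open S" "\<rho> \<in> S" "\<And>x. x \<in> S \<Longrightarrow> FH e x = h x" for h d S
    by (rule DERIV_imp_deriv, rule has_field_derivative_transform_within_open[OF D S(1,2)]) (simp add: S(3))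
  show "deriv (FH e) \<rho> = ln \<rho> + 1 - (1 - \<rho>) / e - ln e" if "\<rho> > 1 - e"
    by (rule local[where S = "{1 - e<..}"
          and h = "\<lambda>\<rho>. \<rho> * ln \<rho> + (1 - \<rho>)\<^sup>2 / (2 * e) + (1 - \<rho>) * ln e - e / 2"])
       (use e that in \<open>auto simp: FH_def field_simps intro!: derivative_eq_intros\<close>)
  have xln: "((\<lambda>\<rho>. \<rho> * ln \<rho>) has_real_derivative ln \<rho> + 1) (at \<rho>)" if "\<rho> > 0" for \<rho> :: real
    using that by (auto intro!: derivative_eq_intros)
  have yln: "((\<lambda>\<rho>. (1 - \<rho>) * ln (1 - \<rho>)) has_real_derivative - ln (1 - \<rho>) - 1) (at \<rho>)" if "\<rho> < 1" for \<rho> :: real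
  proof -
    have "((\<lambda>\<rho>. 1 - \<rho>) has_real_derivative - 1) (at \<rho>)" by (auto intro!: derivative_eq_intros)
    from DERIV_chain2[where f = "\<lambda>\<rho>. \<rho> * ln \<rho>" and g = "\<lambda>\<rho>. 1 - \<rho>", OF xln this] that
    show ?thesis by simp
  qed
  show "deriv (FH e) \<rho> = ln \<rho> - ln (1 - \<rho>)" if "e < \<rho>" "\<rho> < 1 - e"
    by (rule local[where S = "{e<..<1 - e}" and h = "\<lambda>\<rho>. \<rho> * ln \<rho> + (1 - \<rho>) * ln (1 - \<rho>)"])
       (use e that DERIV_add[OF xln[of \<rho>] yln[of \<rho>]] in \<open>auto simp: FH_def\<close>)
  show "deriv (FH e) \<rho> = ln e - ln (1 - \<rho>) - 1 + \<rho> / e" if "\<rho> < e"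
  proof (rule local[where S = "{..<e}"
        and h = "\<lambda>\<rho>. (1 - \<rho>) * ln (1 - \<rho>) + (\<rho>\<^sup>2 / (2 * e) + \<rho> * ln e - e / 2)"])
    have "((\<lambda>\<rho>. \<rho>\<^sup>2 / (2 * e) + \<rho> * ln e - e / 2) has_real_derivative \<rho> / e + ln e) (at \<rho>)"
      using e by (auto intro!: derivative_eq_intros)
    then have "((\<lambda>\<rho>. (1 - \<rho>) * ln (1 - \<rho>) + (\<rho>\<^sup>2 / (2 * e) + \<rho> * ln e - e / 2)) has_real_derivative
        (- ln (1 - \<rho>) - 1) + (\<rho> / e + ln e)) (at \<rho>)"
      using e that by (intro DERIV_add yln) auto
    then show "((\<lambda>\<rho>. (1 - \<rho>) * ln (1 - \<rho>) + (\<rho>\<^sup>2 / (2 * e) + \<rho> * ln e - e / 2)) has_real_derivative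
        ln e - ln (1 - \<rho>) - 1 + \<rho> / e) (at \<rho>)"
      by (simp add: algebra_simps)
  qed (use e that in \<open>auto simp: FH_def\<close>)
qed

lemma FH_H_measurable:
  assumes e: "0 < e" "e < 1 / 2"
  shows "FH_H e A \<in> borel_measurable borel"
proof -
  have "deriv (FH e) = (\<lambda>\<rho>. if \<rho> > 1 - e then ln \<rho> + 1 - (1 - \<rho>) / e - ln e
      else if \<rho> = 1 - e then deriv (FH e) (1 - e) else if \<rho> > e then ln \<rho> - ln (1 - \<rho>)
      else if \<rho> = e then deriv (FH e) e else ln e - ln (1 - \<rho>) - 1 + \<rho> / e)"
    using deriv_FH[OF e] by (auto simp: fun_eq_iff)
  also have "\<dots> \<in> borel_measurable borel" by measurable
  finally have [measurable]: "deriv (FH e) \<in> borel_measurable borel" .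
  have [measurable]: "FH e \<in> borel_measurable borel" unfolding FH_def[abs_def] by measurable
  show ?thesis unfolding FH_H_def[abs_def] by measurable
qed

lemma quotient_bounded_on_interval:
  fixes p q :: "real \<Rightarrow> real"
  assumes "continuous_on {l..u} p" "continuous_on {l..u} q" "\<And>\<rho>. \<rho> \<in> {l..u} \<Longrightarrow> q \<rho> > 0"
  shows "\<exists>B. \<forall>\<rho>\<in>{l..u}. \<bar>p \<rho> / sqrt (q \<rho>)\<bar> \<le> B"
proof -
  have "continuous_on {l..u} (\<lambda>\<rho>. p \<rho> / sqrt (q \<rho>))"
    using assms(3) by (intro continuous_intros assms(1,2)) force
  then have "bounded ((\<lambda>\<rho>. p \<rho> / sqrt (q \<rho>)) ` {l..u})"
    by (intro compact_imp_bounded compact_continuous_image) auto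
  then obtain B where "\<And>y. y \<in> (\<lambda>\<rho>. p \<rho> / sqrt (q \<rho>)) ` {l..u} \<Longrightarrow> norm y \<le> B"
    unfolding bounded_iff by blast
  then show ?thesis by (metis imageI real_norm_def)
qed

text \<open>Both tails of \<open>FH_H\<close> at once, with \<open>t\<close> standing for
  \<open>\<rho> - 1\<close> or \<open>- \<rho>\<close>: the derivative grows at most linearly in
  \<open>t\<close>, and so does the square root of a potential with a quadratic lower bound.\<close>

lemma FH_far_bound:
  fixes x y e A t :: real
  assumes e: "0 < e" "e < 1 / 2" and t: "t \<ge> 1"
    and x: "\<bar>x\<bar> \<le> t * (2 + 1 / e + \<bar>ln e\<bar>)" and y: "t\<^sup>2 / (2 * e) - e / 2 \<le> y"
  shows "\<bar>x / sqrt y\<bar> \<le> 2 * sqrt e * (2 + 1 / e + \<bar>ln e\<bar>)"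
proof -
  let ?K = "2 + 1 / e + \<bar>ln e\<bar>"
  have t2: "1 \<le> t\<^sup>2" using t by simp
  \<comment> \<open>As \<open>e < 1 / 2\<close> and \<open>t \<ge> 1\<close>, subtracting
    \<open>e / 2\<close> costs at most half of \<open>t\<^sup>2 / (2 * e)\<close>; this is the
    factor 2 in the bound.\<close>
  have "e * e \<le> (1 / 2) * (1 / 2)" using e by (intro mult_mono) auto
  then have "2 * (e * e) \<le> t\<^sup>2" using t2 by linarith
  then have "(t / (2 * sqrt e))\<^sup>2 \<le> t\<^sup>2 / (2 * e) - e / 2"
    using e by (simp add: power_divide field_simps power2_eq_square)
  with y have "(t / (2 * sqrt e))\<^sup>2 \<le> y" by linarith
  then have s: "t / (2 * sqrt e) \<le> sqrt y" by (rule real_le_rsqrt)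
  have p: "0 < t / (2 * sqrt e)" using t e by simp
  have "\<bar>x\<bar> / sqrt y \<le> (t * ?K) / (t / (2 * sqrt e))"
    using x s p e t by (intro frac_le) auto
  also have "\<dots> = 2 * sqrt e * ?K" using t e by simp
  finally show ?thesis using s p by (simp add: abs_divide)
qed

text \<open>Boundedness is what makes multiplication by \<open>Hstar\<close> continuous on L2.
  Compactness settles the interval from -1 to 2 apart from the junctions, branch by branch, and
  beyond it the parameter \<open>t\<close> of \<open>FH_far_bound\<close> exceeds 1.\<close>

lemma FH_H_bounded:
  assumes e: "0 < e" "e < 1 / 2" and A: "A > 0" "\<And>\<rho>. FH e \<rho> + A > 0"
  obtains B where "\<And>\<rho>. \<bar>FH_H e A \<rho>\<bar> \<le> B"
proof -
  \<comment> \<open>The three branches are extended to closed, overlapping intervals, where they are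
    continuous and still give the values of \<open>FH e\<close>, so \<open>A(2)\<close> keeps the
    denominators positive up to the end points.\<close>
  define g1 where "g1 \<rho> = \<rho> * ln \<rho> + (1 - \<rho>)\<^sup>2 / (2 * e) + (1 - \<rho>) * ln e - e / 2" for \<rho>
  define g2 where "g2 \<rho> = \<rho> * ln \<rho> + (1 - \<rho>) * ln (1 - \<rho>)" for \<rho> :: real
  define g3 where "g3 \<rho> = (1 - \<rho>) * ln (1 - \<rho>) + \<rho>\<^sup>2 / (2 * e) + \<rho> * ln e - e / 2" for \<rho>
  have lne: "ln e < 0" using e by simp
  have F: "\<rho> \<ge> 1 - e \<Longrightarrow> FH e \<rho> = g1 \<rho>" "e \<le> \<rho> \<Longrightarrow> \<rho> \<le> 1 - e \<Longrightarrow> FH e \<rho> = g2 \<rho>" "\<rho> \<le> e \<Longrightarrow> FH e \<rho> = g3 \<rho>" for \<rho>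
  proof -
    show "FH e \<rho> = g1 \<rho>" if "\<rho> \<ge> 1 - e" using that by (simp add: FH_def g1_def)
    show "FH e \<rho> = g2 \<rho>" if "e \<le> \<rho>" "\<rho> \<le> 1 - e"
    proof (cases "\<rho> = 1 - e")
      case True
      show ?thesis unfolding True using e by (simp add: FH_def g2_def power2_eq_square)
    qed (use that in \<open>simp add: FH_def g2_def\<close>)
    show "FH e \<rho> = g3 \<rho>" if "\<rho> \<le> e"
    proof (cases "\<rho> = e")
      case True
      show ?thesis unfolding True using e by (simp add: FH_def g3_def power2_eq_square)
    qed (use that e in \<open>simp add: FH_def g3_def\<close>)
  qed
  have "\<exists>B. \<forall>\<rho>\<in>{1 - e..2}. \<bar>(ln \<rho> + 1 - (1 - \<rho>) / e - ln e) / sqrt (g1 \<rho> + A)\<bar> \<le> B"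
  proof (rule quotient_bounded_on_interval)
    show "continuous_on {1 - e..2} (\<lambda>\<rho>. ln \<rho> + 1 - (1 - \<rho>) / e - ln e)" "continuous_on {1 - e..2} (\<lambda>\<rho>. g1 \<rho> + A)"
      unfolding g1_def using e by (auto intro!: continuous_intros)
    show "g1 \<rho> + A > 0" if "\<rho> \<in> {1 - e..2}" for \<rho> using A(2)[of \<rho>] that by (simp add: F)
  qed
  then obtain B1 where B1: "\<And>\<rho>. \<rho> \<in> {1 - e..2} \<Longrightarrow> \<bar>(ln \<rho> + 1 - (1 - \<rho>) / e - ln e) / sqrt (g1 \<rho> + A)\<bar> \<le> B1" by blast
  have "\<exists>B. \<forall>\<rho>\<in>{e..1 - e}. \<bar>(ln \<rho> - ln (1 - \<rho>)) / sqrt (g2 \<rho> + A)\<bar> \<le> B"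
  proof (rule quotient_bounded_on_interval)
    show "continuous_on {e..1 - e} (\<lambda>\<rho>. ln \<rho> - ln (1 - \<rho>))" "continuous_on {e..1 - e} (\<lambda>\<rho>. g2 \<rho> + A)"
      unfolding g2_def using e by (auto intro!: continuous_intros)
    show "g2 \<rho> + A > 0" if "\<rho> \<in> {e..1 - e}" for \<rho> using A(2)[of \<rho>] that by (simp add: F)
  qed
  then obtain B2 where B2: "\<And>\<rho>. \<rho> \<in> {e..1 - e} \<Longrightarrow> \<bar>(ln \<rho> - ln (1 - \<rho>)) / sqrt (g2 \<rho> + A)\<bar> \<le> B2" by blast
  have "\<exists>B. \<forall>\<rho>\<in>{-1..e}. \<bar>(ln e - ln (1 - \<rho>) - 1 + \<rho> / e) / sqrt (g3 \<rho> + A)\<bar> \<le> B"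
  proof (rule quotient_bounded_on_interval)
    show "continuous_on {-1..e} (\<lambda>\<rho>. ln e - ln (1 - \<rho>) - 1 + \<rho> / e)" "continuous_on {-1..e} (\<lambda>\<rho>. g3 \<rho> + A)"
      unfolding g3_def using e by (auto intro!: continuous_intros)
    show "g3 \<rho> + A > 0" if "\<rho> \<in> {-1..e}" for \<rho> using A(2)[of \<rho>] that by (simp add: F)
  qed
  then obtain B3 where B3: "\<And>\<rho>. \<rho> \<in> {-1..e} \<Longrightarrow> \<bar>(ln e - ln (1 - \<rho>) - 1 + \<rho> / e) / sqrt (g3 \<rho> + A)\<bar> \<le> B3" by blast
  define B4 where "B4 = 2 * sqrt e * (2 + 1 / e + \<bar>ln e\<bar>)"
  \<comment> \<open>The values at the junctions, where no formula for the derivative is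
    available.\<close>
  define Bd where "Bd = \<bar>FH_H e A e\<bar> + \<bar>FH_H e A (1 - e)\<bar>"
  define M where "M = \<bar>B1\<bar> + \<bar>B2\<bar> + \<bar>B3\<bar> + \<bar>B4\<bar> + Bd"
  have "\<bar>FH_H e A \<rho>\<bar> \<le> M" for \<rho>
  proof -
    consider "\<rho> > 2" | "1 - e < \<rho>" "\<rho> \<le> 2" | "\<rho> = 1 - e" | "e < \<rho>" "\<rho> < 1 - e" | "\<rho> = e"
      | "-1 \<le> \<rho>" "\<rho> < e" | "\<rho> < -1" using e by linarith
    then show ?thesis
    proof cases
      case 1
      have "ln \<rho> \<le> \<rho> - 1" "0 \<le> ln \<rho>" using 1 ln_le_minus_one[of \<rho>] by auto
      then have "\<bar>ln \<rho> + 1 - (1 - \<rho>) / e - ln e\<bar> \<le> (\<rho> - 1) + 1 + (\<rho> - 1) / e + \<bar>ln e\<bar>"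
      proof -
        have "ln \<rho> + 1 - (1 - \<rho>) / e - ln e = ln \<rho> + 1 + (\<rho> - 1) / e + \<bar>ln e\<bar>"
          using lne by (simp add: diff_divide_distrib)
        moreover have "0 \<le> (\<rho> - 1) / e" using 1 e by simp
        ultimately show ?thesis using \<open>ln \<rho> \<le> \<rho> - 1\<close> \<open>0 \<le> ln \<rho>\<close> by linarith
      qed
      also have "\<dots> \<le> (\<rho> - 1) * (2 + 1 / e + \<bar>ln e\<bar>)"
      proof -
        have "1 * (1 + \<bar>ln e\<bar>) \<le> (\<rho> - 1) * (1 + \<bar>ln e\<bar>)" using 1 by (intro mult_right_mono) auto
        then show ?thesis by (simp add: algebra_simps)
      qed
      finally have x: "\<bar>ln \<rho> + 1 - (1 - \<rho>) / e - ln e\<bar> \<le> (\<rho> - 1) * (2 + 1 / e + \<bar>ln e\<bar>)" .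
      have "0 \<le> (1 - \<rho>) * ln e" using 1 lne by (intro mult_nonpos_nonpos) auto
      moreover have "0 \<le> \<rho> * ln \<rho>" using 1 by simp
      ultimately have y: "(\<rho> - 1)\<^sup>2 / (2 * e) - e / 2 \<le> g1 \<rho> + A"
        using A(1) by (simp add: g1_def power2_commute[of 1 \<rho>])
      have "\<bar>FH_H e A \<rho>\<bar> \<le> B4"
        using FH_far_bound[OF e _ x y] 1 e by (simp add: FH_H_def deriv_FH[OF e] F B4_def)
      then show ?thesis by (simp add: M_def Bd_def)
    next
      case 2
      then have "\<bar>FH_H e A \<rho>\<bar> \<le> B1" using B1[of \<rho>] e by (simp add: FH_H_def deriv_FH[OF e] F)
      then show ?thesis by (simp add: M_def Bd_def)
    next
      case 4
      then have "\<bar>FH_H e A \<rho>\<bar> \<le> B2" using B2[of \<rho>] e by (simp add: FH_H_def deriv_FH[OF e] F)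
      then show ?thesis by (simp add: M_def Bd_def)
    next
      case 6
      then have "\<bar>FH_H e A \<rho>\<bar> \<le> B3" using B3[of \<rho>] e by (simp add: FH_H_def deriv_FH[OF e] F)
      then show ?thesis by (simp add: M_def Bd_def)
    next
      case 7
      have "ln (1 - \<rho>) \<le> - \<rho>" "0 \<le> ln (1 - \<rho>)" using 7 ln_le_minus_one[of "1 - \<rho>"] by auto
      then have "\<bar>ln e - ln (1 - \<rho>) - 1 + \<rho> / e\<bar> \<le> (- \<rho>) + 1 + (- \<rho>) / e + \<bar>ln e\<bar>"
      proof -
        have "ln e - ln (1 - \<rho>) - 1 + \<rho> / e = - (ln (1 - \<rho>) + 1 + (- \<rho>) / e + \<bar>ln e\<bar>)"
          using lne by simp
        moreover have "0 \<le> (- \<rho>) / e" using 7 e by (intro divide_nonneg_pos) auto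
        ultimately show ?thesis using \<open>ln (1 - \<rho>) \<le> - \<rho>\<close> \<open>0 \<le> ln (1 - \<rho>)\<close> by linarith
      qed
      also have "\<dots> \<le> (- \<rho>) * (2 + 1 / e + \<bar>ln e\<bar>)"
      proof -
        have "1 * (1 + \<bar>ln e\<bar>) \<le> (- \<rho>) * (1 + \<bar>ln e\<bar>)" using 7 by (intro mult_right_mono) auto
        then show ?thesis by (simp add: algebra_simps)
      qed
      finally have x: "\<bar>ln e - ln (1 - \<rho>) - 1 + \<rho> / e\<bar> \<le> (- \<rho>) * (2 + 1 / e + \<bar>ln e\<bar>)" .
      have "0 \<le> \<rho> * ln e" using 7 lne by (intro mult_nonpos_nonpos) auto
      moreover have "0 \<le> (1 - \<rho>) * ln (1 - \<rho>)" using 7 by simp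
      ultimately have y: "(- \<rho>)\<^sup>2 / (2 * e) - e / 2 \<le> g3 \<rho> + A"
        using A(1) by (simp add: g3_def)
      have "\<bar>FH_H e A \<rho>\<bar> \<le> B4"
        using FH_far_bound[OF e _ x y] 7 e by (simp add: FH_H_def deriv_FH[OF e] F B4_def)
      then show ?thesis by (simp add: M_def Bd_def)
    qed (auto simp: M_def Bd_def)
  qed
  then show thesis by (rule that)
qed

section \<open>The linear scheme\<close>

lemma borel_measurable_vec_componentwise:
  fixes f :: "'a \<Rightarrow> 'b::euclidean_space ^ 'n"
  assumes "\<And>i. (\<lambda>x. f x $ i) \<in> borel_measurable M"
  shows "f \<in> borel_measurable M"
proof (subst borel_measurable_euclidean_space, rule ballI)
  fix j :: "'b ^ 'n" assume "j \<in> Basis"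
  then obtain i u where j: "j = axis i u" by (auto simp: Basis_vec_def)
  have "(\<lambda>x. f x $ i \<bullet> u) \<in> borel_measurable M" using assms by (intro borel_measurable_inner) auto
  then show "(\<lambda>x. f x \<bullet> j) \<in> borel_measurable M" by (simp add: j inner_axis)
qed

lemma norm_vec_le_sum: "norm (x :: 'b::real_normed_vector ^ 'n) \<le> (\<Sum>i\<in>UNIV. norm (x $ i))"
  unfolding norm_vec_def by (rule L2_set_le_sum) simp

section \<open>Vector fields and the convective form\<close>

context periodic_cell begin

lemma L2_zero: "L2 (\<lambda>x. 0)"
  by (simp add: L2_def sq_def)

lemma L2_sum: "(\<And>i. i \<in> A \<Longrightarrow> L2 (f i)) \<Longrightarrow> L2 (\<lambda>x. \<Sum>i\<in>A. f i x)"
  by (induction A rule: infinite_finite_induct) (auto intro: L2_add L2_zero)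

lemma l2_add_le:
  assumes f: "L2 f" and g: "L2 g"
  shows "l2 (\<lambda>x. f x + g x) \<le> l2 f + l2 g"
proof (rule power2_le_imp_le)
  have "(l2 (\<lambda>x. f x + g x))\<^sup>2 = (l2 f)\<^sup>2 + 2 * ip a b f g + (l2 g)\<^sup>2"
    by (simp add: ip_self[symmetric] f g L2_add ip_add_left ip_add_right ip_commute[of g f])
  also have "\<dots> \<le> (l2 f)\<^sup>2 + 2 * (l2 f * l2 g) + (l2 g)\<^sup>2"
    using integrable_inner(2)[OF f g] by simp
  finally show "(l2 (\<lambda>x. f x + g x))\<^sup>2 \<le> (l2 f + l2 g)\<^sup>2" by (simp add: power2_sum)
qed simp

lemma l2_sum_le: "finite A \<Longrightarrow> (\<And>i. i \<in> A \<Longrightarrow> L2 (f i)) \<Longrightarrow> l2 (\<lambda>x. \<Sum>i\<in>A. f i x) \<le> (\<Sum>i\<in>A. l2 (f i))"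
proof (induction A rule: finite_induct)
  case (insert i A)
  then have "l2 (\<lambda>x. f i x + (\<Sum>i\<in>A. f i x)) \<le> l2 (f i) + l2 (\<lambda>x. \<Sum>i\<in>A. f i x)"
    by (intro l2_add_le L2_sum) auto
  with insert show ?case by simp
qed (simp add: l2_def sq_def)

lemma L2_norm: "L2 f \<Longrightarrow> L2 (\<lambda>x. norm (f x))" "L2 f \<Longrightarrow> l2 (\<lambda>x. norm (f x)) = l2 f"
  by (auto simp: L2_def sq_def l2_def)

lemma L2_vec:
  fixes f :: "real^'d \<Rightarrow> 'b::euclidean_space ^ 'n"
  assumes "\<And>i. L2 (\<lambda>x. f x $ i)"
  shows "L2 f" "l2 f \<le> (\<Sum>i\<in>UNIV. l2 (\<lambda>x. f x $ i))"
proof -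
  have m: "f \<in> borel_measurable borel" using assms by (intro borel_measurable_vec_componentwise) (simp add: L2_def)
  have s: "L2 (\<lambda>x. \<Sum>i\<in>UNIV. norm (f x $ i))" by (rule L2_sum[OF L2_norm(1)[OF assms]])
  have le: "norm (f x) \<le> 1 * norm (\<Sum>i\<in>UNIV. norm (f x $ i))" for x
    using norm_vec_le_sum[of "f x"] by (simp add: sum_nonneg)
  show "L2 f" by (rule L2_bound[OF s m _ le]) simp
  have "l2 f \<le> 1 * l2 (\<lambda>x. \<Sum>i\<in>UNIV. norm (f x $ i))" by (rule L2_bound[OF s m _ le]) simp
  also have "\<dots> \<le> (\<Sum>i\<in>UNIV. l2 (\<lambda>x. norm (f x $ i)))"
    using l2_sum_le[of UNIV "\<lambda>i x. norm (f x $ i)"] assms by (simp add: L2_norm)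
  finally show "l2 f \<le> (\<Sum>i\<in>UNIV. l2 (\<lambda>x. f x $ i))" by (simp add: L2_norm assms)
qed

lemma component_measurable:
  "f \<in> borel_measurable M \<Longrightarrow> (\<lambda>x. f x $ i :: 'b::euclidean_space) \<in> borel_measurable M"
  by (rule borel_measurable_continuous_on[OF linear_continuous_on[OF bounded_linear_vec_nth]])

lemma L2_component:
  assumes "L2 f"
  shows "L2 (\<lambda>x. f x $ i)"
  by (rule L2_bound(1)[OF assms component_measurable[OF L2_measurable[OF assms]], of 1])
     (simp_all add: Finite_Cartesian_Product.norm_nth_le)

lemma L2_bounded_mult:
  fixes h :: "real^'d \<Rightarrow> real"
  assumes h: "h \<in> borel_measurable borel" and B: "\<And>x. \<bar>h x\<bar> \<le> B" and f: "L2 f"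
  shows "L2 (\<lambda>x. h x *\<^sub>R f x)"
proof (rule L2_bound(1)[OF f])
  show "(\<lambda>x. h x *\<^sub>R f x) \<in> borel_measurable borel" using h f by (auto simp: L2_def)
  show "0 \<le> B" using B[of 0] by simp
  show "norm (h x *\<^sub>R f x) \<le> B * norm (f x)" for x using B[of x] by (simp add: mult_right_mono)
qed

lemma L2_inner_bounded:
  fixes Z :: "real^'d \<Rightarrow> 'b::euclidean_space"
  assumes Z: "Z \<in> borel_measurable borel" and B: "\<And>x. norm (Z x) \<le> B" and f: "L2 f"
  shows "L2 (\<lambda>x. Z x \<bullet> f x)"
proof (rule L2_bound(1)[OF f])
  show "(\<lambda>x. Z x \<bullet> f x) \<in> borel_measurable borel" using Z f by (auto simp: L2_def)
  show "0 \<le> B" using B[of 0] norm_ge_zero order_trans by blast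
  show "norm (Z x \<bullet> f x) \<le> B * norm (f x)" for x
    using Cauchy_Schwarz_ineq2[of "Z x" "f x"] mult_right_mono[OF B[of x], of "norm (f x)"] by simp
qed

lemma L2_bounded:
  fixes Z :: "real^'d \<Rightarrow> 'b::euclidean_space"
  assumes Z: "Z \<in> borel_measurable borel" and B: "\<And>x. norm (Z x) \<le> B"
  shows "L2 Z"
proof (rule L2_bound(1))
  show "L2 (\<lambda>x. 1 :: real)" by (simp add: L2_def sq_def emeasure_box)
  show "0 \<le> B" using B[of 0] norm_ge_zero order_trans by blast
qed (use assms in auto)

text \<open>\<open>l2\<close> sees only one cell. Periodicity spreads the vanishing over every ball
  through \<open>nn_integral_compact_le\<close>, and countably many balls exhaust the space.\<close>

lemma AE_zero_of_l2:
  assumes f: "L2 f" "ae_periodic a b f" "l2 f = 0"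
  shows "AE x in lborel. f x = 0"
proof -
  have [measurable]: "f \<in> borel_measurable borel" using f by (simp add: L2_def)
  have 0: "sq f = 0" using f by (simp add: sq_l2)
  have "AE x in lborel. x \<in> cball 0 (real n) \<longrightarrow> f x = 0" for n
  proof -
    obtain N :: nat where "\<And>F. F \<in> borel_measurable borel \<Longrightarrow> ae_periodic a b F \<Longrightarrow>
      (\<integral>\<^sup>+x\<in>cball 0 (real n). F x \<partial>lborel) \<le> of_nat N * (\<integral>\<^sup>+x\<in>box a b. F x \<partial>lborel)"
      using nn_integral_compact_le[of "cball 0 (real n)"] by auto
    from this[OF _ ae_periodic_compose[OF f(2), of "\<lambda>y. ennreal ((norm y)\<^sup>2)"]]
    have "(\<integral>\<^sup>+x\<in>cball 0 (real n). ennreal ((norm (f x))\<^sup>2) \<partial>lborel) = 0"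
      using 0 by (simp add: sq_def)
    moreover have [measurable]: "cball (0 :: real^'d) (real n) \<in> sets borel" by (simp add: borel_closed)
    moreover have "(\<lambda>x. ennreal ((norm (f x))\<^sup>2) * indicator (cball 0 (real n)) x) \<in> borel_measurable lborel"
      by measurable
    ultimately have "AE x in lborel. ennreal ((norm (f x))\<^sup>2) * indicator (cball 0 (real n)) x = 0"
      by (simp only: nn_integral_0_iff_AE)
    then show ?thesis by eventually_elim (auto simp: indicator_def split: if_splits)
  qed
  then have "AE x in lborel. \<forall>n. x \<in> cball 0 (real n) \<longrightarrow> f x = 0" unfolding AE_all_countable by blast
  then show ?thesis
  proof eventually_elim
    case (elim x)
    obtain n where "norm x \<le> real n" using real_arch_simple by blast
    with elim show ?case by auto
  qed
qed

lemma box_integral_sum: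
  "finite A \<Longrightarrow> (\<And>i. i \<in> A \<Longrightarrow> set_integrable lborel (box a b) (g i)) \<Longrightarrow>
    (LINT x:box a b|lborel. (\<Sum>i\<in>A. g i x)) = (\<Sum>i\<in>A. (LINT x:box a b|lborel. g i x :: real))"
  unfolding set_lebesgue_integral_def set_integrable_def scaleR_sum_right
  by (rule Bochner_Integration.integral_sum)

lemma H1per_mult_L2:
  assumes "CARD('d) \<le> 3" "f \<in> H1per a b" "g \<in> H1per a b"
  shows "L2 (\<lambda>x. f x * g x)"
  using H1per_product_L2[OF assms(1)] assms(2,3) by metis

lemma box_integrable_sum:
  "(\<And>i. i \<in> A \<Longrightarrow> set_integrable lborel (box a b) (g i)) \<Longrightarrow>
    set_integrable lborel (box a b) (\<lambda>x. (\<Sum>i\<in>A. g i x :: real))"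
  unfolding set_integrable_def scaleR_sum_right by (rule Bochner_Integration.integrable_sum)

text \<open>Each scalar integral pairs an L2 derivative with a product of two H1 functions. The
  field \<open>Bform w u\<close> itself need not be L2, so the general rules for \<open>ip\<close>
  do not apply to it as a whole.\<close>

lemma Bform_expansion:
  assumes d: "CARD('d) \<le> 3" and w: "w \<in> H1vec a b" and u: "u \<in> H1vec a b" and v: "v \<in> H1vec a b"
  shows "ip a b (Bform w u) v = (\<Sum>i\<in>UNIV. \<Sum>j\<in>UNIV.
      ip a b (\<lambda>x. wgrad (\<lambda>y. u y $ i) x $ j) (\<lambda>x. w x $ j * v x $ i)
      + 1 / 2 * ip a b (\<lambda>x. wgrad (\<lambda>y. w y $ j) x $ j) (\<lambda>x. u x $ i * v x $ i))"
proof -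
  have C: "f \<in> H1vec a b \<Longrightarrow> (\<lambda>x. f x $ i) \<in> H1per a b" for f i by (simp add: H1vec_def)
  note G = L2_component[OF H1perD(6)[OF C]]
  note P = H1per_mult_L2[OF d]
  define s where "s i j x = wgrad (\<lambda>y. u y $ i) x $ j * (w x $ j * v x $ i)" for i j x
  define t where "t i j x = wgrad (\<lambda>y. w y $ j) x $ j * (u x $ i * v x $ i)" for i j x
  have sI: "set_integrable lborel (box a b) (s i j)" for i j
    using integrable_inner(1)[OF G[OF u] P[OF C[OF w] C[OF v]], of i j j i] by (simp add: s_def[abs_def])
  have tI: "set_integrable lborel (box a b) (t i j)" for i j
    using integrable_inner(1)[OF G[OF w] P[OF C[OF u] C[OF v]], of j j i i] by (simp add: t_def[abs_def])
  have ist: "set_integrable lborel (box a b) (\<lambda>x. s i j x + 1 / 2 * t i j x)" for i j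
    using sI tI by (intro set_integral_add set_integrable_mult_right)
  have "Bform w u x \<bullet> v x = (\<Sum>i\<in>UNIV. \<Sum>j\<in>UNIV. s i j x + 1 / 2 * t i j x)" for x
    unfolding Bform_def s_def t_def
    by (simp add: inner_vec_def matrix_vector_mult_def vgrad_def wdiv_def sum.distrib distrib_right
      distrib_left sum_distrib_left sum_distrib_right mult_ac)
  then have "ip a b (Bform w u) v = (LINT x:box a b|lborel. (\<Sum>i\<in>UNIV. \<Sum>j\<in>UNIV. s i j x + 1 / 2 * t i j x))"
    by (simp add: ip_def)
  also have "\<dots> = (\<Sum>i\<in>UNIV. \<Sum>j\<in>UNIV. (LINT x:box a b|lborel. s i j x + 1 / 2 * t i j x))"
    by (simp only: box_integral_sum[OF finite box_integrable_sum[OF ist]] box_integral_sum[OF finite ist])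
  also have "(\<lambda>i j. (LINT x:box a b|lborel. s i j x + 1 / 2 * t i j x))
      = (\<lambda>i j. (LINT x:box a b|lborel. s i j x) + 1 / 2 * (LINT x:box a b|lborel. t i j x))"
    using sI tI by (simp add: fun_eq_iff set_integral_add)
  finally show ?thesis by (simp add: ip_def s_def t_def)
qed

text \<open>The sum vanishes term by term: for each pair of indices the bracket is half the integral
  of the derivative of \<open>w $ j * (u $ i)\<^sup>2\<close> in direction \<open>j\<close>.\<close>

lemma Bform_skew:
  assumes d: "CARD('d) \<le> 3" and w: "w \<in> H1vec a b" and u: "u \<in> H1vec a b"
  shows "ip a b (Bform w u) u = 0"
proof -
  have C: "f \<in> H1vec a b \<Longrightarrow> (\<lambda>x. f x $ i) \<in> H1per a b" for f i by (simp add: H1vec_def)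
  note G = L2_component[OF H1perD(6)[OF C]]
  note P = H1per_mult_L2[OF d]
  have "ip a b (\<lambda>x. wgrad (\<lambda>y. u y $ i) x $ j) (\<lambda>x. w x $ j * u x $ i)
      + 1 / 2 * ip a b (\<lambda>x. wgrad (\<lambda>y. w y $ j) x $ j) (\<lambda>x. u x $ i * u x $ i) = 0" for i j
  proof -
    define s where "s x = wgrad (\<lambda>y. u y $ i) x $ j * (w x $ j * u x $ i)" for x
    define t where "t x = wgrad (\<lambda>y. w y $ j) x $ j * (u x $ i * u x $ i)" for x
    have sI: "set_integrable lborel (box a b) s"
      using integrable_inner(1)[OF G[OF u] P[OF C[OF w] C[OF u]], of i j j i] by (simp add: s_def[abs_def])
    have tI: "set_integrable lborel (box a b) t"
      using integrable_inner(1)[OF G[OF w] P[OF C[OF u] C[OF u]], of j j i i] by (simp add: t_def[abs_def])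
    have eq: "(\<lambda>x. wgrad (\<lambda>y. w y $ j) x $ j * (u x $ i)\<^sup>2 + 2 * (w x $ j) * (u x $ i) * wgrad (\<lambda>y. u y $ i) x $ j)
        = (\<lambda>x. t x + 2 * s x)"
      by (auto simp: s_def t_def power2_eq_square)
    have its: "set_integrable lborel (box a b) (\<lambda>x. t x + 2 * s x)"
      using sI tI by (intro set_integral_add set_integrable_mult_right)
    have "(LINT x:box a b|lborel. t x + 2 * s x) = 0"
      using integral_derivative_product_zero[of "\<lambda>x. w x $ j" "wgrad (\<lambda>y. w y $ j)" "\<lambda>x. u x $ i" "wgrad (\<lambda>y. u y $ i)" j]
        H1perD[OF C[OF w]] H1perD[OF C[OF u]] its unfolding eq by blast
    moreover have "(LINT x:box a b|lborel. t x + 2 * s x) = (LINT x:box a b|lborel. t x) + 2 * (LINT x:box a b|lborel. s x)"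
      using sI tI by (simp add: set_integral_add)
    ultimately show ?thesis by (simp add: ip_def s_def t_def)
  qed
  then show ?thesis by (simp add: Bform_expansion[OF d w u u])
qed

end

section \<open>Bounded operators and forms on a semi-Hilbert space\<close>

locale hilbert_cell = periodic_cell a b + semi_hilbert S I
  for a b :: "real^'d" and S :: "'v::real_vector set" and I
begin

text \<open>Linearity is asked for almost everywhere only, because \<open>wgrad\<close> chooses a
  representative for each function separately.\<close>

definition bounded_op :: "('v \<Rightarrow> real^'d \<Rightarrow> 'b::euclidean_space) \<Rightarrow> bool"
  where "bounded_op T \<longleftrightarrow> (\<forall>x\<in>S. L2 (T x)) \<and>
    (\<forall>x\<in>S. \<forall>y\<in>S. AE t in lborel. T (x + y) t = T x t + T y t) \<and>
    (\<forall>x\<in>S. \<forall>c. AE t in lborel. T (c *\<^sub>R x) t = c *\<^sub>R T x t) \<and>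
    (\<exists>C. \<forall>x\<in>S. l2 (T x) \<le> C * N x)"

lemma bounded_opD:
  assumes "bounded_op T"
  shows "x \<in> S \<Longrightarrow> L2 (T x)"
    and "x \<in> S \<Longrightarrow> y \<in> S \<Longrightarrow> AE t in lborel. T (x + y) t = T x t + T y t"
    and "x \<in> S \<Longrightarrow> AE t in lborel. T (c *\<^sub>R x) t = c *\<^sub>R T x t"
  using assms by (auto simp: bounded_op_def)

lemma bounded_op_bound:
  assumes "bounded_op T"
  obtains C where "C \<ge> 0" "\<And>x. x \<in> S \<Longrightarrow> l2 (T x) \<le> C * N x"
proof -
  obtain C where C: "\<forall>x\<in>S. l2 (T x) \<le> C * N x" using assms unfolding bounded_op_def by blast
  have "l2 (T x) \<le> \<bar>C\<bar> * N x" if "x \<in> S" for x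
    using C that mult_right_mono[OF abs_ge_self[of C] N_nonneg[OF that]] by fastforce
  then show thesis by (rule that[rotated]) auto
qed

lemma ip_op_add:
  assumes T: "bounded_op T" and x: "x \<in> S" and y: "y \<in> S" and g: "L2 g"
  shows "ip a b (T (x + y)) g = ip a b (T x) g + ip a b (T y) g"
proof -
  note L = bounded_opD(1)[OF T]
  have "ip a b (T (x + y)) g = ip a b (\<lambda>t. T x t + T y t) g"
    using bounded_opD(2)[OF T x y] L2_measurable[OF L[OF closed(2)[OF x y]]] L2_measurable[OF L2_add[OF L[OF x] L[OF y]]] L2_measurable[OF g]
    by (intro ip_cong_AE) auto
  then show ?thesis by (simp add: ip_add_left[OF L[OF x] L[OF y] g])
qed

lemma ip_op_scale:
  assumes T: "bounded_op T" and x: "x \<in> S" and g: "L2 g"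
  shows "ip a b (T (c *\<^sub>R x)) g = c * ip a b (T x) g"
proof -
  note L = bounded_opD(1)[OF T]
  have "ip a b (T (c *\<^sub>R x)) g = ip a b (\<lambda>t. c *\<^sub>R T x t) g"
    using bounded_opD(3)[OF T x, where c = c] L2_measurable[OF L[OF closed(3)[OF x]]] L2_measurable[OF L2_scale[OF L[OF x]]] L2_measurable[OF g]
    by (intro ip_cong_AE) auto
  then show ?thesis by (simp add: ip_scale_left)
qed

lemma bounded_form_ip:
  assumes T: "bounded_op T" and U: "bounded_op U"
  shows "bounded_form (\<lambda>x y. ip a b (T x) (U y))"
proof -
  note LT = bounded_opD(1)[OF T] and LU = bounded_opD(1)[OF U]
  obtain C where C: "C \<ge> 0" "\<And>x. x \<in> S \<Longrightarrow> l2 (T x) \<le> C * N x" using bounded_op_bound[OF T] by blast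
  obtain D where D: "D \<ge> 0" "\<And>x. x \<in> S \<Longrightarrow> l2 (U x) \<le> D * N x" using bounded_op_bound[OF U] by blast
  have "\<bar>ip a b (T x) (U y)\<bar> \<le> (C * D) * (N x * N y)" if "x \<in> S" "y \<in> S" for x y
  proof -
    have "\<bar>ip a b (T x) (U y)\<bar> \<le> l2 (T x) * l2 (U y)" by (intro integrable_inner LT LU that)
    also have "\<dots> \<le> (C * N x) * (D * N y)" using that C D by (intro mult_mono) (auto simp: N_nonneg)
    finally show ?thesis by (simp add: mult_ac)
  qed
  moreover have "ip a b (T x) (U (y + z)) = ip a b (T x) (U y) + ip a b (T x) (U z)"
    "ip a b (T x) (U (c *\<^sub>R y)) = c * ip a b (T x) (U y)" if "x \<in> S" "y \<in> S" "z \<in> S" for x y z c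
    using ip_op_add[OF U that(2,3) LT[OF that(1)]] ip_op_scale[OF U that(2) LT[OF that(1)]] by (simp_all add: ip_commute)
  ultimately show ?thesis
    unfolding bounded_form_def by (auto simp: ip_op_add[OF T] ip_op_scale[OF T] LU intro!: exI[of _ "C * D"])
qed

lemma bounded_functional_ip:
  assumes f: "L2 f" and T: "bounded_op T"
  shows "bounded_functional (\<lambda>x. ip a b f (T x))"
proof -
  note LT = bounded_opD(1)[OF T]
  obtain C where C: "C \<ge> 0" "\<And>x. x \<in> S \<Longrightarrow> l2 (T x) \<le> C * N x" using bounded_op_bound[OF T] by blast
  have "\<bar>ip a b f (T x)\<bar> \<le> (l2 f * C) * N x" if "x \<in> S" for x
  proof -
    have "\<bar>ip a b f (T x)\<bar> \<le> l2 f * l2 (T x)" by (intro integrable_inner f LT that)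
    also have "\<dots> \<le> l2 f * (C * N x)" using that C by (intro mult_left_mono) auto
    finally show ?thesis by (simp add: mult_ac)
  qed
  then show ?thesis
    unfolding bounded_functional_def ip_commute[of f]
    by (auto simp: ip_op_add[OF T _ _ f] ip_op_scale[OF T _ f] ip_commute[of f] intro!: exI[of _ "l2 f * C"])
qed

text \<open>Here \<open>K t\<close> acts on the value at the point \<open>t\<close>. Components,
  bounded multipliers and inner products with a bounded field are the instances.\<close>

lemma bounded_op_linear_map:
  fixes K :: "real^'d \<Rightarrow> 'b::euclidean_space \<Rightarrow> 'c::euclidean_space"
  assumes T: "bounded_op T" and lin: "\<And>t. linear (K t)" and B: "\<And>t y. norm (K t y) \<le> B * norm y" "B \<ge> 0"
    and meas: "\<And>f. f \<in> borel_measurable borel \<Longrightarrow> (\<lambda>t. K t (f t)) \<in> borel_measurable borel"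
  shows "bounded_op (\<lambda>x t. K t (T x t))"
proof -
  note LT = bounded_opD(1)[OF T]
  obtain C where C: "C \<ge> 0" "\<And>x. x \<in> S \<Longrightarrow> l2 (T x) \<le> C * N x" using bounded_op_bound[OF T] by blast
  have L: "L2 (\<lambda>t. K t (T x t))" and l: "l2 (\<lambda>t. K t (T x t)) \<le> B * l2 (T x)" if "x \<in> S" for x
    by (rule L2_bound[OF LT[OF that] meas[OF L2_measurable[OF LT[OF that]]] B(2,1)])+
  have "l2 (\<lambda>t. K t (T x t)) \<le> (B * C) * N x" if "x \<in> S" for x
    using l[OF that] mult_left_mono[OF C(2)[OF that] B(2)] by (simp add: mult.assoc)
  moreover have "AE t in lborel. K t (T (x + y) t) = K t (T x t) + K t (T y t)" if "x \<in> S" "y \<in> S" for x y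
    using bounded_opD(2)[OF T that] by eventually_elim (simp add: linear_add[OF lin])
  moreover have "AE t in lborel. K t (T (c *\<^sub>R x) t) = c *\<^sub>R K t (T x t)" if "x \<in> S" for x c
    using bounded_opD(3)[OF T that, where c = c] by eventually_elim (simp add: linear_scale[OF lin])
  ultimately show ?thesis using L unfolding bounded_op_def by blast
qed

lemma bounded_op_component: "bounded_op T \<Longrightarrow> bounded_op (\<lambda>x t. T x t $ i)"
  by (rule bounded_op_linear_map[where K = "\<lambda>t y. y $ i" and B = 1])
     (auto simp: Finite_Cartesian_Product.norm_nth_le component_measurable intro!: bounded_linear.linear bounded_linear_vec_nth)

lemma bounded_op_mult_bounded:
  fixes h :: "real^'d \<Rightarrow> real" and T :: "'v \<Rightarrow> real^'d \<Rightarrow> real"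
  assumes T: "bounded_op T" and h: "h \<in> borel_measurable borel" "\<And>x. \<bar>h x\<bar> \<le> B"
  shows "bounded_op (\<lambda>x t. h t * T x t)"
proof (rule bounded_op_linear_map[OF T, where B = B])
  show "linear ((*) (h t))" for t by (rule bounded_linear.linear[OF bounded_linear_mult_right])
  show "norm (h t * y) \<le> B * norm y" for t y using h(2)[of t] by (simp add: abs_mult mult_right_mono)
  show "B \<ge> 0" using h(2)[of 0] by simp
qed (use h in auto)

lemma bounded_op_inner_bounded:
  assumes T: "bounded_op T" and Z: "Z \<in> borel_measurable borel" "\<And>x. norm (Z x) \<le> B"
  shows "bounded_op (\<lambda>x t. Z t \<bullet> T x t)"
proof (rule bounded_op_linear_map[OF T, where B = B])
  show "linear ((\<bullet>) (Z t))" for t by (rule bounded_linear.linear[OF bounded_linear_inner_right])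
  show "norm (Z t \<bullet> y) \<le> B * norm y" for t y
    using Cauchy_Schwarz_ineq2[of "Z t" y] mult_right_mono[OF Z(2)[of t], of "norm y"] by simp
  show "B \<ge> 0" using Z(2)[of 0] norm_ge_zero order_trans by blast
qed (use Z in auto)

lemma bounded_op_vec:
  fixes T :: "'v \<Rightarrow> real^'d \<Rightarrow> 'b::euclidean_space ^ 'n"
  assumes T: "\<And>i. bounded_op (\<lambda>x t. T x t $ i)"
  shows "bounded_op T"
proof -
  have "\<exists>C. \<forall>x\<in>S. l2 (\<lambda>t. T x t $ i) \<le> C * N x" for i using T[of i] by (simp add: bounded_op_def)
  then obtain C where C: "\<And>i x. x \<in> S \<Longrightarrow> l2 (\<lambda>t. T x t $ i) \<le> C i * N x" by metis
  have "l2 (T x) \<le> (\<Sum>i\<in>UNIV. C i) * N x" if x: "x \<in> S" for x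
  proof -
    have "l2 (T x) \<le> (\<Sum>i\<in>UNIV. l2 (\<lambda>t. T x t $ i))" by (rule L2_vec(2)[OF bounded_opD(1)[OF T x]])
    also have "\<dots> \<le> (\<Sum>i\<in>UNIV. C i * N x)" by (intro sum_mono C x)
    finally show ?thesis by (simp add: sum_distrib_right)
  qed
  moreover have "AE t in lborel. T (x + y) t = T x t + T y t" if "x \<in> S" "y \<in> S" for x y
  proof -
    have "AE t in lborel. \<forall>i\<in>UNIV. T (x + y) t $ i = T x t $ i + T y t $ i"
      using bounded_opD(2)[OF T that] by (intro AE_finite_allI) auto
    then show ?thesis by eventually_elim (simp add: vec_eq_iff)
  qed
  moreover have "AE t in lborel. T (c *\<^sub>R x) t = c *\<^sub>R T x t" if "x \<in> S" for x c
  proof -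
    have "AE t in lborel. \<forall>i\<in>UNIV. T (c *\<^sub>R x) t $ i = c *\<^sub>R T x t $ i"
      using bounded_opD(3)[OF T that, where c = c] by (intro AE_finite_allI) auto
    then show ?thesis by eventually_elim (simp add: vec_eq_iff)
  qed
  moreover have "L2 (T x)" if "x \<in> S" for x by (rule L2_vec(1)[OF bounded_opD(1)[OF T that]])
  ultimately show ?thesis unfolding bounded_op_def by blast
qed

text \<open>Modelled on the scalar components of the product space: linear at every point, unlike
  their gradients, and not increasing the norm.\<close>

definition h1_op :: "('v \<Rightarrow> real^'d \<Rightarrow> real) \<Rightarrow> bool"
  where "h1_op P \<longleftrightarrow> (\<forall>x\<in>S. P x \<in> H1per a b \<and> h1 (P x) (P x) \<le> I x x) \<and>
    (\<forall>x y. P (x + y) = P x + P y) \<and> (\<forall>x c. P (c *\<^sub>R x) = c *\<^sub>R P x)"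

lemma h1_opD:
  assumes "h1_op P"
  shows "x \<in> S \<Longrightarrow> P x \<in> H1per a b" "P (x + y) = P x + P y" "P (c *\<^sub>R x) = c *\<^sub>R P x"
    and "x \<in> S \<Longrightarrow> l2 (P x) \<le> N x" "x \<in> S \<Longrightarrow> l2 (wgrad (P x)) \<le> N x"
    and "x \<in> S \<Longrightarrow> sqrt (h1 (P x) (P x)) \<le> N x"
proof -
  show H: "x \<in> S \<Longrightarrow> P x \<in> H1per a b" "P (x + y) = P x + P y" "P (c *\<^sub>R x) = c *\<^sub>R P x" for x y c
    using assms by (auto simp: h1_op_def)
  have le: "(l2 (P x))\<^sup>2 + (l2 (wgrad (P x)))\<^sup>2 \<le> I x x" if "x \<in> S"
    using assms that by (simp add: h1_op_def h1_self[symmetric])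
  have "(l2 (P x))\<^sup>2 \<le> I x x" "(l2 (wgrad (P x)))\<^sup>2 \<le> I x x" if "x \<in> S"
    using le[OF that] zero_le_power2[of "l2 (P x)"] zero_le_power2[of "l2 (wgrad (P x))"] by linarith+
  then show "x \<in> S \<Longrightarrow> l2 (P x) \<le> N x" "x \<in> S \<Longrightarrow> l2 (wgrad (P x)) \<le> N x"
    by (auto simp: N_def intro: real_le_rsqrt)
  show "x \<in> S \<Longrightarrow> sqrt (h1 (P x) (P x)) \<le> N x"
    using assms by (simp add: h1_op_def N_def)
qed

lemma bounded_op_H1: "h1_op P \<Longrightarrow> bounded_op P"
  unfolding bounded_op_def
  by (auto simp: h1_opD H1perD(3) intro!: exI[of _ 1])

lemma bounded_op_wgrad:
  assumes P: "h1_op P"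
  shows "bounded_op (\<lambda>x. wgrad (P x))"
proof -
  note PS = h1_opD(1)[OF P]
  have "AE t in lborel. wgrad (P (x + y)) t = wgrad (P x) t + wgrad (P y) t" if "x \<in> S" "y \<in> S" for x y
    using H1per_fun(4)[OF PS[OF that(1)] PS[OF that(2)]] by (simp add: h1_opD(2)[OF P])
  moreover have "AE t in lborel. wgrad (P (c *\<^sub>R x)) t = c *\<^sub>R wgrad (P x) t" if "x \<in> S" for x c
    using H1per_fun(5)[OF PS[OF that] PS[OF that], of c] by (simp add: h1_opD(3)[OF P])
  ultimately show ?thesis
    unfolding bounded_op_def using H1perD(6)[OF PS] h1_opD(5)[OF P] by (auto intro!: exI[of _ 1])
qed

text \<open>The multiplier may be unbounded; the product estimate pays for it with one H1 norm of
  the argument instead of an L2 norm.\<close>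

lemma bounded_op_H1_mult:
  assumes d: "CARD('d) \<le> 3" and h: "h \<in> H1per a b" and P: "h1_op P"
  shows "bounded_op (\<lambda>x t. h t * P x t)"
proof -
  obtain C where C: "C \<ge> 0" "\<And>f g. f \<in> H1per a b \<Longrightarrow> g \<in> H1per a b \<Longrightarrow> L2 (\<lambda>x. f x * g x) \<and>
      l2 (\<lambda>x. f x * g x) \<le> C * (sqrt (h1 f f) * sqrt (h1 g g))"
    using H1per_product_L2[OF d] by blast
  have "l2 (\<lambda>t. h t * P x t) \<le> (C * sqrt (h1 h h)) * N x" if x: "x \<in> S" for x
  proof -
    have "l2 (\<lambda>t. h t * P x t) \<le> C * (sqrt (h1 h h) * sqrt (h1 (P x) (P x)))"
      using C(2)[OF h h1_opD(1)[OF P x]] by simp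
    also have "\<dots> \<le> C * (sqrt (h1 h h) * N x)"
      using C(1) h1_opD(6)[OF P x] h by (intro mult_left_mono) (auto simp: h1_self)
    finally show ?thesis by (simp add: mult.assoc)
  qed
  then show ?thesis
    unfolding bounded_op_def using C(2)[OF h h1_opD(1)[OF P]]
    by (auto simp: h1_opD[OF P] distrib_left intro!: exI[of _ "C * sqrt (h1 h h)"])
qed

text \<open>Meant for the divergence term: solution and test function multiply each other there, so
  the form is not a pairing of two bounded operators and \<open>bounded_form_ip\<close> does not
  cover it.\<close>

lemma bounded_form_trilinear:
  assumes d: "CARD('d) \<le> 3" and D: "L2 D" and P: "h1_op P" and Q: "h1_op Q"
  shows "bounded_form (\<lambda>x y. ip a b D (\<lambda>t. P x t * Q y t))"
proof -
  obtain C where C: "C \<ge> 0" "\<And>f g. f \<in> H1per a b \<Longrightarrow> g \<in> H1per a b \<Longrightarrow> L2 (\<lambda>x. f x * g x) \<and>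
      l2 (\<lambda>x. f x * g x) \<le> C * (sqrt (h1 f f) * sqrt (h1 g g))"
    using H1per_product_L2[OF d] by blast
  note PS = h1_opD(1)[OF P] and QS = h1_opD(1)[OF Q]
  have L: "L2 (\<lambda>t. P x t * Q y t)" if "x \<in> S" "y \<in> S" for x y
    using C(2)[OF PS[OF that(1)] QS[OF that(2)]] by simp
  have "\<bar>ip a b D (\<lambda>t. P x t * Q y t)\<bar> \<le> (l2 D * C) * (N x * N y)" if x: "x \<in> S" and y: "y \<in> S" for x y
  proof -
    have "\<bar>ip a b D (\<lambda>t. P x t * Q y t)\<bar> \<le> l2 D * l2 (\<lambda>t. P x t * Q y t)"
      by (rule integrable_inner(2)[OF D L[OF x y]])
    also have "\<dots> \<le> l2 D * (C * (sqrt (h1 (P x) (P x)) * sqrt (h1 (Q y) (Q y))))"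
      using C(2)[OF PS[OF x] QS[OF y]] by (intro mult_left_mono) auto
    also have "\<dots> \<le> l2 D * (C * (N x * N y))"
      using C(1) h1_opD(6)[OF P x] h1_opD(6)[OF Q y] x y PS QS
      by (intro mult_left_mono mult_mono) (auto simp: N_nonneg h1_self)
    finally show ?thesis by (simp add: mult_ac)
  qed
  moreover have "ip a b D (\<lambda>t. P (x + y) t * Q z t) = ip a b D (\<lambda>t. P x t * Q z t) + ip a b D (\<lambda>t. P y t * Q z t)"
    "ip a b D (\<lambda>t. P x t * Q (y + z) t) = ip a b D (\<lambda>t. P x t * Q y t) + ip a b D (\<lambda>t. P x t * Q z t)"
    if "x \<in> S" "y \<in> S" "z \<in> S" for x y z
    using ip_add_right[OF L[OF that(1,3)] L[OF that(2,3)] D] ip_add_right[OF L[OF that(1,2)] L[OF that(1,3)] D]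
    by (simp_all add: h1_opD(2)[OF P] h1_opD(2)[OF Q] distrib_left distrib_right)
  moreover have "ip a b D (\<lambda>t. P (c *\<^sub>R x) t * Q y t) = c * ip a b D (\<lambda>t. P x t * Q y t)"
    "ip a b D (\<lambda>t. P x t * Q (c *\<^sub>R y) t) = c * ip a b D (\<lambda>t. P x t * Q y t)" for x y c
    using ip_scale_right[of D c "\<lambda>t. P x t * Q y t"]
    by (simp_all add: h1_opD(3)[OF P] h1_opD(3)[OF Q] mult_ac)
  ultimately show ?thesis
    unfolding bounded_form_def by (blast intro: exI[of _ "l2 D * C"])
qed

lemma bounded_form_cong:
  assumes "bounded_form B" "\<And>x y. x \<in> S \<Longrightarrow> y \<in> S \<Longrightarrow> C x y = B x y"
  shows "bounded_form C"
  using assms(1) unfolding bounded_form_def by (simp add: assms(2) closed)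

lemma bounded_form_sum:
  "finite A \<Longrightarrow> (\<And>i. i \<in> A \<Longrightarrow> bounded_form (B i)) \<Longrightarrow> bounded_form (\<lambda>x y. \<Sum>i\<in>A. B i x y)"
proof (induction A rule: finite_induct)
  case empty
  show ?case by (auto simp: bounded_form_def intro!: exI[of _ 0])
next
  case (insert i A)
  then show ?case using bounded_form_add[of "B i" "\<lambda>x y. \<Sum>i\<in>A. B i x y"] by simp
qed

end

context semi_hilbert begin

lemma bounded_form_zero: "bounded_form B \<Longrightarrow> x \<in> S \<Longrightarrow> B x 0 = 0"
  unfolding bounded_form_def using closed(1) by (metis mult_zero_left scale_zero_left)

lemma bounded_functional_zero: "bounded_functional F \<Longrightarrow> F 0 = 0"
  unfolding bounded_functional_def using closed(1) by (metis mult_zero_left scale_zero_left)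

end

section \<open>The coupled variational problem\<close>

context periodic_cell begin

lemma ip_vec:
  fixes f g :: "real^'d \<Rightarrow> 'b::euclidean_space ^ 'n"
  assumes "L2 f" "L2 g"
  shows "ip a b f g = (\<Sum>i\<in>UNIV. ip a b (\<lambda>x. f x $ i) (\<lambda>x. g x $ i))"
  unfolding ip_def inner_vec_def
  by (rule box_integral_sum[OF finite integrable_inner(1)[OF L2_component L2_component]]) (use assms in auto)

definition unknowns_space :: "'d unknowns set"
  where "unknowns_space = H1vec a b \<times> (H1bar a b \<times> (H1bar a b \<times> (H1bar a b \<times> H1bar a b)))"

definition unknowns_ip :: "'d unknowns \<Rightarrow> 'd unknowns \<Rightarrow> real"
  where "unknowns_ip = (\<lambda>x y. h1v (fst x) (fst y) + (h1 (fst (snd x)) (fst (snd y))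
    + (h1 (fst (snd (snd x))) (fst (snd (snd y))) + (h1 (fst (snd (snd (snd x)))) (fst (snd (snd (snd y))))
    + h1 (snd (snd (snd (snd x)))) (snd (snd (snd (snd y))))))))"

lemma semi_hilbert_unknowns: "semi_hilbert unknowns_space unknowns_ip"
  unfolding unknowns_space_def unknowns_ip_def
  using semi_hilbert_prod[OF semi_hilbert_H1vec semi_hilbert_prod[OF semi_hilbert_H1bar
    semi_hilbert_prod[OF semi_hilbert_H1bar semi_hilbert_prod[OF semi_hilbert_H1bar semi_hilbert_H1bar]]]] .

lemma hilbert_cell_unknowns: "hilbert_cell a b unknowns_space unknowns_ip"
  by (intro hilbert_cell.intro semi_hilbert_unknowns periodic_cell_axioms)

text \<open>Testing the five equations with the solution itself, the transport terms cancel between the momentum and the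
  phase equations, the terms \<open>(\<phi>, \<mu>)\<close> cancel between the phase equations and the potentials, and the terms with
  factor \<open>\<alpha>\<close> complete the square \<open>\<alpha> \<bar>\<rho> - Z \<bullet> \<nabla>\<phi>\<bar>\<^sup>2\<close>.\<close>

theorem linear_scheme_uniquely_solvable:
  fixes w Z f1 :: "real^'d \<Rightarrow> real^'d" and \<phi>s \<rho>s H f2 f4 g1 g2 g3 g5 g6 g7 :: "real^'d \<Rightarrow> real"
    and f3 f5 :: "(real^'d \<Rightarrow> real) \<Rightarrow> real"
  assumes d: "CARD('d) \<le> 3"
    and pos: "dt > 0" "\<nu> > 0" "M1 > 0" "M2 > 0" "\<epsilon> > 0" "\<eta> > 0" "\<alpha> > 0" "\<beta> > 0"
    and w: "w \<in> H1vec a b" and \<phi>s: "\<phi>s \<in> H1per a b" and \<rho>s: "\<rho>s \<in> H1per a b"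
    and Z: "Z \<in> borel_measurable borel" "\<And>x. norm (Z x) \<le> 1"
    and H: "H \<in> borel_measurable borel" "\<And>x. \<bar>H x\<bar> \<le> BH"
    and data: "L2 f1" "L2 f2" "L2 f4" "L2 g1" "L2 g2" "L2 g3" "L2 g5" "L2 g6" "L2 g7"
    and f3: "\<And>\<psi>. f3 \<psi> = s1 * ip a b g1 (\<lambda>x. \<phi>s x * \<psi> x) + s2 * ip a b g2 (\<lambda>x. Z x \<bullet> wgrad \<psi> x)
      + s3 * ip a b g3 \<psi> + s4 * ip a b Z (wgrad \<psi>)"
    and f5: "\<And>r. f5 r = s5 * ip a b g5 r + s6 * ip a b g6 r + s7 * ip a b g7 r"
  shows "unique_up_to eq_ae (\<lambda>(u, \<mu>\<^sub>\<phi>, \<phi>, \<mu>\<^sub>\<rho>, \<rho>).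
    u \<in> H1vec a b \<and> \<mu>\<^sub>\<phi> \<in> H1bar a b \<and> \<phi> \<in> H1bar a b \<and> \<mu>\<^sub>\<rho> \<in> H1bar a b \<and> \<rho> \<in> H1bar a b \<and>
    (\<forall>v\<in>H1vec a b.
      ip a b u v + 2 * dt / 3 * ip a b (Bform w u) v
      + 2 * dt / 3 * \<nu> * ip a b (vgrad u) (vgrad v)
      + 2 * dt / 3 * ip a b (\<lambda>x. \<phi>s x *\<^sub>R wgrad \<mu>\<^sub>\<phi> x + \<rho>s x *\<^sub>R wgrad \<mu>\<^sub>\<rho> x) v
      = ip a b f1 v) \<and>
    (\<forall>w\<in>H1bar a b.
      ip a b \<phi> w - 2 * dt / 3 * ip a b (\<lambda>x. \<phi>s x *\<^sub>R u x) (wgrad w)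
      + 2 * dt / 3 * M1 * ip a b (wgrad \<mu>\<^sub>\<phi>) (wgrad w)
      = ip a b f2 w) \<and>
    (\<forall>\<psi>\<in>H1bar a b.
      - ip a b \<mu>\<^sub>\<phi> \<psi> + \<epsilon> * ip a b (wgrad \<phi>) (wgrad \<psi>)
      + 2/\<epsilon> * ip a b (\<lambda>x. \<phi>s x * \<phi> x) (\<lambda>x. \<phi>s x * \<psi> x)
      - \<alpha> * ip a b (\<lambda>x. \<rho> x *\<^sub>R Z x) (wgrad \<psi>)
      + \<alpha> * ip a b (\<lambda>x. Z x \<bullet> wgrad \<phi> x) (\<lambda>x. Z x \<bullet> wgrad \<psi> x)
      = f3 \<psi>) \<and>
    (\<forall>w\<in>H1bar a b.
      ip a b \<rho> w - 2 * dt / 3 * ip a b (\<lambda>x. \<rho>s x *\<^sub>R u x) (wgrad w)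
      + 2 * dt / 3 * M2 * ip a b (wgrad \<mu>\<^sub>\<rho>) (wgrad w)
      = ip a b f4 w) \<and>
    (\<forall>r\<in>H1bar a b.
      - ip a b \<mu>\<^sub>\<rho> r + \<eta> * ip a b (wgrad \<rho>) (wgrad r) + \<alpha> * ip a b \<rho> r
      - \<alpha> * ip a b (\<lambda>x. Z x \<bullet> wgrad \<phi> x) r
      + \<beta>/2 * ip a b (\<lambda>x. H x * \<rho> x) (\<lambda>x. H x * r x)
      = f5 r))"
proof -
  interpret hilbert_cell a b unknowns_space unknowns_ip by (rule hilbert_cell_unknowns)
  define c where "c = 2 * dt / 3"
  have c: "c > 0" using pos by (simp add: c_def)
  define u where "u X = fst X" for X :: "'d unknowns"
  define m where "m X = fst (snd X)" for X :: "'d unknowns"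
  define p where "p X = fst (snd (snd X))" for X :: "'d unknowns"
  define k where "k X = fst (snd (snd (snd X)))" for X :: "'d unknowns"
  define r where "r X = snd (snd (snd (snd X)))" for X :: "'d unknowns"
  note projs = u_def m_def p_def k_def r_def
  have mem: "X \<in> unknowns_space \<longleftrightarrow>
      u X \<in> H1vec a b \<and> m X \<in> H1bar a b \<and> p X \<in> H1bar a b \<and> k X \<in> H1bar a b \<and> r X \<in> H1bar a b" for X
    by (simp add: unknowns_space_def projs mem_Times_iff)
  have ipX: "unknowns_ip X Y = h1v (u X) (u Y) + (h1 (m X) (m Y) + (h1 (p X) (p Y) + (h1 (k X) (k Y) + h1 (r X) (r Y))))" for X Y
    by (simp add: unknowns_ip_def projs)
  have bar: "f \<in> H1bar a b \<Longrightarrow> f \<in> H1per a b" for f by (simp add: H1bar_def)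
  have vec: "f \<in> H1vec a b \<Longrightarrow> (\<lambda>x. f x $ i) \<in> H1per a b" for f i by (simp add: H1vec_def)
  have h1_pos: "0 \<le> h1 f f" if "f \<in> H1per a b" for f using that by (simp add: h1_self)
  have h1v_pos: "0 \<le> h1v f f" if "f \<in> H1vec a b" for f
    unfolding h1v_def using that by (intro sum_nonneg h1_pos vec)
  have nonneg: "0 \<le> h1v (u X) (u X)" "0 \<le> h1 (m X) (m X)" "0 \<le> h1 (p X) (p X)" "0 \<le> h1 (k X) (k X)" "0 \<le> h1 (r X) (r X)"
    if "X \<in> unknowns_space" for X
    using that by (auto simp: mem intro: h1_pos h1v_pos bar)
  have U: "h1_op (\<lambda>X t. u X t $ i)" for i
    unfolding h1_op_def
  proof (intro conjI ballI allI)
    fix X assume X: "X \<in> unknowns_space"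
    show "(\<lambda>t. u X t $ i) \<in> H1per a b" using X by (auto simp: mem intro: vec)
    have "h1 (\<lambda>t. u X t $ i) (\<lambda>t. u X t $ i) \<le> h1v (u X) (u X)"
      unfolding h1v_def using X
      by (intro member_le_sum[where f = "\<lambda>i. h1 (\<lambda>t. u X t $ i) (\<lambda>t. u X t $ i)"]) (auto simp: mem intro!: h1_pos vec)
    then show "h1 (\<lambda>t. u X t $ i) (\<lambda>t. u X t $ i) \<le> unknowns_ip X X" using nonneg[OF X] by (simp add: ipX)
  qed (auto simp: projs fun_eq_iff)
  have M: "h1_op m" and P: "h1_op p" and K: "h1_op k" and R: "h1_op r"
    unfolding h1_op_def using nonneg by (auto simp: ipX mem intro: bar) (auto simp: projs)
  have opU: "bounded_op u" by (rule bounded_op_vec[OF bounded_op_H1[OF U]])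
  have opGU: "bounded_op (\<lambda>X. vgrad (u X))"
    by (rule bounded_op_vec) (use bounded_op_wgrad[OF U] in \<open>simp add: vgrad_def\<close>)
  have opHU: "bounded_op (\<lambda>X t. h t *\<^sub>R u X t)" if "h \<in> H1per a b" for h
    by (rule bounded_op_vec) (use bounded_op_H1_mult[OF d that U] in simp)
  have opZ: "bounded_op (\<lambda>X t. Z t \<bullet> wgrad (q X) t)" if "h1_op q" for q
    by (rule bounded_op_inner_bounded[OF bounded_op_wgrad[OF that] Z])
  have opH: "bounded_op (\<lambda>X t. H t * q X t)" if "h1_op q" for q
    by (rule bounded_op_mult_bounded[OF bounded_op_H1[OF that] H])
  \<comment> \<open>With \<open>Z\<close> moved onto the other gradient, the pairing becomes one of
    two bounded operators and takes the shape of the mixed term in the fifth equation.\<close>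
  have RZ: "ip a b (\<lambda>x. r X x *\<^sub>R Z x) g = ip a b (r X) (\<lambda>x. Z x \<bullet> g x)" for X and g :: "real^'d \<Rightarrow> real^'d"
    by (simp add: ip_def)
  define E1 where "E1 X v = ip a b (u X) v + c * ip a b (Bform w (u X)) v + c * \<nu> * ip a b (vgrad (u X)) (vgrad v)
      + c * ip a b (\<lambda>x. \<phi>s x *\<^sub>R wgrad (m X) x + \<rho>s x *\<^sub>R wgrad (k X) x) v" for X v
  define E2 where "E2 X v = ip a b (p X) v - c * ip a b (\<lambda>x. \<phi>s x *\<^sub>R u X x) (wgrad v)
      + c * M1 * ip a b (wgrad (m X)) (wgrad v)" for X v
  define E3 where "E3 X v = - ip a b (m X) v + \<epsilon> * ip a b (wgrad (p X)) (wgrad v)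
      + 2/\<epsilon> * ip a b (\<lambda>x. \<phi>s x * p X x) (\<lambda>x. \<phi>s x * v x)
      - \<alpha> * ip a b (\<lambda>x. r X x *\<^sub>R Z x) (wgrad v)
      + \<alpha> * ip a b (\<lambda>x. Z x \<bullet> wgrad (p X) x) (\<lambda>x. Z x \<bullet> wgrad v x)" for X v
  define E4 where "E4 X v = ip a b (r X) v - c * ip a b (\<lambda>x. \<rho>s x *\<^sub>R u X x) (wgrad v)
      + c * M2 * ip a b (wgrad (k X)) (wgrad v)" for X v
  define E5 where "E5 X v = - ip a b (k X) v + \<eta> * ip a b (wgrad (r X)) (wgrad v) + \<alpha> * ip a b (r X) v
      - \<alpha> * ip a b (\<lambda>x. Z x \<bullet> wgrad (p X) x) v
      + \<beta>/2 * ip a b (\<lambda>x. H x * r X x) (\<lambda>x. H x * v x)" for X v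
  \<comment> \<open>The left factor need not be L2. Moving \<open>\<phi>s\<close> and
    \<open>\<rho>s\<close> onto the velocity leaves pairings of L2 fields, and these are the
    transport terms of the phase equations.\<close>
  have coupling: "ip a b (\<lambda>x. \<phi>s x *\<^sub>R wgrad (m X) x + \<rho>s x *\<^sub>R wgrad (k X) x) (u Y)
      = ip a b (wgrad (m X)) (\<lambda>x. \<phi>s x *\<^sub>R u Y x) + ip a b (wgrad (k X)) (\<lambda>x. \<rho>s x *\<^sub>R u Y x)"
    if "X \<in> unknowns_space" "Y \<in> unknowns_space" for X Y
  proof -
    have 1: "set_integrable lborel (box a b) (\<lambda>x. wgrad (m X) x \<bullet> (\<phi>s x *\<^sub>R u Y x))"
      by (rule integrable_inner(1)[OF bounded_opD(1)[OF bounded_op_wgrad[OF M] that(1)] bounded_opD(1)[OF opHU[OF \<phi>s] that(2)]])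
    have 2: "set_integrable lborel (box a b) (\<lambda>x. wgrad (k X) x \<bullet> (\<rho>s x *\<^sub>R u Y x))"
      by (rule integrable_inner(1)[OF bounded_opD(1)[OF bounded_op_wgrad[OF K] that(1)] bounded_opD(1)[OF opHU[OF \<rho>s] that(2)]])
    from set_integral_add(2)[OF 1 2] show ?thesis
      by (simp add: ip_def inner_add_left)
  qed
  \<comment> \<open>In the gradient part \<open>w\<close> multiplies only the test function, so
    \<open>bounded_form_ip\<close> suffices; in the divergence part \<open>u X\<close> multiplies
    \<open>u Y\<close>.\<close>
  have BB: "bounded_form (\<lambda>X Y. ip a b (Bform w (u X)) (u Y))"
  proof (rule bounded_form_cong)
    have "bounded_form (\<lambda>X Y. ip a b (\<lambda>x. wgrad (\<lambda>y. u X y $ i) x $ j) (\<lambda>x. w x $ j * u Y x $ i))" for i j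
      by (rule bounded_form_ip[OF bounded_op_component[OF bounded_op_wgrad[OF U]] bounded_op_H1_mult[OF d vec[OF w] U]])
    moreover have "bounded_form (\<lambda>X Y. ip a b (\<lambda>x. wgrad (\<lambda>y. w y $ j) x $ j) (\<lambda>x. u X x $ i * u Y x $ i))" for i j
      by (rule bounded_form_trilinear[OF d L2_component[OF H1perD(6)[OF vec[OF w]]] U U])
    ultimately show "bounded_form (\<lambda>X Y. \<Sum>i\<in>UNIV. \<Sum>j\<in>UNIV.
      ip a b (\<lambda>x. wgrad (\<lambda>y. u X y $ i) x $ j) (\<lambda>x. w x $ j * u Y x $ i)
      + 1 / 2 * ip a b (\<lambda>x. wgrad (\<lambda>y. w y $ j) x $ j) (\<lambda>x. u X x $ i * u Y x $ i))"
      by (intro bounded_form_sum bounded_form_add bounded_form_cmult finite)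
  qed (simp add: mem Bform_expansion[OF d w])
  note form_rules = bounded_form_ip bounded_op_H1 bounded_op_wgrad bounded_op_H1_mult[OF d \<phi>s]
    bounded_op_H1_mult[OF d \<rho>s] opU opGU opHU[OF \<phi>s] opHU[OF \<rho>s] opZ opH U M P K R
  have neg: "bounded_form (\<lambda>X Y. - B X Y)" if "bounded_form B" for B
    using bounded_form_cmult[OF that, of "-1"] by simp
  have sub: "bounded_form (\<lambda>X Y. B X Y - C X Y)" if "bounded_form B" "bounded_form C" for B C
    using bounded_form_add[OF that(1) neg[OF that(2)]] by simp
  have F1: "bounded_form (\<lambda>X Y. E1 X (u Y))"
  proof (rule bounded_form_cong)
    show "bounded_form (\<lambda>X Y. ip a b (u X) (u Y) + c * ip a b (Bform w (u X)) (u Y) + c * \<nu> * ip a b (vgrad (u X)) (vgrad (u Y))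
      + c * (ip a b (wgrad (m X)) (\<lambda>x. \<phi>s x *\<^sub>R u Y x) + ip a b (wgrad (k X)) (\<lambda>x. \<rho>s x *\<^sub>R u Y x)))"
      by (rule bounded_form_add bounded_form_cmult BB form_rules)+
  qed (simp add: E1_def coupling)
  have F2: "bounded_form (\<lambda>X Y. E2 X (m Y))"
    unfolding E2_def by (rule bounded_form_add sub bounded_form_cmult form_rules)+
  have F3: "bounded_form (\<lambda>X Y. E3 X (p Y))"
    unfolding E3_def RZ by (rule bounded_form_add sub neg bounded_form_cmult form_rules)+
  have F4: "bounded_form (\<lambda>X Y. E4 X (k Y))"
    unfolding E4_def by (rule bounded_form_add sub bounded_form_cmult form_rules)+
  have F5: "bounded_form (\<lambda>X Y. E5 X (r Y))"
    unfolding E5_def by (rule bounded_form_add sub neg bounded_form_cmult form_rules)+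
  have LZ: "L2 Z" by (rule L2_bounded[OF Z])
  have G1: "bounded_functional (\<lambda>Y. ip a b f1 (u Y))" by (rule bounded_functional_ip[OF data(1) opU])
  have G2: "bounded_functional (\<lambda>Y. ip a b f2 (m Y))" by (rule bounded_functional_ip[OF data(2) bounded_op_H1[OF M]])
  have G3: "bounded_functional (\<lambda>Y. f3 (p Y))"
    unfolding f3
    by (intro bounded_functional_add bounded_functional_cmult bounded_functional_ip data LZ
      bounded_op_H1_mult[OF d \<phi>s P] opZ[OF P] bounded_op_H1[OF P] bounded_op_wgrad[OF P])
  have G4: "bounded_functional (\<lambda>Y. ip a b f4 (k Y))" by (rule bounded_functional_ip[OF data(3) bounded_op_H1[OF K]])
  have G5: "bounded_functional (\<lambda>Y. f5 (r Y))"
    unfolding f5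
    by (intro bounded_functional_add bounded_functional_cmult bounded_functional_ip data bounded_op_H1[OF R])
  \<comment> \<open>\<open>E2\<close> and \<open>E4\<close> receive the potentials of
    \<open>Y\<close>, \<open>E3\<close> and \<open>E5\<close> its phases. Because of this crossing,
    each pairing of a phase with its potential occurs in \<open>B X X\<close> twice with opposite
    signs.\<close>
  define B where "B X Y = E1 X (u Y) + E2 X (m Y) + E3 X (p Y) + E4 X (k Y) + E5 X (r Y)" for X Y
  define F where "F Y = ip a b f1 (u Y) + ip a b f2 (m Y) + f3 (p Y) + ip a b f4 (k Y) + f5 (r Y)" for Y
  have B: "bounded_form B" unfolding B_def by (intro bounded_form_add F1 F2 F3 F4 F5)
  have F: "bounded_functional F" unfolding F_def by (intro bounded_functional_add G1 G2 G3 G4 G5)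
  obtain CP where CP: "CP \<ge> 0" "\<And>f. f \<in> H1bar a b \<Longrightarrow> h1 f f \<le> CP * ip a b (wgrad f) (wgrad f)"
    using H1bar_poincare by blast
  \<comment> \<open>The first two entries are the coefficients of the velocity and of its gradient.
    Each of the others is the gradient coefficient of a scalar unknown, reduced by the Poincare
    factor; the added 1 accounts for \<open>CP = 0\<close>.\<close>
  define \<delta> where "\<delta> = Min {1, c * \<nu>, c * M1 / (CP + 1), c * M2 / (CP + 1), \<epsilon> / (CP + 1), \<eta> / (CP + 1)}"
  have \<delta>: "\<delta> > 0" "\<delta> \<le> 1" "\<delta> \<le> c * \<nu>" "\<delta> * (CP + 1) \<le> c * M1" "\<delta> * (CP + 1) \<le> c * M2"
    "\<delta> * (CP + 1) \<le> \<epsilon>" "\<delta> * (CP + 1) \<le> \<eta>"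
  proof -
    show "\<delta> > 0" unfolding \<delta>_def using c pos CP(1) by (subst Min_gr_iff) auto
    have "\<delta> \<le> x" if "x \<in> {1, c * \<nu>, c * M1 / (CP + 1), c * M2 / (CP + 1), \<epsilon> / (CP + 1), \<eta> / (CP + 1)}" for x
      unfolding \<delta>_def using that by (intro Min_le) auto
    then have "\<delta> \<le> 1" "\<delta> \<le> c * \<nu>" "\<delta> \<le> c * M1 / (CP + 1)" "\<delta> \<le> c * M2 / (CP + 1)" "\<delta> \<le> \<epsilon> / (CP + 1)" "\<delta> \<le> \<eta> / (CP + 1)"
      by blast+
    then show "\<delta> \<le> 1" "\<delta> \<le> c * \<nu>" "\<delta> * (CP + 1) \<le> c * M1" "\<delta> * (CP + 1) \<le> c * M2"
      "\<delta> * (CP + 1) \<le> \<epsilon>" "\<delta> * (CP + 1) \<le> \<eta>"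
      using CP(1) by (auto simp: pos_le_divide_eq)
  qed
  have scalar: "\<delta> * h1 f f \<le> q * (l2 (wgrad f))\<^sup>2" if f: "f \<in> H1bar a b" and q: "\<delta> * (CP + 1) \<le> q" for f q
  proof -
    have "h1 f f \<le> (CP + 1) * (l2 (wgrad f))\<^sup>2"
      using CP(2)[OF f] zero_le_power2[of "l2 (wgrad f)"]
      unfolding ip_self[OF H1perD(6)[OF bar[OF f]]] distrib_right by linarith
    then have "\<delta> * h1 f f \<le> \<delta> * ((CP + 1) * (l2 (wgrad f))\<^sup>2)"
      using \<delta>(1) by (intro mult_left_mono) auto
    also have "\<dots> \<le> q * (l2 (wgrad f))\<^sup>2"
      using q by (simp add: mult.assoc[symmetric] mult_right_mono)
    finally show ?thesis .
  qed
  have coercive: "\<delta> * unknowns_ip X X \<le> B X X" if X: "X \<in> unknowns_space" for X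
  proof -
    have X': "u X \<in> H1vec a b" "m X \<in> H1bar a b" "p X \<in> H1bar a b" "k X \<in> H1bar a b" "r X \<in> H1bar a b"
      using X by (auto simp: mem)
    note L = bounded_opD(1)[OF _ X]
    note L_rules = L[OF opU] L[OF opGU] L[OF bounded_op_wgrad[OF M]] L[OF bounded_op_wgrad[OF P]]
      L[OF bounded_op_wgrad[OF K]] L[OF bounded_op_wgrad[OF R]] L[OF bounded_op_H1_mult[OF d \<phi>s P]]
      L[OF opZ[OF P]] L[OF bounded_op_H1[OF R]] L[OF opH[OF R]]
    have sym: "ip a b (wgrad (m X)) (\<lambda>x. \<phi>s x *\<^sub>R u X x) = ip a b (\<lambda>x. \<phi>s x *\<^sub>R u X x) (wgrad (m X))"
      "ip a b (wgrad (k X)) (\<lambda>x. \<rho>s x *\<^sub>R u X x) = ip a b (\<lambda>x. \<rho>s x *\<^sub>R u X x) (wgrad (k X))"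
      "ip a b (m X) (p X) = ip a b (p X) (m X)" "ip a b (k X) (r X) = ip a b (r X) (k X)"
      "ip a b (r X) (\<lambda>x. Z x \<bullet> wgrad (p X) x) = ip a b (\<lambda>x. Z x \<bullet> wgrad (p X) x) (r X)"
      by (simp_all only: ip_commute)
    define zp where "zp = ip a b (\<lambda>x. Z x \<bullet> wgrad (p X) x) (r X)"
    define A where "A = l2 (\<lambda>x. Z x \<bullet> wgrad (p X) x)"
    have zp: "zp \<le> A * l2 (r X)"
      using integrable_inner(2)[OF L[OF opZ[OF P]] L[OF bounded_op_H1[OF R]]] by (simp add: zp_def A_def)
    have "2 * (A * l2 (r X)) \<le> A\<^sup>2 + (l2 (r X))\<^sup>2"
      using zero_le_power2[of "A - l2 (r X)"] by (simp add: power2_diff)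
    with zp have square: "0 \<le> A\<^sup>2 - 2 * zp + (l2 (r X))\<^sup>2" by linarith
    have "B X X = (l2 (u X))\<^sup>2 + c * \<nu> * (l2 (vgrad (u X)))\<^sup>2 + c * M1 * (l2 (wgrad (m X)))\<^sup>2
        + \<epsilon> * (l2 (wgrad (p X)))\<^sup>2 + 2 / \<epsilon> * (l2 (\<lambda>x. \<phi>s x * p X x))\<^sup>2
        + c * M2 * (l2 (wgrad (k X)))\<^sup>2 + \<eta> * (l2 (wgrad (r X)))\<^sup>2 + \<beta> / 2 * (l2 (\<lambda>x. H x * r X x))\<^sup>2
        + \<alpha> * (A\<^sup>2 - 2 * zp + (l2 (r X))\<^sup>2)"
      unfolding B_def E1_def E2_def E3_def E4_def E5_def RZ coupling[OF X X] Bform_skew[OF d w X'(1)] sym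
        zp_def[symmetric] L_rules[THEN ip_self] A_def[symmetric]
      by (simp add: algebra_simps)
    moreover have "0 \<le> 2 / \<epsilon> * (l2 (\<lambda>x. \<phi>s x * p X x))\<^sup>2" "0 \<le> \<beta> / 2 * (l2 (\<lambda>x. H x * r X x))\<^sup>2"
      "0 \<le> \<alpha> * (A\<^sup>2 - 2 * zp + (l2 (r X))\<^sup>2)"
      using pos square by simp_all
    moreover have "\<delta> * h1v (u X) (u X) \<le> (l2 (u X))\<^sup>2 + c * \<nu> * (l2 (vgrad (u X)))\<^sup>2"
    proof -
      have "h1v (u X) (u X) = (l2 (u X))\<^sup>2 + (l2 (vgrad (u X)))\<^sup>2"
        unfolding ip_self[OF L[OF opU], symmetric] ip_self[OF L[OF opGU], symmetric]
          ip_vec[OF L[OF opU] L[OF opU]] ip_vec[OF L[OF opGU] L[OF opGU]]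
        by (simp add: h1v_def h1_def vgrad_def sum.distrib)
      moreover have "\<delta> * (l2 (u X))\<^sup>2 \<le> 1 * (l2 (u X))\<^sup>2" "\<delta> * (l2 (vgrad (u X)))\<^sup>2 \<le> c * \<nu> * (l2 (vgrad (u X)))\<^sup>2"
        using \<delta>(2,3) by (intro mult_right_mono; simp)+
      ultimately show ?thesis by (simp add: distrib_left)
    qed
    moreover note scalar[OF X'(2) \<delta>(4)] scalar[OF X'(3) \<delta>(6)] scalar[OF X'(4) \<delta>(5)] scalar[OF X'(5) \<delta>(7)]
    ultimately show ?thesis by (simp add: ipX distrib_left)
  qed
  have proj0: "u 0 = 0" "m 0 = 0" "p 0 = 0" "k 0 = 0" "r 0 = 0" by (simp_all add: projs)
  have zero: "0 \<in> H1vec a b" "0 \<in> H1bar a b"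
    using closed(1) by (simp_all add: unknowns_space_def zero_prod_def)
  have E0: "E1 X 0 = 0" "E2 X 0 = 0" "E3 X 0 = 0" "E4 X 0 = 0" "E5 X 0 = 0" if "X \<in> unknowns_space" for X
    using bounded_form_zero[OF F1 that] bounded_form_zero[OF F2 that] bounded_form_zero[OF F3 that]
      bounded_form_zero[OF F4 that] bounded_form_zero[OF F5 that] by (simp_all add: proj0)
  have F0: "ip a b f1 0 = 0" "ip a b f2 0 = 0" "f3 0 = 0" "ip a b f4 0 = 0" "f5 0 = 0"
    using bounded_functional_zero[OF G1] bounded_functional_zero[OF G2] bounded_functional_zero[OF G3]
      bounded_functional_zero[OF G4] bounded_functional_zero[OF G5] by (simp_all add: proj0)
  define sol where "sol X \<longleftrightarrow> X \<in> unknowns_space \<and> (\<forall>v\<in>H1vec a b. E1 X v = ip a b f1 v) \<and>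
      (\<forall>v\<in>H1bar a b. E2 X v = ip a b f2 v) \<and> (\<forall>v\<in>H1bar a b. E3 X v = f3 v) \<and>
      (\<forall>v\<in>H1bar a b. E4 X v = ip a b f4 v) \<and> (\<forall>v\<in>H1bar a b. E5 X v = f5 v)" for X
  have sol_iff: "sol X \<longleftrightarrow> X \<in> unknowns_space \<and> (\<forall>Y\<in>unknowns_space. B X Y = F Y)" for X
  proof
    assume "sol X"
    then show "X \<in> unknowns_space \<and> (\<forall>Y\<in>unknowns_space. B X Y = F Y)"
      by (auto simp: sol_def B_def F_def mem)
  next
    \<comment> \<open>The summed equation is split again by testing with tuples that have at most
      one nonzero entry; \<open>E0\<close> and \<open>F0\<close> remove the other four
      equations.\<close>
    assume X: "X \<in> unknowns_space \<and> (\<forall>Y\<in>unknowns_space. B X Y = F Y)"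
    have BF: "B X (v1, v2, v3, v4, v5) = F (v1, v2, v3, v4, v5)"
      if "v1 \<in> H1vec a b" "v2 \<in> H1bar a b" "v3 \<in> H1bar a b" "v4 \<in> H1bar a b" "v5 \<in> H1bar a b" for v1 v2 v3 v4 v5
      using X that by (simp add: unknowns_space_def)
    show "sol X"
      using X BF[OF _ zero(2) zero(2) zero(2) zero(2)] BF[OF zero(1) _ zero(2) zero(2) zero(2)]
        BF[OF zero(1) zero(2) _ zero(2) zero(2)] BF[OF zero(1) zero(2) zero(2) _ zero(2)]
        BF[OF zero(1) zero(2) zero(2) zero(2)]
      by (simp add: sol_def B_def F_def projs E0 F0)
  qed
  have ex: "\<exists>X. sol X"
    using Lax_Milgram[OF B F coercive \<delta>(1)] unfolding sol_iff by blast
  \<comment> \<open>Coercivity makes the seminorm of the difference 0. This says that the difference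
    vanishes almost everywhere, which is the equality meant by \<open>eq_ae\<close>.\<close>
  have unique: "eq_ae X Y" if X: "sol X" and Y: "sol Y" for X Y
  proof -
    have XY: "X \<in> unknowns_space" "Y \<in> unknowns_space" using X Y by (simp_all add: sol_iff)
    have D: "X - Y \<in> unknowns_space" by (rule closed(4)[OF XY])
    have "B (X - Y) (X - Y) = 0"
      using X Y D by (simp add: bounded_form_diff[OF B XY D] sol_iff)
    with coercive[OF D] have "\<delta> * unknowns_ip (X - Y) (X - Y) \<le> 0" by simp
    then have "unknowns_ip (X - Y) (X - Y) \<le> 0" using \<delta>(1) by (simp add: mult_le_0_iff)
    then have h0: "h1v (u (X - Y)) (u (X - Y)) = 0" "h1 (m (X - Y)) (m (X - Y)) = 0" "h1 (p (X - Y)) (p (X - Y)) = 0"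
      "h1 (k (X - Y)) (k (X - Y)) = 0" "h1 (r (X - Y)) (r (X - Y)) = 0"
      using nonneg[OF D] unfolding ipX by linarith+
    have null: "AE x in lborel. f x = 0" if f: "f \<in> H1per a b" "h1 f f = 0" for f
    proof (rule AE_zero_of_l2)
      have "(l2 f)\<^sup>2 = 0"
        using f(2) zero_le_power2[of "l2 f"] zero_le_power2[of "l2 (wgrad f)"] unfolding h1_self[OF f(1)] by linarith
      then show "l2 f = 0" by simp
    qed (use H1perD[OF f(1)] in auto)
    have "AE x in lborel. \<forall>i\<in>UNIV. u (X - Y) x $ i = 0"
    proof (intro AE_finite_allI null)
      fix i
      have v: "(\<lambda>x. u (X - Y) x $ i) \<in> H1per a b" for i using D by (auto simp: mem intro: vec)
      then show "(\<lambda>x. u (X - Y) x $ i) \<in> H1per a b" .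
      show "h1 (\<lambda>x. u (X - Y) x $ i) (\<lambda>x. u (X - Y) x $ i) = 0"
        using h0(1) unfolding h1v_def
        by (subst (asm) sum_nonneg_eq_0_iff) (auto intro: h1_pos v)
    qed simp
    moreover have "AE x in lborel. m (X - Y) x = 0" "AE x in lborel. p (X - Y) x = 0"
      "AE x in lborel. k (X - Y) x = 0" "AE x in lborel. r (X - Y) x = 0"
      using D h0 by (auto simp: mem intro!: null bar)
    ultimately have "AE x in lborel. u X x = u Y x \<and> m X x = m Y x \<and> p X x = p Y x \<and> k X x = k Y x \<and> r X x = r Y x"
      by eventually_elim (auto simp: projs vec_eq_iff)
    then show ?thesis by (simp add: eq_ae_def projs case_prod_unfold)
  qed
  have "unique_up_to eq_ae sol" unfolding unique_up_to_def using ex unique by blast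
  then show ?thesis
    by (simp add: sol_def[abs_def] unknowns_space_def E1_def E2_def E3_def E4_def E5_def projs c_def case_prod_unfold mem_Times_iff conj_assoc)
qed

end

section \<open>Regularity of the derived data\<close>

context periodic_cell begin

lemma star_H1per: "f \<in> H1per a b \<Longrightarrow> g \<in> H1per a b \<Longrightarrow> star f g \<in> H1per a b"
  using H1per_lincomb(1)[of f g 2 "-1"] by (simp add: star_def[abs_def])

lemma dagger_H1per: "f \<in> H1per a b \<Longrightarrow> g \<in> H1per a b \<Longrightarrow> dagger f g \<in> H1per a b"
  using H1per_lincomb(1)[of f g "4 / 3" "- 1 / 3"] by (simp add: dagger_def[abs_def] field_simps)

lemma star_H1vec: "u \<in> H1vec a b \<Longrightarrow> v \<in> H1vec a b \<Longrightarrow> star u v \<in> H1vec a b"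
  using star_H1per[of "\<lambda>x. u x $ i" "\<lambda>x. v x $ i" for i] by (simp add: H1vec_def star_def[abs_def])

lemma L2_dagger: "L2 f \<Longrightarrow> L2 g \<Longrightarrow> L2 (dagger f g)"
  unfolding dagger_def[abs_def] by (rule L2_scale[OF L2_diff[OF L2_scale]])

lemma L2_H1vec: "u \<in> H1vec a b \<Longrightarrow> L2 u"
  by (rule L2_vec(1)) (auto simp: H1vec_def intro: H1perD(3))

lemma L2per_L2: "f \<in> L2per a b \<Longrightarrow> L2 f"
  by (simp add: L2per_def square_integrable_iff)

lemma Zfield_measurable:
  assumes "f \<in> H1per a b"
  shows "Zfield f \<in> borel_measurable borel"
proof -
  have [measurable]: "wgrad f \<in> borel_measurable borel" by (rule L2_measurable[OF H1perD(6)[OF assms]])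
  show ?thesis unfolding Zfield_def[abs_def] by measurable
qed

end

lemma norm_Zfield: "norm (Zfield f x) \<le> 1"
  by (simp add: Zfield_def)

theorem theorem3p1:
  fixes a b :: "real^'d"
    and dt \<nu> M1 M2 \<epsilon> \<eta> \<alpha> \<beta> e A \<phi>bar \<rho>bar :: real
    and u_n u_m :: "real^'d \<Rightarrow> real^'d"  (* levels n and n-1, likewise below *)
    and \<phi>_n \<phi>_m \<rho>_n \<rho>_m U_n U_m V_n V_m W_n W_m p_n :: "real^'d \<Rightarrow> real"
    and ustar Zstar f1 :: "real^'d \<Rightarrow> real^'d"
    and \<phi>star \<rho>star Hstar A1 B1 C1 f2 f4 :: "real^'d \<Rightarrow> real"
    and f3 f5 :: "(real^'d \<Rightarrow> real) \<Rightarrow> real"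
  assumes dim: "CARD('d) = 2 \<or> CARD('d) = 3"
    and box: "\<forall>i. a $ i < b $ i"
    and pos: "dt > 0" "\<nu> > 0" "M1 > 0" "M2 > 0" "\<epsilon> > 0" "\<eta> > 0" "\<alpha> > 0" "\<beta> > 0"
    and e: "0 < e" "e < 1/2"
    and A: "A > 0" "\<forall>\<rho>. FH e \<rho> + A > 0"
    and u_data: "u_n \<in> H1vec a b" "u_m \<in> H1vec a b"
    and phase_data: "\<phi>_n \<in> H1per a b" "\<phi>_m \<in> H1per a b" "\<rho>_n \<in> H1per a b" "\<rho>_m \<in> H1per a b"
    and aux_data: "U_n \<in> L2per a b" "U_m \<in> L2per a b" "V_n \<in> L2per a b" "V_m \<in> L2per a b"
      "W_n \<in> L2per a b" "W_m \<in> L2per a b"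
    and p_data: "p_n \<in> H1per a b"
    and means: "mean a b \<phi>_n = \<phi>bar" "mean a b \<phi>_m = \<phi>bar" "mean a b \<rho>_n = \<rho>bar" "mean a b \<rho>_m = \<rho>bar"
    and ustar: "ustar = star u_n u_m"
    and \<phi>star: "\<phi>star = star \<phi>_n \<phi>_m"
    and \<rho>star: "\<rho>star = star \<rho>_n \<rho>_m"
    and Zstar: "Zstar = Zfield \<phi>star"
    and Hstar: "Hstar = (\<lambda>x. FH_H e A (\<rho>star x))"
    and A1: "A1 = (\<lambda>x. dagger U_n U_m x - 2 * \<phi>star x * dagger \<phi>_n \<phi>_m x)"
    and B1: "B1 = (\<lambda>x. dagger V_n V_m x - dagger \<rho>_n \<rho>_m x + Zstar x \<bullet> wgrad (dagger \<phi>_n \<phi>_m) x)"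
    and C1: "C1 = (\<lambda>x. dagger W_n W_m x - 1/2 * Hstar x * dagger \<rho>_n \<rho>_m x)"
    and f1: "f1 = (\<lambda>x. dagger u_n u_m x - (2 * dt / 3) *\<^sub>R wgrad p_n x)"
    and f2: "f2 = dagger \<phi>_n \<phi>_m"
    and f3: "f3 = (\<lambda>\<psi>. - (1/\<epsilon>) * ip a b (\<lambda>x. \<phi>star x * A1 x) \<psi>
        + \<alpha> * ip a b (\<lambda>x. B1 x *\<^sub>R Zstar x) (wgrad \<psi>)
        - 2/\<epsilon> * \<phi>bar * ip a b (\<lambda>x. \<phi>star x * \<phi>star x) \<psi>
        + \<alpha> * \<rho>bar * ip a b Zstar (wgrad \<psi>))"
    and f4: "f4 = dagger \<rho>_n \<rho>_m"
    and f5: "f5 = (\<lambda>r. - \<alpha> * ip a b B1 r - \<beta> * ip a b (\<lambda>x. Hstar x * C1 x) r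
        - \<beta>/2 * \<rho>bar * ip a b (\<lambda>x. Hstar x * Hstar x) r)"
  shows "unique_up_to eq_ae (\<lambda>(u, \<mu>\<^sub>\<phi>, \<phi>, \<mu>\<^sub>\<rho>, \<rho>).
    u \<in> H1vec a b \<and> \<mu>\<^sub>\<phi> \<in> H1bar a b \<and> \<phi> \<in> H1bar a b \<and> \<mu>\<^sub>\<rho> \<in> H1bar a b \<and> \<rho> \<in> H1bar a b \<and>
    (\<forall>v\<in>H1vec a b.
      ip a b u v + 2 * dt / 3 * ip a b (Bform ustar u) v
      + 2 * dt / 3 * \<nu> * ip a b (vgrad u) (vgrad v)
      + 2 * dt / 3 * ip a b (\<lambda>x. \<phi>star x *\<^sub>R wgrad \<mu>\<^sub>\<phi> x + \<rho>star x *\<^sub>R wgrad \<mu>\<^sub>\<rho> x) v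
      = ip a b f1 v) \<and>
    (\<forall>w\<in>H1bar a b.
      ip a b \<phi> w - 2 * dt / 3 * ip a b (\<lambda>x. \<phi>star x *\<^sub>R u x) (wgrad w)
      + 2 * dt / 3 * M1 * ip a b (wgrad \<mu>\<^sub>\<phi>) (wgrad w)
      = ip a b f2 w) \<and>
    (\<forall>\<psi>\<in>H1bar a b.
      - ip a b \<mu>\<^sub>\<phi> \<psi> + \<epsilon> * ip a b (wgrad \<phi>) (wgrad \<psi>)
      + 2/\<epsilon> * ip a b (\<lambda>x. \<phi>star x * \<phi> x) (\<lambda>x. \<phi>star x * \<psi> x)
      - \<alpha> * ip a b (\<lambda>x. \<rho> x *\<^sub>R Zstar x) (wgrad \<psi>)
      + \<alpha> * ip a b (\<lambda>x. Zstar x \<bullet> wgrad \<phi> x) (\<lambda>x. Zstar x \<bullet> wgrad \<psi> x)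
      = f3 \<psi>) \<and>
    (\<forall>w\<in>H1bar a b.
      ip a b \<rho> w - 2 * dt / 3 * ip a b (\<lambda>x. \<rho>star x *\<^sub>R u x) (wgrad w)
      + 2 * dt / 3 * M2 * ip a b (wgrad \<mu>\<^sub>\<rho>) (wgrad w)
      = ip a b f4 w) \<and>
    (\<forall>r\<in>H1bar a b.
      - ip a b \<mu>\<^sub>\<rho> r + \<eta> * ip a b (wgrad \<rho>) (wgrad r) + \<alpha> * ip a b \<rho> r
      - \<alpha> * ip a b (\<lambda>x. Zstar x \<bullet> wgrad \<phi> x) r
      + \<beta>/2 * ip a b (\<lambda>x. Hstar x * \<rho> x) (\<lambda>x. Hstar x * r x)
      = f5 r))"
proof -
  interpret periodic_cell a b using box by unfold_locales auto
  have d: "CARD('d) \<le> 3" using dim by auto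
  note product = H1per_mult_L2[OF d]
  have \<phi>s: "\<phi>star \<in> H1per a b" and \<rho>s: "\<rho>star \<in> H1per a b"
    unfolding \<phi>star \<rho>star by (intro star_H1per phase_data)+
  have \<phi>d: "dagger \<phi>_n \<phi>_m \<in> H1per a b" and \<rho>d: "dagger \<rho>_n \<rho>_m \<in> H1per a b"
    by (intro dagger_H1per phase_data)+
  have us: "ustar \<in> H1vec a b" unfolding ustar by (intro star_H1vec u_data)
  have Z: "Zstar \<in> borel_measurable borel" "\<And>x. norm (Zstar x) \<le> 1"
    unfolding Zstar by (intro Zfield_measurable \<phi>s norm_Zfield)+
  obtain BH where BH: "\<And>\<rho>. \<bar>FH_H e A \<rho>\<bar> \<le> BH" using FH_H_bounded[OF e A(1)] A(2) by blast
  have H: "Hstar \<in> borel_measurable borel" "\<And>x. \<bar>Hstar x\<bar> \<le> BH"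
    unfolding Hstar
    using measurable_compose[OF L2_measurable[OF H1perD(3)[OF \<rho>s]] FH_H_measurable[OF e]] BH by auto
  have LU: "L2 (dagger U_n U_m)" "L2 (dagger V_n V_m)" "L2 (dagger W_n W_m)"
    by (intro L2_dagger L2per_L2 aux_data)+
  \<comment> \<open>\<open>A1\<close> contains a product of two H1 functions, so even its membership
    in L2 rests on the embedding.\<close>
  have LA: "L2 A1"
    using L2_diff[OF LU(1) L2_scale[OF product[OF \<phi>s \<phi>d], of 2]] by (simp add: A1 mult.assoc)
  have LB: "L2 B1"
    unfolding B1 by (intro L2_add L2_diff LU H1perD(3)[OF \<rho>d] L2_inner_bounded[OF Z H1perD(6)[OF \<phi>d]])
  have LC: "L2 C1"
    using L2_diff[OF LU(3) L2_scale[OF L2_bounded_mult[OF H H1perD(3)[OF \<rho>d]], of "1 / 2"]]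
    by (simp add: C1)
  have Lf1: "L2 f1"
    unfolding f1 using u_data p_data by (intro L2_diff L2_dagger L2_scale L2_H1vec H1perD(6))
  show ?thesis
  proof (rule linear_scheme_uniquely_solvable[OF d pos us \<phi>s \<rho>s Z H, where ?g1.0 = A1 and ?g2.0 = B1
        and ?g3.0 = "\<lambda>x. \<phi>star x * \<phi>star x" and ?g5.0 = B1 and ?g6.0 = "\<lambda>x. Hstar x * C1 x" and ?g7.0 = "\<lambda>x. Hstar x * Hstar x"
        and ?s1.0 = "- (1/\<epsilon>)" and ?s2.0 = \<alpha> and ?s3.0 = "- (2/\<epsilon> * \<phi>bar)" and ?s4.0 = "\<alpha> * \<rho>bar"
        and ?s5.0 = "- \<alpha>" and ?s6.0 = "- \<beta>" and ?s7.0 = "- (\<beta>/2 * \<rho>bar)"])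
    show "L2 f2" "L2 f4" unfolding f2 f4 by (rule H1perD(3)[OF \<phi>d] H1perD(3)[OF \<rho>d])+
    show "L2 (\<lambda>x. \<phi>star x * \<phi>star x)" by (rule product[OF \<phi>s \<phi>s])
    show "L2 (\<lambda>x. Hstar x * C1 x)" using L2_bounded_mult[OF H LC] by simp
    show "L2 (\<lambda>x. Hstar x * Hstar x)" using L2_bounded_mult[OF H L2_bounded[OF H(1), of BH]] H(2) by simp
    \<comment> \<open>\<open>A1\<close> is only L2, so \<open>\<phi>star\<close> is moved onto the
      test function, where the product of two H1 functions is L2 again.\<close>
    show "f3 \<psi> = - (1/\<epsilon>) * ip a b A1 (\<lambda>x. \<phi>star x * \<psi> x) + \<alpha> * ip a b B1 (\<lambda>x. Zstar x \<bullet> wgrad \<psi> x)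
        + - (2/\<epsilon> * \<phi>bar) * ip a b (\<lambda>x. \<phi>star x * \<phi>star x) \<psi> + \<alpha> * \<rho>bar * ip a b Zstar (wgrad \<psi>)" for \<psi>
      by (simp add: f3 ip_def mult_ac)
    show "f5 r = - \<alpha> * ip a b B1 r + - \<beta> * ip a b (\<lambda>x. Hstar x * C1 x) r
        + - (\<beta>/2 * \<rho>bar) * ip a b (\<lambda>x. Hstar x * Hstar x) r" for r
      by (simp add: f5)
  qed (rule Lf1 LA LB)+
qed

end
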